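(* Let $(\mathcal C, i, \boxtimes)$ be a monoidal category. The Drinfeld center $\mathcal Z(\mathcal C)$ classifies monoidal actions on $\mathcal C$: the braided monoidal category $\mathcal Z(\mathcal C)$ acts monoidally on $\mathcal C$ via $(c,\upsilon)\boxtimes_1 d := c\boxtimes d$, and for every braided monoidal category $\mathcal M$ and every monoidal action $\bullet:\mathcal M\times\mathcal C\to\mathcal C$, there is a unique $F_\bullet:\mathcal M\to\mathcal Z(\mathcal C)$ through which $\bullet$ factors as $$\mathcal M\times\mathcal C\xrightarrow{\;F_\bullet\times\mathcal C\;}\mathcal Z(\mathcal C)\times\mathcal C\xrightarrow{\;\boxtimes_1\;}\mathcal C .$$ In other words, $(\mathcal Z(\mathcal C),\boxtimes_1)$ is terminal in the 2-category $\mathrm{Act}^{\mathrm{cart}}_{\mathbf{MonCat}}(\mathcal C)$ of monoidal actions on $\mathcal C$.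
   Context: Actegories. For a monoidal category $(\mathcal M,j,\otimes,\lambda,\rho,\alpha)$ a left $\mathcal M$-actegory (left $\mathcal M$-action) is a category $\mathcal C$ with a functor $\bullet:\mathcal M\times\mathcal C\to\mathcal C$ and natural isomorphisms $\eta_c:c\to j\bullet c$, $\mu_{m,n,c}:m\bullet(n\bullet c)\to(m\otimes n)\bullet c$ such that $(\alpha_{m,n,p}\bullet c)\circ\mu_{m\otimes n,p,c}\circ\mu_{m,n,p\bullet c}=\mu_{m,n\otimes p,c}\circ(m\bullet\mu_{n,p,c})$, $\mu_{j,m,c}\circ\eta_{m\bullet c}=\lambda_m^{-1}\bullet c$, $\mu_{m,j,c}\circ(m\bullet\eta_c)=\rho_m^{-1}\bullet c$. Monoidal actions. Let $(\mathcal M,j,\otimes,\beta)$ be braided monoidal and $(\mathcal C,i,\boxtimes)$ monoidal. A monoidal action of $\mathcal M$ on $\mathcal C$ is a left $\mathcal M$-action $(\bullet,\eta,\mu)$ in which $\bullet:\mathcal M\times\mathcal C\to\mathcal C$ is a strong monoidal functor (in particular with natural isomorphisms $\iota_{m,n,c,d}:(m\otimes n)\bullet(c\boxtimes d)\to(m\bullet c)\boxtimes(n\bullet d)$) and $\eta,\mu$ are monoidal natural transformations; here $\otimes:\mathcal M\times\mathcal M\to\mathcal M$ is regarded as strong monoidal via $m\otimes\beta_{n,m'}\otimes n':(m\otimes n)\otimes(m'\otimes n')\to(m\otimes m')\otimes(n\otimes n')$ (up to associators). Drinfeld center. $\mathcal Z(\mathcal C)$ has as objects pairs $(c,\upsilon)$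 with $c\in\mathcal C$ and $\upsilon:c\boxtimes-\Rightarrow-\boxtimes c$ a natural isomorphism such that (up to associators) $\upsilon_{d\boxtimes e}=(d\boxtimes\upsilon_e)\circ(\upsilon_d\boxtimes e)$; morphisms $(c,\upsilon)\to(d,\tau)$ are $f:c\to d$ with $\tau_b\circ(f\boxtimes b)=(b\boxtimes f)\circ\upsilon_b$ for all $b$. The product is $(c,\upsilon)\boxtimes(d,\tau)=(c\boxtimes d,\;b\mapsto(\upsilon_b\boxtimes d)\circ(c\boxtimes\tau_b))$, the unit is $i$ with $i\boxtimes b\cong b\cong b\boxtimes i$, and the braiding is $\beta_{(c,\upsilon),(d,\tau)}:=\upsilon_d$. For the action $\boxtimes_1$, the unitor and multiplicator come from the unitor and associator of $\mathcal C$, and the interchanger $c\boxtimes c'\boxtimes d\boxtimes d'\to c\boxtimes d\boxtimes c'\boxtimes d'$ is given by $\upsilon'_d$, for $(c,\upsilon),(c',\upsilon')\in\mathcal Z(\mathcal C)$. Restriction. For a strong monoidal $R:\mathcal M\to\mathcal N$ with structure $(\epsilon,\varpi)$ and an $\mathcal N$-action $\star$, $R^*\star$ is the $\mathcal M$-action $(m,c)\mapsto R(m)\star c$ with unitor $(\epsilon\star c)\circ\eta_c$ and multiplicator $(\varpi_{m,m'}\star c)\circ\mu_{R(m),R(m'),c}$. The 2-category $\mathrm{Act}^{\mathrm{cart}}_{\mathbf{MonCat}}(\mathcal C)$: objects are pairs $(\mathcal M,\bullet)$ with $\mathcal M$ braided monoidal and $\bullet$ a monoidal action on $\mathcal C$;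 a morphism $(\mathcal M,\bullet)\to(\mathcal N,\star)$ is a strong braided monoidal functor $R:\mathcal M\to\mathcal N$ together with an identification $R^*\star\cong\bullet$ of monoidal actions (a natural isomorphism $R(m)\star c\cong m\bullet c$ compatible with unitors, multiplicators and interchangers); 2-cells are monoidal natural transformations compatible with these identifications. Uniqueness and terminality are understood in the usual 2-categorical (pseudo) sense: the hom-category into the terminal object is equivalent to the one-object, one-morphism category. *)

theory Defs
  imports "HOL-Library.FuncSet"
begin

section \<open>Categories, functors, natural transformations\<close>

text \<open>
  A category is given by carrier sets of objects and arrows. Functions on carriers are only
  constrained on the carriers, except where they become data of an object or arrow of another
  category; there they are required to be \<open>extensional\<close>, so that HOL equality is the
  mathematical equality.
\<close>

record ('o, 'a) cat =
  Ob :: "'o set"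
  Arr :: "'a set"
  Src :: "'a \<Rightarrow> 'o"
  Tgt :: "'a \<Rightarrow> 'o"
  Ident :: "'o \<Rightarrow> 'a"
  Comp :: "'a \<Rightarrow> 'a \<Rightarrow> 'a"  (infixr "\<cdot>\<index>" 55)

definition hom :: "('o, 'a, 'z) cat_scheme \<Rightarrow> 'o \<Rightarrow> 'o \<Rightarrow> 'a set" where
  "hom C x y = {f \<in> Arr C. Src C f = x \<and> Tgt C f = y}"

locale category =
  fixes C :: "('o, 'a, 'z) cat_scheme" (structure)
  assumes src_in: "f \<in> Arr C \<Longrightarrow> Src C f \<in> Ob C"
    and tgt_in: "f \<in> Arr C \<Longrightarrow> Tgt C f \<in> Ob C"
    and ident_hom: "x \<in> Ob C \<Longrightarrow> Ident C x \<in> hom C x x"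
    and comp_hom: "f \<in> hom C x y \<Longrightarrow> g \<in> hom C y z \<Longrightarrow> g \<cdot> f \<in> hom C x z"
    and comp_ident_left: "f \<in> hom C x y \<Longrightarrow> Ident C y \<cdot> f = f"
    and comp_ident_right: "f \<in> hom C x y \<Longrightarrow> f \<cdot> Ident C x = f"
    and comp_assoc: "f \<in> hom C w x \<Longrightarrow> g \<in> hom C x y \<Longrightarrow> h \<in> hom C y z \<Longrightarrow>
      (h \<cdot> g) \<cdot> f = h \<cdot> (g \<cdot> f)"

definition inverse_arrows :: "('o, 'a, 'z) cat_scheme \<Rightarrow> 'a \<Rightarrow> 'a \<Rightarrow> bool" where
  "inverse_arrows C f g \<longleftrightarrow>
     f \<in> Arr C \<and> g \<in> hom C (Tgt C f) (Src C f) \<and>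
     g \<cdot>\<^bsub>C\<^esub> f = Ident C (Src C f) \<and> f \<cdot>\<^bsub>C\<^esub> g = Ident C (Tgt C f)"

definition iso :: "('o, 'a, 'z) cat_scheme \<Rightarrow> 'a \<Rightarrow> bool" where
  "iso C f \<longleftrightarrow> (\<exists>g. inverse_arrows C f g)"

definition inv_arr :: "('o, 'a, 'z) cat_scheme \<Rightarrow> 'a \<Rightarrow> 'a" where
  "inv_arr C f = (THE g. inverse_arrows C f g)"

record ('o1, 'a1, 'o2, 'a2) fctr =
  fob :: "'o1 \<Rightarrow> 'o2"
  farr :: "'a1 \<Rightarrow> 'a2"

locale cfunctor = A: category A + B: category B
  for A :: "('o1, 'a1, 'z1) cat_scheme" and B :: "('o2, 'a2, 'z2) cat_scheme" +
  fixes F :: "('o1, 'a1, 'o2, 'a2, 'z) fctr_scheme"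
  assumes fob_in: "x \<in> Ob A \<Longrightarrow> fob F x \<in> Ob B"
    and farr_hom: "f \<in> hom A x y \<Longrightarrow> farr F f \<in> hom B (fob F x) (fob F y)"
    and farr_ident: "x \<in> Ob A \<Longrightarrow> farr F (Ident A x) = Ident B (fob F x)"
    and farr_comp: "f \<in> hom A x y \<Longrightarrow> g \<in> hom A y z \<Longrightarrow>
      farr F (g \<cdot>\<^bsub>A\<^esub> f) = farr F g \<cdot>\<^bsub>B\<^esub> farr F f"

locale nat_trans = F: cfunctor A B F + G: cfunctor A B G
  for A :: "('o1, 'a1, 'z1) cat_scheme" and B :: "('o2, 'a2, 'z2) cat_scheme"
    and F :: "('o1, 'a1, 'o2, 'a2, 'y1) fctr_scheme"
    and G :: "('o1, 'a1, 'o2, 'a2, 'y2) fctr_scheme" +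
  fixes \<tau> :: "'o1 \<Rightarrow> 'a2"
  assumes component_hom: "x \<in> Ob A \<Longrightarrow> \<tau> x \<in> hom B (fob F x) (fob G x)"
    and naturality: "f \<in> hom A x y \<Longrightarrow> \<tau> y \<cdot>\<^bsub>B\<^esub> farr F f = farr G f \<cdot>\<^bsub>B\<^esub> \<tau> x"

locale nat_iso = nat_trans +
  assumes component_iso: "x \<in> Ob A \<Longrightarrow> iso B (\<tau> x)"

definition id_fctr :: "('o, 'a, 'o, 'a) fctr" where
  "id_fctr = \<lparr>fob = (\<lambda>x. x), farr = (\<lambda>f. f)\<rparr>"

definition comp_fctr :: "('o2, 'a2, 'o3, 'a3, 'y1) fctr_scheme \<Rightarrow>
    ('o1, 'a1, 'o2, 'a2, 'y2) fctr_scheme \<Rightarrow> ('o1, 'a1, 'o3, 'a3) fctr" where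
  "comp_fctr G F = \<lparr>fob = (\<lambda>x. fob G (fob F x)), farr = (\<lambda>f. farr G (farr F f))\<rparr>"

definition prod_cat :: "('o1, 'a1, 'z1) cat_scheme \<Rightarrow> ('o2, 'a2, 'z2) cat_scheme \<Rightarrow>
    ('o1 \<times> 'o2, 'a1 \<times> 'a2) cat" where
  "prod_cat A B =
     \<lparr>Ob = Ob A \<times> Ob B,
      Arr = Arr A \<times> Arr B,
      Src = map_prod (Src A) (Src B),
      Tgt = map_prod (Tgt A) (Tgt B),
      Ident = map_prod (Ident A) (Ident B),
      Comp = (\<lambda>(g, g') (f, f'). (g \<cdot>\<^bsub>A\<^esub> f, g' \<cdot>\<^bsub>B\<^esub> f'))\<rparr>"

definition unit_cat :: "(unit, unit) cat" where
  "unit_cat =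
     \<lparr>Ob = UNIV, Arr = UNIV, Src = (\<lambda>_. ()), Tgt = (\<lambda>_. ()), Ident = (\<lambda>_. ()), Comp = (\<lambda>_ _. ())\<rparr>"

definition equivalent_categories ::
    "('o1, 'a1, 'z1) cat_scheme \<Rightarrow> ('o2, 'a2, 'z2) cat_scheme \<Rightarrow> bool" where
  "equivalent_categories A B \<longleftrightarrow>
     (\<exists>(F :: ('o1, 'a1, 'o2, 'a2) fctr) (G :: ('o2, 'a2, 'o1, 'a1) fctr) \<tau> \<sigma>.
        cfunctor A B F \<and> cfunctor B A G \<and>
        nat_iso A A id_fctr (comp_fctr G F) \<tau> \<and> nat_iso B B (comp_fctr F G) id_fctr \<sigma>)"


section \<open>Monoidal and braided monoidal categories\<close>

record ('o, 'a) moncat = "('o, 'a) cat" +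
  tensor :: "('o \<times> 'o, 'a \<times> 'a, 'o, 'a) fctr"
  unit_ob :: 'o  ("\<j>\<index>")
  lunit :: "'o \<Rightarrow> 'a"
  runit :: "'o \<Rightarrow> 'a"
  assoc :: "'o \<Rightarrow> 'o \<Rightarrow> 'o \<Rightarrow> 'a"

text \<open>\<open>\<otimes>\<close> is the tensor product on objects, \<open>\<odot>\<close> the one on arrows.\<close>

abbreviation tensor_ob :: "('o, 'a, 'z) moncat_scheme \<Rightarrow> 'o \<Rightarrow> 'o \<Rightarrow> 'o"
    (infixr "\<otimes>\<index>" 70) where
  "x \<otimes>\<^bsub>M\<^esub> y \<equiv> fob (tensor M) (x, y)"

abbreviation tensor_arr :: "('o, 'a, 'z) moncat_scheme \<Rightarrow> 'a \<Rightarrow> 'a \<Rightarrow> 'a"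
    (infixr "\<odot>\<index>" 70) where
  "f \<odot>\<^bsub>M\<^esub> g \<equiv> farr (tensor M) (f, g)"

locale monoidal_category = category M
  for M :: "('o, 'a, 'z) moncat_scheme" (structure) +
  assumes tensor_functor: "cfunctor (prod_cat M M) M (tensor M)"
    and unit_in: "\<j> \<in> Ob M"
    and lunit_iso: "nat_iso M M
      \<lparr>fob = (\<lambda>x. \<j> \<otimes> x), farr = (\<lambda>f. Ident M \<j> \<odot> f)\<rparr> id_fctr (lunit M)"
    and runit_iso: "nat_iso M M
      \<lparr>fob = (\<lambda>x. x \<otimes> \<j>), farr = (\<lambda>f. f \<odot> Ident M \<j>)\<rparr> id_fctr (runit M)"
    and assoc_iso: "nat_iso (prod_cat (prod_cat M M) M) M
      \<lparr>fob = (\<lambda>((x, y), z). (x \<otimes> y) \<otimes> z), farr = (\<lambda>((f, g), h). (f \<odot> g) \<odot> h)\<rparr>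
      \<lparr>fob = (\<lambda>((x, y), z). x \<otimes> (y \<otimes> z)), farr = (\<lambda>((f, g), h). f \<odot> (g \<odot> h))\<rparr>
      (\<lambda>((x, y), z). assoc M x y z)"
    and pentagon: "w \<in> Ob M \<Longrightarrow> x \<in> Ob M \<Longrightarrow> y \<in> Ob M \<Longrightarrow> z \<in> Ob M \<Longrightarrow>
      assoc M w x (y \<otimes> z) \<cdot> assoc M (w \<otimes> x) y z =
      (Ident M w \<odot> assoc M x y z) \<cdot> assoc M w (x \<otimes> y) z \<cdot> (assoc M w x y \<odot> Ident M z)"
    and triangle: "x \<in> Ob M \<Longrightarrow> y \<in> Ob M \<Longrightarrow>
      (Ident M x \<odot> lunit M y) \<cdot> assoc M x \<j> y = runit M x \<odot> Ident M y"

record ('o, 'a) bmoncat = "('o, 'a) moncat" +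
  braid :: "'o \<Rightarrow> 'o \<Rightarrow> 'a"

locale braided_monoidal_category = monoidal_category M
  for M :: "('o, 'a, 'z) bmoncat_scheme" (structure) +
  assumes braid_iso: "nat_iso (prod_cat M M) M
      \<lparr>fob = (\<lambda>(x, y). x \<otimes> y), farr = (\<lambda>(f, g). f \<odot> g)\<rparr>
      \<lparr>fob = (\<lambda>(x, y). y \<otimes> x), farr = (\<lambda>(f, g). g \<odot> f)\<rparr>
      (\<lambda>(x, y). braid M x y)"
    and hexagon1: "x \<in> Ob M \<Longrightarrow> y \<in> Ob M \<Longrightarrow> z \<in> Ob M \<Longrightarrow>
      assoc M y z x \<cdot> braid M x (y \<otimes> z) \<cdot> assoc M x y z =
      (Ident M y \<odot> braid M x z) \<cdot> assoc M y x z \<cdot> (braid M x y \<odot> Ident M z)"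
    and hexagon2: "x \<in> Ob M \<Longrightarrow> y \<in> Ob M \<Longrightarrow> z \<in> Ob M \<Longrightarrow>
      inv_arr M (assoc M z x y) \<cdot> braid M (x \<otimes> y) z \<cdot> inv_arr M (assoc M x y z) =
      (braid M x z \<odot> Ident M y) \<cdot> inv_arr M (assoc M x z y) \<cdot> (Ident M x \<odot> braid M y z)"

text \<open>
  \<open>mid_swap M x y z w s : (x \<otimes> y) \<otimes> (z \<otimes> w) \<rightarrow> (x \<otimes> z) \<otimes> (y \<otimes> w)\<close> is
  \<open>x \<otimes> s \<otimes> w\<close> up to associators, for an arrow \<open>s : y \<otimes> z \<rightarrow> z \<otimes> y\<close>.
\<close>

definition mid_swap ::
    "('o, 'a, 'z) moncat_scheme \<Rightarrow> 'o \<Rightarrow> 'o \<Rightarrow> 'o \<Rightarrow> 'o \<Rightarrow> 'a \<Rightarrow> 'a" where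
  "mid_swap M x y z w s =
     inv_arr M (assoc M x z (y \<otimes>\<^bsub>M\<^esub> w)) \<cdot>\<^bsub>M\<^esub>
     (Ident M x \<odot>\<^bsub>M\<^esub>
       (assoc M z y w \<cdot>\<^bsub>M\<^esub> (s \<odot>\<^bsub>M\<^esub> Ident M w) \<cdot>\<^bsub>M\<^esub> inv_arr M (assoc M y z w))) \<cdot>\<^bsub>M\<^esub>
     assoc M x y (z \<otimes>\<^bsub>M\<^esub> w)"

definition prod_moncat :: "('o1, 'a1, 'z1) moncat_scheme \<Rightarrow> ('o2, 'a2, 'z2) moncat_scheme \<Rightarrow>
    ('o1 \<times> 'o2, 'a1 \<times> 'a2) moncat" where
  "prod_moncat A B = cat.extend (prod_cat A B)
     \<lparr>tensor =
        \<lparr>fob = (\<lambda>((x, x'), (y, y')). (x \<otimes>\<^bsub>A\<^esub> y, x' \<otimes>\<^bsub>B\<^esub> y')),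
         farr = (\<lambda>((f, f'), (g, g')). (f \<odot>\<^bsub>A\<^esub> g, f' \<odot>\<^bsub>B\<^esub> g'))\<rparr>,
      unit_ob = (\<j>\<^bsub>A\<^esub>, \<j>\<^bsub>B\<^esub>),
      lunit = map_prod (lunit A) (lunit B),
      runit = map_prod (runit A) (runit B),
      assoc = (\<lambda>(x, x') (y, y') (z, z'). (assoc A x y z, assoc B x' y' z'))\<rparr>"


section \<open>Strong monoidal functors\<close>

text \<open>
  The structure arrows are \<open>feps F : \<j> \<rightarrow> F \<j>\<close> and \<open>fmult F x y : F x \<otimes> F y \<rightarrow> F (x \<otimes> y)\<close>.
\<close>

record ('o1, 'a1, 'o2, 'a2) mfctr = "('o1, 'a1, 'o2, 'a2) fctr" +
  feps :: 'a2
  fmult :: "'o1 \<Rightarrow> 'o1 \<Rightarrow> 'a2"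

locale strong_monoidal_functor =
  A: monoidal_category A + B: monoidal_category B + cfunctor A B F
  for A :: "('o1, 'a1, 'z1) moncat_scheme" and B :: "('o2, 'a2, 'z2) moncat_scheme"
    and F :: "('o1, 'a1, 'o2, 'a2) mfctr" +
  assumes feps_hom: "feps F \<in> hom B \<j>\<^bsub>B\<^esub> (fob F \<j>\<^bsub>A\<^esub>)"
    and feps_iso: "iso B (feps F)"
    and fmult_iso: "nat_iso (prod_cat A A) B
      \<lparr>fob = (\<lambda>(x, y). fob F x \<otimes>\<^bsub>B\<^esub> fob F y), farr = (\<lambda>(f, g). farr F f \<odot>\<^bsub>B\<^esub> farr F g)\<rparr>
      \<lparr>fob = (\<lambda>(x, y). fob F (x \<otimes>\<^bsub>A\<^esub> y)), farr = (\<lambda>(f, g). farr F (f \<odot>\<^bsub>A\<^esub> g))\<rparr>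
      (\<lambda>(x, y). fmult F x y)"
    and fmult_assoc: "x \<in> Ob A \<Longrightarrow> y \<in> Ob A \<Longrightarrow> z \<in> Ob A \<Longrightarrow>
      farr F (assoc A x y z) \<cdot>\<^bsub>B\<^esub> fmult F (x \<otimes>\<^bsub>A\<^esub> y) z \<cdot>\<^bsub>B\<^esub> (fmult F x y \<odot>\<^bsub>B\<^esub> Ident B (fob F z)) =
      fmult F x (y \<otimes>\<^bsub>A\<^esub> z) \<cdot>\<^bsub>B\<^esub> (Ident B (fob F x) \<odot>\<^bsub>B\<^esub> fmult F y z) \<cdot>\<^bsub>B\<^esub>
        assoc B (fob F x) (fob F y) (fob F z)"
    and fmult_lunit: "x \<in> Ob A \<Longrightarrow>
      farr F (lunit A x) \<cdot>\<^bsub>B\<^esub> fmult F \<j>\<^bsub>A\<^esub> x \<cdot>\<^bsub>B\<^esub> (feps F \<odot>\<^bsub>B\<^esub> Ident B (fob F x)) =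
      lunit B (fob F x)"
    and fmult_runit: "x \<in> Ob A \<Longrightarrow>
      farr F (runit A x) \<cdot>\<^bsub>B\<^esub> fmult F x \<j>\<^bsub>A\<^esub> \<cdot>\<^bsub>B\<^esub> (Ident B (fob F x) \<odot>\<^bsub>B\<^esub> feps F) =
      runit B (fob F x)"

locale strong_braided_functor =
  A: braided_monoidal_category A + B: braided_monoidal_category B + strong_monoidal_functor A B F
  for A :: "('o1, 'a1, 'z1) bmoncat_scheme" and B :: "('o2, 'a2, 'z2) bmoncat_scheme"
    and F :: "('o1, 'a1, 'o2, 'a2) mfctr" +
  assumes farr_braid: "x \<in> Ob A \<Longrightarrow> y \<in> Ob A \<Longrightarrow>
      farr F (braid A x y) \<cdot>\<^bsub>B\<^esub> fmult F x y = fmult F y x \<cdot>\<^bsub>B\<^esub> braid B (fob F x) (fob F y)"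

locale monoidal_nat_trans =
  F: strong_monoidal_functor A B F + G: strong_monoidal_functor A B G + nat_trans A B F G \<tau>
  for A :: "('o1, 'a1, 'z1) moncat_scheme" and B :: "('o2, 'a2, 'z2) moncat_scheme"
    and F :: "('o1, 'a1, 'o2, 'a2) mfctr" and G :: "('o1, 'a1, 'o2, 'a2) mfctr"
    and \<tau> :: "'o1 \<Rightarrow> 'a2" +
  assumes component_feps: "\<tau> \<j>\<^bsub>A\<^esub> \<cdot>\<^bsub>B\<^esub> feps F = feps G"
    and component_fmult: "x \<in> Ob A \<Longrightarrow> y \<in> Ob A \<Longrightarrow>
      \<tau> (x \<otimes>\<^bsub>A\<^esub> y) \<cdot>\<^bsub>B\<^esub> fmult F x y = fmult G x y \<cdot>\<^bsub>B\<^esub> (\<tau> x \<odot>\<^bsub>B\<^esub> \<tau> y)"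

definition id_mfctr :: "('o, 'a, 'z) moncat_scheme \<Rightarrow> ('o, 'a, 'o, 'a) mfctr" where
  "id_mfctr C =
     \<lparr>fob = (\<lambda>x. x), farr = (\<lambda>f. f), feps = Ident C \<j>\<^bsub>C\<^esub>, fmult = (\<lambda>x y. Ident C (x \<otimes>\<^bsub>C\<^esub> y))\<rparr>"

text \<open>In \<open>comp_mfctr D G F\<close>, \<open>D\<close> is the target of \<open>G\<close>.\<close>

definition comp_mfctr :: "('o3, 'a3, 'z) moncat_scheme \<Rightarrow> ('o2, 'a2, 'o3, 'a3) mfctr \<Rightarrow>
    ('o1, 'a1, 'o2, 'a2) mfctr \<Rightarrow> ('o1, 'a1, 'o3, 'a3) mfctr" where
  "comp_mfctr D G F =
     \<lparr>fob = (\<lambda>x. fob G (fob F x)),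
      farr = (\<lambda>f. farr G (farr F f)),
      feps = farr G (feps F) \<cdot>\<^bsub>D\<^esub> feps G,
      fmult = (\<lambda>x y. farr G (fmult F x y) \<cdot>\<^bsub>D\<^esub> fmult G (fob F x) (fob F y))\<rparr>"

definition prod_mfctr :: "('o1, 'a1, 'o2, 'a2) mfctr \<Rightarrow> ('o3, 'a3, 'o4, 'a4) mfctr \<Rightarrow>
    ('o1 \<times> 'o3, 'a1 \<times> 'a3, 'o2 \<times> 'o4, 'a2 \<times> 'a4) mfctr" where
  "prod_mfctr F G =
     \<lparr>fob = map_prod (fob F) (fob G),
      farr = map_prod (farr F) (farr G),
      feps = (feps F, feps G),
      fmult = (\<lambda>(x, x') (y, y'). (fmult F x y, fmult G x' y'))\<rparr>"

text \<open>
  The tensor product of a braided monoidal category as a strong monoidal functor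
  \<open>M \<times> M \<rightarrow> M\<close>. Its comparison \<open>(m \<otimes> n) \<otimes> (m' \<otimes> n') \<rightarrow> (m \<otimes> m') \<otimes> (n \<otimes> n')\<close> is
  \<open>m \<otimes> braid n m' \<otimes> n'\<close>; it goes from the image of the product \<open>(m, m') \<otimes> (n, n')\<close> to the
  product of the images, as interchangers of actions do, and is inverted here because \<open>fmult\<close> has
  the other direction.
\<close>

definition tensor_mfctr :: "('o, 'a, 'z) bmoncat_scheme \<Rightarrow> ('o \<times> 'o, 'a \<times> 'a, 'o, 'a) mfctr" where
  "tensor_mfctr M =
     \<lparr>fob = fob (tensor M),
      farr = farr (tensor M),
      feps = inv_arr M (lunit M \<j>\<^bsub>M\<^esub>),
      fmult = (\<lambda>(m, m') (n, n'). inv_arr M (mid_swap M m n m' n' (braid M n m')))\<rparr>"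

text \<open>The strong monoidal functors \<open>c \<mapsto> (\<j>, c)\<close> and \<open>((m, n), c) \<mapsto> (m, (n, c))\<close>.\<close>

definition unit_mfctr :: "('mo, 'ma, 'y) moncat_scheme \<Rightarrow> ('o, 'a, 'z) moncat_scheme \<Rightarrow>
    ('o, 'a, 'mo \<times> 'o, 'ma \<times> 'a) mfctr" where
  "unit_mfctr M C =
     \<lparr>fob = (\<lambda>c. (\<j>\<^bsub>M\<^esub>, c)),
      farr = (\<lambda>f. (Ident M \<j>\<^bsub>M\<^esub>, f)),
      feps = (Ident M \<j>\<^bsub>M\<^esub>, Ident C \<j>\<^bsub>C\<^esub>),
      fmult = (\<lambda>c d. (lunit M \<j>\<^bsub>M\<^esub>, Ident C (c \<otimes>\<^bsub>C\<^esub> d)))\<rparr>"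

definition reassoc_mfctr :: "('mo, 'ma, 'y) moncat_scheme \<Rightarrow> ('o, 'a, 'z) moncat_scheme \<Rightarrow>
    (('mo \<times> 'mo) \<times> 'o, ('ma \<times> 'ma) \<times> 'a, 'mo \<times> ('mo \<times> 'o), 'ma \<times> ('ma \<times> 'a)) mfctr" where
  "reassoc_mfctr M C =
     \<lparr>fob = (\<lambda>((m, n), c). (m, (n, c))),
      farr = (\<lambda>((f, g), h). (f, (g, h))),
      feps = (Ident M \<j>\<^bsub>M\<^esub>, (Ident M \<j>\<^bsub>M\<^esub>, Ident C \<j>\<^bsub>C\<^esub>)),
      fmult = (\<lambda>((m, n), c) ((m', n'), c').
        (Ident M (m \<otimes>\<^bsub>M\<^esub> m'), (Ident M (n \<otimes>\<^bsub>M\<^esub> n'), Ident C (c \<otimes>\<^bsub>C\<^esub> c'))))\<rparr>"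


section \<open>Actions and monoidal actions\<close>

record ('mo, 'ma, 'o, 'a) action =
  act :: "('mo \<times> 'o, 'ma \<times> 'a, 'o, 'a) fctr"
  unitor :: "'o \<Rightarrow> 'a"
  multiplicator :: "'mo \<Rightarrow> 'mo \<Rightarrow> 'o \<Rightarrow> 'a"

text \<open>\<open>\<bullet>\<close> is the action on objects, \<open>\<star>\<close> the one on arrows.\<close>

abbreviation act_ob :: "('mo, 'ma, 'o, 'a, 'z) action_scheme \<Rightarrow> 'mo \<Rightarrow> 'o \<Rightarrow> 'o"
    (infixr "\<bullet>\<index>" 75) where
  "m \<bullet>\<^bsub>X\<^esub> c \<equiv> fob (act X) (m, c)"

abbreviation act_arr :: "('mo, 'ma, 'o, 'a, 'z) action_scheme \<Rightarrow> 'ma \<Rightarrow> 'a \<Rightarrow> 'a"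
    (infixr "\<star>\<index>" 75) where
  "f \<star>\<^bsub>X\<^esub> g \<equiv> farr (act X) (f, g)"

locale left_action = M: monoidal_category M + C: category C
  for M :: "('mo, 'ma, 'y) moncat_scheme" and C :: "('o, 'a, 'z) cat_scheme" +
  fixes X :: "('mo, 'ma, 'o, 'a, 'x) action_scheme" (structure)
  assumes act_functor: "cfunctor (prod_cat M C) C (act X)"
    and unitor_iso: "nat_iso C C id_fctr
      \<lparr>fob = (\<lambda>c. \<j>\<^bsub>M\<^esub> \<bullet> c), farr = (\<lambda>f. Ident M \<j>\<^bsub>M\<^esub> \<star> f)\<rparr> (unitor X)"
    and multiplicator_iso: "nat_iso (prod_cat (prod_cat M M) C) C
      \<lparr>fob = (\<lambda>((m, n), c). m \<bullet> (n \<bullet> c)), farr = (\<lambda>((f, g), h). f \<star> (g \<star> h))\<rparr>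
      \<lparr>fob = (\<lambda>((m, n), c). (m \<otimes>\<^bsub>M\<^esub> n) \<bullet> c), farr = (\<lambda>((f, g), h). (f \<odot>\<^bsub>M\<^esub> g) \<star> h)\<rparr>
      (\<lambda>((m, n), c). multiplicator X m n c)"
    and act_assoc: "m \<in> Ob M \<Longrightarrow> n \<in> Ob M \<Longrightarrow> p \<in> Ob M \<Longrightarrow> c \<in> Ob C \<Longrightarrow>
      (assoc M m n p \<star> Ident C c) \<cdot>\<^bsub>C\<^esub> multiplicator X (m \<otimes>\<^bsub>M\<^esub> n) p c \<cdot>\<^bsub>C\<^esub>
        multiplicator X m n (p \<bullet> c) =
      multiplicator X m (n \<otimes>\<^bsub>M\<^esub> p) c \<cdot>\<^bsub>C\<^esub> (Ident M m \<star> multiplicator X n p c)"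
    and act_lunit: "m \<in> Ob M \<Longrightarrow> c \<in> Ob C \<Longrightarrow>
      multiplicator X \<j>\<^bsub>M\<^esub> m c \<cdot>\<^bsub>C\<^esub> unitor X (m \<bullet> c) = inv_arr M (lunit M m) \<star> Ident C c"
    and act_runit: "m \<in> Ob M \<Longrightarrow> c \<in> Ob C \<Longrightarrow>
      multiplicator X m \<j>\<^bsub>M\<^esub> c \<cdot>\<^bsub>C\<^esub> (Ident M m \<star> unitor X c) = inv_arr M (runit M m) \<star> Ident C c"

text \<open>
  \<open>interchanger X m n c d : (m \<otimes> n) \<bullet> (c \<otimes> d) \<rightarrow> (m \<bullet> c) \<otimes> (n \<bullet> d)\<close> and
  \<open>unit_interchanger X : \<j> \<bullet> \<j> \<rightarrow> \<j>\<close>; their inverses make the action functor strong monoidal.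
\<close>

record ('mo, 'ma, 'o, 'a) mon_action = "('mo, 'ma, 'o, 'a) action" +
  unit_interchanger :: 'a
  interchanger :: "'mo \<Rightarrow> 'mo \<Rightarrow> 'o \<Rightarrow> 'o \<Rightarrow> 'a"

definition act_mfctr :: "('o, 'a, 'z) moncat_scheme \<Rightarrow> ('mo, 'ma, 'o, 'a, 'x) mon_action_scheme \<Rightarrow>
    ('mo \<times> 'o, 'ma \<times> 'a, 'o, 'a) mfctr" where
  "act_mfctr C X =
     \<lparr>fob = fob (act X),
      farr = farr (act X),
      feps = inv_arr C (unit_interchanger X),
      fmult = (\<lambda>(m, c) (n, d). inv_arr C (interchanger X m n c d))\<rparr>"

locale monoidal_action =
  M: braided_monoidal_category M + C: monoidal_category C + left_action M C X
  for M :: "('mo, 'ma, 'y) bmoncat_scheme" and C :: "('o, 'a, 'z) moncat_scheme"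
    and X :: "('mo, 'ma, 'o, 'a, 'x) mon_action_scheme" (structure) +
  assumes unit_interchanger_hom: "unit_interchanger X \<in> hom C (\<j>\<^bsub>M\<^esub> \<bullet> \<j>\<^bsub>C\<^esub>) \<j>\<^bsub>C\<^esub>"
    and unit_interchanger_iso: "iso C (unit_interchanger X)"
    and interchanger_hom:
      "m \<in> Ob M \<Longrightarrow> n \<in> Ob M \<Longrightarrow> c \<in> Ob C \<Longrightarrow> d \<in> Ob C \<Longrightarrow>
       interchanger X m n c d
         \<in> hom C ((m \<otimes>\<^bsub>M\<^esub> n) \<bullet> (c \<otimes>\<^bsub>C\<^esub> d)) ((m \<bullet> c) \<otimes>\<^bsub>C\<^esub> (n \<bullet> d))"
    and interchanger_iso:
      "m \<in> Ob M \<Longrightarrow> n \<in> Ob M \<Longrightarrow> c \<in> Ob C \<Longrightarrow> d \<in> Ob C \<Longrightarrow> iso C (interchanger X m n c d)"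
    and act_strong_monoidal: "strong_monoidal_functor (prod_moncat M C) C (act_mfctr C X)"
    and unitor_monoidal: "monoidal_nat_trans C C
      (id_mfctr C) (comp_mfctr C (act_mfctr C X) (unit_mfctr M C)) (unitor X)"
    and multiplicator_monoidal: "monoidal_nat_trans (prod_moncat (prod_moncat M M) C) C
      (comp_mfctr C (act_mfctr C X)
        (comp_mfctr (prod_moncat M C) (prod_mfctr (id_mfctr M) (act_mfctr C X))
          (reassoc_mfctr M C)))
      (comp_mfctr C (act_mfctr C X) (prod_mfctr (tensor_mfctr M) (id_mfctr C)))
      (\<lambda>((m, n), c). multiplicator X m n c)"


section \<open>The Drinfeld center\<close>

definition half_braiding :: "('o, 'a, 'z) moncat_scheme \<Rightarrow> 'o \<Rightarrow> ('o \<Rightarrow> 'a) \<Rightarrow> bool" where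
  "half_braiding C c \<upsilon> \<longleftrightarrow>
     \<upsilon> \<in> extensional (Ob C) \<and>
     nat_iso C C
       \<lparr>fob = (\<lambda>b. c \<otimes>\<^bsub>C\<^esub> b), farr = (\<lambda>f. Ident C c \<odot>\<^bsub>C\<^esub> f)\<rparr>
       \<lparr>fob = (\<lambda>b. b \<otimes>\<^bsub>C\<^esub> c), farr = (\<lambda>f. f \<odot>\<^bsub>C\<^esub> Ident C c)\<rparr> \<upsilon> \<and>
     (\<forall>d \<in> Ob C. \<forall>e \<in> Ob C.
        assoc C d e c \<cdot>\<^bsub>C\<^esub> \<upsilon> (d \<otimes>\<^bsub>C\<^esub> e) \<cdot>\<^bsub>C\<^esub> assoc C c d e =
        (Ident C d \<odot>\<^bsub>C\<^esub> \<upsilon> e) \<cdot>\<^bsub>C\<^esub> assoc C d c e \<cdot>\<^bsub>C\<^esub> (\<upsilon> d \<odot>\<^bsub>C\<^esub> Ident C e))"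

type_synonym ('o, 'a) center_ob = "'o \<times> ('o \<Rightarrow> 'a)"
type_synonym ('o, 'a) center_arr = "('o, 'a) center_ob \<times> ('o, 'a) center_ob \<times> 'a"

definition center_obs :: "('o, 'a, 'z) moncat_scheme \<Rightarrow> ('o, 'a) center_ob set" where
  "center_obs C = {(c, \<upsilon>). c \<in> Ob C \<and> half_braiding C c \<upsilon>}"

definition center_arrs :: "('o, 'a, 'z) moncat_scheme \<Rightarrow> ('o, 'a) center_arr set" where
  "center_arrs C = {((c, \<upsilon>), (d, \<tau>), f) | c \<upsilon> d \<tau> f.
     (c, \<upsilon>) \<in> center_obs C \<and> (d, \<tau>) \<in> center_obs C \<and> f \<in> hom C c d \<and>
     (\<forall>b \<in> Ob C. \<tau> b \<cdot>\<^bsub>C\<^esub> (f \<odot>\<^bsub>C\<^esub> Ident C b) = (Ident C b \<odot>\<^bsub>C\<^esub> f) \<cdot>\<^bsub>C\<^esub> \<upsilon> b)}"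

fun center_tensor_ob :: "('o, 'a, 'z) moncat_scheme \<Rightarrow>
    ('o, 'a) center_ob \<Rightarrow> ('o, 'a) center_ob \<Rightarrow> ('o, 'a) center_ob" where
  "center_tensor_ob C (c, \<upsilon>) (d, \<tau>) =
     (c \<otimes>\<^bsub>C\<^esub> d,
      \<lambda>b \<in> Ob C. assoc C b c d \<cdot>\<^bsub>C\<^esub> (\<upsilon> b \<odot>\<^bsub>C\<^esub> Ident C d) \<cdot>\<^bsub>C\<^esub> inv_arr C (assoc C c b d) \<cdot>\<^bsub>C\<^esub>
        (Ident C c \<odot>\<^bsub>C\<^esub> \<tau> b) \<cdot>\<^bsub>C\<^esub> assoc C c d b)"

definition center_unit :: "('o, 'a, 'z) moncat_scheme \<Rightarrow> ('o, 'a) center_ob" where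
  "center_unit C = (\<j>\<^bsub>C\<^esub>, \<lambda>b \<in> Ob C. inv_arr C (runit C b) \<cdot>\<^bsub>C\<^esub> lunit C b)"

definition drinfeld_center ::
    "('o, 'a, 'z) moncat_scheme \<Rightarrow> (('o, 'a) center_ob, ('o, 'a) center_arr) bmoncat" where
  "drinfeld_center C =
     \<lparr>Ob = center_obs C,
      Arr = center_arrs C,
      Src = (\<lambda>(x, y, f). x),
      Tgt = (\<lambda>(x, y, f). y),
      Ident = (\<lambda>x. (x, x, Ident C (fst x))),
      Comp = (\<lambda>(y', z, g) (x, y, f). (x, z, g \<cdot>\<^bsub>C\<^esub> f)),
      tensor =
        \<lparr>fob = (\<lambda>(x, y). center_tensor_ob C x y),
         farr = (\<lambda>((x, y, f), (x', y', f')).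
           (center_tensor_ob C x x', center_tensor_ob C y y', f \<odot>\<^bsub>C\<^esub> f'))\<rparr>,
      unit_ob = center_unit C,
      lunit = (\<lambda>x. (center_tensor_ob C (center_unit C) x, x, lunit C (fst x))),
      runit = (\<lambda>x. (center_tensor_ob C x (center_unit C), x, runit C (fst x))),
      assoc = (\<lambda>x y z.
        (center_tensor_ob C (center_tensor_ob C x y) z,
         center_tensor_ob C x (center_tensor_ob C y z),
         assoc C (fst x) (fst y) (fst z))),
      braid = (\<lambda>x y. (center_tensor_ob C x y, center_tensor_ob C y x, snd x (fst y)))\<rparr>"

text \<open>The action \<open>(c, \<upsilon>) \<bullet> d = c \<otimes> d\<close> of the center.\<close>

definition center_action :: "('o, 'a, 'z) moncat_scheme \<Rightarrow>
    (('o, 'a) center_ob, ('o, 'a) center_arr, 'o, 'a) mon_action" where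
  "center_action C =
     \<lparr>act =
        \<lparr>fob = (\<lambda>((c, \<upsilon>), d). c \<otimes>\<^bsub>C\<^esub> d),
         farr = (\<lambda>((x, y, f), g). f \<odot>\<^bsub>C\<^esub> g)\<rparr>,
      unitor = (\<lambda>d. inv_arr C (lunit C d)),
      multiplicator = (\<lambda>(c, \<upsilon>) (c', \<upsilon>') d. inv_arr C (assoc C c c' d)),
      unit_interchanger = lunit C \<j>\<^bsub>C\<^esub>,
      interchanger = (\<lambda>(c, \<upsilon>) (c', \<upsilon>') d d'. mid_swap C c c' d d' (\<upsilon>' d))\<rparr>"


section \<open>The 2-category of monoidal actions on a monoidal category\<close>

text \<open>Restriction of an action of \<open>N\<close> on \<open>C\<close> along a strong monoidal functor into \<open>N\<close>.\<close>

definition restrict_action :: "('no, 'na, 'y) moncat_scheme \<Rightarrow> ('o, 'a, 'z) moncat_scheme \<Rightarrow>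
    ('mo, 'ma, 'no, 'na) mfctr \<Rightarrow> ('no, 'na, 'o, 'a) mon_action \<Rightarrow> ('mo, 'ma, 'o, 'a) mon_action"
  where
  "restrict_action N C R Y =
     \<lparr>act =
        \<lparr>fob = (\<lambda>(m, c). fob R m \<bullet>\<^bsub>Y\<^esub> c),
         farr = (\<lambda>(f, g). farr R f \<star>\<^bsub>Y\<^esub> g)\<rparr>,
      unitor = (\<lambda>c. (feps R \<star>\<^bsub>Y\<^esub> Ident C c) \<cdot>\<^bsub>C\<^esub> unitor Y c),
      multiplicator = (\<lambda>m n c.
        (fmult R m n \<star>\<^bsub>Y\<^esub> Ident C c) \<cdot>\<^bsub>C\<^esub> multiplicator Y (fob R m) (fob R n) c),
      unit_interchanger =
        unit_interchanger Y \<cdot>\<^bsub>C\<^esub> (inv_arr N (feps R) \<star>\<^bsub>Y\<^esub> Ident C \<j>\<^bsub>C\<^esub>),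
      interchanger = (\<lambda>m n c d.
        interchanger Y (fob R m) (fob R n) c d \<cdot>\<^bsub>C\<^esub>
        (inv_arr N (fmult R m n) \<star>\<^bsub>Y\<^esub> Ident C (c \<otimes>\<^bsub>C\<^esub> d)))\<rparr>"

text \<open>
  Identifications \<open>Y \<cong> X\<close> of monoidal actions of \<open>M\<close> on \<open>C\<close>. Compatibility with the unit
  interchangers is automatic: as the unitors are monoidal, a unit interchanger is inverse to the
  unitor at \<open>\<j>\<close>.
\<close>

locale action_iso = M: braided_monoidal_category M + C: monoidal_category C
  for M :: "('mo, 'ma, 'y) bmoncat_scheme" and C :: "('o, 'a, 'z) moncat_scheme"
    and Y :: "('mo, 'ma, 'o, 'a) mon_action" and X :: "('mo, 'ma, 'o, 'a) mon_action"
    and \<theta> :: "'mo \<times> 'o \<Rightarrow> 'a" +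
  assumes ident_iso: "nat_iso (prod_cat M C) C (act Y) (act X) \<theta>"
    and ident_unitor: "c \<in> Ob C \<Longrightarrow> \<theta> (\<j>\<^bsub>M\<^esub>, c) \<cdot>\<^bsub>C\<^esub> unitor Y c = unitor X c"
    and ident_multiplicator: "m \<in> Ob M \<Longrightarrow> n \<in> Ob M \<Longrightarrow> c \<in> Ob C \<Longrightarrow>
      \<theta> (m \<otimes>\<^bsub>M\<^esub> n, c) \<cdot>\<^bsub>C\<^esub> multiplicator Y m n c =
      multiplicator X m n c \<cdot>\<^bsub>C\<^esub> \<theta> (m, n \<bullet>\<^bsub>X\<^esub> c) \<cdot>\<^bsub>C\<^esub> (Ident M m \<star>\<^bsub>Y\<^esub> \<theta> (n, c))"
    and ident_interchanger:
      "m \<in> Ob M \<Longrightarrow> n \<in> Ob M \<Longrightarrow> c \<in> Ob C \<Longrightarrow> d \<in> Ob C \<Longrightarrow>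
       (\<theta> (m, c) \<odot>\<^bsub>C\<^esub> \<theta> (n, d)) \<cdot>\<^bsub>C\<^esub> interchanger Y m n c d =
       interchanger X m n c d \<cdot>\<^bsub>C\<^esub> \<theta> (m \<otimes>\<^bsub>M\<^esub> n, c \<otimes>\<^bsub>C\<^esub> d)"

text \<open>1-cells \<open>(M, X) \<rightarrow> (N, Y)\<close> of monoidal actions on \<open>C\<close>.\<close>

type_synonym ('mo, 'ma, 'no, 'na, 'o, 'a) act_1cell =
  "('mo, 'ma, 'no, 'na) mfctr \<times> ('mo \<times> 'o \<Rightarrow> 'a)"

definition act_1cells :: "('o, 'a, 'z) moncat_scheme \<Rightarrow>
    ('mo, 'ma) bmoncat \<Rightarrow> ('mo, 'ma, 'o, 'a) mon_action \<Rightarrow>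
    ('no, 'na) bmoncat \<Rightarrow> ('no, 'na, 'o, 'a) mon_action \<Rightarrow>
    ('mo, 'ma, 'no, 'na, 'o, 'a) act_1cell set" where
  "act_1cells C M X N Y = {(R, \<theta>).
     fob R \<in> extensional (Ob M) \<and> farr R \<in> extensional (Arr M) \<and>
     (\<lambda>(m, n). fmult R m n) \<in> extensional (Ob M \<times> Ob M) \<and>
     \<theta> \<in> extensional (Ob M \<times> Ob C) \<and>
     strong_braided_functor M N R \<and> action_iso M C (restrict_action N C R Y) X \<theta>}"

definition act_2cells :: "('o, 'a, 'z) moncat_scheme \<Rightarrow>
    ('mo, 'ma) bmoncat \<Rightarrow> ('mo, 'ma, 'o, 'a) mon_action \<Rightarrow>
    ('no, 'na) bmoncat \<Rightarrow> ('no, 'na, 'o, 'a) mon_action \<Rightarrow>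
    ('mo, 'ma, 'no, 'na, 'o, 'a) act_1cell \<Rightarrow> ('mo, 'ma, 'no, 'na, 'o, 'a) act_1cell \<Rightarrow>
    ('mo \<Rightarrow> 'na) set" where
  "act_2cells C M X N Y = (\<lambda>(R, \<theta>) (S, \<sigma>). {\<kappa>.
     \<kappa> \<in> extensional (Ob M) \<and> monoidal_nat_trans M N R S \<kappa> \<and>
     (\<forall>m \<in> Ob M. \<forall>c \<in> Ob C. \<sigma> (m, c) \<cdot>\<^bsub>C\<^esub> (\<kappa> m \<star>\<^bsub>Y\<^esub> Ident C c) = \<theta> (m, c))})"

text \<open>The hom-category from \<open>(M, X)\<close> to \<open>(N, Y)\<close>.\<close>

definition act_hom_cat :: "('o, 'a, 'z) moncat_scheme \<Rightarrow>
    ('mo, 'ma) bmoncat \<Rightarrow> ('mo, 'ma, 'o, 'a) mon_action \<Rightarrow>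
    ('no, 'na) bmoncat \<Rightarrow> ('no, 'na, 'o, 'a) mon_action \<Rightarrow>
    (('mo, 'ma, 'no, 'na, 'o, 'a) act_1cell,
     ('mo, 'ma, 'no, 'na, 'o, 'a) act_1cell \<times> ('mo, 'ma, 'no, 'na, 'o, 'a) act_1cell \<times>
       ('mo \<Rightarrow> 'na)) cat" where
  "act_hom_cat C M X N Y =
     \<lparr>Ob = act_1cells C M X N Y,
      Arr = {(P, Q, \<kappa>). P \<in> act_1cells C M X N Y \<and> Q \<in> act_1cells C M X N Y \<and>
        \<kappa> \<in> act_2cells C M X N Y P Q},
      Src = (\<lambda>(P, Q, \<kappa>). P),
      Tgt = (\<lambda>(P, Q, \<kappa>). Q),
      Ident = (\<lambda>P. (P, P, \<lambda>m \<in> Ob M. Ident N (fob (fst P) m))),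
      Comp = (\<lambda>(Q', T, \<kappa>') (P, Q, \<kappa>). (P, T, \<lambda>m \<in> Ob M. \<kappa>' m \<cdot>\<^bsub>N\<^esub> \<kappa> m))\<rparr>"

end

theory Submission
  imports Defs
begin

text \<open>
  Write \<open>F m = m \<bullet> \<j>\<close> for a monoidal action of \<open>M\<close> on \<open>C\<close>. Inserting units into the interchangers gives
  natural isomorphisms \<open>(m \<bullet> c) \<otimes> d \<cong> m \<bullet> (c \<otimes> d)\<close> and \<open>c \<otimes> (m \<bullet> d) \<cong> m \<bullet> (c \<otimes> d)\<close>, that is, they make
  \<open>m \<bullet> -\<close> a bimodule endofunctor of \<open>C\<close>. Hence \<open>F m \<otimes> c \<cong> m \<bullet> c \<cong> c \<otimes> F m\<close>, which is a half-braiding on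
  \<open>F m\<close> and identifies the given action with the restriction of the action of the center along \<open>F\<close>;
  the monoidality of the multiplicator translates into \<open>F\<close> being braided. Conversely, for a 1-cell
  \<open>(R, \<theta>)\<close> the interchangers force \<open>\<theta>(m, c)\<close> to be compatible with these isomorphisms, so that
  \<open>\<theta>(m, c)\<close> is determined by \<open>\<theta>(m, \<j>)\<close>; two 1-cells are therefore related by exactly one 2-cell.

  Coherence computations are done in a strictified form: an arrow between bracketed tensor products is
  replaced by the induced arrow between right-nested tensor products with an additional last factor \<open>z\<close>.
\<close>

section \<open>Categories\<close>

text \<open>Inserting units into the axioms of an action floods every diagram with unitors,
  associators and braidings at \<j>; taming these shapes the development. No strict category is
  built: strictified arrows live in the same category, between the objects \<open>nest s z\<close>,
  so associators and unitors literally become identities and simp can compare what is left. The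
  braiding of \<open>M\<close> enters an action solely through monoidality of the multiplicator, a
  diagram with four objects of \<open>M\<close>. Putting \<j> into two of these slots in four ways
  gives the rule for each strength along a multiplicator, the factorisation of an interchanger into
  right strength followed by left strength, and the factorisation in the opposite order, which costs
  one braiding. The last two together are the reason why F is braided. The hexagon of the
  half-braiding comes from associativity of the action functor instead, with \<j> in two of its
  three slots. Since F is unique only up to an invertible 2-cell, terminality is obtained from
  hom-categories that are inhabited and have exactly one arrow between any two objects.\<close>

context category
begin

declare src_in [simp] tgt_in [simp]

lemma arr_ident [simp]:
  assumes "x \<in> Ob C"
  shows "Ident C x \<in> Arr C" "Src C (Ident C x) = x" "Tgt C (Ident C x) = x"
  using ident_hom[OF assms] by (auto simp: hom_def)

lemma arr_comp [simp]:
  assumes "f \<in> Arr C" "g \<in> Arr C" "Src C g = Tgt C f"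
  shows "g \<cdot> f \<in> Arr C" "Src C (g \<cdot> f) = Src C f" "Tgt C (g \<cdot> f) = Tgt C g"
  using comp_hom[of f "Src C f" "Tgt C f" g "Tgt C g"] assms by (auto simp: hom_def)

lemma ident_comp [simp]: "f \<in> Arr C \<Longrightarrow> Tgt C f = y \<Longrightarrow> Ident C y \<cdot> f = f"
  using comp_ident_left by (auto simp: hom_def)

lemma comp_ident [simp]: "f \<in> Arr C \<Longrightarrow> Src C f = x \<Longrightarrow> f \<cdot> Ident C x = f"
  using comp_ident_right by (auto simp: hom_def)

lemma comp_assoc_arr [simp]:
  assumes "f \<in> Arr C" "g \<in> Arr C" "h \<in> Arr C" "Src C g = Tgt C f" "Src C h = Tgt C g"
  shows "(h \<cdot> g) \<cdot> f = h \<cdot> (g \<cdot> f)"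
  using comp_assoc[of f _ _ g _ h] assms by (auto simp: hom_def)

text \<open>Composites are kept right-nested by \<open>comp_assoc_arr\<close>, so an equation about
  g following f is not visible once f is followed by a tail k on its right. The
  \<open>comp_extend\<close> family attaches such a tail, which makes equations with two, three or
  four factors usable in the middle of a composite.\<close>

lemma comp_extend:
  assumes "g \<cdot> f = h" "f \<in> Arr C" "g \<in> Arr C" "Src C g = Tgt C f" "k \<in> Arr C" "Tgt C k = Src C f"
  shows "g \<cdot> (f \<cdot> k) = h \<cdot> k"
  using assms comp_assoc_arr[of k f g] by simp

lemma comp_extend3:
  assumes "g \<cdot> (f \<cdot> e) = h" "e \<in> Arr C" "f \<in> Arr C" "g \<in> Arr C" "Src C g = Tgt C f"
    "Src C f = Tgt C e" "k \<in> Arr C" "Tgt C k = Src C e"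
  shows "g \<cdot> (f \<cdot> (e \<cdot> k)) = h \<cdot> k"
  using assms comp_extend[of g "f \<cdot> e" h k] by simp

lemma comp_extend4:
  assumes "g \<cdot> (f \<cdot> (e \<cdot> d)) = h" "d \<in> Arr C" "e \<in> Arr C" "f \<in> Arr C" "g \<in> Arr C"
    "Src C g = Tgt C f" "Src C f = Tgt C e" "Src C e = Tgt C d" "k \<in> Arr C" "Tgt C k = Src C d"
  shows "g \<cdot> (f \<cdot> (e \<cdot> (d \<cdot> k))) = h \<cdot> k"
  using assms comp_extend3[of g f "e \<cdot> d" h k] by simp

lemma inverse_arrows_unique:
  assumes "inverse_arrows C f g" "inverse_arrows C f g'"
  shows "g = g'"
proof -
  have "(g \<cdot> f) \<cdot> g' = g \<cdot> (f \<cdot> g')"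
    using assms by (intro comp_assoc_arr) (auto simp: inverse_arrows_def hom_def)
  then show ?thesis
    using assms by (simp add: inverse_arrows_def hom_def del: comp_assoc_arr)
qed

lemma inv_arrI: "inverse_arrows C f g \<Longrightarrow> inv_arr C f = g"
  unfolding inv_arr_def using inverse_arrows_unique by blast

lemma inv_arr_inverse: "iso C f \<Longrightarrow> inverse_arrows C f (inv_arr C f)"
  using inv_arrI unfolding iso_def by metis

lemma iso_arr: "iso C f \<Longrightarrow> f \<in> Arr C"
  by (auto simp: iso_def inverse_arrows_def)

lemma inverse_arrows_iff:
  "inverse_arrows C f g \<longleftrightarrow> f \<in> Arr C \<and> g \<in> Arr C \<and> Src C g = Tgt C f \<and> Tgt C g = Src C f \<and>
     g \<cdot> f = Ident C (Src C f) \<and> f \<cdot> g = Ident C (Tgt C f)"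
  by (auto simp: inverse_arrows_def hom_def)

lemma isoI: "inverse_arrows C f g \<Longrightarrow> iso C f"
  by (auto simp: iso_def)

lemma inv_iso [simp]:
  assumes "iso C f"
  shows "inv_arr C f \<in> Arr C" "Src C (inv_arr C f) = Tgt C f" "Tgt C (inv_arr C f) = Src C f"
    "inv_arr C f \<cdot> f = Ident C (Src C f)" "f \<cdot> inv_arr C f = Ident C (Tgt C f)"
    "iso C (inv_arr C f)" "inv_arr C (inv_arr C f) = f"
proof -
  have *: "inverse_arrows C f (inv_arr C f)"
    by (rule inv_arr_inverse[OF assms])
  then have "inverse_arrows C (inv_arr C f) f"
    unfolding inverse_arrows_iff by metis
  with * show "inv_arr C f \<in> Arr C" "Src C (inv_arr C f) = Tgt C f"
    "Tgt C (inv_arr C f) = Src C f" "inv_arr C f \<cdot> f = Ident C (Src C f)"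
    "f \<cdot> inv_arr C f = Ident C (Tgt C f)" "iso C (inv_arr C f)" "inv_arr C (inv_arr C f) = f"
    using inv_arrI isoI unfolding inverse_arrows_iff by blast+
qed

lemma inv_iso_extend [simp]:
  assumes "iso C f" "k \<in> Arr C"
  shows "Tgt C k = Src C f \<Longrightarrow> inv_arr C f \<cdot> (f \<cdot> k) = k"
    "Tgt C k = Tgt C f \<Longrightarrow> f \<cdot> (inv_arr C f \<cdot> k) = k"
  using assms iso_arr[OF assms(1)] comp_extend[of "inv_arr C f" f] comp_extend[of f "inv_arr C f"]
  by simp_all

lemma iso_ident [simp]:
  assumes "x \<in> Ob C"
  shows "iso C (Ident C x)" "inv_arr C (Ident C x) = Ident C x"
proof -
  have "inverse_arrows C (Ident C x) (Ident C x)"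
    using assms by (auto simp: inverse_arrows_iff)
  then show "iso C (Ident C x)" "inv_arr C (Ident C x) = Ident C x"
    using isoI inv_arrI by auto
qed

lemma iso_comp [simp]:
  assumes "iso C f" "iso C g" "Src C g = Tgt C f"
  shows "iso C (g \<cdot> f)" "inv_arr C (g \<cdot> f) = inv_arr C f \<cdot> inv_arr C g"
proof -
  have "inverse_arrows C (g \<cdot> f) (inv_arr C f \<cdot> inv_arr C g)"
    using assms iso_arr by (auto simp: inverse_arrows_iff)
  then show "iso C (g \<cdot> f)" "inv_arr C (g \<cdot> f) = inv_arr C f \<cdot> inv_arr C g"
    using isoI inv_arrI by auto
qed

lemma iso_cancel_left:
  assumes "f \<cdot> g = f \<cdot> h" "iso C f" "g \<in> Arr C" "h \<in> Arr C" "Tgt C g = Src C f" "Tgt C h = Src C f"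
  shows "g = h"
  using assms inv_iso_extend(1)[of f] by metis

lemma iso_cancel_right:
  assumes "g \<cdot> f = h \<cdot> f" "iso C f" "g \<in> Arr C" "h \<in> Arr C" "Src C g = Tgt C f" "Src C h = Tgt C f"
  shows "g = h"
proof -
  have "(g \<cdot> f) \<cdot> inv_arr C f = (h \<cdot> f) \<cdot> inv_arr C f"
    using assms by simp
  then show ?thesis
    using assms(2-) iso_arr[OF assms(2)] by simp
qed

lemma iso_move_left:
  assumes "iso C f" "g \<in> Arr C" "h \<in> Arr C" "Tgt C g = Src C f" "Tgt C h = Tgt C f"
  shows "f \<cdot> g = h \<longleftrightarrow> g = inv_arr C f \<cdot> h"
  using assms iso_arr by auto

lemma iso_move_right:
  assumes "iso C f" "g \<in> Arr C" "h \<in> Arr C" "Src C g = Tgt C f" "Src C h = Src C f"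
  shows "g \<cdot> f = h \<longleftrightarrow> g = h \<cdot> inv_arr C f"
  using assms iso_arr by auto

end

text \<open>The axioms in terms of \<open>Src\<close> and \<open>Tgt\<close>, which simp computes,
  instead of membership in hom-sets. The other introduction rules below follow the same
  pattern.\<close>

lemma categoryI:
  fixes C (structure)
  assumes "\<And>f. f \<in> Arr C \<Longrightarrow> Src C f \<in> Ob C" "\<And>f. f \<in> Arr C \<Longrightarrow> Tgt C f \<in> Ob C"
    "\<And>x. x \<in> Ob C \<Longrightarrow> Ident C x \<in> Arr C \<and> Src C (Ident C x) = x \<and> Tgt C (Ident C x) = x"
    "\<And>f g. f \<in> Arr C \<Longrightarrow> g \<in> Arr C \<Longrightarrow> Src C g = Tgt C f \<Longrightarrow>
      g \<cdot> f \<in> Arr C \<and> Src C (g \<cdot> f) = Src C f \<and> Tgt C (g \<cdot> f) = Tgt C g"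
    "\<And>f. f \<in> Arr C \<Longrightarrow> Ident C (Tgt C f) \<cdot> f = f" "\<And>f. f \<in> Arr C \<Longrightarrow> f \<cdot> Ident C (Src C f) = f"
    "\<And>f g h. f \<in> Arr C \<Longrightarrow> g \<in> Arr C \<Longrightarrow> h \<in> Arr C \<Longrightarrow> Src C g = Tgt C f \<Longrightarrow>
      Src C h = Tgt C g \<Longrightarrow> (h \<cdot> g) \<cdot> f = h \<cdot> (g \<cdot> f)"
  shows "category C"
  using assms by unfold_locales (auto simp: hom_def)

section \<open>Functors and natural isomorphisms\<close>

context cfunctor
begin

lemma fob_ob [simp]: "x \<in> Ob A \<Longrightarrow> fob F x \<in> Ob B"
  by (rule fob_in)

lemma farr_arr [simp]:
  assumes "f \<in> Arr A"
  shows "farr F f \<in> Arr B" "Src B (farr F f) = fob F (Src A f)" "Tgt B (farr F f) = fob F (Tgt A f)"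
  using farr_hom[of f "Src A f" "Tgt A f"] assms by (auto simp: hom_def)

lemma farr_id [simp]: "x \<in> Ob A \<Longrightarrow> farr F (Ident A x) = Ident B (fob F x)"
  by (rule farr_ident)

lemma farr_comp_arr:
  "f \<in> Arr A \<Longrightarrow> g \<in> Arr A \<Longrightarrow> Src A g = Tgt A f \<Longrightarrow>
    farr F (g \<cdot>\<^bsub>A\<^esub> f) = farr F g \<cdot>\<^bsub>B\<^esub> farr F f"
  using farr_comp[of f "Src A f" "Tgt A f" g "Tgt A g"] by (auto simp: hom_def)

lemma farr_iso:
  assumes "iso A f"
  shows "iso B (farr F f)" "inv_arr B (farr F f) = farr F (inv_arr A f)"
proof -
  have f: "f \<in> Arr A" using A.iso_arr assms .
  have "inverse_arrows B (farr F f) (farr F (inv_arr A f))"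
    using assms f farr_comp_arr[of f "inv_arr A f"] farr_comp_arr[of "inv_arr A f" f]
    by (simp add: B.inverse_arrows_iff)
  then show "iso B (farr F f)" "inv_arr B (farr F f) = farr F (inv_arr A f)"
    using B.isoI B.inv_arrI by auto
qed

end

lemma cfunctorI:
  assumes "category A" "category B" "\<And>x. x \<in> Ob A \<Longrightarrow> fob F x \<in> Ob B"
    "\<And>f. f \<in> Arr A \<Longrightarrow> farr F f \<in> Arr B \<and> Src B (farr F f) = fob F (Src A f) \<and>
      Tgt B (farr F f) = fob F (Tgt A f)"
    "\<And>x. x \<in> Ob A \<Longrightarrow> farr F (Ident A x) = Ident B (fob F x)"
    "\<And>f g. f \<in> Arr A \<Longrightarrow> g \<in> Arr A \<Longrightarrow> Src A g = Tgt A f \<Longrightarrow>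
      farr F (g \<cdot>\<^bsub>A\<^esub> f) = farr F g \<cdot>\<^bsub>B\<^esub> farr F f"
  shows "cfunctor A B F"
  using assms by (intro cfunctor.intro cfunctor_axioms.intro) (auto simp: hom_def)

lemma nat_transI:
  assumes "cfunctor A B F" "cfunctor A B G"
    "\<And>x. x \<in> Ob A \<Longrightarrow> \<tau> x \<in> Arr B \<and> Src B (\<tau> x) = fob F x \<and> Tgt B (\<tau> x) = fob G x"
    "\<And>f. f \<in> Arr A \<Longrightarrow> \<tau> (Tgt A f) \<cdot>\<^bsub>B\<^esub> farr F f = farr G f \<cdot>\<^bsub>B\<^esub> \<tau> (Src A f)"
  shows "nat_trans A B F G \<tau>"
  using assms by (intro nat_trans.intro nat_trans_axioms.intro) (auto simp: hom_def)

lemma nat_isoI: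
  assumes "cfunctor A B F" "cfunctor A B G"
    "\<And>x. x \<in> Ob A \<Longrightarrow> iso B (\<tau> x) \<and> Src B (\<tau> x) = fob F x \<and> Tgt B (\<tau> x) = fob G x"
    "\<And>f. f \<in> Arr A \<Longrightarrow> \<tau> (Tgt A f) \<cdot>\<^bsub>B\<^esub> farr F f = farr G f \<cdot>\<^bsub>B\<^esub> \<tau> (Src A f)"
  shows "nat_iso A B F G \<tau>"
proof -
  have "category B" using assms(1) by (simp add: cfunctor_def)
  then have "nat_trans A B F G \<tau>"
    using assms by (intro nat_transI) (auto dest: category.iso_arr)
  then show ?thesis
    using assms(3) by (intro nat_iso.intro nat_iso_axioms.intro) auto
qed

context nat_trans
begin

lemma component_arr:
  assumes "x \<in> Ob A"
  shows "\<tau> x \<in> Arr B" "Src B (\<tau> x) = fob F x" "Tgt B (\<tau> x) = fob G x"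
  using component_hom[OF assms] by (auto simp: hom_def)

lemma naturality_arr:
  "f \<in> Arr A \<Longrightarrow> \<tau> (Tgt A f) \<cdot>\<^bsub>B\<^esub> farr F f = farr G f \<cdot>\<^bsub>B\<^esub> \<tau> (Src A f)"
  using naturality[of f "Src A f" "Tgt A f"] by (auto simp: hom_def)

end

lemma prod_cat_simps [simp]:
  "Ob (prod_cat A B) = Ob A \<times> Ob B" "Arr (prod_cat A B) = Arr A \<times> Arr B"
  "Src (prod_cat A B) (f, f') = (Src A f, Src B f')" "Tgt (prod_cat A B) (f, f') = (Tgt A f, Tgt B f')"
  "Ident (prod_cat A B) (x, y) = (Ident A x, Ident B y)"
  "(g, g') \<cdot>\<^bsub>prod_cat A B\<^esub> (f, f') = (g \<cdot>\<^bsub>A\<^esub> f, g' \<cdot>\<^bsub>B\<^esub> f')"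
  by (simp_all add: prod_cat_def)

lemma category_prod:
  assumes "category A" "category B"
  shows "category (prod_cat A B)"
proof -
  interpret A: category A by fact
  interpret B: category B by fact
  show ?thesis
    by (rule categoryI) auto
qed

lemma cfunctor_id: "category A \<Longrightarrow> cfunctor A A id_fctr"
  by (rule cfunctorI) (auto simp: id_fctr_def)

lemma inverse_arrows_prod:
  assumes "category A" "category B"
  shows "inverse_arrows (prod_cat A B) (f, g) (f', g') \<longleftrightarrow> inverse_arrows A f f' \<and> inverse_arrows B g g'"
  by (auto simp: inverse_arrows_def hom_def)

lemma iso_prod:
  assumes "category A" "category B"
  shows "iso (prod_cat A B) (f, g) \<longleftrightarrow> iso A f \<and> iso B g"
    "iso A f \<Longrightarrow> iso B g \<Longrightarrow> inv_arr (prod_cat A B) (f, g) = (inv_arr A f, inv_arr B g)"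
proof -
  show "iso (prod_cat A B) (f, g) \<longleftrightarrow> iso A f \<and> iso B g"
    using inverse_arrows_prod[OF assms] by (auto simp: iso_def)
  assume "iso A f" "iso B g"
  then show "inv_arr (prod_cat A B) (f, g) = (inv_arr A f, inv_arr B g)"
    by (intro category.inv_arrI[OF category_prod[OF assms]] iffD2[OF inverse_arrows_prod[OF assms]]
        conjI category.inv_arr_inverse[OF assms(1)] category.inv_arr_inverse[OF assms(2)])
qed

section \<open>Monoidal categories\<close>

context monoidal_category
begin

sublocale T: cfunctor "prod_cat M M" M "tensor M"
  by (rule tensor_functor)

lemma unit_ob_in [simp]: "\<j> \<in> Ob M"
  by (rule unit_in)

lemma tensor_ob_in [simp]: "x \<in> Ob M \<Longrightarrow> y \<in> Ob M \<Longrightarrow> x \<otimes> y \<in> Ob M"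
  using T.fob_in by simp

lemma tensor_arr [simp]:
  assumes "f \<in> Arr M" "g \<in> Arr M"
  shows "f \<odot> g \<in> Arr M" "Src M (f \<odot> g) = Src M f \<otimes> Src M g" "Tgt M (f \<odot> g) = Tgt M f \<otimes> Tgt M g"
  using T.farr_arr[of "(f, g)"] assms by auto

lemma tensor_ident [simp]:
  "x \<in> Ob M \<Longrightarrow> y \<in> Ob M \<Longrightarrow> Ident M x \<odot> Ident M y = Ident M (x \<otimes> y)"
  using T.farr_id[of "(x, y)"] by simp

lemma interchange:
  assumes "f \<in> Arr M" "g \<in> Arr M" "f' \<in> Arr M" "g' \<in> Arr M" "Src M g = Tgt M f" "Src M g' = Tgt M f'"
  shows "(g \<odot> g') \<cdot> (f \<odot> f') = (g \<cdot> f) \<odot> (g' \<cdot> f')"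
  using T.farr_comp_arr[of "(f, f')" "(g, g')"] assms by simp

lemmas interchange_extend = comp_extend[OF interchange]

lemma tensor_iso [simp]:
  assumes "iso M f" "iso M g"
  shows "iso M (f \<odot> g)" "inv_arr M (f \<odot> g) = inv_arr M f \<odot> inv_arr M g"
proof -
  have "iso (prod_cat M M) (f, g)"
    using assms iso_prod[OF category_axioms category_axioms] by blast
  then show "iso M (f \<odot> g)" "inv_arr M (f \<odot> g) = inv_arr M f \<odot> inv_arr M g"
    using T.farr_iso iso_prod[OF category_axioms category_axioms] assms by auto
qed

lemma lunit_arr [simp]:
  assumes "x \<in> Ob M"
  shows "lunit M x \<in> Arr M" "Src M (lunit M x) = \<j> \<otimes> x" "Tgt M (lunit M x) = x" "iso M (lunit M x)"
proof -
  interpret nat_iso M M "\<lparr>fob = (\<lambda>x. \<j> \<otimes> x), farr = (\<lambda>f. Ident M \<j> \<odot> f)\<rparr>" id_fctr "lunit M"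
    by (rule lunit_iso)
  show "lunit M x \<in> Arr M" "Src M (lunit M x) = \<j> \<otimes> x" "Tgt M (lunit M x) = x" "iso M (lunit M x)"
    using component_arr[OF assms] component_iso[OF assms] by (auto simp: id_fctr_def)
qed

lemma lunit_natural: "f \<in> Arr M \<Longrightarrow> lunit M (Tgt M f) \<cdot> (Ident M \<j> \<odot> f) = f \<cdot> lunit M (Src M f)"
  using nat_trans.naturality_arr[OF nat_iso.axioms(1)[OF lunit_iso]] by (simp add: id_fctr_def)

lemma runit_arr [simp]:
  assumes "x \<in> Ob M"
  shows "runit M x \<in> Arr M" "Src M (runit M x) = x \<otimes> \<j>" "Tgt M (runit M x) = x" "iso M (runit M x)"
proof -
  interpret nat_iso M M "\<lparr>fob = (\<lambda>x. x \<otimes> \<j>), farr = (\<lambda>f. f \<odot> Ident M \<j>)\<rparr>" id_fctr "runit M"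
    by (rule runit_iso)
  show "runit M x \<in> Arr M" "Src M (runit M x) = x \<otimes> \<j>" "Tgt M (runit M x) = x" "iso M (runit M x)"
    using component_arr[OF assms] component_iso[OF assms] by (auto simp: id_fctr_def)
qed

lemma runit_natural: "f \<in> Arr M \<Longrightarrow> runit M (Tgt M f) \<cdot> (f \<odot> Ident M \<j>) = f \<cdot> runit M (Src M f)"
  using nat_trans.naturality_arr[OF nat_iso.axioms(1)[OF runit_iso]] by (simp add: id_fctr_def)

lemma assoc_arr [simp]:
  assumes "x \<in> Ob M" "y \<in> Ob M" "z \<in> Ob M"
  shows "assoc M x y z \<in> Arr M" "Src M (assoc M x y z) = (x \<otimes> y) \<otimes> z"
    "Tgt M (assoc M x y z) = x \<otimes> (y \<otimes> z)" "iso M (assoc M x y z)"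
proof -
  have *: "((x, y), z) \<in> Ob (prod_cat (prod_cat M M) M)" using assms by simp
  show "assoc M x y z \<in> Arr M" "Src M (assoc M x y z) = (x \<otimes> y) \<otimes> z"
    "Tgt M (assoc M x y z) = x \<otimes> (y \<otimes> z)" "iso M (assoc M x y z)"
    using nat_trans.component_arr[OF nat_iso.axioms(1)[OF assoc_iso] *]
      nat_iso.component_iso[OF assoc_iso *] by auto
qed

lemma assoc_natural:
  "f \<in> Arr M \<Longrightarrow> g \<in> Arr M \<Longrightarrow> h \<in> Arr M \<Longrightarrow>
   assoc M (Tgt M f) (Tgt M g) (Tgt M h) \<cdot> ((f \<odot> g) \<odot> h) =
   (f \<odot> (g \<odot> h)) \<cdot> assoc M (Src M f) (Src M g) (Src M h)"
  using nat_trans.naturality_arr[OF nat_iso.axioms(1)[OF assoc_iso], of "((f, g), h)"] by simp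

lemma left_whisker_comp:
  assumes "x \<in> Ob M" "f \<in> Arr M" "g \<in> Arr M" "Src M g = Tgt M f"
  shows "Ident M x \<odot> (g \<cdot> f) = (Ident M x \<odot> g) \<cdot> (Ident M x \<odot> f)"
  using assms by (simp add: interchange)

lemma right_whisker_comp:
  assumes "x \<in> Ob M" "f \<in> Arr M" "g \<in> Arr M" "Src M g = Tgt M f"
  shows "(g \<cdot> f) \<odot> Ident M x = (g \<odot> Ident M x) \<cdot> (f \<odot> Ident M x)"
  using assms by (simp add: interchange)

section \<open>Kelly's consequences of the pentagon and triangle for the unit\<close>

lemma left_unit_faithful:
  assumes "Ident M \<j> \<odot> f = Ident M \<j> \<odot> g" "f \<in> Arr M" "g \<in> Arr M" "Src M f = Src M g" "Tgt M f = Tgt M g"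
  shows "f = g"
proof -
  have "f \<cdot> lunit M (Src M f) = g \<cdot> lunit M (Src M f)"
    using lunit_natural[of f] lunit_natural[of g] assms by simp
  then show ?thesis
    by (rule iso_cancel_right) (use assms in auto)
qed

lemma right_unit_faithful:
  assumes "f \<odot> Ident M \<j> = g \<odot> Ident M \<j>" "f \<in> Arr M" "g \<in> Arr M" "Src M f = Src M g" "Tgt M f = Tgt M g"
  shows "f = g"
proof -
  have "f \<cdot> runit M (Src M f) = g \<cdot> runit M (Src M f)"
    using runit_natural[of f] runit_natural[of g] assms by simp
  then show ?thesis
    by (rule iso_cancel_right) (use assms in auto)
qed

text \<open>Tensoring with \<j> on the left is faithful, so the claim may be tested there. The
  pentagon for \<j>, \<j>, x, y then turns both left unitors into right unitors by two uses of the
  triangle.\<close>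

lemma lunit_tensor:
  assumes x: "x \<in> Ob M" and y: "y \<in> Ob M"
  shows "lunit M (x \<otimes> y) \<cdot> assoc M \<j> x y = lunit M x \<odot> Ident M y"
proof (rule left_unit_faithful)
  let ?k = "assoc M \<j> (\<j> \<otimes> x) y \<cdot> (assoc M \<j> \<j> x \<odot> Ident M y)"
  have "(Ident M \<j> \<odot> (lunit M (x \<otimes> y) \<cdot> assoc M \<j> x y)) \<cdot> ?k =
      (Ident M \<j> \<odot> lunit M (x \<otimes> y)) \<cdot> (assoc M \<j> \<j> (x \<otimes> y) \<cdot> assoc M (\<j> \<otimes> \<j>) x y)"
    using x y by (simp add: pentagon left_whisker_comp)
  also have "\<dots> = (runit M \<j> \<odot> Ident M (x \<otimes> y)) \<cdot> assoc M (\<j> \<otimes> \<j>) x y"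
    using x y by (simp add: comp_extend[OF triangle])
  also have "\<dots> = assoc M \<j> x y \<cdot> ((runit M \<j> \<odot> Ident M x) \<odot> Ident M y)"
    using x y assoc_natural[of "runit M \<j>" "Ident M x" "Ident M y"] by simp
  also have "\<dots> = assoc M \<j> x y \<cdot> (((Ident M \<j> \<odot> lunit M x) \<odot> Ident M y) \<cdot> (assoc M \<j> \<j> x \<odot> Ident M y))"
    using x y by (simp add: interchange triangle)
  also have "\<dots> = (Ident M \<j> \<odot> (lunit M x \<odot> Ident M y)) \<cdot> ?k"
    using x y comp_extend[OF assoc_natural[of "Ident M \<j>" "lunit M x" "Ident M y"]] by simp
  finally show "Ident M \<j> \<odot> (lunit M (x \<otimes> y) \<cdot> assoc M \<j> x y) = Ident M \<j> \<odot> (lunit M x \<odot> Ident M y)"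
    by (rule iso_cancel_right) (use x y in auto)
qed (use x y in auto)

text \<open>Mirror image of \<open>lunit_tensor\<close>: test after tensoring with \<j> on the right
  and use the pentagon for x, y, \<j>, \<j>.\<close>

lemma runit_tensor:
  assumes x: "x \<in> Ob M" and y: "y \<in> Ob M"
  shows "(Ident M x \<odot> runit M y) \<cdot> assoc M x y \<j> = runit M (x \<otimes> y)"
proof (rule right_unit_faithful)
  let ?a = "assoc M x y \<j>"
  have "?a \<cdot> (((Ident M x \<odot> runit M y) \<cdot> ?a) \<odot> Ident M \<j>) =
     (Ident M x \<odot> (runit M y \<odot> Ident M \<j>)) \<cdot> (assoc M x (y \<otimes> \<j>) \<j> \<cdot> (?a \<odot> Ident M \<j>))"
    using x y comp_extend[OF assoc_natural[of "Ident M x" "runit M y" "Ident M \<j>"]]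
    by (simp add: right_whisker_comp)
  also have "\<dots> = (Ident M x \<odot> (Ident M y \<odot> lunit M \<j>)) \<cdot> ((Ident M x \<odot> assoc M y \<j> \<j>) \<cdot> (assoc M x (y \<otimes> \<j>) \<j> \<cdot> (?a \<odot> Ident M \<j>)))"
    using x y by (simp add: interchange_extend triangle)
  also have "\<dots> = (Ident M x \<odot> (Ident M y \<odot> lunit M \<j>)) \<cdot> (assoc M x y (\<j> \<otimes> \<j>) \<cdot> assoc M (x \<otimes> y) \<j> \<j>)"
    using x y by (simp add: pentagon)
  also have "\<dots> = ?a \<cdot> ((Ident M (x \<otimes> y) \<odot> lunit M \<j>) \<cdot> assoc M (x \<otimes> y) \<j> \<j>)"
    using x y comp_extend[OF assoc_natural[of "Ident M x" "Ident M y" "lunit M \<j>"]] by simp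
  also have "\<dots> = ?a \<cdot> (runit M (x \<otimes> y) \<odot> Ident M \<j>)"
    using x y by (simp add: triangle)
  finally show "((Ident M x \<odot> runit M y) \<cdot> ?a) \<odot> Ident M \<j> = runit M (x \<otimes> y) \<odot> Ident M \<j>"
    by (rule iso_cancel_left) (use x y in auto)
qed (use x y in auto)

text \<open>Naturality of the left unitor at itself identifies its component at \<j> \<otimes> \<j>
  with a whiskering. Then \<open>lunit_tensor\<close> and the triangle compute the same arrow, once
  from each unitor.\<close>

lemma unit_coincidence: "lunit M \<j> = runit M \<j>"
proof (rule right_unit_faithful)
  have "lunit M \<j> \<cdot> lunit M (\<j> \<otimes> \<j>) = lunit M \<j> \<cdot> (Ident M \<j> \<odot> lunit M \<j>)"
    using lunit_natural[of "lunit M \<j>"] by simp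
  then have "lunit M (\<j> \<otimes> \<j>) = Ident M \<j> \<odot> lunit M \<j>"
    by (rule iso_cancel_left) auto
  then show "lunit M \<j> \<odot> Ident M \<j> = runit M \<j> \<odot> Ident M \<j>"
    using lunit_tensor[of \<j> \<j>] triangle[of \<j> \<j>] by simp
qed auto

lemma unit_tensor_unit:
  assumes "x \<in> Ob M"
  shows "lunit M (\<j> \<otimes> x) = Ident M \<j> \<odot> lunit M x" "runit M (x \<otimes> \<j>) = runit M x \<odot> Ident M \<j>"
proof -
  have "lunit M x \<cdot> lunit M (\<j> \<otimes> x) = lunit M x \<cdot> (Ident M \<j> \<odot> lunit M x)"
    using lunit_natural[of "lunit M x"] assms by simp
  then show "lunit M (\<j> \<otimes> x) = Ident M \<j> \<odot> lunit M x"
    by (rule iso_cancel_left) (use assms in auto)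
  have "runit M x \<cdot> runit M (x \<otimes> \<j>) = runit M x \<cdot> (runit M x \<odot> Ident M \<j>)"
    using runit_natural[of "runit M x"] assms by simp
  then show "runit M (x \<otimes> \<j>) = runit M x \<odot> Ident M \<j>"
    by (rule iso_cancel_left) (use assms in auto)
qed

text \<open>The target is a separate variable, so that the rule matches whatever normal form simp
  has given to \<open>Tgt M f\<close>. Each \<open>_slide\<close> collection, here and below, pairs
  such an equation with its version carrying a tail.\<close>

lemma lunit_slide0:
  "f \<in> Arr M \<Longrightarrow> Tgt M f = y \<Longrightarrow> lunit M y \<cdot> (Ident M \<j> \<odot> f) = f \<cdot> lunit M (Src M f)"
  using lunit_natural[of f] by auto

lemmas lunit_slide = lunit_slide0 comp_extend[OF lunit_slide0]

lemma runit_slide0: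
  "f \<in> Arr M \<Longrightarrow> Tgt M f = y \<Longrightarrow> runit M y \<cdot> (f \<odot> Ident M \<j>) = f \<cdot> runit M (Src M f)"
  using runit_natural[of f] by auto

lemmas runit_slide = runit_slide0 comp_extend[OF runit_slide0]

lemma assoc_slide0:
  assumes "f \<in> Arr M" "g \<in> Arr M" "h \<in> Arr M" "Tgt M f = x" "Tgt M g = y" "Tgt M h = z"
  shows "assoc M x y z \<cdot> ((f \<odot> g) \<odot> h) =
      (f \<odot> (g \<odot> h)) \<cdot> assoc M (Src M f) (Src M g) (Src M h)"
  using assoc_natural[of f g h] assms by auto

lemmas assoc_slide = assoc_slide0 comp_extend[OF assoc_slide0]

text \<open>A separate case of \<open>assoc_slide\<close>: simp fuses a tensor product of identities
  into one identity, after which the general pattern no longer matches. The same happens for the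
  other one-sided slide rules.\<close>

lemma assoc_slide_right0:
  assumes "x \<in> Ob M" "y \<in> Ob M" "h \<in> Arr M" "Tgt M h = z"
  shows "assoc M x y z \<cdot> (Ident M (x \<otimes> y) \<odot> h) =
      (Ident M x \<odot> (Ident M y \<odot> h)) \<cdot> assoc M x y (Src M h)"
  using assoc_slide(1)[of "Ident M x" "Ident M y" h x y z] assms by auto

lemmas assoc_slide_right = assoc_slide_right0 comp_extend[OF assoc_slide_right0]

lemma assoc_inv_slide0:
  assumes "f \<in> Arr M" "g \<in> Arr M" "h \<in> Arr M" "Tgt M f = x" "Tgt M g = y" "Tgt M h = z"
  shows "inv_arr M (assoc M x y z) \<cdot> (f \<odot> (g \<odot> h)) =
      ((f \<odot> g) \<odot> h) \<cdot> inv_arr M (assoc M (Src M f) (Src M g) (Src M h))"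
proof -
  have "x \<in> Ob M" "y \<in> Ob M" "z \<in> Ob M" using assms tgt_in by auto
  then show ?thesis
    using assms assoc_slide(2)[of f g h x y z "inv_arr M (assoc M (Src M f) (Src M g) (Src M h))"]
    by (intro iso_move_left[THEN iffD1, symmetric, of "assoc M x y z"]) auto
qed

lemmas assoc_inv_slide = assoc_inv_slide0 comp_extend[OF assoc_inv_slide0]

end

section \<open>Strictification\<close>

datatype 'o shape = At 'o | Emp | Tn "'o shape" "'o shape"

context monoidal_category
begin

text \<open>\<open>nest s z\<close> is the right-nested tensor product of the letters of \<open>s\<close> with last factor \<open>z\<close>; it
  depends on neither brackets nor units in \<open>s\<close>. Thus \<open>strictifies\<close> turns associators and unitors into
  identities, and it is faithful (take \<open>z = \<j>\<close>).\<close>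

primrec eval_shape :: "'o shape \<Rightarrow> 'o" where
  "eval_shape (At x) = x"
| "eval_shape Emp = \<j>"
| "eval_shape (Tn s t) = eval_shape s \<otimes> eval_shape t"

primrec nest :: "'o shape \<Rightarrow> 'o \<Rightarrow> 'o" where
  "nest (At x) z = x \<otimes> z"
| "nest Emp z = z"
| "nest (Tn s t) z = nest s (nest t z)"

primrec nest_arr :: "'o shape \<Rightarrow> 'a \<Rightarrow> 'a" where
  "nest_arr (At x) h = Ident M x \<odot> h"
| "nest_arr Emp h = h"
| "nest_arr (Tn s t) h = nest_arr s (nest_arr t h)"

text \<open>The canonical isomorphism from \<open>eval_shape s \<otimes> z\<close> to
  \<open>nest s z\<close>. As z always stands to the right, left unitors suffice for erasing units,
  and juxtaposition of shapes becomes composition of the functions \<open>nest s\<close> and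
  \<open>nest t\<close>.\<close>

primrec flatten :: "'o shape \<Rightarrow> 'o \<Rightarrow> 'a" where
  "flatten (At x) z = Ident M (x \<otimes> z)"
| "flatten Emp z = lunit M z"
| "flatten (Tn s t) z =
    flatten s (nest t z) \<cdot> (Ident M (eval_shape s) \<odot> flatten t z) \<cdot> assoc M (eval_shape s) (eval_shape t) z"

abbreviation wf_shape :: "'o shape \<Rightarrow> bool" where
  "wf_shape s \<equiv> set_shape s \<subseteq> Ob M"

lemma eval_shape_in [simp]: "wf_shape s \<Longrightarrow> eval_shape s \<in> Ob M"
  by (induction s) auto

lemma nest_in [simp]: "wf_shape s \<Longrightarrow> z \<in> Ob M \<Longrightarrow> nest s z \<in> Ob M"
  by (induction s arbitrary: z) auto

lemma nest_arr_arr [simp]: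
  assumes "wf_shape s" "h \<in> Arr M"
  shows "nest_arr s h \<in> Arr M" "Src M (nest_arr s h) = nest s (Src M h)"
    "Tgt M (nest_arr s h) = nest s (Tgt M h)"
proof -
  have "nest_arr s h \<in> Arr M \<and> Src M (nest_arr s h) = nest s (Src M h) \<and>
    Tgt M (nest_arr s h) = nest s (Tgt M h)"
    using assms by (induction s arbitrary: h) auto
  then show "nest_arr s h \<in> Arr M" "Src M (nest_arr s h) = nest s (Src M h)"
    "Tgt M (nest_arr s h) = nest s (Tgt M h)" by auto
qed

lemma nest_arr_ident [simp]: "wf_shape s \<Longrightarrow> z \<in> Ob M \<Longrightarrow> nest_arr s (Ident M z) = Ident M (nest s z)"
  by (induction s arbitrary: z) auto

lemma nest_arr_iso [simp]:
  "wf_shape s \<Longrightarrow> iso M h \<Longrightarrow> iso M (nest_arr s h)"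
  "wf_shape s \<Longrightarrow> iso M h \<Longrightarrow> inv_arr M (nest_arr s h) = nest_arr s (inv_arr M h)"
proof -
  have "wf_shape s \<Longrightarrow> iso M h \<Longrightarrow>
    iso M (nest_arr s h) \<and> inv_arr M (nest_arr s h) = nest_arr s (inv_arr M h)"
    by (induction s arbitrary: h) auto
  then show "wf_shape s \<Longrightarrow> iso M h \<Longrightarrow> iso M (nest_arr s h)"
    "wf_shape s \<Longrightarrow> iso M h \<Longrightarrow> inv_arr M (nest_arr s h) = nest_arr s (inv_arr M h)" by auto
qed

lemma flatten_iso [simp]:
  assumes "wf_shape s" "z \<in> Ob M"
  shows "iso M (flatten s z)" "flatten s z \<in> Arr M" "Src M (flatten s z) = eval_shape s \<otimes> z"
    "Tgt M (flatten s z) = nest s z"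
proof -
  have "iso M (flatten s z) \<and> flatten s z \<in> Arr M \<and> Src M (flatten s z) = eval_shape s \<otimes> z \<and>
    Tgt M (flatten s z) = nest s z"
    using assms by (induction s arbitrary: z) auto
  then show "iso M (flatten s z)" "flatten s z \<in> Arr M" "Src M (flatten s z) = eval_shape s \<otimes> z"
    "Tgt M (flatten s z) = nest s z" by auto
qed

lemma flatten_natural:
  "wf_shape s \<Longrightarrow> h \<in> Arr M \<Longrightarrow>
    flatten s (Tgt M h) \<cdot> (Ident M (eval_shape s) \<odot> h) = nest_arr s h \<cdot> flatten s (Src M h)"
proof (induction s arbitrary: h)
  case (At x)
  then show ?case by simp
next
  case Emp
  then show ?case by (simp add: lunit_natural)
next
  case (Tn s t)
  have s: "wf_shape s" and t: "wf_shape t" using Tn.prems by auto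
  have "flatten (Tn s t) (Tgt M h) \<cdot> (Ident M (eval_shape (Tn s t)) \<odot> h) =
    flatten s (nest t (Tgt M h)) \<cdot> ((Ident M (eval_shape s) \<odot> flatten t (Tgt M h)) \<cdot>
      ((Ident M (eval_shape s) \<odot> (Ident M (eval_shape t) \<odot> h)) \<cdot> assoc M (eval_shape s) (eval_shape t) (Src M h)))"
    using s t Tn.prems assoc_natural[of "Ident M (eval_shape s)" "Ident M (eval_shape t)" h] by simp
  also have "\<dots> = flatten s (nest t (Tgt M h)) \<cdot> ((Ident M (eval_shape s) \<odot> nest_arr t h) \<cdot>
    ((Ident M (eval_shape s) \<odot> flatten t (Src M h)) \<cdot> assoc M (eval_shape s) (eval_shape t) (Src M h)))"
    using s t Tn.prems Tn.IH(2)[OF t] by (simp add: interchange_extend)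
  also have "\<dots> = nest_arr (Tn s t) h \<cdot> flatten (Tn s t) (Src M h)"
    using s t Tn.prems comp_extend[OF Tn.IH(1)[OF s, of "nest_arr t h"]] by simp
  finally show ?case .
qed

text \<open>The square with the two \<open>flatten\<close> isomorphisms as sides. A whole family in
  z is recorded because tensoring evaluates it at larger objects, namely at \<open>nest t' z\<close>
  in \<open>strictifies_tensor\<close>.\<close>

definition strictifies :: "'o shape \<Rightarrow> 'o shape \<Rightarrow> 'a \<Rightarrow> ('o \<Rightarrow> 'a) \<Rightarrow> bool" where
  "strictifies s t f F \<longleftrightarrow> wf_shape s \<and> wf_shape t \<and> f \<in> Arr M \<and> Src M f = eval_shape s \<and>
    Tgt M f = eval_shape t \<and>
    (\<forall>z\<in>Ob M. F z \<in> Arr M \<and> Src M (F z) = nest s z \<and> Tgt M (F z) = nest t z \<and>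
      F z \<cdot> flatten s z = flatten t z \<cdot> (f \<odot> Ident M z))"

lemma strictifiesD:
  assumes "strictifies s t f F"
  shows "wf_shape s" "wf_shape t" "f \<in> Arr M" "Src M f = eval_shape s" "Tgt M f = eval_shape t"
    "z \<in> Ob M \<Longrightarrow> F z \<in> Arr M" "z \<in> Ob M \<Longrightarrow> Src M (F z) = nest s z"
    "z \<in> Ob M \<Longrightarrow> Tgt M (F z) = nest t z"
    "z \<in> Ob M \<Longrightarrow> F z \<cdot> flatten s z = flatten t z \<cdot> (f \<odot> Ident M z)"
  using assms by (auto simp: strictifies_def)

lemma strictifies_unique:
  assumes "strictifies s t f F" "strictifies s t f G" "z \<in> Ob M"
  shows "F z = G z"
proof -
  have "F z \<cdot> flatten s z = G z \<cdot> flatten s z"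
    using strictifiesD(9) assms by metis
  then show ?thesis
    by (rule iso_cancel_right) (use assms in \<open>auto simp: strictifiesD\<close>)
qed

text \<open>The coherence principle behind all computations below. The value at \<j> determines f
  tensored with \<j>, because \<open>flatten\<close> is invertible, and tensoring with \<j> is
  faithful.\<close>

lemma strictifies_eqI:
  assumes F: "strictifies s t f F" and G: "strictifies s t g G" and eq: "F \<j> = G \<j>"
  shows "f = g"
proof (rule right_unit_faithful)
  have "flatten t \<j> \<cdot> (f \<odot> Ident M \<j>) = flatten t \<j> \<cdot> (g \<odot> Ident M \<j>)"
    using strictifiesD(9)[OF F, of \<j>] strictifiesD(9)[OF G, of \<j>] eq by simp
  then show "f \<odot> Ident M \<j> = g \<odot> Ident M \<j>"
    by (rule iso_cancel_left) (use strictifiesD[OF F] strictifiesD[OF G] in auto)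
qed (use strictifiesD[OF F] strictifiesD[OF G] in auto)

text \<open>Naturality in z is automatic: it is inherited from \<open>flatten\<close> and the
  interchange law. In strictified form it says that an arrow on the left letters commutes with an
  arrow on everything to their right.\<close>

lemma strictifies_natural:
  assumes F: "strictifies s t f F" and h: "h \<in> Arr M"
  shows "F (Tgt M h) \<cdot> nest_arr s h = nest_arr t h \<cdot> F (Src M h)"
proof -
  note D = strictifiesD[OF F]
  have "(F (Tgt M h) \<cdot> nest_arr s h) \<cdot> flatten s (Src M h) =
      F (Tgt M h) \<cdot> (flatten s (Tgt M h) \<cdot> (Ident M (eval_shape s) \<odot> h))"
    using D h by (simp add: flatten_natural)
  also have "\<dots> = flatten t (Tgt M h) \<cdot> (f \<odot> h)"
    using D h by (simp add: comp_extend[OF D(9)] interchange)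
  also have "\<dots> = flatten t (Tgt M h) \<cdot> ((Ident M (eval_shape t) \<odot> h) \<cdot> (f \<odot> Ident M (Src M h)))"
    using D h by (simp add: interchange)
  also have "\<dots> = (nest_arr t h \<cdot> F (Src M h)) \<cdot> flatten s (Src M h)"
    using D h by (simp add: comp_extend[OF flatten_natural])
  finally show ?thesis
    by (rule iso_cancel_right) (use D h in auto)
qed

lemma strictifies_comp:
  assumes F: "strictifies r s f F" and G: "strictifies s t g G"
  shows "strictifies r t (g \<cdot> f) (\<lambda>z. G z \<cdot> F z)"
  unfolding strictifies_def
  using strictifiesD[OF F] strictifiesD[OF G]
  by (auto simp: comp_extend[OF strictifiesD(9)[OF G]] interchange)

text \<open>A tensor product of arrows is first g on the inner letters, whiskered by s, and then f
  on the outer letters, with the already transformed letters t' standing to its right.\<close>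

lemma strictifies_tensor:
  assumes F: "strictifies s s' f F" and G: "strictifies t t' g G"
  shows "strictifies (Tn s t) (Tn s' t') (f \<odot> g) (\<lambda>z. F (nest t' z) \<cdot> nest_arr s (G z))"
proof -
  note D = strictifiesD[OF F] and E = strictifiesD[OF G]
  have "(F (nest t' z) \<cdot> nest_arr s (G z)) \<cdot> flatten (Tn s t) z =
    flatten (Tn s' t') z \<cdot> ((f \<odot> g) \<odot> Ident M z)" if z: "z \<in> Ob M" for z
  proof -
    have "(F (nest t' z) \<cdot> nest_arr s (G z)) \<cdot> flatten (Tn s t) z =
      F (nest t' z) \<cdot> ((nest_arr s (G z) \<cdot> flatten s (nest t z)) \<cdot>
        ((Ident M (eval_shape s) \<odot> flatten t z) \<cdot> assoc M (eval_shape s) (eval_shape t) z))"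
      using D E z by simp
    also have "\<dots> = F (nest t' z) \<cdot> (flatten s (nest t' z) \<cdot> ((Ident M (eval_shape s) \<odot> G z) \<cdot>
        ((Ident M (eval_shape s) \<odot> flatten t z) \<cdot> assoc M (eval_shape s) (eval_shape t) z)))"
      using D E z comp_extend[OF sym[OF flatten_natural[of s "G z"]]] by simp
    also have "\<dots> = flatten s' (nest t' z) \<cdot> ((f \<odot> (flatten t' z \<cdot> (g \<odot> Ident M z))) \<cdot>
        assoc M (eval_shape s) (eval_shape t) z)"
      using D E z by (simp add: comp_extend[OF D(9)] interchange_extend)
    also have "\<dots> = flatten s' (nest t' z) \<cdot> ((Ident M (eval_shape s') \<odot> flatten t' z) \<cdot>
        ((f \<odot> (g \<odot> Ident M z)) \<cdot> assoc M (eval_shape s) (eval_shape t) z))"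
      using D E z by (simp add: interchange_extend)
    also have "\<dots> = flatten (Tn s' t') z \<cdot> ((f \<odot> g) \<odot> Ident M z)"
      using D E z assoc_natural[of f g "Ident M z"] by simp
    finally show ?thesis .
  qed
  then show ?thesis
    unfolding strictifies_def using D E by auto
qed

lemma strictifies_ident:
  "x = eval_shape s \<Longrightarrow> wf_shape s \<Longrightarrow> strictifies s s (Ident M x) (\<lambda>z. Ident M (nest s z))"
  by (auto simp: strictifies_def)

text \<open>After naturality of the associator is used to align the factors, the two ways of
  flattening differ exactly by the pentagon for x, y, w, z.\<close>

lemma strictifies_assoc:
  assumes "x = eval_shape r" "y = eval_shape s" "w = eval_shape t"
    and r: "wf_shape r" and s: "wf_shape s" and t: "wf_shape t"
  shows "strictifies (Tn (Tn r s) t) (Tn r (Tn s t)) (assoc M x y w)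
    (\<lambda>z. Ident M (nest r (nest s (nest t z))))"
proof -
  have "flatten (Tn (Tn r s) t) z = flatten (Tn r (Tn s t)) z \<cdot> (assoc M x y w \<odot> Ident M z)"
    if z: "z \<in> Ob M" for z
  proof -
    have "flatten (Tn (Tn r s) t) z = flatten r (nest s (nest t z)) \<cdot>
      ((Ident M x \<odot> flatten s (nest t z)) \<cdot> ((Ident M x \<odot> (Ident M y \<odot> flatten t z)) \<cdot>
        (assoc M x y (w \<otimes> z) \<cdot> assoc M (x \<otimes> y) w z)))"
      using assms z comp_extend[OF assoc_natural[of "Ident M x" "Ident M y" "flatten t z"]] by simp
    also have "\<dots> = flatten r (nest s (nest t z)) \<cdot>
      ((Ident M x \<odot> flatten s (nest t z)) \<cdot> ((Ident M x \<odot> (Ident M y \<odot> flatten t z)) \<cdot>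
        ((Ident M x \<odot> assoc M y w z) \<cdot> (assoc M x (y \<otimes> w) z \<cdot> (assoc M x y w \<odot> Ident M z)))))"
      using assms z pentagon[of x y w z] by simp
    also have "\<dots> = flatten (Tn r (Tn s t)) z \<cdot> (assoc M x y w \<odot> Ident M z)"
      using assms z by (simp add: interchange_extend)
    finally show ?thesis .
  qed
  then show ?thesis
    unfolding strictifies_def using assms by auto
qed

text \<open>This is where \<open>lunit_tensor\<close> is needed; for the right unitor, the triangle
  axiom itself plays this part.\<close>

lemma strictifies_lunit:
  assumes "x = eval_shape t" "wf_shape t"
  shows "strictifies (Tn Emp t) t (lunit M x) (\<lambda>z. Ident M (nest t z))"
  unfolding strictifies_def
  using assms by (auto simp: lunit_slide lunit_tensor)

lemma strictifies_runit:
  assumes "x = eval_shape t" "wf_shape t"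
  shows "strictifies (Tn t Emp) t (runit M x) (\<lambda>z. Ident M (nest t z))"
  unfolding strictifies_def
  using assms triangle by auto

lemma strictifies_inv:
  assumes F: "strictifies s t f F" and f: "iso M f"
  shows "strictifies t s (inv_arr M f) (\<lambda>z. inv_arr M (F z))" "z \<in> Ob M \<Longrightarrow> iso M (F z)"
proof -
  note D = strictifiesD[OF F]
  have *: "F z = flatten t z \<cdot> ((f \<odot> Ident M z) \<cdot> inv_arr M (flatten s z))" if "z \<in> Ob M" for z
    using D f that iso_move_right[OF flatten_iso(1), of s z "F z" "flatten t z \<cdot> (f \<odot> Ident M z)"] by simp
  have i: "iso M (F z)" if "z \<in> Ob M" for z
    unfolding *[OF that] using that D f by simp
  then show "z \<in> Ob M \<Longrightarrow> iso M (F z)" .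
  show "strictifies t s (inv_arr M f) (\<lambda>z. inv_arr M (F z))"
    unfolding strictifies_def using D i f
    by (auto simp: *)
qed

lemma strictifies_assoc_inv:
  assumes "x = eval_shape r" "y = eval_shape s" "w = eval_shape t"
    and "wf_shape r" "wf_shape s" "wf_shape t"
  shows "strictifies (Tn r (Tn s t)) (Tn (Tn r s) t) (inv_arr M (assoc M x y w))
    (\<lambda>z. Ident M (nest r (nest s (nest t z))))"
  using strictifies_inv(1)[OF strictifies_assoc[OF assms]] assms by (simp add: strictifies_def)

lemma strictifies_lunit_inv:
  assumes "x = eval_shape t" "wf_shape t"
  shows "strictifies t (Tn Emp t) (inv_arr M (lunit M x)) (\<lambda>z. Ident M (nest t z))"
  using strictifies_inv(1)[OF strictifies_lunit[OF assms]] assms by (simp add: strictifies_def)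

lemma strictifies_runit_inv:
  assumes "x = eval_shape t" "wf_shape t"
  shows "strictifies t (Tn t Emp) (inv_arr M (runit M x)) (\<lambda>z. Ident M (nest t z))"
  using strictifies_inv(1)[OF strictifies_runit[OF assms]] assms by (simp add: strictifies_def)

text \<open>Conjugation by \<open>flatten\<close>, the only possible strictification of an arrow
  between the given shapes. It serves for arrows without further structure, which are then carried
  through a computation as opaque letters.\<close>

definition strict_part :: "'o shape \<Rightarrow> 'o shape \<Rightarrow> 'a \<Rightarrow> 'o \<Rightarrow> 'a" where
  "strict_part s t f z = flatten t z \<cdot> (f \<odot> Ident M z) \<cdot> inv_arr M (flatten s z)"

lemma strictifies_strict_part:
  "wf_shape s \<Longrightarrow> wf_shape t \<Longrightarrow> f \<in> Arr M \<Longrightarrow> Src M f = eval_shape s \<Longrightarrow> Tgt M f = eval_shape t \<Longrightarrow>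
    strictifies s t f (strict_part s t f)"
  by (auto simp: strictifies_def strict_part_def)

lemmas strictifies_coherence = strictifies_assoc_inv strictifies_lunit_inv strictifies_runit_inv
  strictifies_assoc strictifies_lunit strictifies_runit strictifies_ident

end

section \<open>Monoidal categories and strong monoidal functors\<close>

lemma monoidal_categoryI:
  fixes M (structure)
  assumes cat: "category M"
    and ob: "\<And>x y. x \<in> Ob M \<Longrightarrow> y \<in> Ob M \<Longrightarrow> x \<otimes> y \<in> Ob M"
    and arr: "\<And>f g. f \<in> Arr M \<Longrightarrow> g \<in> Arr M \<Longrightarrow>
      f \<odot> g \<in> Arr M \<and> Src M (f \<odot> g) = Src M f \<otimes> Src M g \<and> Tgt M (f \<odot> g) = Tgt M f \<otimes> Tgt M g"
    and ident: "\<And>x y. x \<in> Ob M \<Longrightarrow> y \<in> Ob M \<Longrightarrow> Ident M x \<odot> Ident M y = Ident M (x \<otimes> y)"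
    and interchange: "\<And>f g f' g'. f \<in> Arr M \<Longrightarrow> g \<in> Arr M \<Longrightarrow> f' \<in> Arr M \<Longrightarrow> g' \<in> Arr M \<Longrightarrow>
      Src M g = Tgt M f \<Longrightarrow> Src M g' = Tgt M f' \<Longrightarrow> (g \<cdot> f) \<odot> (g' \<cdot> f') = (g \<odot> g') \<cdot> (f \<odot> f')"
    and unit: "\<j> \<in> Ob M"
    and lunit: "\<And>x. x \<in> Ob M \<Longrightarrow> iso M (lunit M x) \<and> Src M (lunit M x) = \<j> \<otimes> x \<and> Tgt M (lunit M x) = x"
    and lunit_nat: "\<And>f. f \<in> Arr M \<Longrightarrow> lunit M (Tgt M f) \<cdot> (Ident M \<j> \<odot> f) = f \<cdot> lunit M (Src M f)"
    and runit: "\<And>x. x \<in> Ob M \<Longrightarrow> iso M (runit M x) \<and> Src M (runit M x) = x \<otimes> \<j> \<and> Tgt M (runit M x) = x"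
    and runit_nat: "\<And>f. f \<in> Arr M \<Longrightarrow> runit M (Tgt M f) \<cdot> (f \<odot> Ident M \<j>) = f \<cdot> runit M (Src M f)"
    and assoc: "\<And>x y z. x \<in> Ob M \<Longrightarrow> y \<in> Ob M \<Longrightarrow> z \<in> Ob M \<Longrightarrow> iso M (assoc M x y z) \<and>
      Src M (assoc M x y z) = (x \<otimes> y) \<otimes> z \<and> Tgt M (assoc M x y z) = x \<otimes> (y \<otimes> z)"
    and assoc_nat: "\<And>f g h. f \<in> Arr M \<Longrightarrow> g \<in> Arr M \<Longrightarrow> h \<in> Arr M \<Longrightarrow>
      assoc M (Tgt M f) (Tgt M g) (Tgt M h) \<cdot> ((f \<odot> g) \<odot> h) =
      (f \<odot> (g \<odot> h)) \<cdot> assoc M (Src M f) (Src M g) (Src M h)"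
    and pentagon: "\<And>w x y z. w \<in> Ob M \<Longrightarrow> x \<in> Ob M \<Longrightarrow> y \<in> Ob M \<Longrightarrow> z \<in> Ob M \<Longrightarrow>
      assoc M w x (y \<otimes> z) \<cdot> assoc M (w \<otimes> x) y z =
      (Ident M w \<odot> assoc M x y z) \<cdot> assoc M w (x \<otimes> y) z \<cdot> (assoc M w x y \<odot> Ident M z)"
    and triangle: "\<And>x y. x \<in> Ob M \<Longrightarrow> y \<in> Ob M \<Longrightarrow>
      (Ident M x \<odot> lunit M y) \<cdot> assoc M x \<j> y = runit M x \<odot> Ident M y"
  shows "monoidal_category M"
proof -
  interpret category M by (rule cat)
  have T: "cfunctor (prod_cat M M) M (tensor M)"
    by (rule cfunctorI) (auto simp: category_prod cat ob arr ident interchange)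
  have L: "cfunctor M M \<lparr>fob = (\<lambda>x. \<j> \<otimes> x), farr = (\<lambda>f. Ident M \<j> \<odot> f)\<rparr>"
    by (rule cfunctorI) (auto simp: cat ob arr ident unit simp flip: interchange)
  have R: "cfunctor M M \<lparr>fob = (\<lambda>x. x \<otimes> \<j>), farr = (\<lambda>f. f \<odot> Ident M \<j>)\<rparr>"
    by (rule cfunctorI) (auto simp: cat ob arr ident unit simp flip: interchange)
  have A: "cfunctor (prod_cat (prod_cat M M) M) M
      \<lparr>fob = (\<lambda>((x, y), z). (x \<otimes> y) \<otimes> z), farr = (\<lambda>((f, g), h). (f \<odot> g) \<odot> h)\<rparr>"
    by (rule cfunctorI) (auto simp: category_prod cat ob arr ident simp flip: interchange)
  have B: "cfunctor (prod_cat (prod_cat M M) M) M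
      \<lparr>fob = (\<lambda>((x, y), z). x \<otimes> (y \<otimes> z)), farr = (\<lambda>((f, g), h). f \<odot> (g \<odot> h))\<rparr>"
    by (rule cfunctorI) (auto simp: category_prod cat ob arr ident simp flip: interchange)
  show ?thesis
    by (intro monoidal_category.intro monoidal_category_axioms.intro cat T nat_isoI L R A B cfunctor_id)
      (auto simp: unit lunit runit assoc pentagon triangle lunit_nat runit_nat assoc_nat id_fctr_def)
qed

lemma prod_moncat_simps [simp]:
  "Ob (prod_moncat A B) = Ob A \<times> Ob B" "Arr (prod_moncat A B) = Arr A \<times> Arr B"
  "Src (prod_moncat A B) (f, f') = (Src A f, Src B f')"
  "Tgt (prod_moncat A B) (f, f') = (Tgt A f, Tgt B f')"
  "Ident (prod_moncat A B) (x, x') = (Ident A x, Ident B x')"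
  "(g, g') \<cdot>\<^bsub>prod_moncat A B\<^esub> (f, f') = (g \<cdot>\<^bsub>A\<^esub> f, g' \<cdot>\<^bsub>B\<^esub> f')"
  "(x, x') \<otimes>\<^bsub>prod_moncat A B\<^esub> (y, y') = (x \<otimes>\<^bsub>A\<^esub> y, x' \<otimes>\<^bsub>B\<^esub> y')"
  "(f, f') \<odot>\<^bsub>prod_moncat A B\<^esub> (g, g') = (f \<odot>\<^bsub>A\<^esub> g, f' \<odot>\<^bsub>B\<^esub> g')"
  "\<j>\<^bsub>prod_moncat A B\<^esub> = (\<j>\<^bsub>A\<^esub>, \<j>\<^bsub>B\<^esub>)"
  "lunit (prod_moncat A B) (x, x') = (lunit A x, lunit B x')"
  "runit (prod_moncat A B) (x, x') = (runit A x, runit B x')"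
  "assoc (prod_moncat A B) (x, x') (y, y') (z, z') = (assoc A x y z, assoc B x' y' z')"
  by (simp_all add: prod_moncat_def prod_cat_def cat.extend_def)

lemma inverse_arrows_prod_moncat:
  "inverse_arrows (prod_moncat A B) (f, g) (f', g') \<longleftrightarrow> inverse_arrows A f f' \<and> inverse_arrows B g g'"
  by (auto simp: inverse_arrows_def hom_def)

lemma category_prod_moncat:
  assumes "category A" "category B"
  shows "category (prod_moncat A B)"
proof -
  interpret A: category A by fact
  interpret B: category B by fact
  show ?thesis
    by (rule categoryI) auto
qed

lemma iso_prod_moncat:
  shows "iso (prod_moncat A B) (f, g) \<longleftrightarrow> iso A f \<and> iso B g"
    and "category A \<Longrightarrow> category B \<Longrightarrow> iso A f \<Longrightarrow> iso B g \<Longrightarrow>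
      inv_arr (prod_moncat A B) (f, g) = (inv_arr A f, inv_arr B g)"
proof -
  show "iso (prod_moncat A B) (f, g) \<longleftrightarrow> iso A f \<and> iso B g"
    by (auto simp: iso_def inverse_arrows_prod_moncat)
  assume c: "category A" "category B" and "iso A f" "iso B g"
  then show "inv_arr (prod_moncat A B) (f, g) = (inv_arr A f, inv_arr B g)"
    by (intro category.inv_arrI[OF category_prod_moncat[OF c]] iffD2[OF inverse_arrows_prod_moncat]
        conjI category.inv_arr_inverse[OF c(1)] category.inv_arr_inverse[OF c(2)])
qed

lemma monoidal_category_prod:
  assumes "monoidal_category A" "monoidal_category B"
  shows "monoidal_category (prod_moncat A B)"
proof -
  interpret A: monoidal_category A by fact
  interpret B: monoidal_category B by fact
  show ?thesis
    by (rule monoidal_categoryI)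
      (auto simp: category_prod_moncat A.category_axioms B.category_axioms iso_prod_moncat(1)
        A.interchange B.interchange A.lunit_natural B.lunit_natural A.runit_natural B.runit_natural
        A.assoc_natural B.assoc_natural A.pentagon B.pentagon A.triangle B.triangle)
qed

context strong_monoidal_functor
begin

lemma feps_arr [simp]:
  "feps F \<in> Arr B" "Src B (feps F) = \<j>\<^bsub>B\<^esub>" "Tgt B (feps F) = fob F \<j>\<^bsub>A\<^esub>" "iso B (feps F)"
  using feps_hom feps_iso by (auto simp: hom_def)

lemma fmult_arr [simp]:
  assumes "x \<in> Ob A" "y \<in> Ob A"
  shows "fmult F x y \<in> Arr B" "Src B (fmult F x y) = fob F x \<otimes>\<^bsub>B\<^esub> fob F y"
    "Tgt B (fmult F x y) = fob F (x \<otimes>\<^bsub>A\<^esub> y)" "iso B (fmult F x y)"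
proof -
  have *: "(x, y) \<in> Ob (prod_cat A A)" using assms by simp
  show "fmult F x y \<in> Arr B" "Src B (fmult F x y) = fob F x \<otimes>\<^bsub>B\<^esub> fob F y"
    "Tgt B (fmult F x y) = fob F (x \<otimes>\<^bsub>A\<^esub> y)" "iso B (fmult F x y)"
    using nat_trans.component_arr[OF nat_iso.axioms(1)[OF fmult_iso] *]
      nat_iso.component_iso[OF fmult_iso *] by auto
qed

lemma fmult_slide0:
  assumes "f \<in> Arr A" "g \<in> Arr A" "Tgt A f = x" "Tgt A g = y"
  shows "fmult F x y \<cdot>\<^bsub>B\<^esub> (farr F f \<odot>\<^bsub>B\<^esub> farr F g) =
      farr F (f \<odot>\<^bsub>A\<^esub> g) \<cdot>\<^bsub>B\<^esub> fmult F (Src A f) (Src A g)"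
  using nat_trans.naturality_arr[OF nat_iso.axioms(1)[OF fmult_iso], of "(f, g)"] assms by simp

lemmas fmult_slide = fmult_slide0 B.comp_extend[OF fmult_slide0]

end

lemma strong_monoidal_functorI:
  assumes A: "monoidal_category A" and B: "monoidal_category B" and F: "cfunctor A B F"
    and feps: "iso B (feps F)" "Src B (feps F) = \<j>\<^bsub>B\<^esub>" "Tgt B (feps F) = fob F \<j>\<^bsub>A\<^esub>"
    and fmult: "\<And>x y. x \<in> Ob A \<Longrightarrow> y \<in> Ob A \<Longrightarrow> iso B (fmult F x y) \<and>
      Src B (fmult F x y) = fob F x \<otimes>\<^bsub>B\<^esub> fob F y \<and> Tgt B (fmult F x y) = fob F (x \<otimes>\<^bsub>A\<^esub> y)"
    and natural: "\<And>f g. f \<in> Arr A \<Longrightarrow> g \<in> Arr A \<Longrightarrow>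
      fmult F (Tgt A f) (Tgt A g) \<cdot>\<^bsub>B\<^esub> (farr F f \<odot>\<^bsub>B\<^esub> farr F g) =
      farr F (f \<odot>\<^bsub>A\<^esub> g) \<cdot>\<^bsub>B\<^esub> fmult F (Src A f) (Src A g)"
    and assoc: "\<And>x y z. x \<in> Ob A \<Longrightarrow> y \<in> Ob A \<Longrightarrow> z \<in> Ob A \<Longrightarrow>
      farr F (assoc A x y z) \<cdot>\<^bsub>B\<^esub> fmult F (x \<otimes>\<^bsub>A\<^esub> y) z \<cdot>\<^bsub>B\<^esub> (fmult F x y \<odot>\<^bsub>B\<^esub> Ident B (fob F z)) =
      fmult F x (y \<otimes>\<^bsub>A\<^esub> z) \<cdot>\<^bsub>B\<^esub> (Ident B (fob F x) \<odot>\<^bsub>B\<^esub> fmult F y z) \<cdot>\<^bsub>B\<^esub>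
        assoc B (fob F x) (fob F y) (fob F z)"
    and lunit: "\<And>x. x \<in> Ob A \<Longrightarrow>
      farr F (lunit A x) \<cdot>\<^bsub>B\<^esub> fmult F \<j>\<^bsub>A\<^esub> x \<cdot>\<^bsub>B\<^esub> (feps F \<odot>\<^bsub>B\<^esub> Ident B (fob F x)) =
      lunit B (fob F x)"
    and runit: "\<And>x. x \<in> Ob A \<Longrightarrow>
      farr F (runit A x) \<cdot>\<^bsub>B\<^esub> fmult F x \<j>\<^bsub>A\<^esub> \<cdot>\<^bsub>B\<^esub> (Ident B (fob F x) \<odot>\<^bsub>B\<^esub> feps F) =
      runit B (fob F x)"
  shows "strong_monoidal_functor A B F"
proof -
  interpret A: monoidal_category A by (rule A)
  interpret B: monoidal_category B by (rule B)
  interpret cfunctor A B F by (rule F)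
  have 1: "cfunctor (prod_cat A A) B
    \<lparr>fob = (\<lambda>(x, y). fob F x \<otimes>\<^bsub>B\<^esub> fob F y), farr = (\<lambda>(f, g). farr F f \<odot>\<^bsub>B\<^esub> farr F g)\<rparr>"
    by (rule cfunctorI)
      (auto simp: category_prod A.category_axioms B.category_axioms B.interchange farr_comp_arr)
  have 2: "cfunctor (prod_cat A A) B
    \<lparr>fob = (\<lambda>(x, y). fob F (x \<otimes>\<^bsub>A\<^esub> y)), farr = (\<lambda>(f, g). farr F (f \<odot>\<^bsub>A\<^esub> g))\<rparr>"
    by (rule cfunctorI)
      (auto simp: category_prod A.category_axioms B.category_axioms farr_comp_arr simp flip: A.interchange)
  show ?thesis
    by (intro strong_monoidal_functor.intro strong_monoidal_functor_axioms.intro A B F nat_isoI 1 2)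
      (auto simp: feps fmult natural assoc lunit runit hom_def B.iso_arr)
qed

section \<open>Identities, composites and products of strong monoidal functors\<close>

lemma strong_monoidal_functor_id:
  assumes "monoidal_category C"
  shows "strong_monoidal_functor C C (id_mfctr C)"
proof -
  interpret monoidal_category C by fact
  have "cfunctor C C (id_mfctr C)"
    by (rule cfunctorI) (auto simp: id_mfctr_def category_axioms)
  then show ?thesis
    by (rule strong_monoidal_functorI[OF assms assms]) (auto simp: id_mfctr_def)
qed

lemma strong_monoidal_functor_comp:
  assumes "strong_monoidal_functor A B F" "strong_monoidal_functor B D G"
  shows "strong_monoidal_functor A D (comp_mfctr D G F)"
proof -
  interpret F: strong_monoidal_functor A B F by fact
  interpret G: strong_monoidal_functor B D G by fact
  note A = F.A.monoidal_category_axioms and D = G.B.monoidal_category_axioms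
  have c: "cfunctor A D (comp_mfctr D G F)"
    by (rule cfunctorI)
      (auto simp: comp_mfctr_def F.A.category_axioms G.B.category_axioms F.farr_comp_arr G.farr_comp_arr)
  \<comment> \<open>Naturality of \<open>fmult G\<close> at a whiskered arrow of the form
    \<open>farr G f\<close> followed on the right by g. It collects all images under
    \<open>farr G\<close> on the left, where they merge into the image of the coherence law for
    \<open>F\<close>.\<close>
  have push: "fmult G (fob F v) (fob F z) \<cdot>\<^bsub>D\<^esub> ((farr G f \<cdot>\<^bsub>D\<^esub> g) \<odot>\<^bsub>D\<^esub> Ident D (fob G (fob F z))) =
      farr G (f \<odot>\<^bsub>B\<^esub> Ident B (fob F z)) \<cdot>\<^bsub>D\<^esub> fmult G (Src B f) (fob F z) \<cdot>\<^bsub>D\<^esub> (g \<odot>\<^bsub>D\<^esub> Ident D (fob G (fob F z)))"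
    "fmult G (fob F z) (fob F v) \<cdot>\<^bsub>D\<^esub> (Ident D (fob G (fob F z)) \<odot>\<^bsub>D\<^esub> (farr G f \<cdot>\<^bsub>D\<^esub> g)) =
      farr G (Ident B (fob F z) \<odot>\<^bsub>B\<^esub> f) \<cdot>\<^bsub>D\<^esub> fmult G (fob F z) (Src B f) \<cdot>\<^bsub>D\<^esub> (Ident D (fob G (fob F z)) \<odot>\<^bsub>D\<^esub> g)"
    if "f \<in> Arr B" "Tgt B f = fob F v" "v \<in> Ob A" "z \<in> Ob A" "g \<in> Arr D" "Tgt D g = fob G (Src B f)" for f g v z
    using that G.fmult_slide(2)[of f "Ident B (fob F z)" "fob F v" "fob F z" "g \<odot>\<^bsub>D\<^esub> Ident D (fob G (fob F z))"]
      G.fmult_slide(2)[of "Ident B (fob F z)" f "fob F z" "fob F v" "Ident D (fob G (fob F z)) \<odot>\<^bsub>D\<^esub> g"]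
    by (simp_all add: G.B.right_whisker_comp G.B.left_whisker_comp)
  show ?thesis
  proof (rule strong_monoidal_functorI[OF A D c], goal_cases)
    case (5 f g)
    then show ?case
      by (simp add: comp_mfctr_def G.fmult_slide F.fmult_slide(1) G.B.comp_extend[OF G.farr_comp_arr[symmetric]])
  next
    case (6 x y z)
    have "farr G (farr F (assoc A x y z)) \<cdot>\<^bsub>D\<^esub> (farr G (fmult F (x \<otimes>\<^bsub>A\<^esub> y) z) \<cdot>\<^bsub>D\<^esub>
          farr G (fmult F x y \<odot>\<^bsub>B\<^esub> Ident B (fob F z))) =
        farr G (fmult F x (y \<otimes>\<^bsub>A\<^esub> z)) \<cdot>\<^bsub>D\<^esub> (farr G (Ident B (fob F x) \<odot>\<^bsub>B\<^esub> fmult F y z) \<cdot>\<^bsub>D\<^esub>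
          farr G (assoc B (fob F x) (fob F y) (fob F z)))"
      using 6 F.fmult_assoc[of x y z] by (simp flip: G.farr_comp_arr)
    note * = G.B.comp_extend3[OF this]
    show ?case
      using 6 G.fmult_assoc[of "fob F x" "fob F y" "fob F z"]
      by (simp add: comp_mfctr_def push G.B.comp_extend[OF push(2)] *)
  next
    case (7 x)
    have "farr G (farr F (lunit A x)) \<cdot>\<^bsub>D\<^esub> (farr G (fmult F \<j>\<^bsub>A\<^esub> x) \<cdot>\<^bsub>D\<^esub>
          farr G (feps F \<odot>\<^bsub>B\<^esub> Ident B (fob F x))) = farr G (lunit B (fob F x))"
      using 7 F.fmult_lunit[of x] by (simp flip: G.farr_comp_arr)
    note * = G.B.comp_extend3[OF this]
    show ?case
      using 7 G.fmult_lunit[of "fob F x"] by (simp add: comp_mfctr_def push *)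
  next
    case (8 x)
    have "farr G (farr F (runit A x)) \<cdot>\<^bsub>D\<^esub> (farr G (fmult F x \<j>\<^bsub>A\<^esub>) \<cdot>\<^bsub>D\<^esub>
          farr G (Ident B (fob F x) \<odot>\<^bsub>B\<^esub> feps F)) = farr G (runit B (fob F x))"
      using 8 F.fmult_runit[of x] by (simp flip: G.farr_comp_arr)
    note * = G.B.comp_extend3[OF this]
    show ?case
      using 8 G.fmult_runit[of "fob F x"] by (simp add: comp_mfctr_def push *)
  qed (auto simp: comp_mfctr_def G.farr_iso)
qed

lemma strong_monoidal_functor_prod:
  assumes "strong_monoidal_functor A B F" "strong_monoidal_functor A' B' F'"
  shows "strong_monoidal_functor (prod_moncat A A') (prod_moncat B B') (prod_mfctr F F')"
proof -
  interpret F: strong_monoidal_functor A B F by fact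
  interpret F': strong_monoidal_functor A' B' F' by fact
  have c: "cfunctor (prod_moncat A A') (prod_moncat B B') (prod_mfctr F F')"
    by (rule cfunctorI)
      (auto simp: prod_mfctr_def category_prod_moncat F.A.category_axioms F'.A.category_axioms
        F.B.category_axioms F'.B.category_axioms F.farr_comp_arr F'.farr_comp_arr)
  show ?thesis
    by (rule strong_monoidal_functorI[OF _ _ c])
      (auto simp: prod_mfctr_def monoidal_category_prod F.A.monoidal_category_axioms
        F'.A.monoidal_category_axioms F.B.monoidal_category_axioms F'.B.monoidal_category_axioms
        iso_prod_moncat(1) F.fmult_slide F'.fmult_slide F.fmult_assoc F'.fmult_assoc
        F.fmult_lunit F'.fmult_lunit F.fmult_runit F'.fmult_runit)
qed

text \<open>In the first component the laws say that the unit of \<open>M\<close>, with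
  multiplication \<open>lunit M \<j>\<close> and an identity as unit arrow, is a monoid. This needs
  that the two unitors agree at \<j>.\<close>

lemma strong_monoidal_functor_unit:
  assumes "monoidal_category M" "monoidal_category C"
  shows "strong_monoidal_functor C (prod_moncat M C) (unit_mfctr M C)"
proof -
  interpret M: monoidal_category M by fact
  interpret C: monoidal_category C by fact
  have c: "cfunctor C (prod_moncat M C) (unit_mfctr M C)"
    by (rule cfunctorI)
      (auto simp: unit_mfctr_def category_prod_moncat M.category_axioms C.category_axioms)
  show ?thesis
    by (rule strong_monoidal_functorI[OF _ _ c])
      (auto simp: unit_mfctr_def monoidal_category_prod assms iso_prod_moncat(1)
        M.unit_coincidence M.lunit_tensor M.triangle M.unit_tensor_unit M.runit_natural[of "runit M \<j>\<^bsub>M\<^esub>"]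
        simp flip: M.triangle)
qed

lemma strong_monoidal_functor_reassoc:
  assumes "monoidal_category M" "monoidal_category C"
  shows "strong_monoidal_functor (prod_moncat (prod_moncat M M) C) (prod_moncat M (prod_moncat M C))
    (reassoc_mfctr M C)"
proof -
  interpret M: monoidal_category M by fact
  interpret C: monoidal_category C by fact
  have c: "cfunctor (prod_moncat (prod_moncat M M) C) (prod_moncat M (prod_moncat M C)) (reassoc_mfctr M C)"
    by (rule cfunctorI)
      (auto simp: reassoc_mfctr_def category_prod_moncat M.category_axioms C.category_axioms)
  show ?thesis
    by (rule strong_monoidal_functorI[OF _ _ c])
      (auto simp: reassoc_mfctr_def monoidal_category_prod assms iso_prod_moncat(1))
qed

lemma monoidal_nat_transI:
  assumes "strong_monoidal_functor A B F" "strong_monoidal_functor A B G" "nat_trans A B F G \<tau>"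
    "\<tau> \<j>\<^bsub>A\<^esub> \<cdot>\<^bsub>B\<^esub> feps F = feps G"
    "\<And>x y. x \<in> Ob A \<Longrightarrow> y \<in> Ob A \<Longrightarrow>
      \<tau> (x \<otimes>\<^bsub>A\<^esub> y) \<cdot>\<^bsub>B\<^esub> fmult F x y = fmult G x y \<cdot>\<^bsub>B\<^esub> (\<tau> x \<odot>\<^bsub>B\<^esub> \<tau> y)"
  shows "monoidal_nat_trans A B F G \<tau>"
  using assms by (intro monoidal_nat_trans.intro monoidal_nat_trans_axioms.intro)

section \<open>The Drinfeld center\<close>

text \<open>The condition on arrows of the center, isolated from the membership conditions, so that
  it can be proved for an underlying arrow of \<open>C\<close> with the two center objects given
  explicitly.\<close>

definition center_natural ::
    "('o, 'a, 'z) moncat_scheme \<Rightarrow> ('o, 'a) center_ob \<Rightarrow> ('o, 'a) center_ob \<Rightarrow> 'a \<Rightarrow> bool" where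
  "center_natural C x y f \<longleftrightarrow>
    (\<forall>b\<in>Ob C. snd y b \<cdot>\<^bsub>C\<^esub> (f \<odot>\<^bsub>C\<^esub> Ident C b) = (Ident C b \<odot>\<^bsub>C\<^esub> f) \<cdot>\<^bsub>C\<^esub> snd x b)"

lemma center_arrs_iff [simp]:
  "(x, y, f) \<in> center_arrs C \<longleftrightarrow> x \<in> center_obs C \<and> y \<in> center_obs C \<and> f \<in> Arr C \<and>
    Src C f = fst x \<and> Tgt C f = fst y \<and> center_natural C x y f"
  by (cases x; cases y) (auto simp: center_arrs_def center_natural_def hom_def)

lemma fst_center_tensor [simp]: "fst (center_tensor_ob C x y) = fst x \<otimes>\<^bsub>C\<^esub> fst y"
  by (cases x; cases y) simp

lemma snd_center_tensor:
  "b \<in> Ob C \<Longrightarrow> snd (center_tensor_ob C x y) b =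
    assoc C b (fst x) (fst y) \<cdot>\<^bsub>C\<^esub> (snd x b \<odot>\<^bsub>C\<^esub> Ident C (fst y)) \<cdot>\<^bsub>C\<^esub>
    inv_arr C (assoc C (fst x) b (fst y)) \<cdot>\<^bsub>C\<^esub> (Ident C (fst x) \<odot>\<^bsub>C\<^esub> snd y b) \<cdot>\<^bsub>C\<^esub> assoc C (fst x) (fst y) b"
  by (cases x; cases y) simp

lemma fst_center_unit [simp]: "fst (center_unit C) = \<j>\<^bsub>C\<^esub>"
  by (simp add: center_unit_def)

lemma snd_center_unit [simp]: "b \<in> Ob C \<Longrightarrow> snd (center_unit C) b = inv_arr C (runit C b) \<cdot>\<^bsub>C\<^esub> lunit C b"
  by (simp add: center_unit_def)

section \<open>Half-braidings and their strictification\<close>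

context monoidal_category
begin

text \<open>Applied first in a backward proof, it lets the strictification rules fill in a family F
  as they go, to be compared with the desired family G only at the end.\<close>

lemma strictifies_cong:
  "strictifies s t f F \<Longrightarrow> (\<And>z. z \<in> Ob M \<Longrightarrow> F z = G z) \<Longrightarrow> strictifies s t f G"
  by (auto simp: strictifies_def)

lemmas strictify = strictifies_comp strictifies_tensor strictifies_coherence

text \<open>The strictified half-braiding of \<open>x\<close> at the tensor product of \<open>s\<close>, built from those at the letters.\<close>

primrec slide :: "('o, 'a) center_ob \<Rightarrow> 'o shape \<Rightarrow> 'o \<Rightarrow> 'a" where
  "slide x (At b) z = strict_part (Tn (At (fst x)) (At b)) (Tn (At b) (At (fst x))) (snd x b) z"
| "slide x Emp z = Ident M (fst x \<otimes> z)"
| "slide x (Tn s t) z = nest_arr s (slide x t z) \<cdot> slide x s (nest t z)"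

declare slide.simps(1) [simp del]

lemma center_obsI:
  assumes "fst x \<in> Ob M" "snd x \<in> extensional (Ob M)"
    "\<And>b. b \<in> Ob M \<Longrightarrow> iso M (snd x b) \<and> Src M (snd x b) = fst x \<otimes> b \<and> Tgt M (snd x b) = b \<otimes> fst x"
    "\<And>f. f \<in> Arr M \<Longrightarrow> snd x (Tgt M f) \<cdot> (Ident M (fst x) \<odot> f) = (f \<odot> Ident M (fst x)) \<cdot> snd x (Src M f)"
    "\<And>d e. d \<in> Ob M \<Longrightarrow> e \<in> Ob M \<Longrightarrow>
        assoc M d e (fst x) \<cdot> snd x (d \<otimes> e) \<cdot> assoc M (fst x) d e =
        (Ident M d \<odot> snd x e) \<cdot> assoc M d (fst x) e \<cdot> (snd x d \<odot> Ident M e)"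
  shows "x \<in> center_obs M"
proof -
  have L: "cfunctor M M \<lparr>fob = (\<lambda>b. fst x \<otimes> b), farr = (\<lambda>f. Ident M (fst x) \<odot> f)\<rparr>"
    by (rule cfunctorI) (auto simp: assms(1) category_axioms left_whisker_comp)
  have R: "cfunctor M M \<lparr>fob = (\<lambda>b. b \<otimes> fst x), farr = (\<lambda>f. f \<odot> Ident M (fst x))\<rparr>"
    by (rule cfunctorI) (auto simp: assms(1) category_axioms right_whisker_comp)
  have "nat_iso M M \<lparr>fob = (\<lambda>b. fst x \<otimes> b), farr = (\<lambda>f. Ident M (fst x) \<odot> f)\<rparr>
       \<lparr>fob = (\<lambda>b. b \<otimes> fst x), farr = (\<lambda>f. f \<odot> Ident M (fst x))\<rparr> (snd x)"
    by (rule nat_isoI[OF L R]) (auto simp: assms)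
  then show ?thesis
    using assms by (auto simp: center_obs_def half_braiding_def case_prod_beta)
qed

end

locale center_object = monoidal_category M
  for M :: "('o, 'a, 'z) moncat_scheme" (structure) +
  fixes x :: "('o, 'a) center_ob"
  assumes center_ob: "x \<in> center_obs M"
begin

lemma fst_in [simp]: "fst x \<in> Ob M"
  using center_ob by (auto simp: center_obs_def)

lemma half_braiding_iso: "nat_iso M M \<lparr>fob = (\<lambda>b. fst x \<otimes> b), farr = (\<lambda>f. Ident M (fst x) \<odot> f)\<rparr>
       \<lparr>fob = (\<lambda>b. b \<otimes> fst x), farr = (\<lambda>f. f \<odot> Ident M (fst x))\<rparr> (snd x)"
  using center_ob by (auto simp: center_obs_def half_braiding_def)

lemma snd_arr [simp]:
  assumes "b \<in> Ob M"
  shows "iso M (snd x b)" "snd x b \<in> Arr M" "Src M (snd x b) = fst x \<otimes> b" "Tgt M (snd x b) = b \<otimes> fst x"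
  using nat_trans.component_arr[OF nat_iso.axioms(1)[OF half_braiding_iso] assms]
    nat_iso.component_iso[OF half_braiding_iso assms] by auto

lemma snd_slide0:
  "f \<in> Arr M \<Longrightarrow> Tgt M f = y \<Longrightarrow>
    snd x y \<cdot> (Ident M (fst x) \<odot> f) = (f \<odot> Ident M (fst x)) \<cdot> snd x (Src M f)"
  using nat_trans.naturality_arr[OF nat_iso.axioms(1)[OF half_braiding_iso]] by auto

lemmas snd_slide = snd_slide0 comp_extend[OF snd_slide0]

lemma snd_hexagon:
  "d \<in> Ob M \<Longrightarrow> e \<in> Ob M \<Longrightarrow> assoc M d e (fst x) \<cdot> snd x (d \<otimes> e) \<cdot> assoc M (fst x) d e =
    (Ident M d \<odot> snd x e) \<cdot> assoc M d (fst x) e \<cdot> (snd x d \<odot> Ident M e)"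
  using center_ob by (auto simp: center_obs_def half_braiding_def)

text \<open>By the hexagon, \<open>w = lunit \<cdot> \<upsilon>\<^sub>\<j> \<cdot> inv runit\<close> is an invertible idempotent.\<close>

lemma snd_unit: "snd x \<j> = inv_arr M (lunit M (fst x)) \<cdot> runit M (fst x)"
proof -
  let ?c = "fst x"
  define w where "w = lunit M ?c \<cdot> snd x \<j> \<cdot> inv_arr M (runit M ?c)"
  have w [simp]: "w \<in> Arr M" "Src M w = ?c" "Tgt M w = ?c" "iso M w"
    by (auto simp: w_def)
  have v: "snd x \<j> = inv_arr M (lunit M ?c) \<cdot> (w \<cdot> runit M ?c)"
    by (simp add: w_def)
  have 1: "(runit M \<j> \<odot> Ident M ?c) \<cdot> snd x (\<j> \<otimes> \<j>) = snd x \<j> \<cdot> (Ident M ?c \<odot> lunit M \<j>)"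
    by (simp add: snd_slide unit_coincidence)
  \<comment> \<open>The hexagon at d = e = \<j>, postcomposed with a whiskered unitor so that the
    triangle removes the associator in front of \<open>snd x (\<j> \<otimes> \<j>)\<close>.\<close>
  have "(Ident M \<j> \<odot> lunit M ?c) \<cdot> (assoc M \<j> \<j> ?c \<cdot> snd x (\<j> \<otimes> \<j>) \<cdot> assoc M ?c \<j> \<j>) =
      ((runit M \<j> \<odot> Ident M ?c) \<cdot> snd x (\<j> \<otimes> \<j>)) \<cdot> assoc M ?c \<j> \<j>"
    by (simp add: comp_extend[OF triangle])
  also have "\<dots> = snd x \<j> \<cdot> (runit M ?c \<odot> Ident M \<j>)"
    unfolding 1 by (simp add: triangle)
  finally have "snd x \<j> \<cdot> (runit M ?c \<odot> Ident M \<j>) =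
      (Ident M \<j> \<odot> (lunit M ?c \<cdot> snd x \<j>)) \<cdot> (assoc M \<j> ?c \<j> \<cdot> (snd x \<j> \<odot> Ident M \<j>))"
    by (simp add: snd_hexagon left_whisker_comp)
  also have "\<dots> = (Ident M \<j> \<odot> w) \<cdot> (runit M (\<j> \<otimes> ?c) \<cdot> (snd x \<j> \<odot> Ident M \<j>))"
    by (simp add: v left_whisker_comp comp_extend[OF runit_tensor])
  also have "\<dots> = (Ident M \<j> \<odot> w) \<cdot> (snd x \<j> \<cdot> runit M (?c \<otimes> \<j>))"
    by (simp add: runit_slide)
  finally have "lunit M ?c \<cdot> (snd x \<j> \<cdot> runit M (?c \<otimes> \<j>)) =
      lunit M ?c \<cdot> ((Ident M \<j> \<odot> w) \<cdot> (snd x \<j> \<cdot> runit M (?c \<otimes> \<j>)))"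
    by (simp add: unit_tensor_unit)
  then have "w \<cdot> (runit M ?c \<cdot> runit M (?c \<otimes> \<j>)) = w \<cdot> (w \<cdot> (runit M ?c \<cdot> runit M (?c \<otimes> \<j>)))"
    by (simp add: v lunit_slide)
  then have "runit M ?c \<cdot> runit M (?c \<otimes> \<j>) = w \<cdot> (runit M ?c \<cdot> runit M (?c \<otimes> \<j>))"
    by (rule iso_cancel_left) auto
  then have "Ident M ?c \<cdot> (runit M ?c \<cdot> runit M (?c \<otimes> \<j>)) = w \<cdot> (runit M ?c \<cdot> runit M (?c \<otimes> \<j>))"
    by simp
  then have "Ident M ?c = w"
    by (rule iso_cancel_right) auto
  then show ?thesis
    using v by (simp flip: \<open>Ident M ?c = w\<close>)
qed

text \<open>Induction on the shape: the hexagon splits the half-braiding at a tensor product,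
  \<open>snd_unit\<close> removes it at \<j>. At a single letter \<open>slide\<close> stays folded,
  so coherence goals end up as words in half-braidings past one letter each.\<close>

lemma strictifies_snd:
  "b = eval_shape s \<Longrightarrow> wf_shape s \<Longrightarrow>
    strictifies (Tn (At (fst x)) s) (Tn s (At (fst x))) (snd x b) (slide x s)"
proof (induction s arbitrary: b)
  case (At b)
  then show ?case
    by (auto intro!: strictifies_cong[OF strictifies_strict_part] simp: slide.simps(1))
next
  case Emp
  have "strictifies (Tn (At (fst x)) Emp) (Tn Emp (At (fst x)))
    (inv_arr M (lunit M (fst x)) \<cdot> runit M (fst x)) (slide x Emp)"
    by (rule strictifies_cong, (rule strictify | simp)+)
  then show ?case using Emp by (simp add: snd_unit del: slide.simps)
next
  case (Tn s t)
  let ?d = "eval_shape s" and ?e = "eval_shape t" and ?c = "fst x"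
  have s: "wf_shape s" and t: "wf_shape t" using Tn.prems by auto
  have b: "snd x b = inv_arr M (assoc M ?d ?e ?c) \<cdot> ((Ident M ?d \<odot> snd x ?e) \<cdot> assoc M ?d ?c ?e \<cdot>
      (snd x ?d \<odot> Ident M ?e)) \<cdot> inv_arr M (assoc M ?c ?d ?e)"
    using s t Tn.prems by (simp flip: snd_hexagon)
  show ?case
    unfolding b
    by (rule strictifies_cong, (rule strictify Tn.IH | simp add: s t)+)
      (use s t strictifiesD(6-8)[OF Tn.IH(1)[OF refl s]] strictifiesD(6-8)[OF Tn.IH(2)[OF refl t]] in simp)
qed

lemma slide_arr [simp]:
  assumes "wf_shape s" "z \<in> Ob M"
  shows "slide x s z \<in> Arr M" "Src M (slide x s z) = fst x \<otimes> nest s z"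
    "Tgt M (slide x s z) = nest s (fst x \<otimes> z)" "iso M (slide x s z)"
  using strictifiesD(6-8)[OF strictifies_snd[OF refl assms(1)] assms(2)] assms
    strictifies_inv(2)[OF strictifies_snd[OF refl assms(1)] _ assms(2)] by auto

text \<open>An arrow acting only on what lies to the right of x and b commutes with the exchange of
  x and b. This is the relation by which words of slides at disjoint places are compared.\<close>

lemma slide_natural0:
  assumes "b \<in> Ob M" "h \<in> Arr M" "Tgt M h = w"
  shows "slide x (At b) w \<cdot> (Ident M (fst x) \<odot> (Ident M b \<odot> h)) =
      (Ident M b \<odot> (Ident M (fst x) \<odot> h)) \<cdot> slide x (At b) (Src M h)"
  using strictifies_natural[OF strictifies_snd[of b "At b"], of h] assms by simp

lemmas slide_natural = slide_natural0 comp_extend[OF slide_natural0]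

lemma strictifies_snd_inv:
  "b = eval_shape s \<Longrightarrow> wf_shape s \<Longrightarrow>
    strictifies (Tn s (At (fst x))) (Tn (At (fst x)) s) (inv_arr M (snd x b)) (\<lambda>z. inv_arr M (slide x s z))"
  using strictifies_inv(1)[OF strictifies_snd] by simp

lemma slide_inv_natural:
  assumes "b \<in> Ob M" "h \<in> Arr M" "Tgt M h = w"
  shows "inv_arr M (slide x (At b) w) \<cdot> (Ident M b \<odot> (Ident M (fst x) \<odot> h)) =
      (Ident M (fst x) \<odot> (Ident M b \<odot> h)) \<cdot> inv_arr M (slide x (At b) (Src M h))"
  using strictifies_natural[OF strictifies_snd_inv[of b "At b"], of h] assms by simp

end

section \<open>Tensor product and unit of the center\<close>

context monoidal_category
begin

lemma center_objectI: "x \<in> center_obs M \<Longrightarrow> center_object M x"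
  by (intro center_object.intro center_object_axioms.intro monoidal_category_axioms)

lemma center_tensor_in:
  assumes "x \<in> center_obs M" "y \<in> center_obs M"
  shows "center_tensor_ob M x y \<in> center_obs M"
proof -
  interpret X: center_object M x using assms by (intro center_objectI)
  interpret Y: center_object M y using assms by (intro center_objectI)
  show ?thesis
  proof (rule center_obsI, goal_cases)
    case 2
    show ?case by (cases x; cases y) simp
  next
    case (4 f)
    let ?c = "Ident M (fst x)" and ?d = "Ident M (fst y)" and ?s = "Src M f" and ?t = "Tgt M f"
    have 1: "(?c \<odot> snd y ?t) \<cdot> ((?c \<odot> (?d \<odot> f)) \<cdot> k) = (?c \<odot> (f \<odot> ?d)) \<cdot> ((?c \<odot> snd y ?s) \<cdot> k)"
      if "k \<in> Arr M" "Tgt M k = fst x \<otimes> (fst y \<otimes> ?s)" for k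
      using 4 that by (simp add: interchange_extend Y.snd_slide)
    have 2: "(snd x ?t \<odot> ?d) \<cdot> (((?c \<odot> f) \<odot> ?d) \<cdot> k) = ((f \<odot> ?c) \<odot> ?d) \<cdot> ((snd x ?s \<odot> ?d) \<cdot> k)"
      if "k \<in> Arr M" "Tgt M k = (fst x \<otimes> ?s) \<otimes> fst y" for k
      using 4 that by (simp add: interchange_extend X.snd_slide)
    show ?case
      using 4 by (simp add: snd_center_tensor assoc_slide_right assoc_slide assoc_inv_slide 1 2)
  next
    case (5 d e)
    show ?case
      \<comment> \<open>The scheme of the coherence proofs: \<open>s\<close> and \<open>t\<close>
        are the bracketings of source and target, the two rule blocks compute the strictifications
        of both sides, and an equation at \<j> remains. Here each side moves x and y past d and e;
        the orders differ in the two exchanges x with d and y with e, which commute.\<close>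
      by (simp only: fst_center_tensor snd_center_tensor tensor_ob_in 5,
          rule strictifies_eqI[where s = "Tn (Tn (Tn (At (fst x)) (At (fst y))) (At d)) (At e)"
            and t = "Tn (At d) (Tn (At e) (Tn (At (fst x)) (At (fst y))))"],
          ((rule strictify X.strictifies_snd Y.strictifies_snd | (simp add: 5; fail))+)[1],
          ((rule strictify X.strictifies_snd Y.strictifies_snd | (simp add: 5; fail))+)[1],
          use 5 in \<open>simp add: left_whisker_comp X.slide_natural Y.slide_natural\<close>)
  qed (auto simp: snd_center_tensor)
qed

lemma center_unit_in: "center_unit M \<in> center_obs M"
proof (rule center_obsI, goal_cases)
  case 2
  show ?case by (simp add: center_unit_def)
next
  case (4 f)
  have *: "(f \<odot> Ident M \<j>) \<cdot> inv_arr M (runit M (Src M f)) = inv_arr M (runit M (Tgt M f)) \<cdot> f"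
    using 4 by (intro iso_move_left[THEN iffD1]) (auto simp: runit_slide)
  show ?case
    using 4 by (simp add: lunit_slide comp_extend[OF *])
next
  case (5 d e)
  show ?case
    by (simp only: fst_center_unit snd_center_unit tensor_ob_in 5,
        rule strictifies_eqI[where s = "Tn (Tn Emp (At d)) (At e)" and t = "Tn (At d) (Tn (At e) Emp)"],
        ((rule strictify | (simp add: 5; fail))+)[1],
        ((rule strictify | (simp add: 5; fail))+)[1],
        use 5 in simp)
qed auto

end

lemma drinfeld_center_simps [simp]:
  "Ob (drinfeld_center C) = center_obs C" "Arr (drinfeld_center C) = center_arrs C"
  "Src (drinfeld_center C) (x, y, f) = x" "Tgt (drinfeld_center C) (x, y, f) = y"
  "Ident (drinfeld_center C) x = (x, x, Ident C (fst x))"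
  "(y', z, g) \<cdot>\<^bsub>drinfeld_center C\<^esub> (x, y, f) = (x, z, g \<cdot>\<^bsub>C\<^esub> f)"
  "x \<otimes>\<^bsub>drinfeld_center C\<^esub> y = center_tensor_ob C x y"
  "(x, y, f) \<odot>\<^bsub>drinfeld_center C\<^esub> (x', y', f') =
    (center_tensor_ob C x x', center_tensor_ob C y y', f \<odot>\<^bsub>C\<^esub> f')"
  "\<j>\<^bsub>drinfeld_center C\<^esub> = center_unit C"
  "lunit (drinfeld_center C) x = (center_tensor_ob C (center_unit C) x, x, lunit C (fst x))"
  "runit (drinfeld_center C) x = (center_tensor_ob C x (center_unit C), x, runit C (fst x))"
  "assoc (drinfeld_center C) x y z = (center_tensor_ob C (center_tensor_ob C x y) z,
    center_tensor_ob C x (center_tensor_ob C y z), assoc C (fst x) (fst y) (fst z))"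
  "braid (drinfeld_center C) x y = (center_tensor_ob C x y, center_tensor_ob C y x, snd x (fst y))"
  by (simp_all add: drinfeld_center_def)

section \<open>The monoidal structure of the center\<close>

context monoidal_category
begin

lemma center_ob_simps [simp]:
  assumes "x \<in> center_obs M"
  shows "fst x \<in> Ob M" "b \<in> Ob M \<Longrightarrow> iso M (snd x b)" "b \<in> Ob M \<Longrightarrow> snd x b \<in> Arr M"
    "b \<in> Ob M \<Longrightarrow> Src M (snd x b) = fst x \<otimes> b" "b \<in> Ob M \<Longrightarrow> Tgt M (snd x b) = b \<otimes> fst x"
proof -
  interpret center_object M x using assms by (rule center_objectI)
  show "fst x \<in> Ob M" "b \<in> Ob M \<Longrightarrow> iso M (snd x b)" "b \<in> Ob M \<Longrightarrow> snd x b \<in> Arr M"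
    "b \<in> Ob M \<Longrightarrow> Src M (snd x b) = fst x \<otimes> b" "b \<in> Ob M \<Longrightarrow> Tgt M (snd x b) = b \<otimes> fst x"
    by auto
qed

lemma center_natural_ident: "x \<in> center_obs M \<Longrightarrow> center_natural M x x (Ident M (fst x))"
  by (simp add: center_natural_def)

lemma center_naturalD:
  "center_natural M x y f \<Longrightarrow> b \<in> Ob M \<Longrightarrow> snd y b \<cdot> (f \<odot> Ident M b) = (Ident M b \<odot> f) \<cdot> snd x b"
  by (simp add: center_natural_def)

lemma center_natural_comp:
  assumes "(x, y, f) \<in> center_arrs M" "(y, z, g) \<in> center_arrs M"
  shows "center_natural M x z (g \<cdot> f)"
  unfolding center_natural_def
proof
  fix b assume b: "b \<in> Ob M"
  have *: "snd y b \<cdot> (f \<odot> Ident M b) = (Ident M b \<odot> f) \<cdot> snd x b"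
    "snd z b \<cdot> (g \<odot> Ident M b) = (Ident M b \<odot> g) \<cdot> snd y b"
    using assms b by (auto intro: center_naturalD)
  show "snd z b \<cdot> ((g \<cdot> f) \<odot> Ident M b) = (Ident M b \<odot> (g \<cdot> f)) \<cdot> snd x b"
    using assms b * by (simp add: right_whisker_comp left_whisker_comp comp_extend[OF *(2)])
qed

text \<open>Cancelling the invertible whiskering of f turns the condition for f into the one for its
  inverse. Hence isomorphisms of the center can be recognised on underlying arrows.\<close>

lemma center_natural_inv:
  assumes "(x, y, f) \<in> center_arrs M" "iso M f"
  shows "center_natural M y x (inv_arr M f)"
  unfolding center_natural_def
proof
  fix b assume b: "b \<in> Ob M"
  have *: "snd y b \<cdot> (f \<odot> Ident M b) = (Ident M b \<odot> f) \<cdot> snd x b"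
    using assms b by (auto intro: center_naturalD)
  have "(Ident M b \<odot> f) \<cdot> (snd x b \<cdot> (inv_arr M f \<odot> Ident M b)) = snd y b"
    using assms b by (simp add: comp_extend[OF *[symmetric]] interchange)
  then have "(Ident M b \<odot> f) \<cdot> (snd x b \<cdot> (inv_arr M f \<odot> Ident M b)) =
      (Ident M b \<odot> f) \<cdot> ((Ident M b \<odot> inv_arr M f) \<cdot> snd y b)"
    using assms b by (simp add: interchange_extend)
  then show "snd x b \<cdot> (inv_arr M f \<odot> Ident M b) = (Ident M b \<odot> inv_arr M f) \<cdot> snd y b"
    by (rule iso_cancel_left) (use assms b in auto)
qed

lemma center_natural_tensor:
  assumes "(x, x', f) \<in> center_arrs M" "(y, y', g) \<in> center_arrs M"
  shows "center_natural M (center_tensor_ob M x y) (center_tensor_ob M x' y') (f \<odot> g)"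
  unfolding center_natural_def
proof
  fix b assume b: "b \<in> Ob M"
  have f: "snd x' b \<cdot> (f \<odot> Ident M b) = (Ident M b \<odot> f) \<cdot> snd x b"
    and g: "snd y' b \<cdot> (g \<odot> Ident M b) = (Ident M b \<odot> g) \<cdot> snd y b"
    using assms b by (auto intro: center_naturalD)
  have 1: "(Ident M (fst x') \<odot> snd y' b) \<cdot> ((f \<odot> (g \<odot> Ident M b)) \<cdot> k) =
      (f \<odot> (Ident M b \<odot> g)) \<cdot> ((Ident M (fst x) \<odot> snd y b) \<cdot> k)"
    if "k \<in> Arr M" "Tgt M k = fst x \<otimes> (fst y \<otimes> b)" for k
    using assms b that g by (simp add: interchange_extend)
  have 2: "(snd x' b \<odot> Ident M (fst y')) \<cdot> (((f \<odot> Ident M b) \<odot> g) \<cdot> k) =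
      ((Ident M b \<odot> f) \<odot> g) \<cdot> ((snd x b \<odot> Ident M (fst y)) \<cdot> k)"
    if "k \<in> Arr M" "Tgt M k = (fst x \<otimes> b) \<otimes> fst y" for k
    using assms b that f by (simp add: interchange_extend)
  show "snd (center_tensor_ob M x' y') b \<cdot> ((f \<odot> g) \<odot> Ident M b) =
      (Ident M b \<odot> (f \<odot> g)) \<cdot> snd (center_tensor_ob M x y) b"
    using assms b by (simp add: snd_center_tensor assoc_slide assoc_inv_slide 1 2)
qed

text \<open>The half-braiding of the unit strictifies to an identity, so both sides become the slide
  of x past b. For the associator, below, both sides are the slides of z, y and x past b in this
  order.\<close>

lemma center_natural_lunit:
  assumes "x \<in> center_obs M"
  shows "center_natural M (center_tensor_ob M (center_unit M) x) x (lunit M (fst x))"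
  unfolding center_natural_def
proof
  interpret X: center_object M x using assms by (rule center_objectI)
  fix b assume b: "b \<in> Ob M"
  show "snd x b \<cdot> (lunit M (fst x) \<odot> Ident M b) =
      (Ident M b \<odot> lunit M (fst x)) \<cdot> snd (center_tensor_ob M (center_unit M) x) b"
    by (simp only: fst_center_unit snd_center_unit snd_center_tensor b,
        rule strictifies_eqI[where s = "Tn (Tn Emp (At (fst x))) (At b)" and t = "Tn (At b) (At (fst x))"],
        ((rule strictify X.strictifies_snd | (simp add: b; fail))+)[1],
        ((rule strictify X.strictifies_snd | (simp add: b; fail))+)[1],
        use b in simp)
qed

lemma center_natural_runit:
  assumes "x \<in> center_obs M"
  shows "center_natural M (center_tensor_ob M x (center_unit M)) x (runit M (fst x))"
  unfolding center_natural_def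
proof
  interpret X: center_object M x using assms by (rule center_objectI)
  fix b assume b: "b \<in> Ob M"
  show "snd x b \<cdot> (runit M (fst x) \<odot> Ident M b) =
      (Ident M b \<odot> runit M (fst x)) \<cdot> snd (center_tensor_ob M x (center_unit M)) b"
    by (simp only: fst_center_unit snd_center_unit snd_center_tensor b,
        rule strictifies_eqI[where s = "Tn (Tn (At (fst x)) Emp) (At b)" and t = "Tn (At b) (At (fst x))"],
        ((rule strictify X.strictifies_snd | (simp add: b; fail))+)[1],
        ((rule strictify X.strictifies_snd | (simp add: b; fail))+)[1],
        use b in simp)
qed

lemma center_natural_assoc:
  assumes "x \<in> center_obs M" "y \<in> center_obs M" "z \<in> center_obs M"
  shows "center_natural M (center_tensor_ob M (center_tensor_ob M x y) z)
    (center_tensor_ob M x (center_tensor_ob M y z)) (assoc M (fst x) (fst y) (fst z))"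
  unfolding center_natural_def
proof
  interpret X: center_object M x using assms by (intro center_objectI)
  interpret Y: center_object M y using assms by (intro center_objectI)
  interpret Z: center_object M z using assms by (intro center_objectI)
  fix b assume b: "b \<in> Ob M"
  show "snd (center_tensor_ob M x (center_tensor_ob M y z)) b \<cdot> (assoc M (fst x) (fst y) (fst z) \<odot> Ident M b) =
      (Ident M b \<odot> assoc M (fst x) (fst y) (fst z)) \<cdot> snd (center_tensor_ob M (center_tensor_ob M x y) z) b"
    by (simp only: fst_center_tensor snd_center_tensor b,
        rule strictifies_eqI[where s = "Tn (Tn (Tn (At (fst x)) (At (fst y))) (At (fst z))) (At b)"
          and t = "Tn (At b) (Tn (At (fst x)) (Tn (At (fst y)) (At (fst z))))"],
        ((rule strictify X.strictifies_snd Y.strictifies_snd Z.strictifies_snd | (simp add: b; fail))+)[1],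
        ((rule strictify X.strictifies_snd Y.strictifies_snd Z.strictifies_snd | (simp add: b; fail))+)[1],
        use b in \<open>simp add: left_whisker_comp\<close>)
qed

text \<open>The Yang-Baxter equation. It is naturality of the half-braiding of x at the arrow
  \<open>snd y b\<close>, with \<open>snd x\<close> at each of the two tensor products split into
  slides.\<close>

lemma slide_braid:
  assumes "x \<in> center_obs M" "y \<in> center_obs M" "b \<in> Ob M" "z \<in> Ob M"
  shows "slide y (At b) (fst x \<otimes> z) \<cdot> ((Ident M (fst y) \<odot> slide x (At b) z) \<cdot> slide x (At (fst y)) (b \<otimes> z)) =
    (Ident M b \<odot> slide x (At (fst y)) z) \<cdot> (slide x (At b) (fst y \<otimes> z) \<cdot> (Ident M (fst x) \<odot> slide y (At b) z))"
proof -
  interpret X: center_object M x using assms by (intro center_objectI)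
  interpret Y: center_object M y using assms by (intro center_objectI)
  let ?s = "Tn (At (fst x)) (Tn (At (fst y)) (At b))" and ?t = "Tn (Tn (At b) (At (fst y))) (At (fst x))"
  have 1: "strictifies ?s ?t (snd x (b \<otimes> fst y) \<cdot> (Ident M (fst x) \<odot> snd y b))
    (\<lambda>z. slide x (Tn (At b) (At (fst y))) z \<cdot> (Ident M (nest (At (fst x)) (nest (Tn (At b) (At (fst y))) z)) \<cdot>
      nest_arr (At (fst x)) (slide y (At b) z)))"
    by (rule strictify X.strictifies_snd Y.strictifies_snd | (simp add: assms; fail))+
  have 2: "strictifies ?s ?t ((snd y b \<odot> Ident M (fst x)) \<cdot> snd x (fst y \<otimes> b))
    (\<lambda>z. (slide y (At b) (nest (At (fst x)) z) \<cdot> nest_arr (Tn (At (fst y)) (At b)) (Ident M (nest (At (fst x)) z))) \<cdot>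
     slide x (Tn (At (fst y)) (At b)) z)"
    by (rule strictify X.strictifies_snd Y.strictifies_snd | (simp add: assms; fail))+
  have 3: "snd x (b \<otimes> fst y) \<cdot> (Ident M (fst x) \<odot> snd y b) = (snd y b \<odot> Ident M (fst x)) \<cdot> snd x (fst y \<otimes> b)"
    using assms X.snd_slide(1)[of "snd y b"] by simp
  show ?thesis
    \<comment> \<open>The two composites are the same arrow by naturality and hence have the same
      strictification, although the two families were computed differently.\<close>
    using strictifies_unique[OF 1[unfolded 3] 2, of z] assms by simp
qed

text \<open>Strictified, compatibility of the braiding with the half-braidings of the two products
  is exactly the Yang-Baxter equation \<open>slide_braid\<close>.\<close>

lemma center_natural_braid:
  assumes "x \<in> center_obs M" "y \<in> center_obs M"
  shows "center_natural M (center_tensor_ob M x y) (center_tensor_ob M y x) (snd x (fst y))"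
  unfolding center_natural_def
proof
  interpret X: center_object M x using assms by (intro center_objectI)
  interpret Y: center_object M y using assms by (intro center_objectI)
  fix b assume b: "b \<in> Ob M"
  show "snd (center_tensor_ob M y x) b \<cdot> (snd x (fst y) \<odot> Ident M b) =
      (Ident M b \<odot> snd x (fst y)) \<cdot> snd (center_tensor_ob M x y) b"
    by (simp only: snd_center_tensor b,
        rule strictifies_eqI[where s = "Tn (Tn (At (fst x)) (At (fst y))) (At b)"
          and t = "Tn (At b) (Tn (At (fst y)) (At (fst x)))"],
        ((rule strictify X.strictifies_snd Y.strictifies_snd | (simp add: b; fail))+)[1],
        ((rule strictify X.strictifies_snd Y.strictifies_snd | (simp add: b; fail))+)[1],
        use b slide_braid[OF assms b] in simp)
qed

lemma category_center: "category (drinfeld_center M)"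
proof (rule categoryI, goal_cases)
  case (4 f g)
  then show ?case
    using center_natural_comp[of "fst f" "fst (snd f)" "snd (snd f)" "fst (snd g)" "snd (snd g)"]
    by (cases f rule: prod_cases3; cases g rule: prod_cases3) simp
next
  case (7 f g h)
  then show ?case
    by (cases f rule: prod_cases3; cases g rule: prod_cases3; cases h rule: prod_cases3) simp
qed (auto simp: center_natural_ident)

lemma inverse_arrows_center:
  assumes "(x, y, f) \<in> center_arrs M" "iso M f"
  shows "inverse_arrows (drinfeld_center M) (x, y, f) (y, x, inv_arr M f)"
  using assms center_natural_inv[OF assms] by (auto simp: inverse_arrows_def hom_def)

lemma iso_center:
  assumes "(x, y, f) \<in> center_arrs M" "iso M f"
  shows "iso (drinfeld_center M) (x, y, f)" "inv_arr (drinfeld_center M) (x, y, f) = (y, x, inv_arr M f)"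
  using inverse_arrows_center[OF assms] category.isoI[OF category_center] category.inv_arrI[OF category_center]
  by auto

lemma iso_center_underlying:
  assumes "iso (drinfeld_center M) (x, y, f)"
  shows "iso M f"
proof -
  obtain g where "inverse_arrows (drinfeld_center M) (x, y, f) g"
    using assms by (auto simp: iso_def)
  then have "inverse_arrows M f (snd (snd g))"
    by (cases g) (auto simp: inverse_arrows_def hom_def)
  then show ?thesis by (auto simp: iso_def)
qed

lemma monoidal_category_center: "monoidal_category (drinfeld_center M)"
proof (rule monoidal_categoryI, goal_cases)
  case (3 f g)
  then show ?case
    by (cases f rule: prod_cases3; cases g rule: prod_cases3)
      (simp add: center_tensor_in center_natural_tensor)
next
  case (5 f g f' g')
  then show ?case
    by (cases f rule: prod_cases3; cases g rule: prod_cases3; cases f' rule: prod_cases3;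
        cases g' rule: prod_cases3) (simp add: interchange)
next
  case (8 f)
  then show ?case by (cases f rule: prod_cases3) (simp add: lunit_slide)
next
  case (10 f)
  then show ?case by (cases f rule: prod_cases3) (simp add: runit_slide)
next
  case (12 f g h)
  then show ?case
    by (cases f rule: prod_cases3; cases g rule: prod_cases3; cases h rule: prod_cases3)
      (simp add: assoc_slide)
qed (simp_all add: category_center center_tensor_in center_unit_in center_natural_lunit
    center_natural_runit center_natural_assoc iso_center pentagon triangle)

end

section \<open>The braiding of the center\<close>

lemma braided_monoidal_categoryI:
  fixes M (structure)
  assumes "monoidal_category M"
    and "\<And>x y. x \<in> Ob M \<Longrightarrow> y \<in> Ob M \<Longrightarrow>
      iso M (braid M x y) \<and> Src M (braid M x y) = x \<otimes> y \<and> Tgt M (braid M x y) = y \<otimes> x"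
    and "\<And>f g. f \<in> Arr M \<Longrightarrow> g \<in> Arr M \<Longrightarrow>
      braid M (Tgt M f) (Tgt M g) \<cdot> (f \<odot> g) = (g \<odot> f) \<cdot> braid M (Src M f) (Src M g)"
    and "\<And>x y z. x \<in> Ob M \<Longrightarrow> y \<in> Ob M \<Longrightarrow> z \<in> Ob M \<Longrightarrow>
      assoc M y z x \<cdot> braid M x (y \<otimes> z) \<cdot> assoc M x y z =
      (Ident M y \<odot> braid M x z) \<cdot> assoc M y x z \<cdot> (braid M x y \<odot> Ident M z)"
    and "\<And>x y z. x \<in> Ob M \<Longrightarrow> y \<in> Ob M \<Longrightarrow> z \<in> Ob M \<Longrightarrow>
      inv_arr M (assoc M z x y) \<cdot> braid M (x \<otimes> y) z \<cdot> inv_arr M (assoc M x y z) =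
      (braid M x z \<odot> Ident M y) \<cdot> inv_arr M (assoc M x z y) \<cdot> (Ident M x \<odot> braid M y z)"
  shows "braided_monoidal_category M"
proof -
  interpret monoidal_category M by fact
  have 1: "cfunctor (prod_cat M M) M \<lparr>fob = (\<lambda>(x, y). x \<otimes> y), farr = (\<lambda>(f, g). f \<odot> g)\<rparr>"
    by (rule cfunctorI) (auto simp: category_prod category_axioms interchange)
  have 2: "cfunctor (prod_cat M M) M \<lparr>fob = (\<lambda>(x, y). y \<otimes> x), farr = (\<lambda>(f, g). g \<odot> f)\<rparr>"
    by (rule cfunctorI) (auto simp: category_prod category_axioms interchange)
  show ?thesis
    by (intro braided_monoidal_category.intro braided_monoidal_category_axioms.intro
        monoidal_category_axioms nat_isoI 1 2) (auto simp: assms)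
qed

context monoidal_category
begin

text \<open>Naturality in the second variable is naturality of half-braidings, in the first it is
  the condition on arrows of the center. The first hexagon is the axiom on half-braidings, and the
  second is the definition of the half-braiding of a product.\<close>

lemma braided_center: "braided_monoidal_category (drinfeld_center M)"
proof (rule braided_monoidal_categoryI[OF monoidal_category_center], goal_cases)
  case (2 f g)
  obtain x x' f' y y' g' where f: "f = (x, x', f')" and g: "g = (y, y', g')"
    by (cases f; cases g)
  interpret X: center_object M x using 2 f by (intro center_objectI) simp
  interpret X': center_object M x' using 2 f by (intro center_objectI) simp
  have "(f' \<odot> g') = (Ident M (fst x') \<odot> g') \<cdot> (f' \<odot> Ident M (fst y))"
    using 2 f g by (simp add: interchange)
  then have "snd x' (fst y') \<cdot> (f' \<odot> g') = (g' \<odot> f') \<cdot> snd x (fst y)"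
    using 2 f g center_naturalD[of x x' f' "fst y"] by (simp add: X'.snd_slide interchange_extend)
  then show ?case
    using 2 f g by simp
next
  case (3 x y z)
  interpret X: center_object M x using 3 by (intro center_objectI) simp
  show ?case
    using 3 X.snd_hexagon[of "fst y" "fst z"] by simp
next
  case (4 x y z)
  then show ?case
    by (simp add: iso_center snd_center_tensor center_tensor_in center_natural_assoc)
qed (auto simp: iso_center center_tensor_in center_natural_braid)

end

section \<open>The action of the center\<close>

context monoidal_category
begin

lemma mid_swap_arr [simp]:
  assumes "x \<in> Ob M" "y \<in> Ob M" "z \<in> Ob M" "w \<in> Ob M" "s \<in> Arr M" "Src M s = y \<otimes> z" "Tgt M s = z \<otimes> y"
  shows "mid_swap M x y z w s \<in> Arr M" "Src M (mid_swap M x y z w s) = (x \<otimes> y) \<otimes> (z \<otimes> w)"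
    "Tgt M (mid_swap M x y z w s) = (x \<otimes> z) \<otimes> (y \<otimes> w)"
  using assms by (simp_all add: mid_swap_def)

lemma mid_swap_iso [simp]:
  assumes "x \<in> Ob M" "y \<in> Ob M" "z \<in> Ob M" "w \<in> Ob M" "iso M s" "Src M s = y \<otimes> z" "Tgt M s = z \<otimes> y"
  shows "iso M (mid_swap M x y z w s)" "inv_arr M (mid_swap M x y z w s) = mid_swap M x z y w (inv_arr M s)"
  using assms by (simp_all add: mid_swap_def iso_arr)

text \<open>The exchanges s and s' are arbitrary up to one commuting square. Thus the lemma also
  covers the replacement of one of the objects by an isomorphic one together with its half-braiding,
  such as \<j> by the image of the unit.\<close>

lemma mid_swap_natural:
  assumes "f \<in> Arr M" "g \<in> Arr M" "k \<in> Arr M" "h \<in> Arr M" "s \<in> Arr M" "s' \<in> Arr M"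
    "Src M s = Src M g \<otimes> Src M k" "Tgt M s = Src M k \<otimes> Src M g"
    "Src M s' = Tgt M g \<otimes> Tgt M k" "Tgt M s' = Tgt M k \<otimes> Tgt M g"
    and s: "s' \<cdot> (g \<odot> k) = (k \<odot> g) \<cdot> s"
  shows "mid_swap M (Tgt M f) (Tgt M g) (Tgt M k) (Tgt M h) s' \<cdot> ((f \<odot> g) \<odot> (k \<odot> h)) =
    ((f \<odot> k) \<odot> (g \<odot> h)) \<cdot> mid_swap M (Src M f) (Src M g) (Src M k) (Src M h) s"
proof -
  let ?a = "\<lambda>x y z w s. assoc M z y w \<cdot> (s \<odot> Ident M w) \<cdot> inv_arr M (assoc M y z w)"
  have 1: "?a x (Tgt M g) (Tgt M k) (Tgt M h) s' \<cdot> (g \<odot> (k \<odot> h)) =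
      (k \<odot> (g \<odot> h)) \<cdot> ?a x (Src M g) (Src M k) (Src M h) s" for x
  proof -
    have "(s' \<odot> Ident M (Tgt M h)) \<cdot> (((g \<odot> k) \<odot> h) \<cdot> inv_arr M (assoc M (Src M g) (Src M k) (Src M h))) =
       ((k \<odot> g) \<odot> h) \<cdot> ((s \<odot> Ident M (Src M h)) \<cdot> inv_arr M (assoc M (Src M g) (Src M k) (Src M h)))"
      using assms by (simp add: interchange_extend)
    then show ?thesis
      using assms by (simp add: assoc_inv_slide assoc_slide)
  qed
  have "(Ident M (Tgt M f) \<odot> ?a x (Tgt M g) (Tgt M k) (Tgt M h) s') \<cdot> ((f \<odot> (g \<odot> (k \<odot> h))) \<cdot> r) =
      (f \<odot> (k \<odot> (g \<odot> h))) \<cdot> ((Ident M (Src M f) \<odot> ?a x (Src M g) (Src M k) (Src M h) s) \<cdot> r)"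
    if "r \<in> Arr M" "Tgt M r = Src M f \<otimes> (Src M g \<otimes> (Src M k \<otimes> Src M h))" for x r
    using assms that 1 by (simp add: interchange_extend del: comp_assoc_arr)
  then show ?thesis
    using assms assoc_slide(1)[of f g "k \<odot> h"] assoc_inv_slide(2)[of f k "g \<odot> h"]
    by (simp add: mid_swap_def)
qed

text \<open>All associators vanish, and only s remains, with r on its left and v to its
  right.\<close>

lemma strictifies_mid_swap:
  assumes S: "strictifies (Tn t u) (Tn u t) s S"
    and "x = eval_shape r" "y = eval_shape t" "z = eval_shape u" "w = eval_shape v"
    and r: "wf_shape r" and t: "wf_shape t" and u: "wf_shape u" and v: "wf_shape v"
  shows "strictifies (Tn (Tn r t) (Tn u v)) (Tn (Tn r u) (Tn t v)) (mid_swap M x y z w s)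
    (\<lambda>b. nest_arr r (S (nest v b)))"
  unfolding mid_swap_def assms(2-5)
  by (rule strictifies_cong, (rule strictify S | (simp add: r t u v; fail))+)
    (use r t u v strictifiesD(6-8)[OF S] in simp)

text \<open>The form of naturality that matches after \<open>left_whisker_comp\<close> has
  distributed a whiskering over a composite of inverse slides.\<close>

lemma slide_inv_natural_whisker0:
  assumes "x \<in> center_obs M" "a \<in> Ob M" "b \<in> Ob M" "h \<in> Arr M" "Tgt M h = w"
  shows "(Ident M a \<odot> inv_arr M (slide x (At b) w)) \<cdot> (Ident M a \<odot> (Ident M b \<odot> (Ident M (fst x) \<odot> h))) =
      (Ident M a \<odot> (Ident M (fst x) \<odot> (Ident M b \<odot> h))) \<cdot> (Ident M a \<odot> inv_arr M (slide x (At b) (Src M h)))"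
proof -
  interpret X: center_object M x using assms by (intro center_objectI)
  have "w \<in> Ob M" using assms by auto
  then show ?thesis
    using assms X.slide_inv_natural[of b h w] by (simp add: interchange)
qed

lemmas slide_inv_natural_whisker = slide_inv_natural_whisker0 comp_extend[OF slide_inv_natural_whisker0]

text \<open>The inverse interchanger of the action of the center.\<close>

definition center_swap :: "('o, 'a) center_ob \<Rightarrow> 'o \<Rightarrow> ('o, 'a) center_ob \<Rightarrow> 'o \<Rightarrow> 'a" where
  "center_swap m c n d = mid_swap M (fst m) c (fst n) d (inv_arr M (snd n c))"

lemma center_swap_iso [simp]:
  assumes "m \<in> center_obs M" "n \<in> center_obs M" "c \<in> Ob M" "d \<in> Ob M"
  shows "iso M (center_swap m c n d)" "center_swap m c n d \<in> Arr M"
    "Src M (center_swap m c n d) = (fst m \<otimes> c) \<otimes> (fst n \<otimes> d)"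
    "Tgt M (center_swap m c n d) = (fst m \<otimes> fst n) \<otimes> (c \<otimes> d)"
  using assms by (simp_all add: center_swap_def)

lemma center_swap_natural:
  assumes "(m, m', f) \<in> center_arrs M" "(n, n', k) \<in> center_arrs M" "g \<in> Arr M" "h \<in> Arr M"
  shows "center_swap m' (Tgt M g) n' (Tgt M h) \<cdot> ((f \<odot> g) \<odot> (k \<odot> h)) =
    ((f \<odot> k) \<odot> (g \<odot> h)) \<cdot> center_swap m (Src M g) n (Src M h)"
proof -
  interpret N: center_object M n using assms by (intro center_objectI) simp
  interpret N': center_object M n' using assms by (intro center_objectI) simp
  \<comment> \<open>Splitting the tensor product separates the two reasons: the half-braiding of n'
    is natural in g, and k is an arrow of the center.\<close>
  have "(k \<odot> g) = (Ident M (fst n') \<odot> g) \<cdot> (k \<odot> Ident M (Src M g))"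
    using assms by (simp add: interchange)
  then have "snd n' (Tgt M g) \<cdot> (k \<odot> g) = (g \<odot> k) \<cdot> snd n (Src M g)"
    using assms center_naturalD[of n n' k "Src M g"] by (simp add: N'.snd_slide interchange_extend)
  then have "snd n' (Tgt M g) \<cdot> ((k \<odot> g) \<cdot> inv_arr M (snd n (Src M g))) = (g \<odot> k)"
    using assms comp_extend[of "snd n' (Tgt M g)" "k \<odot> g"] by simp
  then have "inv_arr M (snd n' (Tgt M g)) \<cdot> (g \<odot> k) =
      inv_arr M (snd n' (Tgt M g)) \<cdot> (snd n' (Tgt M g) \<cdot> ((k \<odot> g) \<cdot> inv_arr M (snd n (Src M g))))"
    by simp
  also have "\<dots> = (k \<odot> g) \<cdot> inv_arr M (snd n (Src M g))"
    using assms by simp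
  finally have "inv_arr M (snd n' (Tgt M g)) \<cdot> (g \<odot> k) = (k \<odot> g) \<cdot> inv_arr M (snd n (Src M g))" .
  then show ?thesis
    unfolding center_swap_def
    using assms mid_swap_natural[of f g k h "inv_arr M (snd n (Src M g))" "inv_arr M (snd n' (Tgt M g))"]
    by simp
qed

lemma inv_snd_center_tensor:
  assumes "x \<in> center_obs M" "y \<in> center_obs M" "b \<in> Ob M"
  shows "inv_arr M (snd (center_tensor_ob M x y) b) =
    inv_arr M (assoc M (fst x) (fst y) b) \<cdot> (Ident M (fst x) \<odot> inv_arr M (snd y b)) \<cdot>
    assoc M (fst x) b (fst y) \<cdot> (inv_arr M (snd x b) \<odot> Ident M (fst y)) \<cdot> inv_arr M (assoc M b (fst x) (fst y))"
  using assms by (simp add: snd_center_tensor)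

lemma inv_snd_center_unit:
  "b \<in> Ob M \<Longrightarrow> inv_arr M (snd (center_unit M) b) = inv_arr M (lunit M b) \<cdot> runit M b"
  by simp

text \<open>In strictified form the word m c n d p e is rearranged to m n p c d e by moving n past
  c, and p past d and then c. The two sides differ in the order of moving n past c and p past d,
  which happen at disjoint places.\<close>

lemma center_swap_assoc:
  assumes "m \<in> center_obs M" "n \<in> center_obs M" "p \<in> center_obs M"
    and "c \<in> Ob M" "d \<in> Ob M" "e \<in> Ob M"
  shows "(assoc M (fst m) (fst n) (fst p) \<odot> assoc M c d e) \<cdot>
      center_swap (center_tensor_ob M m n) (c \<otimes> d) p e \<cdot> (center_swap m c n d \<odot> Ident M (fst p \<otimes> e)) =
    center_swap m c (center_tensor_ob M n p) (d \<otimes> e) \<cdot>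
      (Ident M (fst m \<otimes> c) \<odot> center_swap n d p e) \<cdot> assoc M (fst m \<otimes> c) (fst n \<otimes> d) (fst p \<otimes> e)"
proof -
  interpret N: center_object M n using assms by (intro center_objectI)
  interpret P: center_object M p using assms by (intro center_objectI)
  show ?thesis
    by (simp only: center_swap_def fst_center_tensor inv_snd_center_tensor assms,
        rule strictifies_eqI[where
          s = "Tn (Tn (Tn (At (fst m)) (At c)) (Tn (At (fst n)) (At d))) (Tn (At (fst p)) (At e))"
          and t = "Tn (Tn (At (fst m)) (Tn (At (fst n)) (At (fst p)))) (Tn (At c) (Tn (At d) (At e)))"],
        ((rule strictify strictifies_mid_swap N.strictifies_snd_inv P.strictifies_snd_inv | (simp add: assms; fail))+)[1],
        ((rule strictify strictifies_mid_swap N.strictifies_snd_inv P.strictifies_snd_inv | (simp add: assms; fail))+)[1],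
        use assms in \<open>simp add: left_whisker_comp slide_inv_natural_whisker\<close>)
qed

lemma center_swap_lunit:
  assumes "m \<in> center_obs M" "c \<in> Ob M"
  shows "(lunit M (fst m) \<odot> lunit M c) \<cdot> center_swap (center_unit M) \<j> m c \<cdot>
    (inv_arr M (lunit M \<j>) \<odot> Ident M (fst m \<otimes> c)) = lunit M (fst m \<otimes> c)"
proof -
  interpret X: center_object M m using assms by (intro center_objectI)
  show ?thesis
    by (simp only: center_swap_def fst_center_unit assms,
        rule strictifies_eqI[where s = "Tn Emp (Tn (At (fst m)) (At c))" and t = "Tn (At (fst m)) (At c)"],
        ((rule strictify strictifies_mid_swap X.strictifies_snd_inv | (simp add: assms; fail))+)[1],
        ((rule strictify | (simp add: assms; fail))+)[1],
        use assms in simp)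
qed

lemma center_swap_runit:
  assumes "m \<in> center_obs M" "c \<in> Ob M"
  shows "(runit M (fst m) \<odot> runit M c) \<cdot> center_swap m c (center_unit M) \<j> \<cdot>
    (Ident M (fst m \<otimes> c) \<odot> inv_arr M (lunit M \<j>)) = runit M (fst m \<otimes> c)"
proof -
  interpret X: center_object M m using assms by (intro center_objectI)
  show ?thesis
    by (simp only: center_swap_def fst_center_unit inv_snd_center_unit assms,
        rule strictifies_eqI[where s = "Tn (Tn (At (fst m)) (At c)) Emp" and t = "Tn (At (fst m)) (At c)"],
        ((rule strictify strictifies_mid_swap | (simp add: assms; fail))+)[1],
        ((rule strictify | (simp add: assms; fail))+)[1],
        use assms in simp)
qed

lemma center_swap_unitor:
  assumes "c \<in> Ob M" "d \<in> Ob M"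
  shows "(lunit M \<j> \<odot> Ident M (c \<otimes> d)) \<cdot> center_swap (center_unit M) c (center_unit M) d \<cdot>
    (inv_arr M (lunit M c) \<odot> inv_arr M (lunit M d)) = inv_arr M (lunit M (c \<otimes> d))"
    by (simp only: center_swap_def fst_center_unit inv_snd_center_unit assms,
        rule strictifies_eqI[where s = "Tn (At c) (At d)" and t = "Tn Emp (Tn (At c) (At d))"],
        ((rule strictify strictifies_mid_swap | (simp add: assms; fail))+)[1],
        ((rule strictify | (simp add: assms; fail))+)[1],
        use assms in simp)

text \<open>The word m n c m' n' c' is rearranged to m m' n n' c c'. Both sides move m' past c and
  n, and n' past c; the factor exchanging n with m' is the inverse braiding contributed by the
  tensor functor of the center.\<close>

lemma center_swap_multiplicator:
  assumes "m \<in> center_obs M" "n \<in> center_obs M" "m' \<in> center_obs M" "n' \<in> center_obs M"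
    and "c \<in> Ob M" "c' \<in> Ob M"
  shows "inv_arr M (assoc M (fst m \<otimes> fst m') (fst n \<otimes> fst n') (c \<otimes> c')) \<cdot>
      (Ident M (fst m \<otimes> fst m') \<odot> center_swap n c n' c') \<cdot> center_swap m (fst n \<otimes> c) m' (fst n' \<otimes> c') =
    (center_swap m (fst n) m' (fst n') \<odot> Ident M (c \<otimes> c')) \<cdot>
      center_swap (center_tensor_ob M m n) c (center_tensor_ob M m' n') c' \<cdot>
      (inv_arr M (assoc M (fst m) (fst n) c) \<odot> inv_arr M (assoc M (fst m') (fst n') c'))"
proof -
  interpret M': center_object M m' using assms by (intro center_objectI)
  interpret N': center_object M n' using assms by (intro center_objectI)
  show ?thesis
    by (simp only: center_swap_def fst_center_tensor inv_snd_center_tensor assms,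
        rule strictifies_eqI[where
          s = "Tn (Tn (At (fst m)) (Tn (At (fst n)) (At c))) (Tn (At (fst m')) (Tn (At (fst n')) (At c')))"
          and t = "Tn (Tn (Tn (At (fst m)) (At (fst m'))) (Tn (At (fst n)) (At (fst n')))) (Tn (At c) (At c'))"],
        ((rule strictify strictifies_mid_swap M'.strictifies_snd_inv N'.strictifies_snd_inv | (simp add: assms; fail))+)[1],
        ((rule strictify strictifies_mid_swap M'.strictifies_snd_inv N'.strictifies_snd_inv | (simp add: assms; fail))+)[1],
        use assms in \<open>simp add: left_whisker_comp slide_inv_natural_whisker\<close>)
qed

end

section \<open>The left action of the center on the category\<close>

lemma center_action_simps [simp]:
  "m \<bullet>\<^bsub>center_action C\<^esub> c = fst m \<otimes>\<^bsub>C\<^esub> c"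
  "p \<star>\<^bsub>center_action C\<^esub> g = snd (snd p) \<odot>\<^bsub>C\<^esub> g"
  "unitor (center_action C) d = inv_arr C (lunit C d)"
  "multiplicator (center_action C) m n d = inv_arr C (assoc C (fst m) (fst n) d)"
  "unit_interchanger (center_action C) = lunit C \<j>\<^bsub>C\<^esub>"
  "interchanger (center_action C) m n d d' = mid_swap C (fst m) (fst n) d d' (snd n d)"
  by (simp_all add: center_action_def case_prod_beta)

context monoidal_category
begin

lemma act_functor_center: "cfunctor (prod_cat (drinfeld_center M) M) M (act (center_action M))"
proof (rule cfunctorI, goal_cases)
  case (3 x)
  then show ?case by (cases x) simp
next
  case (4 f)
  then show ?case by (cases f; cases "fst f" rule: prod_cases3) simp
next
  case (5 x)
  then show ?case by (cases x) simp
next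
  case (6 f g)
  then show ?case
    by (cases f; cases g; cases "fst f" rule: prod_cases3; cases "fst g" rule: prod_cases3)
      (simp add: interchange)
qed (auto simp: category_prod category_center category_axioms)

end

lemma left_actionI:
  fixes X (structure)
  assumes M: "monoidal_category M" and C: "category C" and act: "cfunctor (prod_cat M C) C (act X)"
    and unitor: "\<And>c. c \<in> Ob C \<Longrightarrow>
      iso C (unitor X c) \<and> Src C (unitor X c) = c \<and> Tgt C (unitor X c) = \<j>\<^bsub>M\<^esub> \<bullet> c"
    and unitor_nat: "\<And>f. f \<in> Arr C \<Longrightarrow>
      unitor X (Tgt C f) \<cdot>\<^bsub>C\<^esub> f = (Ident M \<j>\<^bsub>M\<^esub> \<star> f) \<cdot>\<^bsub>C\<^esub> unitor X (Src C f)"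
    and mult: "\<And>m n c. m \<in> Ob M \<Longrightarrow> n \<in> Ob M \<Longrightarrow> c \<in> Ob C \<Longrightarrow> iso C (multiplicator X m n c) \<and>
      Src C (multiplicator X m n c) = m \<bullet> (n \<bullet> c) \<and> Tgt C (multiplicator X m n c) = (m \<otimes>\<^bsub>M\<^esub> n) \<bullet> c"
    and mult_nat: "\<And>f g h. f \<in> Arr M \<Longrightarrow> g \<in> Arr M \<Longrightarrow> h \<in> Arr C \<Longrightarrow>
      multiplicator X (Tgt M f) (Tgt M g) (Tgt C h) \<cdot>\<^bsub>C\<^esub> (f \<star> (g \<star> h)) =
      ((f \<odot>\<^bsub>M\<^esub> g) \<star> h) \<cdot>\<^bsub>C\<^esub> multiplicator X (Src M f) (Src M g) (Src C h)"
    and "\<And>m n p c. m \<in> Ob M \<Longrightarrow> n \<in> Ob M \<Longrightarrow> p \<in> Ob M \<Longrightarrow> c \<in> Ob C \<Longrightarrow>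
      (assoc M m n p \<star> Ident C c) \<cdot>\<^bsub>C\<^esub> multiplicator X (m \<otimes>\<^bsub>M\<^esub> n) p c \<cdot>\<^bsub>C\<^esub>
        multiplicator X m n (p \<bullet> c) =
      multiplicator X m (n \<otimes>\<^bsub>M\<^esub> p) c \<cdot>\<^bsub>C\<^esub> (Ident M m \<star> multiplicator X n p c)"
    and "\<And>m c. m \<in> Ob M \<Longrightarrow> c \<in> Ob C \<Longrightarrow>
      multiplicator X \<j>\<^bsub>M\<^esub> m c \<cdot>\<^bsub>C\<^esub> unitor X (m \<bullet> c) = inv_arr M (lunit M m) \<star> Ident C c"
    and "\<And>m c. m \<in> Ob M \<Longrightarrow> c \<in> Ob C \<Longrightarrow>
      multiplicator X m \<j>\<^bsub>M\<^esub> c \<cdot>\<^bsub>C\<^esub> (Ident M m \<star> unitor X c) = inv_arr M (runit M m) \<star> Ident C c"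
  shows "left_action M C X"
proof -
  interpret M: monoidal_category M by (rule M)
  interpret C: category C by (rule C)
  interpret act: cfunctor "prod_cat M C" C "act X" by (rule act)
  have [simp]: "m \<bullet> c \<in> Ob C" if "m \<in> Ob M" "c \<in> Ob C" for m c
    using that act.fob_ob by simp
  have [simp]: "f \<star> g \<in> Arr C" "Src C (f \<star> g) = Src M f \<bullet> Src C g" "Tgt C (f \<star> g) = Tgt M f \<bullet> Tgt C g"
    if "f \<in> Arr M" "g \<in> Arr C" for f g
    using that act.farr_arr[of "(f, g)"] by auto
  have [simp]: "Ident M m \<star> Ident C c = Ident C (m \<bullet> c)" if "m \<in> Ob M" "c \<in> Ob C" for m c
    using that act.farr_id[of "(m, c)"] by simp
  have comp: "(g \<cdot>\<^bsub>M\<^esub> f) \<star> (g' \<cdot>\<^bsub>C\<^esub> f') = (g \<star> g') \<cdot>\<^bsub>C\<^esub> (f \<star> f')"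
    if "f \<in> Arr M" "g \<in> Arr M" "f' \<in> Arr C" "g' \<in> Arr C" "Src M g = Tgt M f" "Src C g' = Tgt C f'"
    for f g f' g'
    using that act.farr_comp_arr[of "(f, f')" "(g, g')"] by simp
  have 1: "cfunctor C C \<lparr>fob = (\<lambda>c. \<j>\<^bsub>M\<^esub> \<bullet> c), farr = (\<lambda>f. Ident M \<j>\<^bsub>M\<^esub> \<star> f)\<rparr>"
    by (rule cfunctorI) (auto simp: C simp flip: comp)
  have 2: "cfunctor (prod_cat (prod_cat M M) C) C
      \<lparr>fob = (\<lambda>((m, n), c). m \<bullet> (n \<bullet> c)), farr = (\<lambda>((f, g), h). f \<star> (g \<star> h))\<rparr>"
    by (rule cfunctorI) (auto simp: C M.category_axioms category_prod comp)
  have 3: "cfunctor (prod_cat (prod_cat M M) C) C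
      \<lparr>fob = (\<lambda>((m, n), c). (m \<otimes>\<^bsub>M\<^esub> n) \<bullet> c), farr = (\<lambda>((f, g), h). (f \<odot>\<^bsub>M\<^esub> g) \<star> h)\<rparr>"
    by (rule cfunctorI) (auto simp: C M.category_axioms category_prod simp flip: comp M.interchange)
  show ?thesis
    by (intro left_action.intro left_action_axioms.intro M C act nat_isoI cfunctor_id 1 2 3)
      (auto simp: assms id_fctr_def)
qed

context monoidal_category
begin

text \<open>As unitor and multiplicator are inverses of structure arrows, the three coherence laws
  are the inverted pentagon, the inverted \<open>lunit_tensor\<close> and the inverted
  triangle.\<close>

lemma left_action_center: "left_action (drinfeld_center M) M (center_action M)"
proof (rule left_actionI[OF monoidal_category_center category_axioms act_functor_center], goal_cases)
  case (1 c)
  then show ?case by simp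
next
  case (2 f)
  then show ?case
    using iso_move_left[of "lunit M (Tgt M f)" "(Ident M \<j> \<odot> f) \<cdot> inv_arr M (lunit M (Src M f))" f]
    by (simp add: lunit_slide)
next
  case (3 m n c)
  then show ?case by simp
next
  case (4 f g h)
  then show ?case
    by (cases f rule: prod_cases3; cases g rule: prod_cases3) (simp add: assoc_inv_slide)
next
  case (5 m n p c)
  then have "inv_arr M (assoc M (fst m) (fst n) (fst p \<otimes> c) \<cdot> assoc M (fst m \<otimes> fst n) (fst p) c) =
    inv_arr M ((Ident M (fst m) \<odot> assoc M (fst n) (fst p) c) \<cdot> assoc M (fst m) (fst n \<otimes> fst p) c \<cdot>
      (assoc M (fst m) (fst n) (fst p) \<odot> Ident M c))"
    by (simp add: pentagon)
  with 5 show ?case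
    by (simp add: interchange_extend)
next
  case (6 m c)
  then have "inv_arr M (lunit M (fst m \<otimes> c) \<cdot> assoc M \<j> (fst m) c) = inv_arr M (lunit M (fst m) \<odot> Ident M c)"
    by (simp add: lunit_tensor)
  with 6 show ?case by (simp add: iso_center center_tensor_in center_unit_in center_natural_lunit)
next
  case (7 m c)
  then have "inv_arr M ((Ident M (fst m) \<odot> lunit M c) \<cdot> assoc M (fst m) \<j> c) = inv_arr M (runit M (fst m) \<odot> Ident M c)"
    by (simp add: triangle)
  with 7 show ?case by (simp add: iso_center center_tensor_in center_unit_in center_natural_runit)
qed

lemma act_mfctr_center [simp]:
  "fob (act_mfctr M (center_action M)) (m, c) = fst m \<otimes> c"
  "farr (act_mfctr M (center_action M)) ((m, m', f), g) = f \<odot> g"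
  "feps (act_mfctr M (center_action M)) = inv_arr M (lunit M \<j>)"
  "m \<in> center_obs M \<Longrightarrow> n \<in> center_obs M \<Longrightarrow> c \<in> Ob M \<Longrightarrow> d \<in> Ob M \<Longrightarrow>
    fmult (act_mfctr M (center_action M)) (m, c) (n, d) = center_swap m c n d"
  by (simp_all add: act_mfctr_def center_swap_def)

section \<open>Strong monoidality of the action and of the tensor product of the center\<close>

lemma act_strong_monoidal_center:
  "strong_monoidal_functor (prod_moncat (drinfeld_center M) M) M (act_mfctr M (center_action M))"
proof -
  have A: "monoidal_category (prod_moncat (drinfeld_center M) M)"
    by (intro monoidal_category_prod monoidal_category_center monoidal_category_axioms)
  have F: "cfunctor (prod_moncat (drinfeld_center M) M) M (act_mfctr M (center_action M))"
  proof (rule cfunctorI, goal_cases)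
    case (3 x)
    then show ?case by (cases x) simp
  next
    case (4 f)
    then show ?case by (cases f; cases "fst f" rule: prod_cases3) simp
  next
    case (5 x)
    then show ?case by (cases x) simp
  next
    case (6 f g)
    then show ?case
      by (cases f; cases g; cases "fst f" rule: prod_cases3; cases "fst g" rule: prod_cases3)
        (simp add: interchange)
  qed (auto simp: category_prod_moncat category_center category_axioms)
  show ?thesis
  proof (rule strong_monoidal_functorI[OF A monoidal_category_axioms F], goal_cases)
    case (4 x y)
    then show ?case by (cases x; cases y) simp
  next
    case (5 f g)
    then show ?case
      by (cases f; cases g; cases "fst f" rule: prod_cases3; cases "fst g" rule: prod_cases3)
        (simp add: center_swap_natural)
  next
    case (6 x y z)
    then show ?case
      by (cases x; cases y; cases z) (simp add: center_tensor_in center_swap_assoc)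
  next
    case (7 x)
    then show ?case by (cases x) (simp add: center_unit_in center_swap_lunit)
  next
    case (8 x)
    then show ?case by (cases x) (simp add: center_unit_in center_swap_runit)
  qed auto
qed

lemma mid_swap_center:
  assumes "x \<in> center_obs M" "y \<in> center_obs M" "z \<in> center_obs M" "w \<in> center_obs M"
    and "(center_tensor_ob M y z, center_tensor_ob M z y, s) \<in> center_arrs M"
  shows "mid_swap (drinfeld_center M) x y z w (center_tensor_ob M y z, center_tensor_ob M z y, s) =
    (center_tensor_ob M (center_tensor_ob M x y) (center_tensor_ob M z w),
     center_tensor_ob M (center_tensor_ob M x z) (center_tensor_ob M y w),
     mid_swap M (fst x) (fst y) (fst z) (fst w) s)"
  using assms center_natural_assoc[of x z "center_tensor_ob M y w"]
    center_natural_assoc[of x y "center_tensor_ob M z w"]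
  by (simp add: mid_swap_def iso_center center_tensor_in center_natural_assoc)

text \<open>The comparison of the tensor functor lies over the same \<open>center_swap\<close> as
  that of the action, with the underlying objects of m' and n' in place of objects acted upon. So
  the laws of \<open>center_swap\<close> prove both functors strong monoidal.\<close>

lemma fmult_tensor_center:
  assumes "m \<in> center_obs M" "m' \<in> center_obs M" "n \<in> center_obs M" "n' \<in> center_obs M"
  shows "fmult (tensor_mfctr (drinfeld_center M)) (m, m') (n, n') =
    (center_tensor_ob M (center_tensor_ob M m m') (center_tensor_ob M n n'),
     center_tensor_ob M (center_tensor_ob M m n) (center_tensor_ob M m' n'),
     center_swap m (fst m') n (fst n'))"
    "iso (drinfeld_center M) (fmult (tensor_mfctr (drinfeld_center M)) (m, m') (n, n'))"
proof -
  interpret Z: monoidal_category "drinfeld_center M" by (rule monoidal_category_center)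
  let ?b = "braid (drinfeld_center M) n m'"
  note b = center_natural_braid[of n m'] center_natural_inv[of "center_tensor_ob M n m'" "center_tensor_ob M m' n" "snd n (fst m')"]
  have i: "iso (drinfeld_center M) ?b" "?b \<in> Arr (drinfeld_center M)"
    "inv_arr (drinfeld_center M) ?b =
      (center_tensor_ob M m' n, center_tensor_ob M n m', inv_arr M (snd n (fst m')))"
    using assms b by (simp_all add: iso_center center_tensor_in)
  then have 1: "fmult (tensor_mfctr (drinfeld_center M)) (m, m') (n, n') =
      mid_swap (drinfeld_center M) m m' n n' (inv_arr (drinfeld_center M) ?b)"
    using assms by (simp add: tensor_mfctr_def)
  show "fmult (tensor_mfctr (drinfeld_center M)) (m, m') (n, n') =
    (center_tensor_ob M (center_tensor_ob M m m') (center_tensor_ob M n n'),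
     center_tensor_ob M (center_tensor_ob M m n) (center_tensor_ob M m' n'),
     center_swap m (fst m') n (fst n'))"
    using assms b unfolding 1 i(3) by (simp add: center_tensor_in mid_swap_center center_swap_def)
  show "iso (drinfeld_center M) (fmult (tensor_mfctr (drinfeld_center M)) (m, m') (n, n'))"
    unfolding 1 using assms i(1) by (intro Z.mid_swap_iso(1) Z.inv_iso(6)) simp_all
qed

lemma tensor_strong_monoidal_center:
  "strong_monoidal_functor (prod_moncat (drinfeld_center M) (drinfeld_center M)) (drinfeld_center M)
    (tensor_mfctr (drinfeld_center M))"
proof -
  interpret Z: monoidal_category "drinfeld_center M" by (rule monoidal_category_center)
  let ?Z = "drinfeld_center M"
  have A: "monoidal_category (prod_moncat ?Z ?Z)"
    by (intro monoidal_category_prod monoidal_category_center)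
  have F: "cfunctor (prod_moncat ?Z ?Z) ?Z (tensor_mfctr ?Z)"
  proof (rule cfunctorI, goal_cases)
    case (3 x)
    then show ?case by (cases x rule: prod.exhaust) (simp add: tensor_mfctr_def center_tensor_in)
  next
    case (4 f)
    then show ?case
      by (cases f rule: prod.exhaust; cases "fst f" rule: prod_cases3; cases "snd f" rule: prod_cases3)
        (simp add: tensor_mfctr_def center_tensor_in center_natural_tensor)
  next
    case (5 x)
    then show ?case by (cases x rule: prod.exhaust) (simp add: tensor_mfctr_def)
  next
    case (6 f g)
    then show ?case
      by (cases f rule: prod.exhaust; cases g rule: prod.exhaust; cases "fst f" rule: prod_cases3; cases "fst g" rule: prod_cases3;
          cases "snd f" rule: prod_cases3; cases "snd g" rule: prod_cases3)
        (simp add: tensor_mfctr_def interchange)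
  qed (auto simp: category_prod_moncat category_center)
  have [simp]: "fob (tensor_mfctr ?Z) (m, m') = center_tensor_ob M m m'"
    "farr (tensor_mfctr ?Z) (f, f') = f \<odot>\<^bsub>?Z\<^esub> f'"
    "feps (tensor_mfctr ?Z) = (center_unit M, center_tensor_ob M (center_unit M) (center_unit M), inv_arr M (lunit M \<j>))"
    for m m' f f'
    by (simp_all add: tensor_mfctr_def iso_center center_tensor_in center_unit_in
        center_natural_lunit[of "center_unit M", simplified])
  show ?thesis
  proof (rule strong_monoidal_functorI[OF A monoidal_category_center F], goal_cases)
    case 1
    have "iso ?Z (inv_arr ?Z (lunit ?Z \<j>\<^bsub>?Z\<^esub>))" by (intro Z.inv_iso Z.lunit_arr Z.unit_ob_in)
    then show ?case by (simp only: tensor_mfctr_def mfctr.simps)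
  next
    case (4 x y)
    then show ?case using fmult_tensor_center(2) by (cases x rule: prod.exhaust; cases y rule: prod.exhaust) (simp add: fmult_tensor_center(1))
  next
    case (5 f g)
    obtain m1 n1 f1 m2 n2 f2 where f: "f = ((m1, n1, f1), (m2, n2, f2))" by (metis prod.exhaust)
    obtain p1 q1 g1 p2 q2 g2 where g: "g = ((p1, q1, g1), (p2, q2, g2))" by (metis prod.exhaust)
    show ?case
      using 5 f g center_swap_natural[of m1 n1 f1 p1 q1 g1 f2 g2]
      by (simp add: fmult_tensor_center(1))
  next
    case (6 x y z)
    then show ?case
      by (cases x rule: prod.exhaust; cases y rule: prod.exhaust; cases z rule: prod.exhaust) (simp add: center_tensor_in fmult_tensor_center(1) center_swap_assoc)
  next
    case (7 x)
    then show ?case by (cases x rule: prod.exhaust) (simp add: center_unit_in fmult_tensor_center(1) center_swap_lunit[where c = "fst _"])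
  next
    case (8 x)
    then show ?case by (cases x rule: prod.exhaust) (simp add: center_unit_in fmult_tensor_center(1) center_swap_runit[where c = "fst _"])
  qed (auto simp: center_unit_in center_tensor_in)
qed

lemma monoidal_action_center: "monoidal_action (drinfeld_center M) M (center_action M)"
proof -
  let ?Z = "drinfeld_center M"
  let ?act = "act_mfctr M (center_action M)"
  interpret Z: braided_monoidal_category ?Z by (rule braided_center)
  interpret X: left_action ?Z M "center_action M" by (rule left_action_center)
  interpret U: strong_monoidal_functor M M "comp_mfctr M ?act (unit_mfctr ?Z M)"
    by (rule strong_monoidal_functor_comp[OF strong_monoidal_functor_unit act_strong_monoidal_center])
      (intro monoidal_category_center monoidal_category_axioms)+
  interpret I: strong_monoidal_functor M M "id_mfctr M"
    by (intro strong_monoidal_functor_id monoidal_category_axioms)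
  let ?F = "comp_mfctr M ?act (comp_mfctr (prod_moncat ?Z M) (prod_mfctr (id_mfctr ?Z) ?act) (reassoc_mfctr ?Z M))"
  let ?G = "comp_mfctr M ?act (prod_mfctr (tensor_mfctr ?Z) (id_mfctr M))"
  interpret F: strong_monoidal_functor "prod_moncat (prod_moncat ?Z ?Z) M" M ?F
    by (rule strong_monoidal_functor_comp[OF strong_monoidal_functor_comp[OF strong_monoidal_functor_reassoc
            strong_monoidal_functor_prod[OF strong_monoidal_functor_id]]])
      (intro act_strong_monoidal_center monoidal_category_center monoidal_category_axioms)+
  interpret G: strong_monoidal_functor "prod_moncat (prod_moncat ?Z ?Z) M" M ?G
    by (rule strong_monoidal_functor_comp[OF strong_monoidal_functor_prod[OF tensor_strong_monoidal_center
            strong_monoidal_functor_id] act_strong_monoidal_center]) (rule monoidal_category_axioms)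
  note defs = comp_mfctr_def unit_mfctr_def id_mfctr_def prod_mfctr_def reassoc_mfctr_def
  have unitor: "monoidal_nat_trans M M (id_mfctr M) (comp_mfctr M ?act (unit_mfctr ?Z M)) (unitor (center_action M))"
  proof (rule monoidal_nat_transI[OF I.strong_monoidal_functor_axioms U.strong_monoidal_functor_axioms
        nat_transI[OF I.cfunctor_axioms U.cfunctor_axioms]], goal_cases)
    case (2 f)
    then show ?case
      using nat_trans.naturality_arr[OF nat_iso.axioms(1)[OF X.unitor_iso], of f]
      by (simp add: defs id_fctr_def)
  next
    case (4 x y)
    then show ?case
      using center_swap_unitor[of x y] by (simp add: defs center_unit_in)
  qed (simp_all add: defs)
  have multiplicator: "monoidal_nat_trans (prod_moncat (prod_moncat ?Z ?Z) M) M ?F ?G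
    (\<lambda>((m, n), c). multiplicator (center_action M) m n c)"
  proof (rule monoidal_nat_transI[OF F.strong_monoidal_functor_axioms G.strong_monoidal_functor_axioms
        nat_transI[OF F.cfunctor_axioms G.cfunctor_axioms]], goal_cases)
    case (1 x)
    then show ?case
      by (cases x; cases "fst x" rule: prod.exhaust) (simp add: defs tensor_mfctr_def)
  next
    case (2 f)
    then show ?case
      by (cases f; cases "fst f" rule: prod.exhaust; cases "fst (fst f)" rule: prod_cases3; cases "snd (fst f)" rule: prod_cases3)
        (simp add: defs tensor_mfctr_def assoc_inv_slide)
  next
    case 3
    have 1: "inv_arr ?Z (center_tensor_ob M (center_unit M) (center_unit M), center_unit M, lunit M \<j>) =
      (center_unit M, center_tensor_ob M (center_unit M) (center_unit M), inv_arr M (lunit M \<j>))"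
      by (simp add: iso_center center_tensor_in center_unit_in center_natural_lunit[of "center_unit M", simplified])
    \<comment> \<open>The unit condition on the multiplicator is the triangle at \<j>, inverted,
      where both unitors agree.\<close>
    have "inv_arr M ((Ident M \<j> \<odot> lunit M \<j>) \<cdot> assoc M \<j> \<j> \<j>) = inv_arr M (lunit M \<j> \<odot> Ident M \<j>)"
      using triangle[of \<j> \<j>] by (simp add: unit_coincidence)
    then have 2: "inv_arr M (assoc M \<j> \<j> \<j>) \<cdot> ((Ident M \<j> \<odot> inv_arr M (lunit M \<j>)) \<cdot> inv_arr M (lunit M \<j>)) =
      (inv_arr M (lunit M \<j>) \<odot> Ident M \<j>) \<cdot> inv_arr M (lunit M \<j>)"
      using comp_extend[of "inv_arr M (assoc M \<j> \<j> \<j>)" "Ident M \<j> \<odot> inv_arr M (lunit M \<j>)"] by simp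
    show ?case
      using 1 2 by (simp add: defs tensor_mfctr_def center_unit_in)
  next
    case (4 x y)
    have f: "fob (tensor_mfctr ?Z) (m, m') = center_tensor_ob M m m'" for m m'
      by (simp add: tensor_mfctr_def)
    obtain m n c where x: "x = ((m, n), c)" by (metis prod.exhaust)
    obtain m' n' c' where y: "y = ((m', n'), c')" by (metis prod.exhaust)
    show ?case
      using 4 x y center_swap_multiplicator[of m n m' n' c c'] f
      by (simp add: defs fmult_tensor_center(1) center_tensor_in)
  qed
  show ?thesis
    by (intro monoidal_action.intro monoidal_action_axioms.intro braided_center monoidal_category_axioms
        left_action_center act_strong_monoidal_center unitor multiplicator) (auto simp: hom_def)
qed

end

section \<open>Monoidal actions\<close>

context braided_monoidal_category
begin

lemma braid_arr [simp]:
  assumes "x \<in> Ob M" "y \<in> Ob M"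
  shows "braid M x y \<in> Arr M" "Src M (braid M x y) = x \<otimes> y" "Tgt M (braid M x y) = y \<otimes> x" "iso M (braid M x y)"
proof -
  have *: "(x, y) \<in> Ob (prod_cat M M)" using assms by simp
  show "braid M x y \<in> Arr M" "Src M (braid M x y) = x \<otimes> y" "Tgt M (braid M x y) = y \<otimes> x" "iso M (braid M x y)"
    using nat_trans.component_arr[OF nat_iso.axioms(1)[OF braid_iso] *]
      nat_iso.component_iso[OF braid_iso *] by auto
qed

lemma braid_natural:
  "f \<in> Arr M \<Longrightarrow> g \<in> Arr M \<Longrightarrow>
    braid M (Tgt M f) (Tgt M g) \<cdot> (f \<odot> g) = (g \<odot> f) \<cdot> braid M (Src M f) (Src M g)"
  using nat_trans.naturality_arr[OF nat_iso.axioms(1)[OF braid_iso], of "(f, g)"] by simp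

text \<open>The first hexagon is literally the axiom on half-braidings. With the next lemma, which
  uses the inverted second hexagon, it makes \<open>snd_unit\<close> available for the braidings of
  \<open>M\<close> on either side.\<close>

lemma braid_center_ob:
  assumes "x \<in> Ob M"
  shows "(x, \<lambda>b\<in>Ob M. braid M x b) \<in> center_obs M"
proof (rule center_obsI, goal_cases)
  case (4 f)
  then show ?case using assms braid_natural[of "Ident M x" f] by simp
next
  case (5 d e)
  then show ?case using assms hexagon1[of x d e] by simp
qed (use assms in auto)

lemma inv_braid_center_ob:
  assumes "x \<in> Ob M"
  shows "(x, \<lambda>b\<in>Ob M. inv_arr M (braid M b x)) \<in> center_obs M"
proof (rule center_obsI, goal_cases)
  case (4 f)
  let ?s = "Src M f" and ?t = "Tgt M f"
  have "braid M ?t x \<cdot> ((f \<odot> Ident M x) \<cdot> inv_arr M (braid M ?s x)) = Ident M x \<odot> f"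
    using assms 4 comp_extend[OF braid_natural[of f "Ident M x"]] by simp
  then have "(f \<odot> Ident M x) \<cdot> inv_arr M (braid M ?s x) = inv_arr M (braid M ?t x) \<cdot> (Ident M x \<odot> f)"
    by (subst (asm) iso_move_left) (use assms 4 in auto)
  then show ?case using assms 4 by simp
next
  case (5 d e)
  have "inv_arr M (inv_arr M (assoc M x d e) \<cdot> braid M (d \<otimes> e) x \<cdot> inv_arr M (assoc M d e x)) =
      inv_arr M ((braid M d x \<odot> Ident M e) \<cdot> inv_arr M (assoc M d x e) \<cdot> (Ident M d \<odot> braid M e x))"
    using assms 5 hexagon2[of d e x] by simp
  then show ?case using assms 5 by simp
qed (use assms in auto)

lemma braid_unit:
  assumes "x \<in> Ob M"
  shows "braid M x \<j> = inv_arr M (lunit M x) \<cdot> runit M x" "braid M \<j> x = inv_arr M (runit M x) \<cdot> lunit M x"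
proof -
  interpret X: center_object M "(x, \<lambda>b\<in>Ob M. braid M x b)"
    using braid_center_ob[OF assms] by (rule center_objectI)
  interpret Y: center_object M "(x, \<lambda>b\<in>Ob M. inv_arr M (braid M b x))"
    using inv_braid_center_ob[OF assms] by (rule center_objectI)
  show "braid M x \<j> = inv_arr M (lunit M x) \<cdot> runit M x"
    using X.snd_unit by simp
  \<comment> \<open>The half-braiding here consists of inverse braidings, so the result of
    \<open>snd_unit\<close> has to be inverted once more.\<close>
  have "inv_arr M (inv_arr M (braid M \<j> x)) = inv_arr M (inv_arr M (lunit M x) \<cdot> runit M x)"
    using Y.snd_unit by simp
  then show "braid M \<j> x = inv_arr M (runit M x) \<cdot> lunit M x"
    using assms by simp
qed

text \<open>The four degenerations of the comparison of the tensor functor of \<open>M\<close> that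
  occur when \<j> is put into two of its four places. In the first three the exchange involves \<j>
  and disappears by coherence; in the last it is a genuine inverse braiding and survives.\<close>

lemma mid_swap_units:
  assumes m: "m \<in> Ob M" and n: "n \<in> Ob M"
  shows "(runit M m \<odot> runit M n) \<cdot> mid_swap M m n \<j> \<j> (inv_arr M (braid M \<j> n)) \<cdot>
      (Ident M (m \<otimes> n) \<odot> inv_arr M (runit M \<j>)) = runit M (m \<otimes> n)"
    "(lunit M m \<odot> lunit M n) \<cdot> mid_swap M \<j> \<j> m n (inv_arr M (braid M m \<j>)) \<cdot>
      (inv_arr M (lunit M \<j>) \<odot> Ident M (m \<otimes> n)) = lunit M (m \<otimes> n)"
    "(runit M m \<odot> lunit M n) \<cdot> mid_swap M m \<j> \<j> n (inv_arr M (braid M \<j> \<j>)) = runit M m \<odot> lunit M n"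
    "(lunit M n \<odot> runit M m) \<cdot> mid_swap M \<j> m n \<j> (inv_arr M (braid M n m)) =
      inv_arr M (braid M n m) \<cdot> (lunit M m \<odot> runit M n)"
proof -
  have 1: "inv_arr M (braid M \<j> x) = inv_arr M (lunit M x) \<cdot> runit M x" if "x \<in> Ob M" for x
    using that by (simp add: braid_unit)
  have 2: "inv_arr M (braid M x \<j>) = inv_arr M (runit M x) \<cdot> lunit M x" if "x \<in> Ob M" for x
    using that by (simp add: braid_unit)
  show "(runit M m \<odot> runit M n) \<cdot> mid_swap M m n \<j> \<j> (inv_arr M (braid M \<j> n)) \<cdot>
      (Ident M (m \<otimes> n) \<odot> inv_arr M (runit M \<j>)) = runit M (m \<otimes> n)"
    by (simp only: 1 n, rule strictifies_eqI[where s = "Tn (Tn (At m) (At n)) Emp" and t = "Tn (At m) (At n)"],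
        ((rule strictify strictifies_mid_swap | (simp add: assms; fail))+)[1],
        ((rule strictify | (simp add: assms; fail))+)[1], use assms in simp)
  show "(lunit M m \<odot> lunit M n) \<cdot> mid_swap M \<j> \<j> m n (inv_arr M (braid M m \<j>)) \<cdot>
      (inv_arr M (lunit M \<j>) \<odot> Ident M (m \<otimes> n)) = lunit M (m \<otimes> n)"
    by (simp only: 2 m, rule strictifies_eqI[where s = "Tn Emp (Tn (At m) (At n))" and t = "Tn (At m) (At n)"],
        ((rule strictify strictifies_mid_swap | (simp add: assms; fail))+)[1],
        ((rule strictify | (simp add: assms; fail))+)[1], use assms in simp)
  show "(runit M m \<odot> lunit M n) \<cdot> mid_swap M m \<j> \<j> n (inv_arr M (braid M \<j> \<j>)) = runit M m \<odot> lunit M n"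
    by (simp only: 1 unit_ob_in,
        rule strictifies_eqI[where s = "Tn (Tn (At m) Emp) (Tn Emp (At n))" and t = "Tn (At m) (At n)"],
        ((rule strictify strictifies_mid_swap | (simp add: assms; fail))+)[1],
        ((rule strictify | (simp add: assms; fail))+)[1], use assms in simp)
  have b: "strictifies (Tn (At m) (At n)) (Tn (At n) (At m)) (inv_arr M (braid M n m))
      (strict_part (Tn (At m) (At n)) (Tn (At n) (At m)) (inv_arr M (braid M n m)))"
    using assms by (intro strictifies_strict_part) auto
  show "(lunit M n \<odot> runit M m) \<cdot> mid_swap M \<j> m n \<j> (inv_arr M (braid M n m)) =
      inv_arr M (braid M n m) \<cdot> (lunit M m \<odot> runit M n)"
    by (rule strictifies_eqI[where s = "Tn (Tn Emp (At m)) (Tn (At n) Emp)" and t = "Tn (At n) (At m)"],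
        ((rule strictify strictifies_mid_swap b | (simp add: assms; fail))+)[1],
        ((rule strictify b | (simp add: assms; fail))+)[1], use assms strictifiesD(6-8)[OF b] in simp)
qed

end

section \<open>Computation rules for actions\<close>

context left_action
begin

abbreviation comp_C (infixr "\<cdot>\<^sub>C" 55) where "g \<cdot>\<^sub>C f \<equiv> g \<cdot>\<^bsub>C\<^esub> f"
abbreviation comp_M (infixr "\<cdot>\<^sub>M" 55) where "g \<cdot>\<^sub>M f \<equiv> g \<cdot>\<^bsub>M\<^esub> f"
abbreviation tensor_ob_M (infixr "\<otimes>\<^sub>M" 70) where "m \<otimes>\<^sub>M n \<equiv> m \<otimes>\<^bsub>M\<^esub> n"
abbreviation tensor_arr_M (infixr "\<odot>\<^sub>M" 70) where "f \<odot>\<^sub>M g \<equiv> f \<odot>\<^bsub>M\<^esub> g"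
abbreviation unit_M ("\<j>\<^sub>M") where "\<j>\<^sub>M \<equiv> \<j>\<^bsub>M\<^esub>"
abbreviation eta ("\<eta>") where "\<eta> \<equiv> unitor X"
abbreviation mu ("\<mu>") where "\<mu> \<equiv> multiplicator X"

lemma act_ob_in [simp]: "m \<in> Ob M \<Longrightarrow> c \<in> Ob C \<Longrightarrow> m \<bullet> c \<in> Ob C"
  using cfunctor.fob_ob[OF act_functor] by simp

lemma act_arr [simp]:
  assumes "f \<in> Arr M" "g \<in> Arr C"
  shows "f \<star> g \<in> Arr C" "Src C (f \<star> g) = Src M f \<bullet> Src C g" "Tgt C (f \<star> g) = Tgt M f \<bullet> Tgt C g"
  using cfunctor.farr_arr[OF act_functor, of "(f, g)"] assms by auto

lemma act_ident [simp]: "m \<in> Ob M \<Longrightarrow> c \<in> Ob C \<Longrightarrow> Ident M m \<star> Ident C c = Ident C (m \<bullet> c)"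
  using cfunctor.farr_id[OF act_functor, of "(m, c)"] by simp

lemma act_interchange0:
  assumes "f \<in> Arr M" "g \<in> Arr M" "f' \<in> Arr C" "g' \<in> Arr C" "Src M g = Tgt M f" "Src C g' = Tgt C f'"
  shows "(g \<star> g') \<cdot>\<^sub>C (f \<star> f') = (g \<cdot>\<^sub>M f) \<star> (g' \<cdot>\<^sub>C f')"
  using cfunctor.farr_comp_arr[OF act_functor, of "(f, f')" "(g, g')"] assms by simp

lemmas act_interchange = act_interchange0 C.comp_extend[OF act_interchange0]

lemma act_iso [simp]:
  assumes "iso M f" "iso C g"
  shows "iso C (f \<star> g)" "inv_arr C (f \<star> g) = inv_arr M f \<star> inv_arr C g"
proof -
  have "iso (prod_cat M C) (f, g)" "inv_arr (prod_cat M C) (f, g) = (inv_arr M f, inv_arr C g)"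
    using assms iso_prod[OF M.category_axioms C.category_axioms] by auto
  then show "iso C (f \<star> g)" "inv_arr C (f \<star> g) = inv_arr M f \<star> inv_arr C g"
    using cfunctor.farr_iso[OF act_functor] by auto
qed

lemma unitor_arr [simp]:
  assumes "c \<in> Ob C"
  shows "\<eta> c \<in> Arr C" "Src C (\<eta> c) = c" "Tgt C (\<eta> c) = \<j>\<^sub>M \<bullet> c" "iso C (\<eta> c)"
  using nat_trans.component_arr[OF nat_iso.axioms(1)[OF unitor_iso] assms]
    nat_iso.component_iso[OF unitor_iso assms] by (auto simp: id_fctr_def)

lemma unitor_slide0:
  "f \<in> Arr C \<Longrightarrow> Tgt C f = y \<Longrightarrow> \<eta> y \<cdot>\<^sub>C f = (Ident M \<j>\<^sub>M \<star> f) \<cdot>\<^sub>C \<eta> (Src C f)"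
  using nat_trans.naturality_arr[OF nat_iso.axioms(1)[OF unitor_iso], of f] by (simp add: id_fctr_def)

lemmas unitor_slide = unitor_slide0 C.comp_extend[OF unitor_slide0]

lemma multiplicator_arr [simp]:
  assumes "m \<in> Ob M" "n \<in> Ob M" "c \<in> Ob C"
  shows "\<mu> m n c \<in> Arr C" "Src C (\<mu> m n c) = m \<bullet> (n \<bullet> c)"
    "Tgt C (\<mu> m n c) = (m \<otimes>\<^sub>M n) \<bullet> c" "iso C (\<mu> m n c)"
proof -
  have *: "((m, n), c) \<in> Ob (prod_cat (prod_cat M M) C)" using assms by simp
  show "\<mu> m n c \<in> Arr C" "Src C (\<mu> m n c) = m \<bullet> (n \<bullet> c)"
    "Tgt C (\<mu> m n c) = (m \<otimes>\<^sub>M n) \<bullet> c" "iso C (\<mu> m n c)"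
    using nat_trans.component_arr[OF nat_iso.axioms(1)[OF multiplicator_iso] *]
      nat_iso.component_iso[OF multiplicator_iso *] by auto
qed

lemma multiplicator_slide0:
  assumes "f \<in> Arr M" "g \<in> Arr M" "h \<in> Arr C" "Tgt M f = m" "Tgt M g = n" "Tgt C h = c"
  shows "\<mu> m n c \<cdot>\<^sub>C (f \<star> (g \<star> h)) = ((f \<odot>\<^sub>M g) \<star> h) \<cdot>\<^sub>C \<mu> (Src M f) (Src M g) (Src C h)"
  using nat_trans.naturality_arr[OF nat_iso.axioms(1)[OF multiplicator_iso], of "((f, g), h)"] assms by simp

lemmas multiplicator_slide = multiplicator_slide0 C.comp_extend[OF multiplicator_slide0]

end

context monoidal_action
begin

abbreviation tensor_ob_C (infixr "\<otimes>\<^sub>C" 70) where "c \<otimes>\<^sub>C d \<equiv> c \<otimes>\<^bsub>C\<^esub> d"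
abbreviation tensor_arr_C (infixr "\<odot>\<^sub>C" 70) where "f \<odot>\<^sub>C g \<equiv> f \<odot>\<^bsub>C\<^esub> g"
abbreviation unit_C ("\<j>\<^sub>C") where "\<j>\<^sub>C \<equiv> \<j>\<^bsub>C\<^esub>"

text \<open>The inverse interchanger, since \<open>fmult\<close> and hence all laws of strong
  monoidal functors point in this direction. The order of arguments follows the pairs (m, c) and (n,
  d).\<close>

definition phi :: "'mo \<Rightarrow> 'o \<Rightarrow> 'mo \<Rightarrow> 'o \<Rightarrow> 'a" where
  "phi m c n d = inv_arr C (interchanger X m n c d)"

lemma phi_arr [simp]:
  assumes "m \<in> Ob M" "n \<in> Ob M" "c \<in> Ob C" "d \<in> Ob C"
  shows "phi m c n d \<in> Arr C" "Src C (phi m c n d) = (m \<bullet> c) \<otimes>\<^sub>C (n \<bullet> d)" "Tgt C (phi m c n d) = (m \<otimes>\<^sub>M n) \<bullet> (c \<otimes>\<^sub>C d)"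
    "iso C (phi m c n d)"
  using interchanger_hom[OF assms] interchanger_iso[OF assms] by (auto simp: phi_def hom_def)

lemma act_mfctr_simps:
  "fob (act_mfctr C X) (m, c) = m \<bullet> c" "farr (act_mfctr C X) (f, g) = f \<star> g"
  "feps (act_mfctr C X) = inv_arr C (unit_interchanger X)" "fmult (act_mfctr C X) (m, c) (n, d) = phi m c n d"
  by (simp_all add: act_mfctr_def phi_def)

sublocale act: strong_monoidal_functor "prod_moncat M C" C "act_mfctr C X"
  by (rule act_strong_monoidal)

lemma phi_slide0:
  assumes "f \<in> Arr M" "g \<in> Arr C" "h \<in> Arr M" "k \<in> Arr C"
    "Tgt M f = m" "Tgt C g = c" "Tgt M h = n" "Tgt C k = d"
  shows "phi m c n d \<cdot>\<^sub>C ((f \<star> g) \<odot>\<^sub>C (h \<star> k)) = ((f \<odot>\<^sub>M h) \<star> (g \<odot>\<^sub>C k)) \<cdot>\<^sub>C phi (Src M f) (Src C g) (Src M h) (Src C k)"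
  using act.fmult_slide(1)[of "(f, g)" "(h, k)" "(m, c)" "(n, d)"] assms by (simp add: act_mfctr_simps)

lemmas phi_slide = phi_slide0 C.comp_extend[OF phi_slide0]

lemma phi_assoc:
  assumes "m \<in> Ob M" "n \<in> Ob M" "p \<in> Ob M" "c \<in> Ob C" "d \<in> Ob C" "e \<in> Ob C"
  shows "(assoc M m n p \<star> assoc C c d e) \<cdot>\<^sub>C phi (m \<otimes>\<^sub>M n) (c \<otimes>\<^sub>C d) p e \<cdot>\<^sub>C (phi m c n d \<odot>\<^sub>C Ident C (p \<bullet> e)) =
    phi m c (n \<otimes>\<^sub>M p) (d \<otimes>\<^sub>C e) \<cdot>\<^sub>C (Ident C (m \<bullet> c) \<odot>\<^sub>C phi n d p e) \<cdot>\<^sub>C assoc C (m \<bullet> c) (n \<bullet> d) (p \<bullet> e)"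
  using act.fmult_assoc[of "(m, c)" "(n, d)" "(p, e)"] assms by (simp add: act_mfctr_simps)

text \<open>Monoidality of the unitor at the unit. It eliminates the unit interchanger, so that the
  unit laws of the action functor can be written with \<eta> as in \<open>phi_unit\<close>.\<close>

lemma unitor_unit: "\<eta> \<j>\<^sub>C = inv_arr C (unit_interchanger X)"
proof -
  interpret monoidal_nat_trans C C "id_mfctr C" "comp_mfctr C (act_mfctr C X) (unit_mfctr M C)" "\<eta>"
    by (rule unitor_monoidal)
  have "iso C (unit_interchanger X)" "Src C (unit_interchanger X) = \<j>\<^sub>M \<bullet> \<j>\<^sub>C"
    using unit_interchanger_iso unit_interchanger_hom by (auto simp: hom_def)
  then show ?thesis
    using component_feps by (simp add: id_mfctr_def comp_mfctr_def unit_mfctr_def act_mfctr_simps)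
qed

lemma phi_unit:
  assumes "m \<in> Ob M" "c \<in> Ob C"
  shows "(lunit M m \<star> lunit C c) \<cdot>\<^sub>C phi \<j>\<^sub>M \<j>\<^sub>C m c \<cdot>\<^sub>C (\<eta> \<j>\<^sub>C \<odot>\<^sub>C Ident C (m \<bullet> c)) = lunit C (m \<bullet> c)"
    "(runit M m \<star> runit C c) \<cdot>\<^sub>C phi m c \<j>\<^sub>M \<j>\<^sub>C \<cdot>\<^sub>C (Ident C (m \<bullet> c) \<odot>\<^sub>C \<eta> \<j>\<^sub>C) = runit C (m \<bullet> c)"
  using act.fmult_lunit[of "(m, c)"] act.fmult_runit[of "(m, c)"] assms
  by (simp_all add: act_mfctr_simps unitor_unit)

lemma unitor_tensor:
  assumes "c \<in> Ob C" "d \<in> Ob C"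
  shows "\<eta> (c \<otimes>\<^sub>C d) = (lunit M \<j>\<^sub>M \<star> Ident C (c \<otimes>\<^sub>C d)) \<cdot>\<^sub>C phi \<j>\<^sub>M c \<j>\<^sub>M d \<cdot>\<^sub>C (\<eta> c \<odot>\<^sub>C \<eta> d)"
proof -
  interpret monoidal_nat_trans C C "id_mfctr C" "comp_mfctr C (act_mfctr C X) (unit_mfctr M C)" "\<eta>"
    by (rule unitor_monoidal)
  show ?thesis
    using component_fmult[of c d] assms by (simp add: id_mfctr_def comp_mfctr_def unit_mfctr_def act_mfctr_simps)
qed

text \<open>Monoidality of the multiplicator written out, the only law of the action that mentions a
  braiding. Its instances with \<j> at two of m, n, m', n' are the source of all relations between
  strengths, multiplicators and braidings.\<close>

lemma multiplicator_tensor: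
  assumes "m \<in> Ob M" "n \<in> Ob M" "m' \<in> Ob M" "n' \<in> Ob M" "c \<in> Ob C" "c' \<in> Ob C"
  shows "\<mu> (m \<otimes>\<^sub>M m') (n \<otimes>\<^sub>M n') (c \<otimes>\<^sub>C c') \<cdot>\<^sub>C (Ident M (m \<otimes>\<^sub>M m') \<star> phi n c n' c') \<cdot>\<^sub>C phi m (n \<bullet> c) m' (n' \<bullet> c') =
    (mid_swap M m n m' n' (inv_arr M (braid M m' n)) \<star> Ident C (c \<otimes>\<^sub>C c')) \<cdot>\<^sub>C 
      phi (m \<otimes>\<^sub>M n) c (m' \<otimes>\<^sub>M n') c' \<cdot>\<^sub>C (\<mu> m n c \<odot>\<^sub>C \<mu> m' n' c')"
proof -
  interpret monoidal_nat_trans "prod_moncat (prod_moncat M M) C" C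
      "comp_mfctr C (act_mfctr C X)
        (comp_mfctr (prod_moncat M C) (prod_mfctr (id_mfctr M) (act_mfctr C X)) (reassoc_mfctr M C))"
      "comp_mfctr C (act_mfctr C X) (prod_mfctr (tensor_mfctr M) (id_mfctr C))"
      "\<lambda>((m, n), c). \<mu> m n c"
    by (rule multiplicator_monoidal)
  show ?thesis
    using component_fmult[of "((m, n), c)" "((m', n'), c')"] assms
    by (simp add: id_mfctr_def comp_mfctr_def prod_mfctr_def reassoc_mfctr_def tensor_mfctr_def act_mfctr_simps)
qed

section \<open>The strengths of a monoidal action\<close>

text \<open>Together with \<open>unitor\<close> and \<open>multiplicator\<close>, the two strengths determine the
  interchangers (\<open>phi_rstr_lstr\<close>) and are simpler to handle.\<close>

definition rstr :: "'mo \<Rightarrow> 'o \<Rightarrow> 'o \<Rightarrow> 'a" where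
  "rstr m c d = (runit M m \<star> Ident C (c \<otimes>\<^sub>C d)) \<cdot>\<^sub>C phi m c \<j>\<^sub>M d \<cdot>\<^sub>C (Ident C (m \<bullet> c) \<odot>\<^sub>C \<eta> d)"

definition lstr :: "'mo \<Rightarrow> 'o \<Rightarrow> 'o \<Rightarrow> 'a" where
  "lstr m c d = (lunit M m \<star> Ident C (c \<otimes>\<^sub>C d)) \<cdot>\<^sub>C phi \<j>\<^sub>M c m d \<cdot>\<^sub>C (\<eta> c \<odot>\<^sub>C Ident C (m \<bullet> d))"

lemma rstr_arr [simp]:
  assumes "m \<in> Ob M" "c \<in> Ob C" "d \<in> Ob C"
  shows "rstr m c d \<in> Arr C" "Src C (rstr m c d) = (m \<bullet> c) \<otimes>\<^sub>C d" "Tgt C (rstr m c d) = m \<bullet> (c \<otimes>\<^sub>C d)"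
    "iso C (rstr m c d)"
  using assms by (simp_all add: rstr_def)

lemma lstr_arr [simp]:
  assumes "m \<in> Ob M" "c \<in> Ob C" "d \<in> Ob C"
  shows "lstr m c d \<in> Arr C" "Src C (lstr m c d) = c \<otimes>\<^sub>C (m \<bullet> d)" "Tgt C (lstr m c d) = m \<bullet> (c \<otimes>\<^sub>C d)"
    "iso C (lstr m c d)"
  using assms by (simp_all add: lstr_def)

text \<open>\<open>phi_slide\<close> for the case in which the second arrow is an identity, already
  fused by \<open>act_ident\<close>.\<close>

lemma phi_slide_left0:
  assumes "f \<in> Arr M" "g \<in> Arr C" "Tgt M f = m" "Tgt C g = c" "n \<in> Ob M" "d \<in> Ob C"
  shows "phi m c n d \<cdot>\<^sub>C ((f \<star> g) \<odot>\<^sub>C Ident C (n \<bullet> d)) = ((f \<odot>\<^sub>M Ident M n) \<star> (g \<odot>\<^sub>C Ident C d)) \<cdot>\<^sub>C phi (Src M f) (Src C g) n d"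
  using phi_slide(1)[of f g "Ident M n" "Ident C d" m c n d] assms by auto

lemmas phi_slide_left = phi_slide_left0 C.comp_extend[OF phi_slide_left0]

lemma phi_slide_right0:
  assumes "f \<in> Arr M" "g \<in> Arr C" "Tgt M f = n" "Tgt C g = d" "m \<in> Ob M" "c \<in> Ob C"
  shows "phi m c n d \<cdot>\<^sub>C (Ident C (m \<bullet> c) \<odot>\<^sub>C (f \<star> g)) = ((Ident M m \<odot>\<^sub>M f) \<star> (Ident C c \<odot>\<^sub>C g)) \<cdot>\<^sub>C phi m c (Src M f) (Src C g)"
  using phi_slide(1)[of "Ident M m" "Ident C c" f g m c n d] assms by auto

lemmas phi_slide_right = phi_slide_right0 C.comp_extend[OF phi_slide_right0]

lemma rstr_slide0:
  assumes "f \<in> Arr M" "g \<in> Arr C" "h \<in> Arr C" "Tgt M f = m" "Tgt C g = c" "Tgt C h = d"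
  shows "rstr m c d \<cdot>\<^sub>C ((f \<star> g) \<odot>\<^sub>C h) = (f \<star> (g \<odot>\<^sub>C h)) \<cdot>\<^sub>C rstr (Src M f) (Src C g) (Src C h)"
proof -
  have in_ob: "m \<in> Ob M" "c \<in> Ob C" "d \<in> Ob C" using assms by auto
  have "(Ident C (m \<bullet> c) \<odot>\<^sub>C \<eta> d) \<cdot>\<^sub>C ((f \<star> g) \<odot>\<^sub>C h) = ((f \<star> g) \<odot>\<^sub>C (Ident M \<j>\<^sub>M \<star> h)) \<cdot>\<^sub>C (Ident C (Src M f \<bullet> Src C g) \<odot>\<^sub>C \<eta> (Src C h))"
    using assms in_ob by (simp add: C.interchange unitor_slide)
  then show ?thesis
    using assms in_ob by (simp add: rstr_def phi_slide act_interchange M.runit_slide)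
qed

lemmas rstr_slide = rstr_slide0 C.comp_extend[OF rstr_slide0]

lemma lstr_slide0:
  assumes "f \<in> Arr M" "g \<in> Arr C" "h \<in> Arr C" "Tgt M f = m" "Tgt C g = c" "Tgt C h = d"
  shows "lstr m c d \<cdot>\<^sub>C (g \<odot>\<^sub>C (f \<star> h)) = (f \<star> (g \<odot>\<^sub>C h)) \<cdot>\<^sub>C lstr (Src M f) (Src C g) (Src C h)"
proof -
  have in_ob: "m \<in> Ob M" "c \<in> Ob C" "d \<in> Ob C" using assms by auto
  have "(\<eta> c \<odot>\<^sub>C Ident C (m \<bullet> d)) \<cdot>\<^sub>C (g \<odot>\<^sub>C (f \<star> h)) = ((Ident M \<j>\<^sub>M \<star> g) \<odot>\<^sub>C (f \<star> h)) \<cdot>\<^sub>C (\<eta> (Src C g) \<odot>\<^sub>C Ident C (Src M f \<bullet> Src C h))"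
    using assms in_ob by (simp add: C.interchange unitor_slide)
  then show ?thesis
    using assms in_ob by (simp add: lstr_def phi_slide act_interchange M.lunit_slide)
qed

lemmas lstr_slide = lstr_slide0 C.comp_extend[OF lstr_slide0]

text \<open>Associativity of the action functor with an arbitrary arrow u out of the threefold
  product of \<open>M\<close> in place of the associator. The strengths put there the arrow that
  collapses the inserted units.\<close>

lemma phi_assoc_extend:
  assumes "m \<in> Ob M" "n \<in> Ob M" "p \<in> Ob M" "c \<in> Ob C" "d \<in> Ob C" "e \<in> Ob C"
    and u: "u \<in> Arr M" "Src M u = (m \<otimes>\<^sub>M n) \<otimes>\<^sub>M p" and k: "k \<in> Arr C" "Tgt C k = ((m \<bullet> c) \<otimes>\<^sub>C (n \<bullet> d)) \<otimes>\<^sub>C (p \<bullet> e)"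
  shows "(u \<star> assoc C c d e) \<cdot>\<^sub>C (phi (m \<otimes>\<^sub>M n) (c \<otimes>\<^sub>C d) p e \<cdot>\<^sub>C ((phi m c n d \<odot>\<^sub>C Ident C (p \<bullet> e)) \<cdot>\<^sub>C k)) =
    ((u \<cdot>\<^sub>M inv_arr M (assoc M m n p)) \<star> Ident C (c \<otimes>\<^sub>C (d \<otimes>\<^sub>C e))) \<cdot>\<^sub>C (phi m c (n \<otimes>\<^sub>M p) (d \<otimes>\<^sub>C e) \<cdot>\<^sub>C 
      ((Ident C (m \<bullet> c) \<odot>\<^sub>C phi n d p e) \<cdot>\<^sub>C (assoc C (m \<bullet> c) (n \<bullet> d) (p \<bullet> e) \<cdot>\<^sub>C k)))"
proof -
  have "u \<star> assoc C c d e = ((u \<cdot>\<^sub>M inv_arr M (assoc M m n p)) \<star> Ident C (c \<otimes>\<^sub>C (d \<otimes>\<^sub>C e))) \<cdot>\<^sub>C (assoc M m n p \<star> assoc C c d e)"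
    using assms by (simp add: act_interchange)
  then show ?thesis
    using assms by (simp add: C.comp_extend3[OF phi_assoc])
qed

text \<open>Associativity of the action functor at m, \<j>, \<j>. The two unitors at d and e merge
  into the unitor at their product by \<open>unitor_tensor\<close>.\<close>

lemma rstr_assoc:
  assumes "m \<in> Ob M" "c \<in> Ob C" "d \<in> Ob C" "e \<in> Ob C"
  shows "(Ident M m \<star> assoc C c d e) \<cdot>\<^sub>C rstr m (c \<otimes>\<^sub>C d) e \<cdot>\<^sub>C (rstr m c d \<odot>\<^sub>C Ident C e) = rstr m c (d \<otimes>\<^sub>C e) \<cdot>\<^sub>C assoc C (m \<bullet> c) d e"
proof -
  let ?u = "runit M m \<cdot>\<^sub>M (runit M m \<odot>\<^sub>M Ident M \<j>\<^sub>M)"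
  \<comment> \<open>Two ways of collapsing m \<otimes> (\<j> \<otimes> \<j>) agree by the triangle;
    the inserted inverse \<open>lunit\<close> comes from merging the unitors in fact
    \<open>2\<close>.\<close>
  have 1: "?u \<cdot>\<^sub>M inv_arr M (assoc M m \<j>\<^sub>M \<j>\<^sub>M) \<cdot>\<^sub>M (Ident M m \<odot>\<^sub>M inv_arr M (lunit M \<j>\<^sub>M)) = runit M m"
    using assms by (simp add: M.interchange flip: M.triangle)
  have 2: "phi \<j>\<^sub>M d \<j>\<^sub>M e \<cdot>\<^sub>C (\<eta> d \<odot>\<^sub>C \<eta> e) = (inv_arr M (lunit M \<j>\<^sub>M) \<star> Ident C (d \<otimes>\<^sub>C e)) \<cdot>\<^sub>C \<eta> (d \<otimes>\<^sub>C e)"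
    using assms by (simp add: unitor_tensor act_interchange)
  have "(Ident C (m \<bullet> (c \<otimes>\<^sub>C d)) \<odot>\<^sub>C \<eta> e) \<cdot>\<^sub>C (rstr m c d \<odot>\<^sub>C Ident C e) =
      ((runit M m \<star> Ident C (c \<otimes>\<^sub>C d)) \<odot>\<^sub>C Ident C (\<j>\<^sub>M \<bullet> e)) \<cdot>\<^sub>C ((phi m c \<j>\<^sub>M d \<odot>\<^sub>C Ident C (\<j>\<^sub>M \<bullet> e)) \<cdot>\<^sub>C ((Ident C (m \<bullet> c) \<odot>\<^sub>C \<eta> d) \<odot>\<^sub>C \<eta> e))"
    using assms by (simp add: rstr_def C.interchange)
  then have "(Ident M m \<star> assoc C c d e) \<cdot>\<^sub>C rstr m (c \<otimes>\<^sub>C d) e \<cdot>\<^sub>C (rstr m c d \<odot>\<^sub>C Ident C e) =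
    (?u \<star> assoc C c d e) \<cdot>\<^sub>C (phi (m \<otimes>\<^sub>M \<j>\<^sub>M) (c \<otimes>\<^sub>C d) \<j>\<^sub>M e \<cdot>\<^sub>C ((phi m c \<j>\<^sub>M d \<odot>\<^sub>C Ident C (\<j>\<^sub>M \<bullet> e)) \<cdot>\<^sub>C ((Ident C (m \<bullet> c) \<odot>\<^sub>C \<eta> d) \<odot>\<^sub>C \<eta> e)))"
    using assms by (simp add: rstr_def[of m "c \<otimes>\<^sub>C d"] phi_slide_left act_interchange)
  also have "\<dots> = ((?u \<cdot>\<^sub>M inv_arr M (assoc M m \<j>\<^sub>M \<j>\<^sub>M)) \<star> Ident C (c \<otimes>\<^sub>C (d \<otimes>\<^sub>C e))) \<cdot>\<^sub>C (phi m c (\<j>\<^sub>M \<otimes>\<^sub>M \<j>\<^sub>M) (d \<otimes>\<^sub>C e) \<cdot>\<^sub>C 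
      ((Ident C (m \<bullet> c) \<odot>\<^sub>C (phi \<j>\<^sub>M d \<j>\<^sub>M e \<cdot>\<^sub>C (\<eta> d \<odot>\<^sub>C \<eta> e))) \<cdot>\<^sub>C assoc C (m \<bullet> c) d e))"
    using assms by (simp add: phi_assoc_extend C.assoc_slide C.interchange_extend)
  also have "\<dots> = ((?u \<cdot>\<^sub>M inv_arr M (assoc M m \<j>\<^sub>M \<j>\<^sub>M)) \<star> Ident C (c \<otimes>\<^sub>C (d \<otimes>\<^sub>C e))) \<cdot>\<^sub>C (phi m c (\<j>\<^sub>M \<otimes>\<^sub>M \<j>\<^sub>M) (d \<otimes>\<^sub>C e) \<cdot>\<^sub>C 
      ((Ident C (m \<bullet> c) \<odot>\<^sub>C (inv_arr M (lunit M \<j>\<^sub>M) \<star> Ident C (d \<otimes>\<^sub>C e))) \<cdot>\<^sub>C ((Ident C (m \<bullet> c) \<odot>\<^sub>C \<eta> (d \<otimes>\<^sub>C e)) \<cdot>\<^sub>C assoc C (m \<bullet> c) d e)))"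
    unfolding 2 using assms by (simp add: C.interchange_extend)
  also have "\<dots> = rstr m c (d \<otimes>\<^sub>C e) \<cdot>\<^sub>C assoc C (m \<bullet> c) d e"
    using assms 1 by (simp add: phi_slide_right act_interchange rstr_def)
  finally show ?thesis .
qed

text \<open>Associativity of the action functor at \<j>, m, \<j>. It says that the left and right
  module structures on m \<bullet> - commute, and it later produces one half of the hexagon for the
  half-braiding.\<close>

lemma rstr_lstr:
  assumes "m \<in> Ob M" "c \<in> Ob C" "d \<in> Ob C" "e \<in> Ob C"
  shows "(Ident M m \<star> assoc C c d e) \<cdot>\<^sub>C rstr m (c \<otimes>\<^sub>C d) e \<cdot>\<^sub>C (lstr m c d \<odot>\<^sub>C Ident C e) =
    lstr m c (d \<otimes>\<^sub>C e) \<cdot>\<^sub>C (Ident C c \<odot>\<^sub>C rstr m d e) \<cdot>\<^sub>C assoc C c (m \<bullet> d) e"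
proof -
  let ?u = "runit M m \<cdot>\<^sub>M (lunit M m \<odot>\<^sub>M Ident M \<j>\<^sub>M)"
  have 1: "?u \<cdot>\<^sub>M inv_arr M (assoc M \<j>\<^sub>M m \<j>\<^sub>M) = lunit M m \<cdot>\<^sub>M (Ident M \<j>\<^sub>M \<odot>\<^sub>M runit M m)"
    using assms by (simp add: M.runit_slide flip: M.runit_tensor)
  have "(Ident C (m \<bullet> (c \<otimes>\<^sub>C d)) \<odot>\<^sub>C \<eta> e) \<cdot>\<^sub>C (lstr m c d \<odot>\<^sub>C Ident C e) =
      ((lunit M m \<star> Ident C (c \<otimes>\<^sub>C d)) \<odot>\<^sub>C Ident C (\<j>\<^sub>M \<bullet> e)) \<cdot>\<^sub>C ((phi \<j>\<^sub>M c m d \<odot>\<^sub>C Ident C (\<j>\<^sub>M \<bullet> e)) \<cdot>\<^sub>C ((\<eta> c \<odot>\<^sub>C Ident C (m \<bullet> d)) \<odot>\<^sub>C \<eta> e))"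
    using assms by (simp add: lstr_def C.interchange)
  then have "(Ident M m \<star> assoc C c d e) \<cdot>\<^sub>C rstr m (c \<otimes>\<^sub>C d) e \<cdot>\<^sub>C (lstr m c d \<odot>\<^sub>C Ident C e) =
    (?u \<star> assoc C c d e) \<cdot>\<^sub>C (phi (\<j>\<^sub>M \<otimes>\<^sub>M m) (c \<otimes>\<^sub>C d) \<j>\<^sub>M e \<cdot>\<^sub>C ((phi \<j>\<^sub>M c m d \<odot>\<^sub>C Ident C (\<j>\<^sub>M \<bullet> e)) \<cdot>\<^sub>C ((\<eta> c \<odot>\<^sub>C Ident C (m \<bullet> d)) \<odot>\<^sub>C \<eta> e)))"
    using assms by (simp add: rstr_def phi_slide_left act_interchange)
  also have "\<dots> = ((lunit M m \<cdot>\<^sub>M (Ident M \<j>\<^sub>M \<odot>\<^sub>M runit M m)) \<star> Ident C (c \<otimes>\<^sub>C (d \<otimes>\<^sub>C e))) \<cdot>\<^sub>C (phi \<j>\<^sub>M c (m \<otimes>\<^sub>M \<j>\<^sub>M) (d \<otimes>\<^sub>C e) \<cdot>\<^sub>C 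
      ((Ident C (\<j>\<^sub>M \<bullet> c) \<odot>\<^sub>C phi m d \<j>\<^sub>M e) \<cdot>\<^sub>C ((\<eta> c \<odot>\<^sub>C (Ident C (m \<bullet> d) \<odot>\<^sub>C \<eta> e)) \<cdot>\<^sub>C assoc C c (m \<bullet> d) e)))"
    using assms 1 by (simp add: phi_assoc_extend C.assoc_slide)
  also have "\<dots> = (lunit M m \<star> Ident C (c \<otimes>\<^sub>C (d \<otimes>\<^sub>C e))) \<cdot>\<^sub>C (phi \<j>\<^sub>M c m (d \<otimes>\<^sub>C e) \<cdot>\<^sub>C ((Ident C (\<j>\<^sub>M \<bullet> c) \<odot>\<^sub>C (runit M m \<star> Ident C (d \<otimes>\<^sub>C e))) \<cdot>\<^sub>C 
      ((Ident C (\<j>\<^sub>M \<bullet> c) \<odot>\<^sub>C phi m d \<j>\<^sub>M e) \<cdot>\<^sub>C ((\<eta> c \<odot>\<^sub>C (Ident C (m \<bullet> d) \<odot>\<^sub>C \<eta> e)) \<cdot>\<^sub>C assoc C c (m \<bullet> d) e))))"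
    using assms by (simp add: phi_slide_right act_interchange)
  also have "\<dots> = lstr m c (d \<otimes>\<^sub>C e) \<cdot>\<^sub>C (Ident C c \<odot>\<^sub>C rstr m d e) \<cdot>\<^sub>C assoc C c (m \<bullet> d) e"
    using assms by (simp add: lstr_def rstr_def C.interchange_extend)
  finally show ?thesis .
qed

text \<open>Associativity of the action functor at \<j>, \<j>, m, again with the unitors at c and d
  merged by \<open>unitor_tensor\<close>.\<close>

lemma lstr_assoc:
  assumes "m \<in> Ob M" "c \<in> Ob C" "d \<in> Ob C" "e \<in> Ob C"
  shows "(Ident M m \<star> assoc C c d e) \<cdot>\<^sub>C lstr m (c \<otimes>\<^sub>C d) e = lstr m c (d \<otimes>\<^sub>C e) \<cdot>\<^sub>C (Ident C c \<odot>\<^sub>C lstr m d e) \<cdot>\<^sub>C assoc C c d (m \<bullet> e)"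
proof -
  let ?u = "lunit M m \<cdot>\<^sub>M (lunit M \<j>\<^sub>M \<odot>\<^sub>M Ident M m)"
  have 1: "?u \<cdot>\<^sub>M inv_arr M (assoc M \<j>\<^sub>M \<j>\<^sub>M m) = lunit M m \<cdot>\<^sub>M (Ident M \<j>\<^sub>M \<odot>\<^sub>M lunit M m)"
    using assms by (simp add: M.unit_coincidence flip: M.triangle)
  have "\<eta> (c \<otimes>\<^sub>C d) \<odot>\<^sub>C Ident C (m \<bullet> e) = ((lunit M \<j>\<^sub>M \<star> Ident C (c \<otimes>\<^sub>C d)) \<odot>\<^sub>C Ident C (m \<bullet> e)) \<cdot>\<^sub>C 
      ((phi \<j>\<^sub>M c \<j>\<^sub>M d \<odot>\<^sub>C Ident C (m \<bullet> e)) \<cdot>\<^sub>C ((\<eta> c \<odot>\<^sub>C \<eta> d) \<odot>\<^sub>C Ident C (m \<bullet> e)))"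
    using assms by (simp add: unitor_tensor C.interchange)
  then have "(Ident M m \<star> assoc C c d e) \<cdot>\<^sub>C lstr m (c \<otimes>\<^sub>C d) e =
    (?u \<star> assoc C c d e) \<cdot>\<^sub>C (phi (\<j>\<^sub>M \<otimes>\<^sub>M \<j>\<^sub>M) (c \<otimes>\<^sub>C d) m e \<cdot>\<^sub>C ((phi \<j>\<^sub>M c \<j>\<^sub>M d \<odot>\<^sub>C Ident C (m \<bullet> e)) \<cdot>\<^sub>C ((\<eta> c \<odot>\<^sub>C \<eta> d) \<odot>\<^sub>C Ident C (m \<bullet> e))))"
    using assms by (simp add: lstr_def phi_slide_left act_interchange)
  also have "\<dots> = ((lunit M m \<cdot>\<^sub>M (Ident M \<j>\<^sub>M \<odot>\<^sub>M lunit M m)) \<star> Ident C (c \<otimes>\<^sub>C (d \<otimes>\<^sub>C e))) \<cdot>\<^sub>C (phi \<j>\<^sub>M c (\<j>\<^sub>M \<otimes>\<^sub>M m) (d \<otimes>\<^sub>C e) \<cdot>\<^sub>C 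
      ((Ident C (\<j>\<^sub>M \<bullet> c) \<odot>\<^sub>C phi \<j>\<^sub>M d m e) \<cdot>\<^sub>C ((\<eta> c \<odot>\<^sub>C (\<eta> d \<odot>\<^sub>C Ident C (m \<bullet> e))) \<cdot>\<^sub>C assoc C c d (m \<bullet> e))))"
    using assms 1 by (simp add: phi_assoc_extend C.assoc_slide)
  also have "\<dots> = (lunit M m \<star> Ident C (c \<otimes>\<^sub>C (d \<otimes>\<^sub>C e))) \<cdot>\<^sub>C (phi \<j>\<^sub>M c m (d \<otimes>\<^sub>C e) \<cdot>\<^sub>C ((Ident C (\<j>\<^sub>M \<bullet> c) \<odot>\<^sub>C (lunit M m \<star> Ident C (d \<otimes>\<^sub>C e))) \<cdot>\<^sub>C 
      ((Ident C (\<j>\<^sub>M \<bullet> c) \<odot>\<^sub>C phi \<j>\<^sub>M d m e) \<cdot>\<^sub>C ((\<eta> c \<odot>\<^sub>C (\<eta> d \<odot>\<^sub>C Ident C (m \<bullet> e))) \<cdot>\<^sub>C assoc C c d (m \<bullet> e)))))"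
    using assms by (simp add: phi_slide_right act_interchange)
  also have "\<dots> = lstr m c (d \<otimes>\<^sub>C e) \<cdot>\<^sub>C (Ident C c \<odot>\<^sub>C lstr m d e) \<cdot>\<^sub>C assoc C c d (m \<bullet> e)"
    using assms by (simp add: lstr_def C.interchange_extend)
  finally show ?thesis .
qed

lemma rstr_unit:
  assumes "m \<in> Ob M" "c \<in> Ob C"
  shows "(Ident M m \<star> runit C c) \<cdot>\<^sub>C rstr m c \<j>\<^sub>C = runit C (m \<bullet> c)"
  using assms phi_unit(2)[of m c] by (simp add: rstr_def act_interchange)

lemma lstr_unit:
  assumes "m \<in> Ob M" "c \<in> Ob C"
  shows "(Ident M m \<star> lunit C c) \<cdot>\<^sub>C lstr m \<j>\<^sub>C c = lunit C (m \<bullet> c)"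
  using assms phi_unit(1)[of m c] by (simp add: lstr_def act_interchange)

text \<open>Monoidality of the unitor. The definition of \<open>rstr\<close> collapses \<j>
  \<otimes> \<j> by the right unitor and \<open>unitor_tensor\<close> by the left one, so their
  coincidence is used.\<close>

lemma rstr_unitor:
  assumes "c \<in> Ob C" "d \<in> Ob C"
  shows "rstr \<j>\<^sub>M c d \<cdot>\<^sub>C (\<eta> c \<odot>\<^sub>C Ident C d) = \<eta> (c \<otimes>\<^sub>C d)"
  using assms by (simp add: rstr_def C.interchange unitor_tensor M.unit_coincidence)

lemma lstr_unitor:
  assumes "c \<in> Ob C" "d \<in> Ob C"
  shows "lstr \<j>\<^sub>M c d \<cdot>\<^sub>C (Ident C c \<odot>\<^sub>C \<eta> d) = \<eta> (c \<otimes>\<^sub>C d)"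
  using assms by (simp add: lstr_def C.interchange unitor_tensor)

text \<open>\<open>multiplicator_tensor\<close> with m' = n' = \<j>. The exchange of n with \<j> is
  absorbed by \<open>mid_swap_units\<close>.\<close>

lemma rstr_multiplicator:
  assumes "m \<in> Ob M" "n \<in> Ob M" "c \<in> Ob C" "d \<in> Ob C"
  shows "rstr (m \<otimes>\<^sub>M n) c d \<cdot>\<^sub>C (\<mu> m n c \<odot>\<^sub>C Ident C d) =
    \<mu> m n (c \<otimes>\<^sub>C d) \<cdot>\<^sub>C (Ident M m \<star> rstr n c d) \<cdot>\<^sub>C rstr m (n \<bullet> c) d"
proof -
  \<comment> \<open>\<open>?e\<close> inserts the two missing units of \<open>M\<close> in front of
    d, and \<open>?r\<close> collapses them again at the end. The two displayed composites are the
    two sides of \<open>multiplicator_tensor\<close> between them.\<close>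
  let ?r = "runit M m \<odot>\<^sub>M runit M n" and ?e = "Ident C (m \<bullet> (n \<bullet> c)) \<odot>\<^sub>C ((Ident M \<j>\<^sub>M \<star> \<eta> d) \<cdot>\<^sub>C \<eta> d)"
  let ?s = "mid_swap M m n \<j>\<^sub>M \<j>\<^sub>M (inv_arr M (braid M \<j>\<^sub>M n))"
  have s: "?s \<in> Arr M" "Src M ?s = (m \<otimes>\<^sub>M n) \<otimes>\<^sub>M (\<j>\<^sub>M \<otimes>\<^sub>M \<j>\<^sub>M)" "Tgt M ?s = (m \<otimes>\<^sub>M \<j>\<^sub>M) \<otimes>\<^sub>M (n \<otimes>\<^sub>M \<j>\<^sub>M)" using assms by simp_all
  have "((?r \<star> Ident C (c \<otimes>\<^sub>C d)) \<cdot>\<^sub>C \<mu> (m \<otimes>\<^sub>M \<j>\<^sub>M) (n \<otimes>\<^sub>M \<j>\<^sub>M) (c \<otimes>\<^sub>C d) \<cdot>\<^sub>C (Ident M (m \<otimes>\<^sub>M \<j>\<^sub>M) \<star> phi n c \<j>\<^sub>M d) \<cdot>\<^sub>C phi m (n \<bullet> c) \<j>\<^sub>M (\<j>\<^sub>M \<bullet> d)) \<cdot>\<^sub>C ?e =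
     (?r \<star> Ident C (c \<otimes>\<^sub>C d)) \<cdot>\<^sub>C (((?s \<star> Ident C (c \<otimes>\<^sub>C d)) \<cdot>\<^sub>C phi (m \<otimes>\<^sub>M n) c (\<j>\<^sub>M \<otimes>\<^sub>M \<j>\<^sub>M) d \<cdot>\<^sub>C 
       (\<mu> m n c \<odot>\<^sub>C \<mu> \<j>\<^sub>M \<j>\<^sub>M d)) \<cdot>\<^sub>C ?e)"
    using assms s by (simp flip: multiplicator_tensor)
  moreover have "((?r \<star> Ident C (c \<otimes>\<^sub>C d)) \<cdot>\<^sub>C \<mu> (m \<otimes>\<^sub>M \<j>\<^sub>M) (n \<otimes>\<^sub>M \<j>\<^sub>M) (c \<otimes>\<^sub>C d) \<cdot>\<^sub>C (Ident M (m \<otimes>\<^sub>M \<j>\<^sub>M) \<star> phi n c \<j>\<^sub>M d) \<cdot>\<^sub>C phi m (n \<bullet> c) \<j>\<^sub>M (\<j>\<^sub>M \<bullet> d)) \<cdot>\<^sub>C ?e =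
     \<mu> m n (c \<otimes>\<^sub>C d) \<cdot>\<^sub>C (Ident M m \<star> rstr n c d) \<cdot>\<^sub>C rstr m (n \<bullet> c) d"
  proof -
    have 1: "?e = (Ident C (m \<bullet> (n \<bullet> c)) \<odot>\<^sub>C (Ident M \<j>\<^sub>M \<star> \<eta> d)) \<cdot>\<^sub>C (Ident C (m \<bullet> (n \<bullet> c)) \<odot>\<^sub>C \<eta> d)"
      using assms by (simp add: C.interchange)
    have 2: "(?r \<star> Ident C (c \<otimes>\<^sub>C d)) \<cdot>\<^sub>C \<mu> (m \<otimes>\<^sub>M \<j>\<^sub>M) (n \<otimes>\<^sub>M \<j>\<^sub>M) (c \<otimes>\<^sub>C d) =
      \<mu> m n (c \<otimes>\<^sub>C d) \<cdot>\<^sub>C (runit M m \<star> (runit M n \<star> Ident C (c \<otimes>\<^sub>C d)))"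
      using assms by (simp add: multiplicator_slide)
    show ?thesis
      unfolding 1 using assms C.comp_extend[OF 2]
      by (simp add: phi_slide_right act_interchange rstr_def)
  qed
  moreover have "(?r \<star> Ident C (c \<otimes>\<^sub>C d)) \<cdot>\<^sub>C (((?s \<star> Ident C (c \<otimes>\<^sub>C d)) \<cdot>\<^sub>C phi (m \<otimes>\<^sub>M n) c (\<j>\<^sub>M \<otimes>\<^sub>M \<j>\<^sub>M) d \<cdot>\<^sub>C 
       (\<mu> m n c \<odot>\<^sub>C \<mu> \<j>\<^sub>M \<j>\<^sub>M d)) \<cdot>\<^sub>C ?e) = rstr (m \<otimes>\<^sub>M n) c d \<cdot>\<^sub>C (\<mu> m n c \<odot>\<^sub>C Ident C d)"
  proof -
    have 1: "(\<mu> m n c \<odot>\<^sub>C \<mu> \<j>\<^sub>M \<j>\<^sub>M d) \<cdot>\<^sub>C ?e =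
      (Ident C ((m \<otimes>\<^sub>M n) \<bullet> c) \<odot>\<^sub>C (inv_arr M (runit M \<j>\<^sub>M) \<star> Ident C d)) \<cdot>\<^sub>C ((Ident C ((m \<otimes>\<^sub>M n) \<bullet> c) \<odot>\<^sub>C \<eta> d) \<cdot>\<^sub>C (\<mu> m n c \<odot>\<^sub>C Ident C d))"
      using assms C.comp_extend[OF act_runit[of "\<j>\<^sub>M" d]] by (simp add: C.interchange)
    have 2: "?r \<cdot>\<^sub>M (?s \<cdot>\<^sub>M (Ident M (m \<otimes>\<^sub>M n) \<odot>\<^sub>M inv_arr M (runit M \<j>\<^sub>M))) = runit M (m \<otimes>\<^sub>M n)"
      using M.mid_swap_units(1)[OF assms(1,2)] .
    show ?thesis
      using assms s 1 2 by (simp add: phi_slide_right act_interchange rstr_def)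
  qed
  ultimately show ?thesis by simp
qed

text \<open>The mirror image: \<open>multiplicator_tensor\<close> with its first two objects equal
  to \<j>, the units being inserted in front of c.\<close>

lemma lstr_multiplicator:
  assumes "m \<in> Ob M" "n \<in> Ob M" "c \<in> Ob C" "d \<in> Ob C"
  shows "lstr (m \<otimes>\<^sub>M n) c d \<cdot>\<^sub>C (Ident C c \<odot>\<^sub>C \<mu> m n d) =
    \<mu> m n (c \<otimes>\<^sub>C d) \<cdot>\<^sub>C (Ident M m \<star> lstr n c d) \<cdot>\<^sub>C lstr m c (n \<bullet> d)"
proof -
  let ?r = "lunit M m \<odot>\<^sub>M lunit M n" and ?e = "((Ident M \<j>\<^sub>M \<star> \<eta> c) \<cdot>\<^sub>C \<eta> c) \<odot>\<^sub>C Ident C (m \<bullet> (n \<bullet> d))"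
  let ?s = "mid_swap M \<j>\<^sub>M \<j>\<^sub>M m n (inv_arr M (braid M m \<j>\<^sub>M))"
  have s: "?s \<in> Arr M" "Src M ?s = (\<j>\<^sub>M \<otimes>\<^sub>M \<j>\<^sub>M) \<otimes>\<^sub>M (m \<otimes>\<^sub>M n)" "Tgt M ?s = (\<j>\<^sub>M \<otimes>\<^sub>M m) \<otimes>\<^sub>M (\<j>\<^sub>M \<otimes>\<^sub>M n)" using assms by simp_all
  have "((?r \<star> Ident C (c \<otimes>\<^sub>C d)) \<cdot>\<^sub>C \<mu> (\<j>\<^sub>M \<otimes>\<^sub>M m) (\<j>\<^sub>M \<otimes>\<^sub>M n) (c \<otimes>\<^sub>C d) \<cdot>\<^sub>C (Ident M (\<j>\<^sub>M \<otimes>\<^sub>M m) \<star> phi \<j>\<^sub>M c n d) \<cdot>\<^sub>C phi \<j>\<^sub>M (\<j>\<^sub>M \<bullet> c) m (n \<bullet> d)) \<cdot>\<^sub>C ?e =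
     (?r \<star> Ident C (c \<otimes>\<^sub>C d)) \<cdot>\<^sub>C (((?s \<star> Ident C (c \<otimes>\<^sub>C d)) \<cdot>\<^sub>C phi (\<j>\<^sub>M \<otimes>\<^sub>M \<j>\<^sub>M) c (m \<otimes>\<^sub>M n) d \<cdot>\<^sub>C 
       (\<mu> \<j>\<^sub>M \<j>\<^sub>M c \<odot>\<^sub>C \<mu> m n d)) \<cdot>\<^sub>C ?e)"
    using assms s by (simp flip: multiplicator_tensor)
  moreover have "((?r \<star> Ident C (c \<otimes>\<^sub>C d)) \<cdot>\<^sub>C \<mu> (\<j>\<^sub>M \<otimes>\<^sub>M m) (\<j>\<^sub>M \<otimes>\<^sub>M n) (c \<otimes>\<^sub>C d) \<cdot>\<^sub>C (Ident M (\<j>\<^sub>M \<otimes>\<^sub>M m) \<star> phi \<j>\<^sub>M c n d) \<cdot>\<^sub>C phi \<j>\<^sub>M (\<j>\<^sub>M \<bullet> c) m (n \<bullet> d)) \<cdot>\<^sub>C ?e =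
     \<mu> m n (c \<otimes>\<^sub>C d) \<cdot>\<^sub>C (Ident M m \<star> lstr n c d) \<cdot>\<^sub>C lstr m c (n \<bullet> d)"
  proof -
    have 1: "?e = ((Ident M \<j>\<^sub>M \<star> \<eta> c) \<odot>\<^sub>C Ident C (m \<bullet> (n \<bullet> d))) \<cdot>\<^sub>C (\<eta> c \<odot>\<^sub>C Ident C (m \<bullet> (n \<bullet> d)))"
      using assms by (simp add: C.interchange)
    have 2: "(?r \<star> Ident C (c \<otimes>\<^sub>C d)) \<cdot>\<^sub>C \<mu> (\<j>\<^sub>M \<otimes>\<^sub>M m) (\<j>\<^sub>M \<otimes>\<^sub>M n) (c \<otimes>\<^sub>C d) =
      \<mu> m n (c \<otimes>\<^sub>C d) \<cdot>\<^sub>C (lunit M m \<star> (lunit M n \<star> Ident C (c \<otimes>\<^sub>C d)))"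
      using assms by (simp add: multiplicator_slide)
    show ?thesis
      unfolding 1 using assms C.comp_extend[OF 2]
      by (simp add: phi_slide_left act_interchange lstr_def)
  qed
  moreover have "(?r \<star> Ident C (c \<otimes>\<^sub>C d)) \<cdot>\<^sub>C (((?s \<star> Ident C (c \<otimes>\<^sub>C d)) \<cdot>\<^sub>C phi (\<j>\<^sub>M \<otimes>\<^sub>M \<j>\<^sub>M) c (m \<otimes>\<^sub>M n) d \<cdot>\<^sub>C 
       (\<mu> \<j>\<^sub>M \<j>\<^sub>M c \<odot>\<^sub>C \<mu> m n d)) \<cdot>\<^sub>C ?e) = lstr (m \<otimes>\<^sub>M n) c d \<cdot>\<^sub>C (Ident C c \<odot>\<^sub>C \<mu> m n d)"
  proof -
    have 1: "(\<mu> \<j>\<^sub>M \<j>\<^sub>M c \<odot>\<^sub>C \<mu> m n d) \<cdot>\<^sub>C ?e =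
      ((inv_arr M (lunit M \<j>\<^sub>M) \<star> Ident C c) \<odot>\<^sub>C Ident C ((m \<otimes>\<^sub>M n) \<bullet> d)) \<cdot>\<^sub>C ((\<eta> c \<odot>\<^sub>C Ident C ((m \<otimes>\<^sub>M n) \<bullet> d)) \<cdot>\<^sub>C (Ident C c \<odot>\<^sub>C \<mu> m n d))"
      using assms C.comp_extend[OF act_runit[of "\<j>\<^sub>M" c]] by (simp add: C.interchange M.unit_coincidence)
    have 2: "?r \<cdot>\<^sub>M (?s \<cdot>\<^sub>M (inv_arr M (lunit M \<j>\<^sub>M) \<odot>\<^sub>M Ident M (m \<otimes>\<^sub>M n))) = lunit M (m \<otimes>\<^sub>M n)"
      using M.mid_swap_units(2)[OF assms(1,2)] .
    show ?thesis
      using assms s 1 2 by (simp add: phi_slide_left act_interchange lstr_def)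
  qed
  ultimately show ?thesis by simp
qed

text \<open>\<open>multiplicator_tensor\<close> with \<j> in the two inner slots, where the
  exchanged objects are both units. It gives the factorisation of the interchanger with m taken out
  first.\<close>

lemma phi_rstr_lstr:
  assumes "m \<in> Ob M" "n \<in> Ob M" "c \<in> Ob C" "d \<in> Ob C"
  shows "phi m c n d = \<mu> m n (c \<otimes>\<^sub>C d) \<cdot>\<^sub>C (Ident M m \<star> lstr n c d) \<cdot>\<^sub>C rstr m c (n \<bullet> d)"
proof -
  let ?r = "runit M m \<odot>\<^sub>M lunit M n" and ?e = "(Ident M m \<star> \<eta> c) \<odot>\<^sub>C \<eta> (n \<bullet> d)"
  let ?s = "mid_swap M m \<j>\<^sub>M \<j>\<^sub>M n (inv_arr M (braid M \<j>\<^sub>M \<j>\<^sub>M))"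
  have s: "?s \<in> Arr M" "Src M ?s = (m \<otimes>\<^sub>M \<j>\<^sub>M) \<otimes>\<^sub>M (\<j>\<^sub>M \<otimes>\<^sub>M n)" "Tgt M ?s = (m \<otimes>\<^sub>M \<j>\<^sub>M) \<otimes>\<^sub>M (\<j>\<^sub>M \<otimes>\<^sub>M n)" using assms by simp_all
  have "((?r \<star> Ident C (c \<otimes>\<^sub>C d)) \<cdot>\<^sub>C \<mu> (m \<otimes>\<^sub>M \<j>\<^sub>M) (\<j>\<^sub>M \<otimes>\<^sub>M n) (c \<otimes>\<^sub>C d) \<cdot>\<^sub>C (Ident M (m \<otimes>\<^sub>M \<j>\<^sub>M) \<star> phi \<j>\<^sub>M c n d) \<cdot>\<^sub>C phi m (\<j>\<^sub>M \<bullet> c) \<j>\<^sub>M (n \<bullet> d)) \<cdot>\<^sub>C ?e =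
     (?r \<star> Ident C (c \<otimes>\<^sub>C d)) \<cdot>\<^sub>C (((?s \<star> Ident C (c \<otimes>\<^sub>C d)) \<cdot>\<^sub>C phi (m \<otimes>\<^sub>M \<j>\<^sub>M) c (\<j>\<^sub>M \<otimes>\<^sub>M n) d \<cdot>\<^sub>C 
       (\<mu> m \<j>\<^sub>M c \<odot>\<^sub>C \<mu> \<j>\<^sub>M n d)) \<cdot>\<^sub>C ?e)"
    using assms s by (simp flip: multiplicator_tensor)
  moreover have "((?r \<star> Ident C (c \<otimes>\<^sub>C d)) \<cdot>\<^sub>C \<mu> (m \<otimes>\<^sub>M \<j>\<^sub>M) (\<j>\<^sub>M \<otimes>\<^sub>M n) (c \<otimes>\<^sub>C d) \<cdot>\<^sub>C (Ident M (m \<otimes>\<^sub>M \<j>\<^sub>M) \<star> phi \<j>\<^sub>M c n d) \<cdot>\<^sub>C phi m (\<j>\<^sub>M \<bullet> c) \<j>\<^sub>M (n \<bullet> d)) \<cdot>\<^sub>C ?e =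
     \<mu> m n (c \<otimes>\<^sub>C d) \<cdot>\<^sub>C (Ident M m \<star> lstr n c d) \<cdot>\<^sub>C rstr m c (n \<bullet> d)"
  proof -
    have 1: "?e = ((Ident M m \<star> \<eta> c) \<odot>\<^sub>C Ident C (\<j>\<^sub>M \<bullet> (n \<bullet> d))) \<cdot>\<^sub>C (Ident C (m \<bullet> c) \<odot>\<^sub>C \<eta> (n \<bullet> d))"
      using assms by (simp add: C.interchange)
    have 2: "(?r \<star> Ident C (c \<otimes>\<^sub>C d)) \<cdot>\<^sub>C \<mu> (m \<otimes>\<^sub>M \<j>\<^sub>M) (\<j>\<^sub>M \<otimes>\<^sub>M n) (c \<otimes>\<^sub>C d) =
      \<mu> m n (c \<otimes>\<^sub>C d) \<cdot>\<^sub>C (runit M m \<star> (lunit M n \<star> Ident C (c \<otimes>\<^sub>C d)))"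
      using assms by (simp add: multiplicator_slide)
    show ?thesis
      unfolding 1 using assms C.comp_extend[OF 2]
      by (simp add: phi_slide_left act_interchange rstr_def lstr_def)
  qed
  moreover have "(?r \<star> Ident C (c \<otimes>\<^sub>C d)) \<cdot>\<^sub>C (((?s \<star> Ident C (c \<otimes>\<^sub>C d)) \<cdot>\<^sub>C phi (m \<otimes>\<^sub>M \<j>\<^sub>M) c (\<j>\<^sub>M \<otimes>\<^sub>M n) d \<cdot>\<^sub>C 
       (\<mu> m \<j>\<^sub>M c \<odot>\<^sub>C \<mu> \<j>\<^sub>M n d)) \<cdot>\<^sub>C ?e) = phi m c n d"
  proof -
    have 1: "(\<mu> m \<j>\<^sub>M c \<odot>\<^sub>C \<mu> \<j>\<^sub>M n d) \<cdot>\<^sub>C ?e =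
      (inv_arr M (runit M m) \<star> Ident C c) \<odot>\<^sub>C (inv_arr M (lunit M n) \<star> Ident C d)"
      using assms by (simp add: C.interchange act_runit act_lunit)
    show ?thesis
      using assms s 1 M.comp_extend[OF M.mid_swap_units(3)[OF assms(1,2)]]
      by (simp add: phi_slide act_interchange M.interchange)
  qed
  ultimately show ?thesis by simp
qed

text \<open>\<open>multiplicator_tensor\<close> with \<j> in the two outer slots, so that m and n
  themselves are exchanged. Taking n out first is therefore possible at the price of an inverse
  braiding.\<close>

lemma phi_lstr_rstr:
  assumes "m \<in> Ob M" "n \<in> Ob M" "c \<in> Ob C" "d \<in> Ob C"
  shows "(inv_arr M (braid M n m) \<star> Ident C (c \<otimes>\<^sub>C d)) \<cdot>\<^sub>C phi m c n d =
    \<mu> n m (c \<otimes>\<^sub>C d) \<cdot>\<^sub>C (Ident M n \<star> rstr m c d) \<cdot>\<^sub>C lstr n (m \<bullet> c) d"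
proof -
  let ?r = "lunit M n \<odot>\<^sub>M runit M m" and ?e = "\<eta> (m \<bullet> c) \<odot>\<^sub>C (Ident M n \<star> \<eta> d)"
  let ?s = "mid_swap M \<j>\<^sub>M m n \<j>\<^sub>M (inv_arr M (braid M n m))"
  have s: "?s \<in> Arr M" "Src M ?s = (\<j>\<^sub>M \<otimes>\<^sub>M m) \<otimes>\<^sub>M (n \<otimes>\<^sub>M \<j>\<^sub>M)" "Tgt M ?s = (\<j>\<^sub>M \<otimes>\<^sub>M n) \<otimes>\<^sub>M (m \<otimes>\<^sub>M \<j>\<^sub>M)" using assms by simp_all
  have "((?r \<star> Ident C (c \<otimes>\<^sub>C d)) \<cdot>\<^sub>C \<mu> (\<j>\<^sub>M \<otimes>\<^sub>M n) (m \<otimes>\<^sub>M \<j>\<^sub>M) (c \<otimes>\<^sub>C d) \<cdot>\<^sub>C (Ident M (\<j>\<^sub>M \<otimes>\<^sub>M n) \<star> phi m c \<j>\<^sub>M d) \<cdot>\<^sub>C phi \<j>\<^sub>M (m \<bullet> c) n (\<j>\<^sub>M \<bullet> d)) \<cdot>\<^sub>C ?e =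
     (?r \<star> Ident C (c \<otimes>\<^sub>C d)) \<cdot>\<^sub>C (((?s \<star> Ident C (c \<otimes>\<^sub>C d)) \<cdot>\<^sub>C phi (\<j>\<^sub>M \<otimes>\<^sub>M m) c (n \<otimes>\<^sub>M \<j>\<^sub>M) d \<cdot>\<^sub>C 
       (\<mu> \<j>\<^sub>M m c \<odot>\<^sub>C \<mu> n \<j>\<^sub>M d)) \<cdot>\<^sub>C ?e)"
    using assms s by (simp flip: multiplicator_tensor)
  moreover have "((?r \<star> Ident C (c \<otimes>\<^sub>C d)) \<cdot>\<^sub>C \<mu> (\<j>\<^sub>M \<otimes>\<^sub>M n) (m \<otimes>\<^sub>M \<j>\<^sub>M) (c \<otimes>\<^sub>C d) \<cdot>\<^sub>C (Ident M (\<j>\<^sub>M \<otimes>\<^sub>M n) \<star> phi m c \<j>\<^sub>M d) \<cdot>\<^sub>C phi \<j>\<^sub>M (m \<bullet> c) n (\<j>\<^sub>M \<bullet> d)) \<cdot>\<^sub>C ?e =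
     \<mu> n m (c \<otimes>\<^sub>C d) \<cdot>\<^sub>C (Ident M n \<star> rstr m c d) \<cdot>\<^sub>C lstr n (m \<bullet> c) d"
  proof -
    have 1: "?e = (Ident C (\<j>\<^sub>M \<bullet> (m \<bullet> c)) \<odot>\<^sub>C (Ident M n \<star> \<eta> d)) \<cdot>\<^sub>C (\<eta> (m \<bullet> c) \<odot>\<^sub>C Ident C (n \<bullet> d))"
      using assms by (simp add: C.interchange)
    have 2: "(?r \<star> Ident C (c \<otimes>\<^sub>C d)) \<cdot>\<^sub>C \<mu> (\<j>\<^sub>M \<otimes>\<^sub>M n) (m \<otimes>\<^sub>M \<j>\<^sub>M) (c \<otimes>\<^sub>C d) =
      \<mu> n m (c \<otimes>\<^sub>C d) \<cdot>\<^sub>C (lunit M n \<star> (runit M m \<star> Ident C (c \<otimes>\<^sub>C d)))"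
      using assms by (simp add: multiplicator_slide)
    show ?thesis
      unfolding 1 using assms C.comp_extend[OF 2]
      by (simp add: phi_slide_right act_interchange rstr_def lstr_def)
  qed
  moreover have "(?r \<star> Ident C (c \<otimes>\<^sub>C d)) \<cdot>\<^sub>C (((?s \<star> Ident C (c \<otimes>\<^sub>C d)) \<cdot>\<^sub>C phi (\<j>\<^sub>M \<otimes>\<^sub>M m) c (n \<otimes>\<^sub>M \<j>\<^sub>M) d \<cdot>\<^sub>C 
       (\<mu> \<j>\<^sub>M m c \<odot>\<^sub>C \<mu> n \<j>\<^sub>M d)) \<cdot>\<^sub>C ?e) = (inv_arr M (braid M n m) \<star> Ident C (c \<otimes>\<^sub>C d)) \<cdot>\<^sub>C phi m c n d"
  proof -
    have 1: "(\<mu> \<j>\<^sub>M m c \<odot>\<^sub>C \<mu> n \<j>\<^sub>M d) \<cdot>\<^sub>C ?e =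
      (inv_arr M (lunit M m) \<star> Ident C c) \<odot>\<^sub>C (inv_arr M (runit M n) \<star> Ident C d)"
      using assms by (simp add: C.interchange act_runit act_lunit)
    show ?thesis
      using assms s 1 M.comp_extend[OF M.mid_swap_units(4)[OF assms(1,2)]]
      by (simp add: phi_slide act_interchange M.interchange)
  qed
  ultimately show ?thesis by simp
qed

section \<open>The classifying functor\<close>

text \<open>\<open>leval m c\<close> and \<open>reval m c\<close> compare \<open>c \<otimes> F m\<close> and \<open>F m \<otimes> c\<close> with \<open>m \<bullet> c\<close>, where \<open>F m = m \<bullet> \<j>\<close>.\<close>

definition reval :: "'mo \<Rightarrow> 'o \<Rightarrow> 'a" where
  "reval m c = (Ident M m \<star> lunit C c) \<cdot>\<^sub>C rstr m \<j>\<^sub>C c"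

definition leval :: "'mo \<Rightarrow> 'o \<Rightarrow> 'a" where
  "leval m c = (Ident M m \<star> runit C c) \<cdot>\<^sub>C lstr m c \<j>\<^sub>C"

lemma reval_arr [simp]:
  assumes "m \<in> Ob M" "c \<in> Ob C"
  shows "reval m c \<in> Arr C" "Src C (reval m c) = (m \<bullet> \<j>\<^sub>C) \<otimes>\<^sub>C c" "Tgt C (reval m c) = m \<bullet> c" "iso C (reval m c)"
  using assms by (simp_all add: reval_def)

lemma leval_arr [simp]:
  assumes "m \<in> Ob M" "c \<in> Ob C"
  shows "leval m c \<in> Arr C" "Src C (leval m c) = c \<otimes>\<^sub>C (m \<bullet> \<j>\<^sub>C)" "Tgt C (leval m c) = m \<bullet> c" "iso C (leval m c)"
  using assms by (simp_all add: leval_def)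

lemma reval_slide0:
  "f \<in> Arr M \<Longrightarrow> g \<in> Arr C \<Longrightarrow> Tgt M f = m \<Longrightarrow> Tgt C g = c \<Longrightarrow>
    reval m c \<cdot>\<^sub>C ((f \<star> Ident C \<j>\<^sub>C) \<odot>\<^sub>C g) = (f \<star> g) \<cdot>\<^sub>C reval (Src M f) (Src C g)"
  by (auto simp: reval_def rstr_slide act_interchange C.lunit_slide)

lemmas reval_slide = reval_slide0 C.comp_extend[OF reval_slide0]

lemma reval_slide_right0:
  "g \<in> Arr C \<Longrightarrow> m \<in> Ob M \<Longrightarrow> Tgt C g = c \<Longrightarrow> reval m c \<cdot>\<^sub>C (Ident C (m \<bullet> \<j>\<^sub>C) \<odot>\<^sub>C g) = (Ident M m \<star> g) \<cdot>\<^sub>C reval m (Src C g)"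
  using reval_slide(1)[of "Ident M m" g m c] by auto

lemmas reval_slide_right = reval_slide_right0 C.comp_extend[OF reval_slide_right0]

lemma leval_slide0:
  "f \<in> Arr M \<Longrightarrow> g \<in> Arr C \<Longrightarrow> Tgt M f = m \<Longrightarrow> Tgt C g = c \<Longrightarrow>
    leval m c \<cdot>\<^sub>C (g \<odot>\<^sub>C (f \<star> Ident C \<j>\<^sub>C)) = (f \<star> g) \<cdot>\<^sub>C leval (Src M f) (Src C g)"
  by (auto simp: leval_def lstr_slide act_interchange C.runit_slide)

lemmas leval_slide = leval_slide0 C.comp_extend[OF leval_slide0]

text \<open>\<open>rstr_assoc\<close> with first object \<j>, so the right strength is determined by
  the evaluations.\<close>

lemma rstr_reval:
  assumes "m \<in> Ob M" "c \<in> Ob C" "d \<in> Ob C"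
  shows "rstr m c d \<cdot>\<^sub>C (reval m c \<odot>\<^sub>C Ident C d) = reval m (c \<otimes>\<^sub>C d) \<cdot>\<^sub>C assoc C (m \<bullet> \<j>\<^sub>C) c d"
proof -
  have "rstr m c d \<cdot>\<^sub>C (reval m c \<odot>\<^sub>C Ident C d) =
      (Ident M m \<star> (lunit C c \<odot>\<^sub>C Ident C d)) \<cdot>\<^sub>C (rstr m (\<j>\<^sub>C \<otimes>\<^sub>C c) d \<cdot>\<^sub>C (rstr m \<j>\<^sub>C c \<odot>\<^sub>C Ident C d))"
    using assms by (simp add: reval_def C.right_whisker_comp rstr_slide)
  also have "\<dots> = (Ident M m \<star> lunit C (c \<otimes>\<^sub>C d)) \<cdot>\<^sub>C ((Ident M m \<star> assoc C \<j>\<^sub>C c d) \<cdot>\<^sub>C rstr m (\<j>\<^sub>C \<otimes>\<^sub>C c) d \<cdot>\<^sub>C (rstr m \<j>\<^sub>C c \<odot>\<^sub>C Ident C d))"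
    using assms by (simp add: act_interchange C.lunit_tensor)
  also have "\<dots> = reval m (c \<otimes>\<^sub>C d) \<cdot>\<^sub>C assoc C (m \<bullet> \<j>\<^sub>C) c d"
    using assms by (simp only: rstr_assoc C.unit_ob_in) (simp add: reval_def)
  finally show ?thesis .
qed

text \<open>\<open>rstr_lstr\<close> with \<j> in the middle; the triangle exchanges the left unitor
  inside \<open>reval\<close> for the right unitor inside \<open>leval\<close>.\<close>

lemma lstr_reval:
  assumes "m \<in> Ob M" "b \<in> Ob C" "e \<in> Ob C"
  shows "lstr m b e \<cdot>\<^sub>C (Ident C b \<odot>\<^sub>C reval m e) \<cdot>\<^sub>C assoc C b (m \<bullet> \<j>\<^sub>C) e = rstr m b e \<cdot>\<^sub>C (leval m b \<odot>\<^sub>C Ident C e)"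
proof -
  have "lstr m b e \<cdot>\<^sub>C (Ident C b \<odot>\<^sub>C reval m e) \<cdot>\<^sub>C assoc C b (m \<bullet> \<j>\<^sub>C) e =
      (Ident M m \<star> (Ident C b \<odot>\<^sub>C lunit C e)) \<cdot>\<^sub>C (lstr m b (\<j>\<^sub>C \<otimes>\<^sub>C e) \<cdot>\<^sub>C (Ident C b \<odot>\<^sub>C rstr m \<j>\<^sub>C e) \<cdot>\<^sub>C assoc C b (m \<bullet> \<j>\<^sub>C) e)"
    using assms by (simp add: reval_def C.left_whisker_comp lstr_slide)
  also have "\<dots> = (Ident M m \<star> (Ident C b \<odot>\<^sub>C lunit C e)) \<cdot>\<^sub>C ((Ident M m \<star> assoc C b \<j>\<^sub>C e) \<cdot>\<^sub>C rstr m (b \<otimes>\<^sub>C \<j>\<^sub>C) e \<cdot>\<^sub>C (lstr m b \<j>\<^sub>C \<odot>\<^sub>C Ident C e))"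
    using assms by (simp only: rstr_lstr C.unit_ob_in)
  also have "\<dots> = (Ident M m \<star> (runit C b \<odot>\<^sub>C Ident C e)) \<cdot>\<^sub>C (rstr m (b \<otimes>\<^sub>C \<j>\<^sub>C) e \<cdot>\<^sub>C (lstr m b \<j>\<^sub>C \<odot>\<^sub>C Ident C e))"
    using assms by (simp add: act_interchange C.triangle)
  also have "\<dots> = rstr m b e \<cdot>\<^sub>C (leval m b \<odot>\<^sub>C Ident C e)"
    using assms by (simp add: leval_def C.right_whisker_comp rstr_slide)
  finally show ?thesis .
qed

text \<open>\<open>lstr_assoc\<close> with last object \<j>, where \<open>runit_tensor\<close>
  absorbs the associator.\<close>

lemma lstr_leval:
  assumes "m \<in> Ob M" "c \<in> Ob C" "d \<in> Ob C"
  shows "lstr m c d \<cdot>\<^sub>C (Ident C c \<odot>\<^sub>C leval m d) \<cdot>\<^sub>C assoc C c d (m \<bullet> \<j>\<^sub>C) = leval m (c \<otimes>\<^sub>C d)"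
proof -
  have "lstr m c d \<cdot>\<^sub>C (Ident C c \<odot>\<^sub>C leval m d) \<cdot>\<^sub>C assoc C c d (m \<bullet> \<j>\<^sub>C) =
      (Ident M m \<star> (Ident C c \<odot>\<^sub>C runit C d)) \<cdot>\<^sub>C (lstr m c (d \<otimes>\<^sub>C \<j>\<^sub>C) \<cdot>\<^sub>C (Ident C c \<odot>\<^sub>C lstr m d \<j>\<^sub>C) \<cdot>\<^sub>C assoc C c d (m \<bullet> \<j>\<^sub>C))"
    using assms by (simp add: leval_def C.left_whisker_comp lstr_slide)
  also have "\<dots> = (Ident M m \<star> (Ident C c \<odot>\<^sub>C runit C d)) \<cdot>\<^sub>C ((Ident M m \<star> assoc C c d \<j>\<^sub>C) \<cdot>\<^sub>C lstr m (c \<otimes>\<^sub>C d) \<j>\<^sub>C)"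
    using assms by (simp only: lstr_assoc C.unit_ob_in)
  also have "\<dots> = leval m (c \<otimes>\<^sub>C d)"
    using assms by (simp add: act_interchange C.runit_tensor leval_def)
  finally show ?thesis .
qed

lemma reval_multiplicator:
  assumes "m \<in> Ob M" "n \<in> Ob M" "c \<in> Ob C"
  shows "reval (m \<otimes>\<^sub>M n) c \<cdot>\<^sub>C (\<mu> m n \<j>\<^sub>C \<odot>\<^sub>C Ident C c) =
    \<mu> m n c \<cdot>\<^sub>C (Ident M m \<star> reval n c) \<cdot>\<^sub>C rstr m (n \<bullet> \<j>\<^sub>C) c"
proof -
  have "reval (m \<otimes>\<^sub>M n) c \<cdot>\<^sub>C (\<mu> m n \<j>\<^sub>C \<odot>\<^sub>C Ident C c) = (Ident C ((m \<otimes>\<^sub>M n) \<bullet> c)) \<cdot>\<^sub>C ((Ident M (m \<otimes>\<^sub>M n) \<star> lunit C c) \<cdot>\<^sub>C 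
      (\<mu> m n (\<j>\<^sub>C \<otimes>\<^sub>C c) \<cdot>\<^sub>C (Ident M m \<star> rstr n \<j>\<^sub>C c) \<cdot>\<^sub>C rstr m (n \<bullet> \<j>\<^sub>C) c))"
    using assms rstr_multiplicator[of m n "\<j>\<^sub>C" c] by (simp add: reval_def)
  also have "\<dots> = \<mu> m n c \<cdot>\<^sub>C ((Ident M m \<star> (Ident M n \<star> lunit C c)) \<cdot>\<^sub>C ((Ident M m \<star> rstr n \<j>\<^sub>C c) \<cdot>\<^sub>C rstr m (n \<bullet> \<j>\<^sub>C) c))"
    using assms by (simp add: multiplicator_slide)
  also have "\<dots> = \<mu> m n c \<cdot>\<^sub>C (Ident M m \<star> reval n c) \<cdot>\<^sub>C rstr m (n \<bullet> \<j>\<^sub>C) c"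
    using assms by (simp add: act_interchange reval_def)
  finally show ?thesis .
qed

lemma leval_multiplicator:
  assumes "m \<in> Ob M" "n \<in> Ob M" "b \<in> Ob C"
  shows "leval (m \<otimes>\<^sub>M n) b \<cdot>\<^sub>C (Ident C b \<odot>\<^sub>C \<mu> m n \<j>\<^sub>C) =
    \<mu> m n b \<cdot>\<^sub>C (Ident M m \<star> leval n b) \<cdot>\<^sub>C lstr m b (n \<bullet> \<j>\<^sub>C)"
proof -
  have "leval (m \<otimes>\<^sub>M n) b \<cdot>\<^sub>C (Ident C b \<odot>\<^sub>C \<mu> m n \<j>\<^sub>C) = (Ident M (m \<otimes>\<^sub>M n) \<star> runit C b) \<cdot>\<^sub>C 
      (\<mu> m n (b \<otimes>\<^sub>C \<j>\<^sub>C) \<cdot>\<^sub>C (Ident M m \<star> lstr n b \<j>\<^sub>C) \<cdot>\<^sub>C lstr m b (n \<bullet> \<j>\<^sub>C))"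
    using assms lstr_multiplicator[of m n b "\<j>\<^sub>C"] by (simp add: leval_def)
  also have "\<dots> = \<mu> m n b \<cdot>\<^sub>C ((Ident M m \<star> (Ident M n \<star> runit C b)) \<cdot>\<^sub>C ((Ident M m \<star> lstr n b \<j>\<^sub>C) \<cdot>\<^sub>C lstr m b (n \<bullet> \<j>\<^sub>C)))"
    using assms by (simp add: multiplicator_slide)
  also have "\<dots> = \<mu> m n b \<cdot>\<^sub>C (Ident M m \<star> leval n b) \<cdot>\<^sub>C lstr m b (n \<bullet> \<j>\<^sub>C)"
    using assms by (simp add: act_interchange leval_def)
  finally show ?thesis .
qed

text \<open>At the unit of \<open>M\<close> the evaluation is a unitor of \<open>C\<close> followed
  by \<eta>. With \<open>leval_unitor\<close> this gives \<open>class_unit_natural\<close>, and it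
  is also the unitor condition for the identification by \<open>reval\<close>.\<close>

lemma reval_unitor:
  assumes "c \<in> Ob C"
  shows "reval \<j>\<^sub>M c \<cdot>\<^sub>C (\<eta> \<j>\<^sub>C \<odot>\<^sub>C Ident C c) = \<eta> c \<cdot>\<^sub>C lunit C c"
  using assms rstr_unitor[of "\<j>\<^sub>C" c] by (simp add: reval_def unitor_slide)

lemma leval_unitor:
  assumes "c \<in> Ob C"
  shows "leval \<j>\<^sub>M c \<cdot>\<^sub>C (Ident C c \<odot>\<^sub>C \<eta> \<j>\<^sub>C) = \<eta> c \<cdot>\<^sub>C runit C c"
  using assms lstr_unitor[of c "\<j>\<^sub>C"] by (simp add: leval_def unitor_slide)

lemma reval_unit: "m \<in> Ob M \<Longrightarrow> reval m \<j>\<^sub>C = runit C (m \<bullet> \<j>\<^sub>C)"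
  using rstr_unit[of m "\<j>\<^sub>C"] by (simp add: reval_def C.unit_coincidence)

definition class_ob :: "'mo \<Rightarrow> ('o, 'a) center_ob" where
  "class_ob m = (m \<bullet> \<j>\<^sub>C, \<lambda>b\<in>Ob C. inv_arr C (leval m b) \<cdot>\<^sub>C reval m b)"

lemma class_ob_simps [simp]:
  "fst (class_ob m) = m \<bullet> \<j>\<^sub>C" "b \<in> Ob C \<Longrightarrow> snd (class_ob m) b = inv_arr C (leval m b) \<cdot>\<^sub>C reval m b"
  by (simp_all add: class_ob_def)

text \<open>\<open>lstr_reval\<close> composed with the half-braiding, which turns
  \<open>leval\<close> into \<open>reval\<close>, followed by \<open>rstr_reval\<close>. It allows a
  half-braiding to be removed without inverses of evaluations appearing.\<close>

lemma reval_class: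
  assumes "m \<in> Ob M" "c \<in> Ob C" "d \<in> Ob C"
  shows "lstr m c d \<cdot>\<^sub>C (Ident C c \<odot>\<^sub>C reval m d) \<cdot>\<^sub>C assoc C c (m \<bullet> \<j>\<^sub>C) d \<cdot>\<^sub>C (snd (class_ob m) c \<odot>\<^sub>C Ident C d) =
    reval m (c \<otimes>\<^sub>C d) \<cdot>\<^sub>C assoc C (m \<bullet> \<j>\<^sub>C) c d"
proof -
  have "lstr m c d \<cdot>\<^sub>C (Ident C c \<odot>\<^sub>C reval m d) \<cdot>\<^sub>C assoc C c (m \<bullet> \<j>\<^sub>C) d \<cdot>\<^sub>C (snd (class_ob m) c \<odot>\<^sub>C Ident C d) =
      (lstr m c d \<cdot>\<^sub>C (Ident C c \<odot>\<^sub>C reval m d) \<cdot>\<^sub>C assoc C c (m \<bullet> \<j>\<^sub>C) d) \<cdot>\<^sub>C (snd (class_ob m) c \<odot>\<^sub>C Ident C d)"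
    using assms by simp
  also have "\<dots> = rstr m c d \<cdot>\<^sub>C (reval m c \<odot>\<^sub>C Ident C d)"
    unfolding lstr_reval[OF assms] using assms by (simp add: C.interchange)
  finally show ?thesis
    using assms by (simp only: rstr_reval)
qed

lemma class_ob_in [simp]:
  assumes "m \<in> Ob M"
  shows "class_ob m \<in> center_obs C"
proof (rule C.center_obsI, goal_cases)
  case 2
  show ?case by (simp add: class_ob_def)
next
  case (4 f)
  have "leval m (Tgt C f) \<cdot>\<^sub>C ((f \<odot>\<^sub>C Ident C (m \<bullet> \<j>\<^sub>C)) \<cdot>\<^sub>C (inv_arr C (leval m (Src C f)) \<cdot>\<^sub>C reval m (Src C f))) =
      (Ident M m \<star> f) \<cdot>\<^sub>C reval m (Src C f)"
    using assms 4 leval_slide(2)[of "Ident M m" f m "Tgt C f"] by simp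
  then show ?case
    using assms 4 C.iso_move_left[of "leval m (Tgt C f)"] by (simp add: reval_slide_right)
next
  case (5 d e)
  let ?v = "snd (class_ob m)" and ?c = "m \<bullet> \<j>\<^sub>C"
  \<comment> \<open>Both sides of the hexagon are compared after an invertible arrow that clears the
    inverses of \<open>leval\<close>: \<open>lstr_leval\<close> evaluates one side,
    \<open>reval_class\<close> the other.\<close>
  have "(lstr m d e \<cdot>\<^sub>C (Ident C d \<odot>\<^sub>C leval m e)) \<cdot>\<^sub>C (assoc C d e ?c \<cdot>\<^sub>C (?v (d \<otimes>\<^sub>C e) \<cdot>\<^sub>C assoc C ?c d e)) =
     (lstr m d e \<cdot>\<^sub>C (Ident C d \<odot>\<^sub>C leval m e) \<cdot>\<^sub>C assoc C d e ?c) \<cdot>\<^sub>C (?v (d \<otimes>\<^sub>C e) \<cdot>\<^sub>C assoc C ?c d e)"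
    using assms 5 by simp
  also have "\<dots> = reval m (d \<otimes>\<^sub>C e) \<cdot>\<^sub>C assoc C ?c d e"
    unfolding lstr_leval[OF assms 5] using assms 5 by simp
  also have "\<dots> = (lstr m d e \<cdot>\<^sub>C (Ident C d \<odot>\<^sub>C leval m e)) \<cdot>\<^sub>C ((Ident C d \<odot>\<^sub>C ?v e) \<cdot>\<^sub>C (assoc C d ?c e \<cdot>\<^sub>C (?v d \<odot>\<^sub>C Ident C e)))"
    unfolding reval_class[OF assms 5, symmetric] using assms 5 by (simp add: C.interchange_extend)
  finally have "assoc C d e ?c \<cdot>\<^sub>C (?v (d \<otimes>\<^sub>C e) \<cdot>\<^sub>C assoc C ?c d e) = (Ident C d \<odot>\<^sub>C ?v e) \<cdot>\<^sub>C (assoc C d ?c e \<cdot>\<^sub>C (?v d \<odot>\<^sub>C Ident C e))"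
    by (rule C.iso_cancel_left) (use assms 5 in auto)
  then show ?case by simp
qed (use assms in auto)

text \<open>Both evaluations are natural in m, hence so is the half-braiding composed from
  them.\<close>

lemma class_arr_natural:
  assumes "f \<in> Arr M"
  shows "center_natural C (class_ob (Src M f)) (class_ob (Tgt M f)) (f \<star> Ident C \<j>\<^sub>C)"
  unfolding center_natural_def
proof
  fix b assume b: "b \<in> Ob C"
  have "leval (Tgt M f) b \<cdot>\<^sub>C ((Ident C b \<odot>\<^sub>C (f \<star> Ident C \<j>\<^sub>C)) \<cdot>\<^sub>C (inv_arr C (leval (Src M f) b) \<cdot>\<^sub>C reval (Src M f) b)) =
      (f \<star> Ident C b) \<cdot>\<^sub>C reval (Src M f) b"
    using assms b leval_slide(2)[of f "Ident C b" "Tgt M f" b] by simp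
  then show "snd (class_ob (Tgt M f)) b \<cdot>\<^sub>C ((f \<star> Ident C \<j>\<^sub>C) \<odot>\<^sub>C Ident C b) = (Ident C b \<odot>\<^sub>C (f \<star> Ident C \<j>\<^sub>C)) \<cdot>\<^sub>C snd (class_ob (Src M f)) b"
    using assms b C.iso_move_left[of "leval (Tgt M f) b"] by (simp add: reval_slide)
qed

text \<open>The comparison of F m \<otimes> F n with F (m \<otimes> n). It equals
  \<open>phi m \<j> n \<j>\<close> followed by the collapse of \<j> \<otimes> \<j>, as the proof of
  \<open>braid_multiplicator\<close> shows; the present form avoids the left strength.\<close>

definition class_mult :: "'mo \<Rightarrow> 'mo \<Rightarrow> 'a" where
  "class_mult m n = \<mu> m n \<j>\<^sub>C \<cdot>\<^sub>C reval m (n \<bullet> \<j>\<^sub>C)"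

lemma class_mult_arr [simp]:
  assumes "m \<in> Ob M" "n \<in> Ob M"
  shows "class_mult m n \<in> Arr C" "Src C (class_mult m n) = (m \<bullet> \<j>\<^sub>C) \<otimes>\<^sub>C (n \<bullet> \<j>\<^sub>C)"
    "Tgt C (class_mult m n) = (m \<otimes>\<^sub>M n) \<bullet> \<j>\<^sub>C" "iso C (class_mult m n)"
  using assms by (simp_all add: class_mult_def)

text \<open>\<open>reval_multiplicator\<close> followed by \<open>rstr_reval\<close>. It is the
  multiplicator condition for the identification by \<open>reval\<close>, and at c = p \<bullet>
  \<j> it reduces associativity of F to that of the action.\<close>

lemma reval_class_mult:
  assumes "m \<in> Ob M" "n \<in> Ob M" "c \<in> Ob C"
  shows "reval (m \<otimes>\<^sub>M n) c \<cdot>\<^sub>C (class_mult m n \<odot>\<^sub>C Ident C c) =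
    \<mu> m n c \<cdot>\<^sub>C reval m (n \<bullet> c) \<cdot>\<^sub>C (Ident C (m \<bullet> \<j>\<^sub>C) \<odot>\<^sub>C reval n c) \<cdot>\<^sub>C assoc C (m \<bullet> \<j>\<^sub>C) (n \<bullet> \<j>\<^sub>C) c"
proof -
  have "reval (m \<otimes>\<^sub>M n) c \<cdot>\<^sub>C (class_mult m n \<odot>\<^sub>C Ident C c) =
      (reval (m \<otimes>\<^sub>M n) c \<cdot>\<^sub>C (\<mu> m n \<j>\<^sub>C \<odot>\<^sub>C Ident C c)) \<cdot>\<^sub>C (reval m (n \<bullet> \<j>\<^sub>C) \<odot>\<^sub>C Ident C c)"
    using assms by (simp add: class_mult_def C.right_whisker_comp)
  also have "\<dots> = \<mu> m n c \<cdot>\<^sub>C ((Ident M m \<star> reval n c) \<cdot>\<^sub>C (rstr m (n \<bullet> \<j>\<^sub>C) c \<cdot>\<^sub>C (reval m (n \<bullet> \<j>\<^sub>C) \<odot>\<^sub>C Ident C c)))"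
    unfolding reval_multiplicator[OF assms] using assms by simp
  also have "\<dots> = \<mu> m n c \<cdot>\<^sub>C ((Ident M m \<star> reval n c) \<cdot>\<^sub>C (reval m ((n \<bullet> \<j>\<^sub>C) \<otimes>\<^sub>C c) \<cdot>\<^sub>C assoc C (m \<bullet> \<j>\<^sub>C) (n \<bullet> \<j>\<^sub>C) c))"
    using assms by (simp only: rstr_reval act_ob_in C.unit_ob_in)
  also have "\<dots> = \<mu> m n c \<cdot>\<^sub>C reval m (n \<bullet> c) \<cdot>\<^sub>C (Ident C (m \<bullet> \<j>\<^sub>C) \<odot>\<^sub>C reval n c) \<cdot>\<^sub>C assoc C (m \<bullet> \<j>\<^sub>C) (n \<bullet> \<j>\<^sub>C) c"
    using assms by (simp add: reval_slide_right)
  finally show ?thesis .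
qed

lemma class_mult_natural:
  assumes m: "m \<in> Ob M" and n: "n \<in> Ob M"
  shows "center_natural C (center_tensor_ob C (class_ob m) (class_ob n)) (class_ob (m \<otimes>\<^sub>M n)) (class_mult m n)"
  unfolding center_natural_def
proof
  fix b assume b: "b \<in> Ob C"
  let ?c = "m \<bullet> \<j>\<^sub>C" and ?d = "n \<bullet> \<j>\<^sub>C"
  let ?u = "snd (class_ob m) b" and ?v = "snd (class_ob n) b"
  have u: "?u \<in> Arr C" "Src C ?u = ?c \<otimes>\<^sub>C b" "Tgt C ?u = b \<otimes>\<^sub>C ?c" and v: "?v \<in> Arr C" "Src C ?v = ?d \<otimes>\<^sub>C b" "Tgt C ?v = b \<otimes>\<^sub>C ?d"
    using m n b by simp_all
  \<comment> \<open>Postcomposing with \<open>leval\<close> clears the inverse in the half-braiding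
    of F (m \<otimes> n). Then \<open>leval_multiplicator\<close> exposes a left strength, and the
    half-braidings of m and n are consumed by \<open>reval_class\<close> and by the definition of
    \<open>class_ob\<close>.\<close>
  have "leval (m \<otimes>\<^sub>M n) b \<cdot>\<^sub>C ((Ident C b \<odot>\<^sub>C class_mult m n) \<cdot>\<^sub>C snd (center_tensor_ob C (class_ob m) (class_ob n)) b) =
     (leval (m \<otimes>\<^sub>M n) b \<cdot>\<^sub>C (Ident C b \<odot>\<^sub>C \<mu> m n \<j>\<^sub>C)) \<cdot>\<^sub>C ((Ident C b \<odot>\<^sub>C reval m ?d) \<cdot>\<^sub>C (assoc C b ?c ?d \<cdot>\<^sub>C ((?u \<odot>\<^sub>C Ident C ?d) \<cdot>\<^sub>C 
       (inv_arr C (assoc C ?c b ?d) \<cdot>\<^sub>C ((Ident C ?c \<odot>\<^sub>C ?v) \<cdot>\<^sub>C assoc C ?c ?d b)))))"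
    using m n b u v by (simp add: snd_center_tensor class_mult_def C.left_whisker_comp del: class_ob_simps(2))
  also have "\<dots> = \<mu> m n b \<cdot>\<^sub>C ((Ident M m \<star> leval n b) \<cdot>\<^sub>C ((lstr m b ?d \<cdot>\<^sub>C (Ident C b \<odot>\<^sub>C reval m ?d) \<cdot>\<^sub>C assoc C b ?c ?d \<cdot>\<^sub>C (?u \<odot>\<^sub>C Ident C ?d)) \<cdot>\<^sub>C 
       (inv_arr C (assoc C ?c b ?d) \<cdot>\<^sub>C ((Ident C ?c \<odot>\<^sub>C ?v) \<cdot>\<^sub>C assoc C ?c ?d b))))"
    unfolding leval_multiplicator[OF m n b] using m n b u v by (simp del: class_ob_simps(2))
  also have "\<dots> = \<mu> m n b \<cdot>\<^sub>C ((Ident M m \<star> leval n b) \<cdot>\<^sub>C (reval m (b \<otimes>\<^sub>C ?d) \<cdot>\<^sub>C ((Ident C ?c \<odot>\<^sub>C ?v) \<cdot>\<^sub>C assoc C ?c ?d b)))"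
    using m n b u v by (simp add: reval_class del: class_ob_simps(2))
  also have "\<dots> = \<mu> m n b \<cdot>\<^sub>C ((Ident M m \<star> (leval n b \<cdot>\<^sub>C ?v)) \<cdot>\<^sub>C (reval m (?d \<otimes>\<^sub>C b) \<cdot>\<^sub>C assoc C ?c ?d b))"
    using m n b u v by (simp add: reval_slide_right act_interchange del: class_ob_simps(2))
  also have "\<dots> = reval (m \<otimes>\<^sub>M n) b \<cdot>\<^sub>C (class_mult m n \<odot>\<^sub>C Ident C b)"
    using m n b by (simp add: reval_class_mult reval_slide_right)
  finally have "(Ident C b \<odot>\<^sub>C class_mult m n) \<cdot>\<^sub>C snd (center_tensor_ob C (class_ob m) (class_ob n)) b =
      inv_arr C (leval (m \<otimes>\<^sub>M n) b) \<cdot>\<^sub>C (reval (m \<otimes>\<^sub>M n) b \<cdot>\<^sub>C (class_mult m n \<odot>\<^sub>C Ident C b))"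
    using m n b by (subst (asm) C.iso_move_left) (simp_all add: C.center_tensor_in)
  then show "snd (class_ob (m \<otimes>\<^sub>M n)) b \<cdot>\<^sub>C (class_mult m n \<odot>\<^sub>C Ident C b) =
      (Ident C b \<odot>\<^sub>C class_mult m n) \<cdot>\<^sub>C snd (center_tensor_ob C (class_ob m) (class_ob n)) b"
    using m n b by simp
qed

lemma class_unit_natural: "center_natural C (center_unit C) (class_ob \<j>\<^sub>M) (\<eta> \<j>\<^sub>C)"
  unfolding center_natural_def
proof
  fix b assume b: "b \<in> Ob C"
  have "leval \<j>\<^sub>M b \<cdot>\<^sub>C ((Ident C b \<odot>\<^sub>C \<eta> \<j>\<^sub>C) \<cdot>\<^sub>C snd (center_unit C) b) = \<eta> b \<cdot>\<^sub>C lunit C b"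
    using b C.comp_extend[OF leval_unitor[OF b]] by simp
  then have "(Ident C b \<odot>\<^sub>C \<eta> \<j>\<^sub>C) \<cdot>\<^sub>C snd (center_unit C) b = inv_arr C (leval \<j>\<^sub>M b) \<cdot>\<^sub>C (reval \<j>\<^sub>M b \<cdot>\<^sub>C (\<eta> \<j>\<^sub>C \<odot>\<^sub>C Ident C b))"
    using b by (subst (asm) C.iso_move_left) (simp_all add: reval_unitor)
  then show "snd (class_ob \<j>\<^sub>M) b \<cdot>\<^sub>C (\<eta> \<j>\<^sub>C \<odot>\<^sub>C Ident C b) = (Ident C b \<odot>\<^sub>C \<eta> \<j>\<^sub>C) \<cdot>\<^sub>C snd (center_unit C) b"
    using b by simp
qed

end

lemma restrict_center_action_simps [simp]:
  "fob (act (restrict_action N C R (center_action C))) (m, c) = fst (fob R m) \<otimes>\<^bsub>C\<^esub> c"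
  "farr (act (restrict_action N C R (center_action C))) (f, g) = snd (snd (farr R f)) \<odot>\<^bsub>C\<^esub> g"
  "unitor (restrict_action N C R (center_action C)) c = (snd (snd (feps R)) \<odot>\<^bsub>C\<^esub> Ident C c) \<cdot>\<^bsub>C\<^esub> inv_arr C (lunit C c)"
  "multiplicator (restrict_action N C R (center_action C)) m n c =
    (snd (snd (fmult R m n)) \<odot>\<^bsub>C\<^esub> Ident C c) \<cdot>\<^bsub>C\<^esub> inv_arr C (assoc C (fst (fob R m)) (fst (fob R n)) c)"
  "interchanger (restrict_action N C R (center_action C)) m n c d =
    mid_swap C (fst (fob R m)) (fst (fob R n)) c d (snd (fob R n) c) \<cdot>\<^bsub>C\<^esub> 
      (snd (snd (inv_arr N (fmult R m n))) \<odot>\<^bsub>C\<^esub> Ident C (c \<otimes>\<^bsub>C\<^esub> d))"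
  by (simp_all add: restrict_action_def)

section \<open>The classifying functor is strong monoidal and braided, and recovers the
  action\<close>

context monoidal_action
begin

text \<open>Both sides are the interchanger \<open>phi n \<j> m \<j>\<close> followed by the
  collapse of \<j> \<otimes> \<j>. The factorisation \<open>phi_rstr_lstr\<close> yields the
  right-hand side, and \<open>phi_lstr_rstr\<close>, with its braiding, the left-hand side.\<close>

lemma braid_multiplicator:
  assumes m: "m \<in> Ob M" and n: "n \<in> Ob M"
  shows "(braid M m n \<star> Ident C \<j>\<^sub>C) \<cdot>\<^sub>C \<mu> m n \<j>\<^sub>C \<cdot>\<^sub>C leval m (n \<bullet> \<j>\<^sub>C) = \<mu> n m \<j>\<^sub>C \<cdot>\<^sub>C reval n (m \<bullet> \<j>\<^sub>C)"
proof -
  have 1: "\<mu> m n \<j>\<^sub>C \<cdot>\<^sub>C (Ident M m \<star> (Ident M n \<star> lunit C \<j>\<^sub>C)) =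
      (Ident M (m \<otimes>\<^sub>M n) \<star> lunit C \<j>\<^sub>C) \<cdot>\<^sub>C \<mu> m n (\<j>\<^sub>C \<otimes>\<^sub>C \<j>\<^sub>C)" if "m \<in> Ob M" "n \<in> Ob M" for m n
    using that by (simp add: multiplicator_slide)
  have "(Ident M (n \<otimes>\<^sub>M m) \<star> lunit C \<j>\<^sub>C) \<cdot>\<^sub>C phi n \<j>\<^sub>C m \<j>\<^sub>C = \<mu> n m \<j>\<^sub>C \<cdot>\<^sub>C reval n (m \<bullet> \<j>\<^sub>C)"
  proof -
    have "(Ident M (n \<otimes>\<^sub>M m) \<star> lunit C \<j>\<^sub>C) \<cdot>\<^sub>C phi n \<j>\<^sub>C m \<j>\<^sub>C =
      \<mu> n m \<j>\<^sub>C \<cdot>\<^sub>C ((Ident M n \<star> ((Ident M m \<star> lunit C \<j>\<^sub>C) \<cdot>\<^sub>C lstr m \<j>\<^sub>C \<j>\<^sub>C)) \<cdot>\<^sub>C rstr n \<j>\<^sub>C (m \<bullet> \<j>\<^sub>C))"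
      using assms C.comp_extend[OF 1[OF n m, symmetric]] by (simp add: phi_rstr_lstr act_interchange)
    then show ?thesis
      using assms by (simp add: lstr_unit reval_def)
  qed
  moreover have "(Ident M (n \<otimes>\<^sub>M m) \<star> lunit C \<j>\<^sub>C) \<cdot>\<^sub>C phi n \<j>\<^sub>C m \<j>\<^sub>C =
      (braid M m n \<star> Ident C \<j>\<^sub>C) \<cdot>\<^sub>C \<mu> m n \<j>\<^sub>C \<cdot>\<^sub>C leval m (n \<bullet> \<j>\<^sub>C)"
  proof -
    have "(Ident M (n \<otimes>\<^sub>M m) \<star> lunit C \<j>\<^sub>C) \<cdot>\<^sub>C phi n \<j>\<^sub>C m \<j>\<^sub>C =
      (braid M m n \<star> Ident C \<j>\<^sub>C) \<cdot>\<^sub>C ((Ident M (m \<otimes>\<^sub>M n) \<star> lunit C \<j>\<^sub>C) \<cdot>\<^sub>C ((inv_arr M (braid M m n) \<star> Ident C (\<j>\<^sub>C \<otimes>\<^sub>C \<j>\<^sub>C)) \<cdot>\<^sub>C phi n \<j>\<^sub>C m \<j>\<^sub>C))"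
      using assms by (simp add: act_interchange)
    also have "\<dots> = (braid M m n \<star> Ident C \<j>\<^sub>C) \<cdot>\<^sub>C ((Ident M (m \<otimes>\<^sub>M n) \<star> runit C \<j>\<^sub>C) \<cdot>\<^sub>C 
        (\<mu> m n (\<j>\<^sub>C \<otimes>\<^sub>C \<j>\<^sub>C) \<cdot>\<^sub>C (Ident M m \<star> rstr n \<j>\<^sub>C \<j>\<^sub>C) \<cdot>\<^sub>C lstr m (n \<bullet> \<j>\<^sub>C) \<j>\<^sub>C))"
      using assms by (simp only: phi_lstr_rstr C.unit_ob_in C.unit_coincidence)
    also have "\<dots> = (braid M m n \<star> Ident C \<j>\<^sub>C) \<cdot>\<^sub>C (\<mu> m n \<j>\<^sub>C \<cdot>\<^sub>C 
        ((Ident M m \<star> ((Ident M n \<star> runit C \<j>\<^sub>C) \<cdot>\<^sub>C rstr n \<j>\<^sub>C \<j>\<^sub>C)) \<cdot>\<^sub>C lstr m (n \<bullet> \<j>\<^sub>C) \<j>\<^sub>C))"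
      using assms C.comp_extend[OF 1[OF m n, symmetric]] by (simp add: act_interchange C.unit_coincidence)
    finally show ?thesis
      using assms by (simp add: rstr_unit leval_def)
  qed
  ultimately show ?thesis by simp
qed

text \<open>Writing the inner comparison through \<open>reval_class_mult\<close> puts all
  multiplicators next to each other, where the associativity law of the action applies.\<close>

lemma class_mult_assoc:
  assumes "m \<in> Ob M" "n \<in> Ob M" "p \<in> Ob M"
  shows "(assoc M m n p \<star> Ident C \<j>\<^sub>C) \<cdot>\<^sub>C class_mult (m \<otimes>\<^sub>M n) p \<cdot>\<^sub>C (class_mult m n \<odot>\<^sub>C Ident C (p \<bullet> \<j>\<^sub>C)) =
    class_mult m (n \<otimes>\<^sub>M p) \<cdot>\<^sub>C (Ident C (m \<bullet> \<j>\<^sub>C) \<odot>\<^sub>C class_mult n p) \<cdot>\<^sub>C assoc C (m \<bullet> \<j>\<^sub>C) (n \<bullet> \<j>\<^sub>C) (p \<bullet> \<j>\<^sub>C)"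
proof -
  have "(assoc M m n p \<star> Ident C \<j>\<^sub>C) \<cdot>\<^sub>C class_mult (m \<otimes>\<^sub>M n) p \<cdot>\<^sub>C (class_mult m n \<odot>\<^sub>C Ident C (p \<bullet> \<j>\<^sub>C)) =
    (assoc M m n p \<star> Ident C \<j>\<^sub>C) \<cdot>\<^sub>C (\<mu> (m \<otimes>\<^sub>M n) p \<j>\<^sub>C \<cdot>\<^sub>C (\<mu> m n (p \<bullet> \<j>\<^sub>C) \<cdot>\<^sub>C 
      (reval m (n \<bullet> (p \<bullet> \<j>\<^sub>C)) \<cdot>\<^sub>C ((Ident C (m \<bullet> \<j>\<^sub>C) \<odot>\<^sub>C reval n (p \<bullet> \<j>\<^sub>C)) \<cdot>\<^sub>C assoc C (m \<bullet> \<j>\<^sub>C) (n \<bullet> \<j>\<^sub>C) (p \<bullet> \<j>\<^sub>C)))))"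
    using assms reval_class_mult[of m n "p \<bullet> \<j>\<^sub>C"] by (simp add: class_mult_def[of "m \<otimes>\<^sub>M n"])
  also have "\<dots> = \<mu> m (n \<otimes>\<^sub>M p) \<j>\<^sub>C \<cdot>\<^sub>C ((Ident M m \<star> \<mu> n p \<j>\<^sub>C) \<cdot>\<^sub>C 
      (reval m (n \<bullet> (p \<bullet> \<j>\<^sub>C)) \<cdot>\<^sub>C ((Ident C (m \<bullet> \<j>\<^sub>C) \<odot>\<^sub>C reval n (p \<bullet> \<j>\<^sub>C)) \<cdot>\<^sub>C assoc C (m \<bullet> \<j>\<^sub>C) (n \<bullet> \<j>\<^sub>C) (p \<bullet> \<j>\<^sub>C))))"
    using assms by (simp add: C.comp_extend3[OF act_assoc])
  also have "\<dots> = class_mult m (n \<otimes>\<^sub>M p) \<cdot>\<^sub>C (Ident C (m \<bullet> \<j>\<^sub>C) \<odot>\<^sub>C class_mult n p) \<cdot>\<^sub>C assoc C (m \<bullet> \<j>\<^sub>C) (n \<bullet> \<j>\<^sub>C) (p \<bullet> \<j>\<^sub>C)"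
    using assms by (simp add: class_mult_def C.left_whisker_comp reval_slide_right)
  finally show ?thesis .
qed

lemma class_mult_lunit:
  assumes "m \<in> Ob M"
  shows "(lunit M m \<star> Ident C \<j>\<^sub>C) \<cdot>\<^sub>C class_mult \<j>\<^sub>M m \<cdot>\<^sub>C (\<eta> \<j>\<^sub>C \<odot>\<^sub>C Ident C (m \<bullet> \<j>\<^sub>C)) = lunit C (m \<bullet> \<j>\<^sub>C)"
proof -
  have "(lunit M m \<star> Ident C \<j>\<^sub>C) \<cdot>\<^sub>C class_mult \<j>\<^sub>M m \<cdot>\<^sub>C (\<eta> \<j>\<^sub>C \<odot>\<^sub>C Ident C (m \<bullet> \<j>\<^sub>C)) =
      (lunit M m \<star> Ident C \<j>\<^sub>C) \<cdot>\<^sub>C ((\<mu> \<j>\<^sub>M m \<j>\<^sub>C \<cdot>\<^sub>C \<eta> (m \<bullet> \<j>\<^sub>C)) \<cdot>\<^sub>C lunit C (m \<bullet> \<j>\<^sub>C))"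
    using assms by (simp add: class_mult_def reval_unitor)
  also have "\<dots> = lunit C (m \<bullet> \<j>\<^sub>C)"
    using assms by (subst act_lunit) (simp_all add: act_interchange)
  finally show ?thesis .
qed

lemma class_mult_runit:
  assumes "m \<in> Ob M"
  shows "(runit M m \<star> Ident C \<j>\<^sub>C) \<cdot>\<^sub>C class_mult m \<j>\<^sub>M \<cdot>\<^sub>C (Ident C (m \<bullet> \<j>\<^sub>C) \<odot>\<^sub>C \<eta> \<j>\<^sub>C) = runit C (m \<bullet> \<j>\<^sub>C)"
proof -
  have "(runit M m \<star> Ident C \<j>\<^sub>C) \<cdot>\<^sub>C class_mult m \<j>\<^sub>M \<cdot>\<^sub>C (Ident C (m \<bullet> \<j>\<^sub>C) \<odot>\<^sub>C \<eta> \<j>\<^sub>C) =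
      (runit M m \<star> Ident C \<j>\<^sub>C) \<cdot>\<^sub>C ((\<mu> m \<j>\<^sub>M \<j>\<^sub>C \<cdot>\<^sub>C (Ident M m \<star> \<eta> \<j>\<^sub>C)) \<cdot>\<^sub>C reval m \<j>\<^sub>C)"
    using assms by (simp add: class_mult_def reval_slide_right)
  also have "\<dots> = runit C (m \<bullet> \<j>\<^sub>C)"
    using assms by (subst act_runit) (simp_all add: act_interchange reval_unit)
  finally show ?thesis .
qed

text \<open>The components are restricted because 1-cells are required to be extensional; for
  \<open>fmult\<close> that requirement concerns the uncurried function, hence \<open>curry\<close>
  of a function restricted on pairs.\<close>

definition class_fctr :: "('mo, 'ma, ('o, 'a) center_ob, ('o, 'a) center_arr) mfctr" where
  "class_fctr =
    \<lparr>fob = (\<lambda>m\<in>Ob M. class_ob m),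
     farr = (\<lambda>f\<in>Arr M. (class_ob (Src M f), class_ob (Tgt M f), f \<star> Ident C \<j>\<^sub>C)),
     feps = (center_unit C, class_ob \<j>\<^sub>M, \<eta> \<j>\<^sub>C),
     fmult = curry (\<lambda>(m, n)\<in>Ob M \<times> Ob M.
       (center_tensor_ob C (class_ob m) (class_ob n), class_ob (m \<otimes>\<^sub>M n), class_mult m n))\<rparr>"

lemma class_fctr_simps [simp]:
  "m \<in> Ob M \<Longrightarrow> fob class_fctr m = class_ob m"
  "f \<in> Arr M \<Longrightarrow> farr class_fctr f = (class_ob (Src M f), class_ob (Tgt M f), f \<star> Ident C \<j>\<^sub>C)"
  "feps class_fctr = (center_unit C, class_ob \<j>\<^sub>M, \<eta> \<j>\<^sub>C)"
  "m \<in> Ob M \<Longrightarrow> n \<in> Ob M \<Longrightarrow> fmult class_fctr m n =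
    (center_tensor_ob C (class_ob m) (class_ob n), class_ob (m \<otimes>\<^sub>M n), class_mult m n)"
  by (simp_all add: class_fctr_def)

lemma strong_braided_class_fctr: "strong_braided_functor M (drinfeld_center C) class_fctr"
proof -
  let ?Z = "drinfeld_center C"
  interpret Z: braided_monoidal_category ?Z by (rule C.braided_center)
  have F: "cfunctor M ?Z class_fctr"
    by (rule cfunctorI)
      (simp_all add: M.category_axioms Z.category_axioms class_arr_natural act_interchange)
  have S: "strong_monoidal_functor M ?Z class_fctr"
  proof (rule strong_monoidal_functorI[OF M.monoidal_category_axioms Z.monoidal_category_axioms F], goal_cases)
    case (5 f g)
    then show ?case
      by (simp add: class_mult_def reval_slide multiplicator_slide)
  next
    case (6 m n p)
    then show ?case
      using class_mult_assoc[of m n p] by simp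
  next
    case (7 m)
    then show ?case
      using class_mult_lunit[of m] by simp
  next
    case (8 m)
    then show ?case
      using class_mult_runit[of m] by simp
  qed (simp_all add: C.iso_center C.center_unit_in C.center_tensor_in class_unit_natural class_mult_natural)
  show ?thesis
  proof (intro strong_braided_functor.intro strong_braided_functor_axioms.intro M.braided_monoidal_category_axioms
      Z.braided_monoidal_category_axioms S)
    fix m n assume m: "m \<in> Ob M" and n: "n \<in> Ob M"
    \<comment> \<open>Inserting \<open>leval\<close> and its inverse splits off the half-braiding of
      F m at F n, which is the braiding of the center; the bracket in front is then
      \<open>braid_multiplicator\<close>.\<close>
    have "(braid M m n \<star> Ident C \<j>\<^sub>C) \<cdot>\<^sub>C (\<mu> m n \<j>\<^sub>C \<cdot>\<^sub>C reval m (n \<bullet> \<j>\<^sub>C)) =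
        ((braid M m n \<star> Ident C \<j>\<^sub>C) \<cdot>\<^sub>C \<mu> m n \<j>\<^sub>C \<cdot>\<^sub>C leval m (n \<bullet> \<j>\<^sub>C)) \<cdot>\<^sub>C (inv_arr C (leval m (n \<bullet> \<j>\<^sub>C)) \<cdot>\<^sub>C reval m (n \<bullet> \<j>\<^sub>C))"
      using m n by simp
    then show "farr class_fctr (braid M m n) \<cdot>\<^bsub>?Z\<^esub> fmult class_fctr m n =
        fmult class_fctr n m \<cdot>\<^bsub>?Z\<^esub> braid ?Z (fob class_fctr m) (fob class_fctr n)"
      unfolding braid_multiplicator[OF m n] using m n by (simp add: class_mult_def)
  qed
qed

text \<open>The interchanger condition for the identification by \<open>reval\<close>, cleared of
  inverses. The factorisation of \<open>phi\<close> reduces it to \<open>rstr_reval\<close> for m,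
  \<open>reval_class\<close> for n and \<open>reval_class_mult\<close> for the product.\<close>

lemma phi_reval:
  assumes "m \<in> Ob M" "n \<in> Ob M" "c \<in> Ob C" "d \<in> Ob C"
  shows "phi m c n d \<cdot>\<^sub>C (reval m c \<odot>\<^sub>C reval n d) \<cdot>\<^sub>C mid_swap C (m \<bullet> \<j>\<^sub>C) (n \<bullet> \<j>\<^sub>C) c d (snd (class_ob n) c) =
    reval (m \<otimes>\<^sub>M n) (c \<otimes>\<^sub>C d) \<cdot>\<^sub>C (class_mult m n \<odot>\<^sub>C Ident C (c \<otimes>\<^sub>C d))"
proof -
  let ?v = "snd (class_ob n) c" and ?p = "m \<bullet> \<j>\<^sub>C" and ?q = "n \<bullet> \<j>\<^sub>C"
  let ?w = "assoc C c ?q d \<cdot>\<^sub>C (?v \<odot>\<^sub>C Ident C d) \<cdot>\<^sub>C inv_arr C (assoc C ?q c d)"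
  have v: "?v \<in> Arr C" "Src C ?v = ?q \<otimes>\<^sub>C c" "Tgt C ?v = c \<otimes>\<^sub>C ?q"
    using assms by simp_all
  have 1: "rstr m c (n \<bullet> d) \<cdot>\<^sub>C (reval m c \<odot>\<^sub>C reval n d) = reval m (c \<otimes>\<^sub>C (n \<bullet> d)) \<cdot>\<^sub>C ((Ident C ?p \<odot>\<^sub>C (Ident C c \<odot>\<^sub>C reval n d)) \<cdot>\<^sub>C assoc C ?p c (?q \<otimes>\<^sub>C d))"
  proof -
    have "reval m c \<odot>\<^sub>C reval n d = (reval m c \<odot>\<^sub>C Ident C (n \<bullet> d)) \<cdot>\<^sub>C (Ident C (?p \<otimes>\<^sub>C c) \<odot>\<^sub>C reval n d)"
      using assms by (simp add: C.interchange)
    then show ?thesis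
      using assms by (simp add: C.comp_extend[OF rstr_reval] C.assoc_slide_right)
  qed
  \<comment> \<open>The inner part of the middle exchange, \<open>?w\<close>, is the half-braiding
    of F n at c up to associators, so \<open>reval_class\<close> absorbs it into one
    evaluation.\<close>
  have 2: "lstr n c d \<cdot>\<^sub>C ((Ident C c \<odot>\<^sub>C reval n d) \<cdot>\<^sub>C ?w) = reval n (c \<otimes>\<^sub>C d)"
    using assms v C.comp_extend4[OF reval_class[of n c d]] by (simp del: class_ob_simps(2))
  have "phi m c n d \<cdot>\<^sub>C (reval m c \<odot>\<^sub>C reval n d) \<cdot>\<^sub>C mid_swap C ?p ?q c d ?v =
      \<mu> m n (c \<otimes>\<^sub>C d) \<cdot>\<^sub>C ((Ident M m \<star> lstr n c d) \<cdot>\<^sub>C (reval m (c \<otimes>\<^sub>C (n \<bullet> d)) \<cdot>\<^sub>C ((Ident C ?p \<odot>\<^sub>C (Ident C c \<odot>\<^sub>C reval n d)) \<cdot>\<^sub>C 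
        ((Ident C ?p \<odot>\<^sub>C ?w) \<cdot>\<^sub>C assoc C ?p ?q (c \<otimes>\<^sub>C d)))))"
    using assms v by (simp add: phi_rstr_lstr mid_swap_def C.comp_extend[OF 1] del: class_ob_simps(2))
  also have "\<dots> = \<mu> m n (c \<otimes>\<^sub>C d) \<cdot>\<^sub>C (reval m (n \<bullet> (c \<otimes>\<^sub>C d)) \<cdot>\<^sub>C 
      ((Ident C ?p \<odot>\<^sub>C (lstr n c d \<cdot>\<^sub>C ((Ident C c \<odot>\<^sub>C reval n d) \<cdot>\<^sub>C ?w))) \<cdot>\<^sub>C assoc C ?p ?q (c \<otimes>\<^sub>C d)))"
    using assms v by (simp add: reval_slide_right C.left_whisker_comp del: class_ob_simps(2))
  also have "\<dots> = reval (m \<otimes>\<^sub>M n) (c \<otimes>\<^sub>C d) \<cdot>\<^sub>C (class_mult m n \<odot>\<^sub>C Ident C (c \<otimes>\<^sub>C d))"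
    unfolding 2 using assms by (simp add: reval_class_mult)
  finally show ?thesis .
qed

end

text \<open>The 2-category is defined for records without additional fields only.\<close>

locale plain_monoidal_action = monoidal_action M C X
  for M :: "('mo, 'ma) bmoncat" and C :: "('o, 'a) moncat" and X :: "('mo, 'ma, 'o, 'a) mon_action" (structure)
begin

abbreviation Z :: "(('o, 'a) center_ob, ('o, 'a) center_arr) bmoncat" where
  "Z \<equiv> drinfeld_center C"

abbreviation one_cells where "one_cells \<equiv> act_1cells C M X Z (center_action C)"
abbreviation two_cells where "two_cells \<equiv> act_2cells C M X Z (center_action C)"

lemma cfunctor_restrict:
  assumes "cfunctor M Z R"
  shows "cfunctor (prod_cat M C) C (act (restrict_action Z C R (center_action C)))"
proof -
  interpret R: cfunctor M Z R by fact
  have [simp]: "fst (fob R m) \<in> Ob C" if "m \<in> Ob M" for m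
    using R.fob_ob[OF that] by simp
  have [simp]: "snd (snd (farr R f)) \<in> Arr C" "Src C (snd (snd (farr R f))) = fst (fob R (Src M f))"
    "Tgt C (snd (snd (farr R f))) = fst (fob R (Tgt M f))" if "f \<in> Arr M" for f
    using R.farr_arr[OF that] by (cases "farr R f" rule: prod_cases3; simp)+
  have [simp]: "snd (snd (farr R (g \<cdot>\<^sub>M f))) = snd (snd (farr R g)) \<cdot>\<^sub>C snd (snd (farr R f))"
    if "f \<in> Arr M" "g \<in> Arr M" "Src M g = Tgt M f" for f g
    using R.farr_comp_arr[OF that]
    by (cases "farr R f" rule: prod_cases3; cases "farr R g" rule: prod_cases3) simp
  show ?thesis
    by (rule cfunctorI) (auto simp: category_prod M.category_axioms C.category_axioms C.interchange)
qed

definition class_iso :: "'mo \<times> 'o \<Rightarrow> 'a" where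
  "class_iso = (\<lambda>(m, c)\<in>Ob M \<times> Ob C. reval m c)"

lemma action_iso_class: "action_iso M C (restrict_action Z C class_fctr (center_action C)) X class_iso"
proof -
  interpret R: strong_braided_functor M Z class_fctr by (rule strong_braided_class_fctr)
  have i: "class_iso (m, c) = reval m c" if "m \<in> Ob M" "c \<in> Ob C" for m c
    using that by (simp add: class_iso_def)
  show ?thesis
  proof (intro action_iso.intro action_iso_axioms.intro M.braided_monoidal_category_axioms
      C.monoidal_category_axioms nat_isoI cfunctor_restrict R.cfunctor_axioms act_functor, goal_cases)
    case (1 x)
    then show ?case by (cases x) (simp add: i)
  next
    case (2 f)
    then show ?case by (cases f) (simp add: i reval_slide)
  next
    case (3 c)
    then show ?case by (simp add: i C.comp_extend[OF reval_unitor])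
  next
    case (4 m n c)
    then show ?case by (simp add: i C.comp_extend[OF reval_class_mult])
  next
    case (5 m n c d)
    have inv: "inv_arr Z (fmult class_fctr m n) =
      (class_ob (m \<otimes>\<^sub>M n), center_tensor_ob C (class_ob m) (class_ob n), inv_arr C (class_mult m n))"
      using 5 by (simp add: C.iso_center C.center_tensor_in class_mult_natural)
    let ?s = "mid_swap C (m \<bullet> \<j>\<^sub>C) (n \<bullet> \<j>\<^sub>C) c d (snd (class_ob n) c)"
    have s: "?s \<in> Arr C" "Src C ?s = ((m \<bullet> \<j>\<^sub>C) \<otimes>\<^sub>C (n \<bullet> \<j>\<^sub>C)) \<otimes>\<^sub>C (c \<otimes>\<^sub>C d)" "Tgt C ?s = ((m \<bullet> \<j>\<^sub>C) \<otimes>\<^sub>C c) \<otimes>\<^sub>C ((n \<bullet> \<j>\<^sub>C) \<otimes>\<^sub>C d)"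
      using 5 by simp_all
    \<comment> \<open>The interchanger of \<open>X\<close> is the inverse of \<open>phi\<close>, and
      that of the restricted action contains the inverse of \<open>class_mult\<close>; both inverses
      are moved across \<open>phi_reval\<close>.\<close>
    have "phi m c n d \<cdot>\<^sub>C ((reval m c \<odot>\<^sub>C reval n d) \<cdot>\<^sub>C (?s \<cdot>\<^sub>C (inv_arr C (class_mult m n) \<odot>\<^sub>C Ident C (c \<otimes>\<^sub>C d)))) = reval (m \<otimes>\<^sub>M n) (c \<otimes>\<^sub>C d)"
      using 5 s C.comp_extend3[OF phi_reval[of m n c d]] by (simp add: C.interchange del: class_ob_simps(2))
    then have "(reval m c \<odot>\<^sub>C reval n d) \<cdot>\<^sub>C (?s \<cdot>\<^sub>C (inv_arr C (class_mult m n) \<odot>\<^sub>C Ident C (c \<otimes>\<^sub>C d))) =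
        inv_arr C (phi m c n d) \<cdot>\<^sub>C reval (m \<otimes>\<^sub>M n) (c \<otimes>\<^sub>C d)"
      using 5 s by (subst (asm) C.iso_move_left) (simp_all del: class_ob_simps(2))
    moreover have "inv_arr C (phi m c n d) = interchanger X m n c d"
      using 5 by (simp add: phi_def interchanger_iso)
    ultimately show ?case
      using 5 inv by (simp add: i del: class_ob_simps(2) class_fctr_simps(4))
  qed
qed

lemma class_1cell: "(class_fctr, class_iso) \<in> one_cells"
  using strong_braided_class_fctr action_iso_class
  by (auto simp: act_1cells_def class_fctr_def class_iso_def extensional_def curry_def)

end

section \<open>Uniqueness\<close>

locale classifying_cell = plain_monoidal_action M C X
  for M :: "('mo, 'ma) bmoncat" and C :: "('o, 'a) moncat" and X :: "('mo, 'ma, 'o, 'a) mon_action" (structure) +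
  fixes R :: "('mo, 'ma, ('o, 'a) center_ob, ('o, 'a) center_arr) mfctr" and \<theta> :: "'mo \<times> 'o \<Rightarrow> 'a"
  assumes cell: "(R, \<theta>) \<in> one_cells"
begin

sublocale R: strong_braided_functor M "drinfeld_center C" R
  using cell by (simp add: act_1cells_def)

sublocale I: action_iso M C "restrict_action (drinfeld_center C) C R (center_action C)" X \<theta>
  using cell by (simp add: act_1cells_def)

text \<open>The underlying data of \<open>R\<close> in \<open>C\<close>. As arrows of the center
  carry their source and target, \<open>R\<close> is recovered from these by \<open>R_farr\<close>,
  \<open>R_feps\<close> and \<open>R_fmult\<close>, and all computations can take place in
  \<open>C\<close>.\<close>

definition ob :: "'mo \<Rightarrow> 'o" where "ob m = fst (fob R m)"
definition hb :: "'mo \<Rightarrow> 'o \<Rightarrow> 'a" where "hb m = snd (fob R m)"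
definition ar :: "'ma \<Rightarrow> 'a" where "ar f = snd (snd (farr R f))"
definition ep :: 'a where "ep = snd (snd (feps R))"
definition mt :: "'mo \<Rightarrow> 'mo \<Rightarrow> 'a" where "mt m n = snd (snd (fmult R m n))"

lemma R_ob [simp]: "m \<in> Ob M \<Longrightarrow> fob R m \<in> center_obs C"
  using R.fob_ob by simp

lemma ob_in [simp]: "m \<in> Ob M \<Longrightarrow> ob m \<in> Ob C"
  by (simp add: ob_def)

lemma hb_arr [simp]:
  assumes "m \<in> Ob M" "b \<in> Ob C"
  shows "hb m b \<in> Arr C" "Src C (hb m b) = ob m \<otimes>\<^sub>C b" "Tgt C (hb m b) = b \<otimes>\<^sub>C ob m" "iso C (hb m b)"
  using assms by (simp_all add: hb_def ob_def)

lemma R_farr: "f \<in> Arr M \<Longrightarrow> farr R f = (fob R (Src M f), fob R (Tgt M f), ar f)"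
  using R.farr_arr[of f] by (cases "farr R f" rule: prod_cases3) (simp add: ar_def)

lemma R_feps: "feps R = (center_unit C, fob R \<j>\<^sub>M, ep)"
  using R.feps_arr by (cases "feps R" rule: prod_cases3) (simp add: ep_def)

lemma R_fmult:
  "m \<in> Ob M \<Longrightarrow> n \<in> Ob M \<Longrightarrow> fmult R m n = (center_tensor_ob C (fob R m) (fob R n), fob R (m \<otimes>\<^sub>M n), mt m n)"
  using R.fmult_arr[of m n] by (cases "fmult R m n" rule: prod_cases3) (simp add: mt_def)

lemma ar_arr [simp]:
  assumes "f \<in> Arr M"
  shows "ar f \<in> Arr C" "Src C (ar f) = ob (Src M f)" "Tgt C (ar f) = ob (Tgt M f)"
  using R.farr_arr(1)[OF assms] by (simp_all add: R_farr[OF assms] ob_def)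

lemma ar_ident [simp]: "m \<in> Ob M \<Longrightarrow> ar (Ident M m) = Ident C (ob m)"
  using R.farr_id[of m] by (simp add: ar_def ob_def)

lemma ep_arr [simp]: "ep \<in> Arr C" "Src C ep = \<j>\<^sub>C" "Tgt C ep = ob \<j>\<^sub>M" "iso C ep"
    "center_natural C (center_unit C) (fob R \<j>\<^sub>M) ep"
  using R.feps_arr(1) R.feps_arr(4) C.iso_center_underlying by (auto simp: R_feps ob_def)

lemma mt_arr [simp]:
  assumes "m \<in> Ob M" "n \<in> Ob M"
  shows "mt m n \<in> Arr C" "Src C (mt m n) = ob m \<otimes>\<^sub>C ob n" "Tgt C (mt m n) = ob (m \<otimes>\<^sub>M n)" "iso C (mt m n)"
  using R.fmult_arr(1)[OF assms] R.fmult_arr(4)[OF assms] C.iso_center_underlying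
  by (auto simp: R_fmult[OF assms] ob_def)

lemma inv_R_fmult:
  assumes "m \<in> Ob M" "n \<in> Ob M"
  shows "snd (snd (inv_arr (drinfeld_center C) (fmult R m n))) = inv_arr C (mt m n)"
  using R.fmult_arr(1)[OF assms] mt_arr[OF assms] C.iso_center(2) by (simp add: R_fmult[OF assms])

lemma mt_lunit: "m \<in> Ob M \<Longrightarrow> ar (lunit M m) \<cdot>\<^sub>C mt \<j>\<^sub>M m \<cdot>\<^sub>C (ep \<odot>\<^sub>C Ident C (ob m)) = lunit C (ob m)"
  using R.fmult_lunit[of m] by (simp add: R_farr R_fmult R_feps ob_def)

lemma mt_runit: "m \<in> Ob M \<Longrightarrow> ar (runit M m) \<cdot>\<^sub>C mt m \<j>\<^sub>M \<cdot>\<^sub>C (Ident C (ob m) \<odot>\<^sub>C ep) = runit C (ob m)"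
  using R.fmult_runit[of m] by (simp add: R_farr R_fmult R_feps ob_def)

lemma th_arr [simp]:
  assumes "m \<in> Ob M" "c \<in> Ob C"
  shows "\<theta> (m, c) \<in> Arr C" "Src C (\<theta> (m, c)) = ob m \<otimes>\<^sub>C c" "Tgt C (\<theta> (m, c)) = m \<bullet> c" "iso C (\<theta> (m, c))"
proof -
  have *: "(m, c) \<in> Ob (prod_cat M C)" using assms by simp
  show "\<theta> (m, c) \<in> Arr C" "Src C (\<theta> (m, c)) = ob m \<otimes>\<^sub>C c" "Tgt C (\<theta> (m, c)) = m \<bullet> c" "iso C (\<theta> (m, c))"
    using nat_trans.component_arr[OF nat_iso.axioms(1)[OF I.ident_iso] *]
      nat_iso.component_iso[OF I.ident_iso *] by (simp_all add: ob_def)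
qed

lemma th_slide0:
  "f \<in> Arr M \<Longrightarrow> g \<in> Arr C \<Longrightarrow> Tgt M f = m \<Longrightarrow> Tgt C g = c \<Longrightarrow>
    \<theta> (m, c) \<cdot>\<^sub>C (ar f \<odot>\<^sub>C g) = (f \<star> g) \<cdot>\<^sub>C \<theta> (Src M f, Src C g)"
  using nat_trans.naturality_arr[OF nat_iso.axioms(1)[OF I.ident_iso], of "(f, g)"] by (simp add: ar_def)

lemmas th_slide = th_slide0 C.comp_extend[OF th_slide0]

lemma th_slide_right0:
  "m \<in> Ob M \<Longrightarrow> g \<in> Arr C \<Longrightarrow> Tgt C g = c \<Longrightarrow> \<theta> (m, c) \<cdot>\<^sub>C (Ident C (ob m) \<odot>\<^sub>C g) = (Ident M m \<star> g) \<cdot>\<^sub>C \<theta> (m, Src C g)"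
  using th_slide(1)[of "Ident M m" g m c] by auto

lemmas th_slide_right = th_slide_right0 C.comp_extend[OF th_slide_right0]

lemma th_unitor: "c \<in> Ob C \<Longrightarrow> \<theta> (\<j>\<^sub>M, c) \<cdot>\<^sub>C (ep \<odot>\<^sub>C Ident C c) = \<eta> c \<cdot>\<^sub>C lunit C c"
proof -
  assume c: "c \<in> Ob C"
  have "(\<theta> (\<j>\<^sub>M, c) \<cdot>\<^sub>C ((ep \<odot>\<^sub>C Ident C c) \<cdot>\<^sub>C inv_arr C (lunit C c))) \<cdot>\<^sub>C lunit C c = \<eta> c \<cdot>\<^sub>C lunit C c"
    using I.ident_unitor[OF c] by (simp add: ep_def)
  then show ?thesis using c by simp
qed

lemma th_multiplicator:
  assumes "m \<in> Ob M" "n \<in> Ob M" "c \<in> Ob C"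
  shows "\<theta> (m \<otimes>\<^sub>M n, c) \<cdot>\<^sub>C (mt m n \<odot>\<^sub>C Ident C c) =
    \<mu> m n c \<cdot>\<^sub>C \<theta> (m, n \<bullet> c) \<cdot>\<^sub>C (Ident C (ob m) \<odot>\<^sub>C \<theta> (n, c)) \<cdot>\<^sub>C assoc C (ob m) (ob n) c"
proof -
  have "(\<theta> (m \<otimes>\<^sub>M n, c) \<cdot>\<^sub>C ((mt m n \<odot>\<^sub>C Ident C c) \<cdot>\<^sub>C inv_arr C (assoc C (ob m) (ob n) c))) \<cdot>\<^sub>C assoc C (ob m) (ob n) c =
      (\<mu> m n c \<cdot>\<^sub>C \<theta> (m, n \<bullet> c) \<cdot>\<^sub>C (ar (Ident M m) \<odot>\<^sub>C \<theta> (n, c))) \<cdot>\<^sub>C assoc C (ob m) (ob n) c"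
    using I.ident_multiplicator[OF assms] by (simp add: mt_def ob_def ar_def)
  then show ?thesis using assms by simp
qed

text \<open>The interchanger condition with both inverses cleared, as in \<open>phi_reval\<close>,
  so that the laws of \<open>phi\<close> apply directly.\<close>

lemma th_interchanger:
  assumes "m \<in> Ob M" "n \<in> Ob M" "c \<in> Ob C" "d \<in> Ob C"
  shows "phi m c n d \<cdot>\<^sub>C (\<theta> (m, c) \<odot>\<^sub>C \<theta> (n, d)) \<cdot>\<^sub>C mid_swap C (ob m) (ob n) c d (hb n c) =
    \<theta> (m \<otimes>\<^sub>M n, c \<otimes>\<^sub>C d) \<cdot>\<^sub>C (mt m n \<odot>\<^sub>C Ident C (c \<otimes>\<^sub>C d))"
proof -
  let ?s = "mid_swap C (ob m) (ob n) c d (hb n c)"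
  have "((\<theta> (m, c) \<odot>\<^sub>C \<theta> (n, d)) \<cdot>\<^sub>C (?s \<cdot>\<^sub>C (inv_arr C (mt m n) \<odot>\<^sub>C Ident C (c \<otimes>\<^sub>C d)))) \<cdot>\<^sub>C (mt m n \<odot>\<^sub>C Ident C (c \<otimes>\<^sub>C d)) =
      (interchanger X m n c d \<cdot>\<^sub>C \<theta> (m \<otimes>\<^sub>M n, c \<otimes>\<^sub>C d)) \<cdot>\<^sub>C (mt m n \<odot>\<^sub>C Ident C (c \<otimes>\<^sub>C d))"
    using I.ident_interchanger[OF assms] by (simp add: ob_def hb_def inv_R_fmult[OF assms(1,2)])
  moreover have "interchanger X m n c d = inv_arr C (phi m c n d)"
    using assms by (simp add: phi_def interchanger_iso)
  ultimately have "(\<theta> (m, c) \<odot>\<^sub>C \<theta> (n, d)) \<cdot>\<^sub>C ?s = inv_arr C (phi m c n d) \<cdot>\<^sub>C (\<theta> (m \<otimes>\<^sub>M n, c \<otimes>\<^sub>C d) \<cdot>\<^sub>C (mt m n \<odot>\<^sub>C Ident C (c \<otimes>\<^sub>C d)))"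
    using assms by (simp add: C.interchange)
  then show ?thesis using assms by simp
qed

text \<open>The unit arrow \<open>ep\<close> belongs to the center, which transports the
  half-braiding of the unit object to the one of the image of \<j>.\<close>

lemma hb_unit:
  assumes "c \<in> Ob C"
  shows "hb \<j>\<^sub>M c \<cdot>\<^sub>C (ep \<odot>\<^sub>C Ident C c) = (Ident C c \<odot>\<^sub>C ep) \<cdot>\<^sub>C (inv_arr C (runit C c) \<cdot>\<^sub>C lunit C c)"
  using C.center_naturalD[OF ep_arr(5) assms] assms by (simp add: hb_def)

text \<open>The interchanger condition at m and \<j>, with \<open>ep\<close> and the unitor inserted
  for the second action. It plays for \<theta> the part that \<open>rstr_reval\<close> plays for
  \<open>reval\<close>, and forces the values of \<theta> from those at \<j>.\<close>

lemma rstr_th: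
  assumes "m \<in> Ob M" "c \<in> Ob C" "d \<in> Ob C"
  shows "rstr m c d \<cdot>\<^sub>C (\<theta> (m, c) \<odot>\<^sub>C Ident C d) = \<theta> (m, c \<otimes>\<^sub>C d) \<cdot>\<^sub>C assoc C (ob m) c d"
proof -
  let ?u = "inv_arr C (runit C c) \<cdot>\<^sub>C lunit C c"
  let ?s = "mid_swap C (ob m) (ob \<j>\<^sub>M) c d (hb \<j>\<^sub>M c)" and ?t = "mid_swap C (ob m) \<j>\<^sub>C c d ?u"
  \<comment> \<open>Along \<open>ep\<close> the exchange with the image of \<j> becomes an exchange
    with \<j> itself, which fact \<open>t\<close> then removes by coherence.\<close>
  have s: "?s \<cdot>\<^sub>C ((Ident C (ob m) \<odot>\<^sub>C ep) \<odot>\<^sub>C Ident C (c \<otimes>\<^sub>C d)) = (Ident C (ob m \<otimes>\<^sub>C c) \<odot>\<^sub>C (ep \<odot>\<^sub>C Ident C d)) \<cdot>\<^sub>C ?t"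
    using assms C.mid_swap_natural[of "Ident C (ob m)" ep "Ident C c" "Ident C d" ?u "hb \<j>\<^sub>M c"] hb_unit[of c] by simp
  have t: "(Ident C (ob m \<otimes>\<^sub>C c) \<odot>\<^sub>C lunit C d) \<cdot>\<^sub>C ?t = inv_arr C (assoc C (ob m) c d) \<cdot>\<^sub>C (runit C (ob m) \<odot>\<^sub>C Ident C (c \<otimes>\<^sub>C d))"
    by (rule C.strictifies_eqI[where s = "Tn (Tn (At (ob m)) Emp) (Tn (At c) (At d))"
          and t = "Tn (Tn (At (ob m)) (At c)) (At d)"],
        ((rule C.strictify C.strictifies_mid_swap | (simp add: assms; fail))+)[1],
        ((rule C.strictify | (simp add: assms; fail))+)[1],
        use assms in simp)
  \<comment> \<open>The invertible right unitor on the right makes room for a factor \<j>, which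
    becomes the image of \<j> through \<open>ep\<close>; it is cancelled at the end.\<close>
  have "(rstr m c d \<cdot>\<^sub>C (\<theta> (m, c) \<odot>\<^sub>C Ident C d) \<cdot>\<^sub>C inv_arr C (assoc C (ob m) c d)) \<cdot>\<^sub>C (runit C (ob m) \<odot>\<^sub>C Ident C (c \<otimes>\<^sub>C d)) =
      rstr m c d \<cdot>\<^sub>C ((\<theta> (m, c) \<odot>\<^sub>C Ident C d) \<cdot>\<^sub>C ((Ident C (ob m \<otimes>\<^sub>C c) \<odot>\<^sub>C lunit C d) \<cdot>\<^sub>C ?t))"
    unfolding t using assms by simp
  also have "\<dots> = (runit M m \<star> Ident C (c \<otimes>\<^sub>C d)) \<cdot>\<^sub>C (phi m c \<j>\<^sub>M d \<cdot>\<^sub>C ((\<theta> (m, c) \<odot>\<^sub>C (\<eta> d \<cdot>\<^sub>C lunit C d)) \<cdot>\<^sub>C ?t))"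
    using assms by (simp add: rstr_def C.interchange_extend)
  also have "\<dots> = (runit M m \<star> Ident C (c \<otimes>\<^sub>C d)) \<cdot>\<^sub>C (phi m c \<j>\<^sub>M d \<cdot>\<^sub>C ((\<theta> (m, c) \<odot>\<^sub>C \<theta> (\<j>\<^sub>M, d)) \<cdot>\<^sub>C (?s \<cdot>\<^sub>C ((Ident C (ob m) \<odot>\<^sub>C ep) \<odot>\<^sub>C Ident C (c \<otimes>\<^sub>C d)))))"
    unfolding s using assms by (simp add: C.interchange_extend th_unitor)
  also have "\<dots> = (runit M m \<star> Ident C (c \<otimes>\<^sub>C d)) \<cdot>\<^sub>C ((phi m c \<j>\<^sub>M d \<cdot>\<^sub>C (\<theta> (m, c) \<odot>\<^sub>C \<theta> (\<j>\<^sub>M, d)) \<cdot>\<^sub>C ?s) \<cdot>\<^sub>C ((Ident C (ob m) \<odot>\<^sub>C ep) \<odot>\<^sub>C Ident C (c \<otimes>\<^sub>C d)))"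
    using assms by simp
  also have "\<dots> = (runit M m \<star> Ident C (c \<otimes>\<^sub>C d)) \<cdot>\<^sub>C (\<theta> (m \<otimes>\<^sub>M \<j>\<^sub>M, c \<otimes>\<^sub>C d) \<cdot>\<^sub>C ((mt m \<j>\<^sub>M \<cdot>\<^sub>C (Ident C (ob m) \<odot>\<^sub>C ep)) \<odot>\<^sub>C Ident C (c \<otimes>\<^sub>C d)))"
    using assms by (subst th_interchanger) (simp_all add: C.interchange)
  also have "\<dots> = \<theta> (m, c \<otimes>\<^sub>C d) \<cdot>\<^sub>C ((ar (runit M m) \<cdot>\<^sub>C (mt m \<j>\<^sub>M \<cdot>\<^sub>C (Ident C (ob m) \<odot>\<^sub>C ep))) \<odot>\<^sub>C Ident C (c \<otimes>\<^sub>C d))"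
    using assms C.comp_extend[OF th_slide(1)[of "runit M m" "Ident C (c \<otimes>\<^sub>C d)" m "c \<otimes>\<^sub>C d", symmetric]]
    by (simp add: C.interchange)
  also have "\<dots> = \<theta> (m, c \<otimes>\<^sub>C d) \<cdot>\<^sub>C (runit C (ob m) \<odot>\<^sub>C Ident C (c \<otimes>\<^sub>C d))"
    using assms by (simp add: mt_runit)
  finally have "rstr m c d \<cdot>\<^sub>C (\<theta> (m, c) \<odot>\<^sub>C Ident C d) \<cdot>\<^sub>C inv_arr C (assoc C (ob m) c d) = \<theta> (m, c \<otimes>\<^sub>C d)"
    by (rule C.iso_cancel_right) (use assms in auto)
  then have "(rstr m c d \<cdot>\<^sub>C (\<theta> (m, c) \<odot>\<^sub>C Ident C d) \<cdot>\<^sub>C inv_arr C (assoc C (ob m) c d)) \<cdot>\<^sub>C assoc C (ob m) c d =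
      \<theta> (m, c \<otimes>\<^sub>C d) \<cdot>\<^sub>C assoc C (ob m) c d"
    by simp
  then show ?thesis using assms by simp
qed

text \<open>The interchanger condition at \<j> and n. Now the exchanged object is the image of n, so
  its half-braiding remains: the action and \<theta> determine it.\<close>

lemma lstr_th:
  assumes "n \<in> Ob M" "c \<in> Ob C" "d \<in> Ob C"
  shows "lstr n c d \<cdot>\<^sub>C (Ident C c \<odot>\<^sub>C \<theta> (n, d)) \<cdot>\<^sub>C assoc C c (ob n) d \<cdot>\<^sub>C (hb n c \<odot>\<^sub>C Ident C d) = \<theta> (n, c \<otimes>\<^sub>C d) \<cdot>\<^sub>C assoc C (ob n) c d"
proof -
  let ?s = "mid_swap C (ob \<j>\<^sub>M) (ob n) c d (hb n c)" and ?t = "mid_swap C \<j>\<^sub>C (ob n) c d (hb n c)"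
  have s: "?s \<cdot>\<^sub>C ((ep \<odot>\<^sub>C Ident C (ob n)) \<odot>\<^sub>C Ident C (c \<otimes>\<^sub>C d)) = ((ep \<odot>\<^sub>C Ident C c) \<odot>\<^sub>C Ident C (ob n \<otimes>\<^sub>C d)) \<cdot>\<^sub>C ?t"
    using assms C.mid_swap_natural[of ep "Ident C (ob n)" "Ident C c" "Ident C d" "hb n c" "hb n c"] by simp
  have b: "C.strictifies (Tn (At (ob n)) (At c)) (Tn (At c) (At (ob n))) (hb n c)
      (C.strict_part (Tn (At (ob n)) (At c)) (Tn (At c) (At (ob n))) (hb n c))"
    using assms by (intro C.strictifies_strict_part) auto
  \<comment> \<open>With \<j> in front, the middle exchange is coherence around the single arrow
    \<open>hb n c\<close>, treated as an opaque letter by fact \<open>b\<close>.\<close>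
  have t: "(lunit C c \<odot>\<^sub>C Ident C (ob n \<otimes>\<^sub>C d)) \<cdot>\<^sub>C ?t =
      assoc C c (ob n) d \<cdot>\<^sub>C (hb n c \<odot>\<^sub>C Ident C d) \<cdot>\<^sub>C inv_arr C (assoc C (ob n) c d) \<cdot>\<^sub>C (lunit C (ob n) \<odot>\<^sub>C Ident C (c \<otimes>\<^sub>C d))"
    by (rule C.strictifies_eqI[where s = "Tn (Tn Emp (At (ob n))) (Tn (At c) (At d))"
          and t = "Tn (At c) (Tn (At (ob n)) (At d))"],
        ((rule C.strictify C.strictifies_mid_swap b | (simp add: assms; fail))+)[1],
        ((rule C.strictify b | (simp add: assms; fail))+)[1],
        use assms C.strictifiesD(6-8)[OF b] in simp)
  have "(lstr n c d \<cdot>\<^sub>C (Ident C c \<odot>\<^sub>C \<theta> (n, d)) \<cdot>\<^sub>C assoc C c (ob n) d \<cdot>\<^sub>C (hb n c \<odot>\<^sub>C Ident C d) \<cdot>\<^sub>C inv_arr C (assoc C (ob n) c d)) \<cdot>\<^sub>C 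
      (lunit C (ob n) \<odot>\<^sub>C Ident C (c \<otimes>\<^sub>C d)) = lstr n c d \<cdot>\<^sub>C ((Ident C c \<odot>\<^sub>C \<theta> (n, d)) \<cdot>\<^sub>C ((lunit C c \<odot>\<^sub>C Ident C (ob n \<otimes>\<^sub>C d)) \<cdot>\<^sub>C ?t))"
    unfolding t using assms by simp
  also have "\<dots> = (lunit M n \<star> Ident C (c \<otimes>\<^sub>C d)) \<cdot>\<^sub>C (phi \<j>\<^sub>M c n d \<cdot>\<^sub>C (((\<eta> c \<cdot>\<^sub>C lunit C c) \<odot>\<^sub>C \<theta> (n, d)) \<cdot>\<^sub>C ?t))"
    using assms by (simp add: lstr_def C.interchange_extend)
  also have "\<dots> = (lunit M n \<star> Ident C (c \<otimes>\<^sub>C d)) \<cdot>\<^sub>C (phi \<j>\<^sub>M c n d \<cdot>\<^sub>C ((\<theta> (\<j>\<^sub>M, c) \<odot>\<^sub>C \<theta> (n, d)) \<cdot>\<^sub>C (?s \<cdot>\<^sub>C ((ep \<odot>\<^sub>C Ident C (ob n)) \<odot>\<^sub>C Ident C (c \<otimes>\<^sub>C d)))))"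
    unfolding s using assms by (simp add: C.interchange_extend th_unitor)
  also have "\<dots> = (lunit M n \<star> Ident C (c \<otimes>\<^sub>C d)) \<cdot>\<^sub>C ((phi \<j>\<^sub>M c n d \<cdot>\<^sub>C (\<theta> (\<j>\<^sub>M, c) \<odot>\<^sub>C \<theta> (n, d)) \<cdot>\<^sub>C ?s) \<cdot>\<^sub>C ((ep \<odot>\<^sub>C Ident C (ob n)) \<odot>\<^sub>C Ident C (c \<otimes>\<^sub>C d)))"
    using assms by simp
  also have "\<dots> = (lunit M n \<star> Ident C (c \<otimes>\<^sub>C d)) \<cdot>\<^sub>C (\<theta> (\<j>\<^sub>M \<otimes>\<^sub>M n, c \<otimes>\<^sub>C d) \<cdot>\<^sub>C ((mt \<j>\<^sub>M n \<cdot>\<^sub>C (ep \<odot>\<^sub>C Ident C (ob n))) \<odot>\<^sub>C Ident C (c \<otimes>\<^sub>C d)))"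
    using assms by (subst th_interchanger) (simp_all add: C.interchange)
  also have "\<dots> = \<theta> (n, c \<otimes>\<^sub>C d) \<cdot>\<^sub>C ((ar (lunit M n) \<cdot>\<^sub>C (mt \<j>\<^sub>M n \<cdot>\<^sub>C (ep \<odot>\<^sub>C Ident C (ob n)))) \<odot>\<^sub>C Ident C (c \<otimes>\<^sub>C d))"
    using assms C.comp_extend[OF th_slide(1)[of "lunit M n" "Ident C (c \<otimes>\<^sub>C d)" n "c \<otimes>\<^sub>C d", symmetric]]
    by (simp add: C.interchange)
  also have "\<dots> = \<theta> (n, c \<otimes>\<^sub>C d) \<cdot>\<^sub>C (lunit C (ob n) \<odot>\<^sub>C Ident C (c \<otimes>\<^sub>C d))"
    using assms by (simp add: mt_lunit)
  finally have "lstr n c d \<cdot>\<^sub>C (Ident C c \<odot>\<^sub>C \<theta> (n, d)) \<cdot>\<^sub>C assoc C c (ob n) d \<cdot>\<^sub>C (hb n c \<odot>\<^sub>C Ident C d) \<cdot>\<^sub>C inv_arr C (assoc C (ob n) c d) = \<theta> (n, c \<otimes>\<^sub>C d)"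
    by (rule C.iso_cancel_right) (use assms in auto)
  then have "(lstr n c d \<cdot>\<^sub>C (Ident C c \<odot>\<^sub>C \<theta> (n, d)) \<cdot>\<^sub>C assoc C c (ob n) d \<cdot>\<^sub>C (hb n c \<odot>\<^sub>C Ident C d) \<cdot>\<^sub>C inv_arr C (assoc C (ob n) c d)) \<cdot>\<^sub>C assoc C (ob n) c d =
      \<theta> (n, c \<otimes>\<^sub>C d) \<cdot>\<^sub>C assoc C (ob n) c d"
    by simp
  then show ?thesis using assms by simp
qed

end

section \<open>The unique 2-cell between two 1-cells\<close>

locale two_classifying_cells = P: classifying_cell M C X R \<theta> + Q: classifying_cell M C X S \<sigma>
  for M :: "('mo, 'ma) bmoncat" and C :: "('o, 'a) moncat" and X :: "('mo, 'ma, 'o, 'a) mon_action" (structure)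
    and R :: "('mo, 'ma, ('o, 'a) center_ob, ('o, 'a) center_arr) mfctr" and \<theta> :: "'mo \<times> 'o \<Rightarrow> 'a"
    and S :: "('mo, 'ma, ('o, 'a) center_ob, ('o, 'a) center_arr) mfctr" and \<sigma> :: "'mo \<times> 'o \<Rightarrow> 'a"
begin

text \<open>The triangle condition on a 2-cell at c = \<j>, solved for the component: \<sigma> is
  invertible, and conjugation by right unitors removes the factor \<j>.\<close>

definition cmp :: "'mo \<Rightarrow> 'a" where
  "cmp m = runit C (Q.ob m) \<cdot>\<^sub>C inv_arr C (\<sigma> (m, \<j>\<^sub>C)) \<cdot>\<^sub>C \<theta> (m, \<j>\<^sub>C) \<cdot>\<^sub>C inv_arr C (runit C (P.ob m))"

lemma cmp_arr [simp]:
  assumes "m \<in> Ob M"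
  shows "cmp m \<in> Arr C" "Src C (cmp m) = P.ob m" "Tgt C (cmp m) = Q.ob m"
  using assms by (simp_all add: cmp_def)

lemma cmp_unit:
  assumes "m \<in> Ob M"
  shows "\<sigma> (m, \<j>\<^sub>C) \<cdot>\<^sub>C (cmp m \<odot>\<^sub>C Ident C \<j>\<^sub>C) = \<theta> (m, \<j>\<^sub>C)"
proof -
  have "runit C (Q.ob m) \<cdot>\<^sub>C (cmp m \<odot>\<^sub>C Ident C \<j>\<^sub>C) = runit C (Q.ob m) \<cdot>\<^sub>C (inv_arr C (\<sigma> (m, \<j>\<^sub>C)) \<cdot>\<^sub>C \<theta> (m, \<j>\<^sub>C))"
    using assms by (simp add: P.C.runit_slide) (simp add: cmp_def)
  then have "cmp m \<odot>\<^sub>C Ident C \<j>\<^sub>C = inv_arr C (\<sigma> (m, \<j>\<^sub>C)) \<cdot>\<^sub>C \<theta> (m, \<j>\<^sub>C)"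
    by (rule P.C.iso_cancel_left) (use assms in auto)
  then show ?thesis using assms by simp
qed

lemma cmp_th:
  assumes "m \<in> Ob M" "c \<in> Ob C"
  shows "\<sigma> (m, c) \<cdot>\<^sub>C (cmp m \<odot>\<^sub>C Ident C c) = \<theta> (m, c)"
proof -
  \<comment> \<open>The case \<j> \<otimes> c comes first: \<open>rstr_th\<close> for both cells
    reduces it to \<open>cmp_unit\<close>. Naturality along the left unitor of c then gives the
    general case.\<close>
  have "(\<sigma> (m, \<j>\<^sub>C \<otimes>\<^sub>C c) \<cdot>\<^sub>C (cmp m \<odot>\<^sub>C Ident C (\<j>\<^sub>C \<otimes>\<^sub>C c))) \<cdot>\<^sub>C assoc C (P.ob m) \<j>\<^sub>C c =
      \<sigma> (m, \<j>\<^sub>C \<otimes>\<^sub>C c) \<cdot>\<^sub>C (assoc C (Q.ob m) \<j>\<^sub>C c \<cdot>\<^sub>C ((cmp m \<odot>\<^sub>C Ident C \<j>\<^sub>C) \<odot>\<^sub>C Ident C c))"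
    using assms P.C.assoc_slide(1)[of "cmp m" "Ident C \<j>\<^sub>C" "Ident C c"] by simp
  also have "\<dots> = (P.rstr m \<j>\<^sub>C c \<cdot>\<^sub>C (\<sigma> (m, \<j>\<^sub>C) \<odot>\<^sub>C Ident C c)) \<cdot>\<^sub>C ((cmp m \<odot>\<^sub>C Ident C \<j>\<^sub>C) \<odot>\<^sub>C Ident C c)"
    using assms by (simp add: Q.rstr_th)
  also have "\<dots> = P.rstr m \<j>\<^sub>C c \<cdot>\<^sub>C (\<theta> (m, \<j>\<^sub>C) \<odot>\<^sub>C Ident C c)"
    using assms by (simp add: P.C.interchange cmp_unit)
  also have "\<dots> = \<theta> (m, \<j>\<^sub>C \<otimes>\<^sub>C c) \<cdot>\<^sub>C assoc C (P.ob m) \<j>\<^sub>C c"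
    using assms by (simp add: P.rstr_th)
  finally have 1: "\<sigma> (m, \<j>\<^sub>C \<otimes>\<^sub>C c) \<cdot>\<^sub>C (cmp m \<odot>\<^sub>C Ident C (\<j>\<^sub>C \<otimes>\<^sub>C c)) = \<theta> (m, \<j>\<^sub>C \<otimes>\<^sub>C c)"
    by (rule P.C.iso_cancel_right) (use assms in auto)
  have "(\<sigma> (m, c) \<cdot>\<^sub>C (cmp m \<odot>\<^sub>C Ident C c)) \<cdot>\<^sub>C (Ident C (P.ob m) \<odot>\<^sub>C lunit C c) =
      (Ident M m \<star> lunit C c) \<cdot>\<^sub>C (\<sigma> (m, \<j>\<^sub>C \<otimes>\<^sub>C c) \<cdot>\<^sub>C (cmp m \<odot>\<^sub>C Ident C (\<j>\<^sub>C \<otimes>\<^sub>C c)))"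
    using assms P.C.comp_extend[OF Q.th_slide_right(1)[of m "lunit C c" c, symmetric]]
    by (simp add: P.C.interchange)
  also have "\<dots> = \<theta> (m, c) \<cdot>\<^sub>C (Ident C (P.ob m) \<odot>\<^sub>C lunit C c)"
    unfolding 1 using assms by (simp add: P.th_slide_right)
  finally show ?thesis
    by (rule P.C.iso_cancel_right) (use assms in auto)
qed

lemma cmp_unique:
  assumes "m \<in> Ob M" "g \<in> Arr C" "Src C g = P.ob m" "Tgt C g = Q.ob m" "\<sigma> (m, \<j>\<^sub>C) \<cdot>\<^sub>C (g \<odot>\<^sub>C Ident C \<j>\<^sub>C) = \<theta> (m, \<j>\<^sub>C)"
  shows "g = cmp m"
proof (rule P.C.right_unit_faithful)
  have "\<sigma> (m, \<j>\<^sub>C) \<cdot>\<^sub>C (g \<odot>\<^sub>C Ident C \<j>\<^sub>C) = \<sigma> (m, \<j>\<^sub>C) \<cdot>\<^sub>C (cmp m \<odot>\<^sub>C Ident C \<j>\<^sub>C)"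
    using assms by (simp add: cmp_unit)
  then show "g \<odot>\<^sub>C Ident C \<j>\<^sub>C = cmp m \<odot>\<^sub>C Ident C \<j>\<^sub>C"
    by (rule P.C.iso_cancel_left) (use assms in auto)
qed (use assms in auto)

text \<open>Invertibility of \<sigma> and faithfulness of tensoring with \<j>. All laws for
  \<open>cmp\<close> are tested in this form, where \<open>cmp_unit\<close> turns \<sigma> into
  \<theta>.\<close>

lemma cmp_faithful:
  assumes "m \<in> Ob M" "f \<in> Arr C" "g \<in> Arr C" "Src C f = Src C g" "Tgt C f = Q.ob m" "Tgt C g = Q.ob m"
    "\<sigma> (m, \<j>\<^sub>C) \<cdot>\<^sub>C (f \<odot>\<^sub>C Ident C \<j>\<^sub>C) = \<sigma> (m, \<j>\<^sub>C) \<cdot>\<^sub>C (g \<odot>\<^sub>C Ident C \<j>\<^sub>C)"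
  shows "f = g"
proof (rule P.C.right_unit_faithful)
  show "f \<odot>\<^sub>C Ident C \<j>\<^sub>C = g \<odot>\<^sub>C Ident C \<j>\<^sub>C"
    by (rule P.C.iso_cancel_left[OF assms(7)]) (use assms in auto)
qed (use assms in auto)

lemma cmp_center_natural:
  assumes "m \<in> Ob M"
  shows "center_natural C (fob R m) (fob S m) (cmp m)"
  unfolding center_natural_def
proof
  fix b assume b: "b \<in> Ob C"
  \<comment> \<open>\<open>?k\<close> is the invertible part of \<open>lstr_th\<close> at d = \<j>
    that stands to the left of the half-braiding of the target. It lets \<open>lstr_th\<close> be
    used for both cells, linked by \<open>cmp_th\<close>.\<close>
  let ?k = "P.lstr m b \<j>\<^sub>C \<cdot>\<^sub>C (Ident C b \<odot>\<^sub>C \<sigma> (m, \<j>\<^sub>C)) \<cdot>\<^sub>C assoc C b (Q.ob m) \<j>\<^sub>C"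
  have k: "?k \<in> Arr C" "Src C ?k = (b \<otimes>\<^sub>C Q.ob m) \<otimes>\<^sub>C \<j>\<^sub>C" "iso C ?k" using assms b by auto
  have "?k \<cdot>\<^sub>C ((Q.hb m b \<cdot>\<^sub>C (cmp m \<odot>\<^sub>C Ident C b)) \<odot>\<^sub>C Ident C \<j>\<^sub>C) =
      (P.lstr m b \<j>\<^sub>C \<cdot>\<^sub>C (Ident C b \<odot>\<^sub>C \<sigma> (m, \<j>\<^sub>C)) \<cdot>\<^sub>C assoc C b (Q.ob m) \<j>\<^sub>C \<cdot>\<^sub>C (Q.hb m b \<odot>\<^sub>C Ident C \<j>\<^sub>C)) \<cdot>\<^sub>C ((cmp m \<odot>\<^sub>C Ident C b) \<odot>\<^sub>C Ident C \<j>\<^sub>C)"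
    using assms b by (simp add: P.C.right_whisker_comp)
  also have "\<dots> = \<sigma> (m, b \<otimes>\<^sub>C \<j>\<^sub>C) \<cdot>\<^sub>C ((cmp m \<odot>\<^sub>C Ident C (b \<otimes>\<^sub>C \<j>\<^sub>C)) \<cdot>\<^sub>C assoc C (P.ob m) b \<j>\<^sub>C)"
    using assms b P.C.assoc_slide(1)[of "cmp m" "Ident C b" "Ident C \<j>\<^sub>C"] by (simp add: Q.lstr_th)
  also have "\<dots> = \<theta> (m, b \<otimes>\<^sub>C \<j>\<^sub>C) \<cdot>\<^sub>C assoc C (P.ob m) b \<j>\<^sub>C"
    using assms b P.C.comp_extend[OF cmp_th[of m "b \<otimes>\<^sub>C \<j>\<^sub>C"]] by simp
  also have "\<dots> = P.lstr m b \<j>\<^sub>C \<cdot>\<^sub>C ((Ident C b \<odot>\<^sub>C \<theta> (m, \<j>\<^sub>C)) \<cdot>\<^sub>C (assoc C b (P.ob m) \<j>\<^sub>C \<cdot>\<^sub>C (P.hb m b \<odot>\<^sub>C Ident C \<j>\<^sub>C)))"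
    using assms b by (simp add: P.lstr_th)
  also have "\<dots> = P.lstr m b \<j>\<^sub>C \<cdot>\<^sub>C ((Ident C b \<odot>\<^sub>C \<sigma> (m, \<j>\<^sub>C)) \<cdot>\<^sub>C ((Ident C b \<odot>\<^sub>C (cmp m \<odot>\<^sub>C Ident C \<j>\<^sub>C)) \<cdot>\<^sub>C (assoc C b (P.ob m) \<j>\<^sub>C \<cdot>\<^sub>C (P.hb m b \<odot>\<^sub>C Ident C \<j>\<^sub>C))))"
    using assms b by (simp add: P.C.interchange_extend cmp_unit)
  also have "\<dots> = ?k \<cdot>\<^sub>C (((Ident C b \<odot>\<^sub>C cmp m) \<cdot>\<^sub>C P.hb m b) \<odot>\<^sub>C Ident C \<j>\<^sub>C)"
    using assms b P.C.assoc_slide(2)[of "Ident C b" "cmp m" "Ident C \<j>\<^sub>C"] by (simp add: P.C.right_whisker_comp)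
  finally have "(Q.hb m b \<cdot>\<^sub>C (cmp m \<odot>\<^sub>C Ident C b)) \<odot>\<^sub>C Ident C \<j>\<^sub>C = ((Ident C b \<odot>\<^sub>C cmp m) \<cdot>\<^sub>C P.hb m b) \<odot>\<^sub>C Ident C \<j>\<^sub>C"
    by (rule P.C.iso_cancel_left) (use assms b k in auto)
  then have "Q.hb m b \<cdot>\<^sub>C (cmp m \<odot>\<^sub>C Ident C b) = (Ident C b \<odot>\<^sub>C cmp m) \<cdot>\<^sub>C P.hb m b"
    by (rule P.C.right_unit_faithful) (use assms b in auto)
  then show "snd (fob S m) b \<cdot>\<^sub>C (cmp m \<odot>\<^sub>C Ident C b) = (Ident C b \<odot>\<^sub>C cmp m) \<cdot>\<^sub>C snd (fob R m) b"
    by (simp add: P.hb_def Q.hb_def)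
qed

lemma cmp_natural:
  assumes "f \<in> Arr M"
  shows "cmp (Tgt M f) \<cdot>\<^sub>C P.ar f = Q.ar f \<cdot>\<^sub>C cmp (Src M f)"
proof (rule cmp_faithful[of "Tgt M f"])
  let ?m = "Src M f" and ?n = "Tgt M f"
  have "\<sigma> (?n, \<j>\<^sub>C) \<cdot>\<^sub>C ((cmp ?n \<cdot>\<^sub>C P.ar f) \<odot>\<^sub>C Ident C \<j>\<^sub>C) = (\<sigma> (?n, \<j>\<^sub>C) \<cdot>\<^sub>C (cmp ?n \<odot>\<^sub>C Ident C \<j>\<^sub>C)) \<cdot>\<^sub>C (P.ar f \<odot>\<^sub>C Ident C \<j>\<^sub>C)"
    using assms by (simp add: P.C.interchange)
  also have "\<dots> = (f \<star> Ident C \<j>\<^sub>C) \<cdot>\<^sub>C (\<sigma> (?m, \<j>\<^sub>C) \<cdot>\<^sub>C (cmp ?m \<odot>\<^sub>C Ident C \<j>\<^sub>C))"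
    using assms by (simp only: cmp_unit P.M.src_in P.M.tgt_in) (simp add: P.th_slide)
  also have "\<dots> = \<sigma> (?n, \<j>\<^sub>C) \<cdot>\<^sub>C ((Q.ar f \<cdot>\<^sub>C cmp ?m) \<odot>\<^sub>C Ident C \<j>\<^sub>C)"
    using assms P.C.comp_extend[OF Q.th_slide(1)[of f "Ident C \<j>\<^sub>C" ?n "\<j>\<^sub>C", symmetric]] by (simp add: P.C.interchange)
  finally show "\<sigma> (?n, \<j>\<^sub>C) \<cdot>\<^sub>C ((cmp ?n \<cdot>\<^sub>C P.ar f) \<odot>\<^sub>C Ident C \<j>\<^sub>C) = \<sigma> (?n, \<j>\<^sub>C) \<cdot>\<^sub>C ((Q.ar f \<cdot>\<^sub>C cmp ?m) \<odot>\<^sub>C Ident C \<j>\<^sub>C)" .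
qed (use assms in auto)

lemma cmp_ep: "cmp \<j>\<^sub>M \<cdot>\<^sub>C P.ep = Q.ep"
proof (rule cmp_faithful[of "\<j>\<^sub>M"])
  have "\<sigma> (\<j>\<^sub>M, \<j>\<^sub>C) \<cdot>\<^sub>C ((cmp \<j>\<^sub>M \<cdot>\<^sub>C P.ep) \<odot>\<^sub>C Ident C \<j>\<^sub>C) = (\<sigma> (\<j>\<^sub>M, \<j>\<^sub>C) \<cdot>\<^sub>C (cmp \<j>\<^sub>M \<odot>\<^sub>C Ident C \<j>\<^sub>C)) \<cdot>\<^sub>C (P.ep \<odot>\<^sub>C Ident C \<j>\<^sub>C)"
    by (simp add: P.C.interchange)
  also have "\<dots> = \<sigma> (\<j>\<^sub>M, \<j>\<^sub>C) \<cdot>\<^sub>C (Q.ep \<odot>\<^sub>C Ident C \<j>\<^sub>C)"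
    by (simp only: cmp_unit P.M.unit_ob_in P.th_unitor Q.th_unitor P.C.unit_ob_in)
  finally show "\<sigma> (\<j>\<^sub>M, \<j>\<^sub>C) \<cdot>\<^sub>C ((cmp \<j>\<^sub>M \<cdot>\<^sub>C P.ep) \<odot>\<^sub>C Ident C \<j>\<^sub>C) = \<sigma> (\<j>\<^sub>M, \<j>\<^sub>C) \<cdot>\<^sub>C (Q.ep \<odot>\<^sub>C Ident C \<j>\<^sub>C)" .
qed auto

text \<open>Under \<sigma> at \<j> both sides unfold to the multiplicator conditions of the two
  cells; \<open>cmp_th\<close> at n \<bullet> \<j> and \<open>cmp_unit\<close> at n replace \<theta>
  by \<sigma>.\<close>

lemma cmp_mt:
  assumes m: "m \<in> Ob M" and n: "n \<in> Ob M"
  shows "cmp (m \<otimes>\<^sub>M n) \<cdot>\<^sub>C P.mt m n = Q.mt m n \<cdot>\<^sub>C (cmp m \<odot>\<^sub>C cmp n)"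
proof (rule cmp_faithful[of "m \<otimes>\<^sub>M n"])
  let ?f = "cmp m" and ?g = "cmp n"
  have "\<sigma> (m \<otimes>\<^sub>M n, \<j>\<^sub>C) \<cdot>\<^sub>C ((cmp (m \<otimes>\<^sub>M n) \<cdot>\<^sub>C P.mt m n) \<odot>\<^sub>C Ident C \<j>\<^sub>C) = (\<sigma> (m \<otimes>\<^sub>M n, \<j>\<^sub>C) \<cdot>\<^sub>C (cmp (m \<otimes>\<^sub>M n) \<odot>\<^sub>C Ident C \<j>\<^sub>C)) \<cdot>\<^sub>C (P.mt m n \<odot>\<^sub>C Ident C \<j>\<^sub>C)"
    using m n by (simp add: P.C.interchange)
  also have "\<dots> = \<mu> m n \<j>\<^sub>C \<cdot>\<^sub>C (\<theta> (m, n \<bullet> \<j>\<^sub>C) \<cdot>\<^sub>C ((Ident C (P.ob m) \<odot>\<^sub>C \<theta> (n, \<j>\<^sub>C)) \<cdot>\<^sub>C assoc C (P.ob m) (P.ob n) \<j>\<^sub>C))"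
    using m n by (simp only: cmp_unit P.M.tensor_ob_in P.th_multiplicator P.C.unit_ob_in)
  also have "\<dots> = \<mu> m n \<j>\<^sub>C \<cdot>\<^sub>C ((\<sigma> (m, n \<bullet> \<j>\<^sub>C) \<cdot>\<^sub>C (?f \<odot>\<^sub>C Ident C (n \<bullet> \<j>\<^sub>C))) \<cdot>\<^sub>C 
      ((Ident C (P.ob m) \<odot>\<^sub>C (\<sigma> (n, \<j>\<^sub>C) \<cdot>\<^sub>C (?g \<odot>\<^sub>C Ident C \<j>\<^sub>C))) \<cdot>\<^sub>C assoc C (P.ob m) (P.ob n) \<j>\<^sub>C))"
    using m n by (simp only: cmp_unit cmp_th P.act_ob_in P.C.unit_ob_in)
  also have "\<dots> = \<mu> m n \<j>\<^sub>C \<cdot>\<^sub>C (\<sigma> (m, n \<bullet> \<j>\<^sub>C) \<cdot>\<^sub>C ((Ident C (Q.ob m) \<odot>\<^sub>C \<sigma> (n, \<j>\<^sub>C)) \<cdot>\<^sub>C 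
      ((?f \<odot>\<^sub>C (?g \<odot>\<^sub>C Ident C \<j>\<^sub>C)) \<cdot>\<^sub>C assoc C (P.ob m) (P.ob n) \<j>\<^sub>C)))"
    using m n by (simp add: P.C.interchange_extend)
  also have "\<dots> = (\<mu> m n \<j>\<^sub>C \<cdot>\<^sub>C \<sigma> (m, n \<bullet> \<j>\<^sub>C) \<cdot>\<^sub>C (Ident C (Q.ob m) \<odot>\<^sub>C \<sigma> (n, \<j>\<^sub>C)) \<cdot>\<^sub>C assoc C (Q.ob m) (Q.ob n) \<j>\<^sub>C) \<cdot>\<^sub>C 
      ((?f \<odot>\<^sub>C ?g) \<odot>\<^sub>C Ident C \<j>\<^sub>C)"
    using m n by (simp add: P.C.assoc_slide)
  also have "\<dots> = \<sigma> (m \<otimes>\<^sub>M n, \<j>\<^sub>C) \<cdot>\<^sub>C ((Q.mt m n \<cdot>\<^sub>C (?f \<odot>\<^sub>C ?g)) \<odot>\<^sub>C Ident C \<j>\<^sub>C)"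
    using m n by (simp add: P.C.interchange flip: Q.th_multiplicator)
  finally show "\<sigma> (m \<otimes>\<^sub>M n, \<j>\<^sub>C) \<cdot>\<^sub>C ((cmp (m \<otimes>\<^sub>M n) \<cdot>\<^sub>C P.mt m n) \<odot>\<^sub>C Ident C \<j>\<^sub>C) = \<sigma> (m \<otimes>\<^sub>M n, \<j>\<^sub>C) \<cdot>\<^sub>C ((Q.mt m n \<cdot>\<^sub>C (?f \<odot>\<^sub>C ?g)) \<odot>\<^sub>C Ident C \<j>\<^sub>C)" .
qed (use m n in auto)

definition cmp_cell :: "'mo \<Rightarrow> ('o, 'a) center_arr" where
  "cmp_cell = (\<lambda>m\<in>Ob M. (fob R m, fob S m, cmp m))"

lemma cmp_cell_in: "cmp_cell \<in> P.two_cells (R, \<theta>) (S, \<sigma>)"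
proof -
  have "monoidal_nat_trans M P.Z R S cmp_cell"
  proof (rule monoidal_nat_transI[OF P.R.strong_monoidal_functor_axioms Q.R.strong_monoidal_functor_axioms
        nat_transI[OF P.R.cfunctor_axioms Q.R.cfunctor_axioms]], goal_cases)
    case (1 m)
    then show ?case
      using cmp_arr[of m] by (simp add: cmp_cell_def cmp_center_natural P.ob_def Q.ob_def)
  next
    case (2 f)
    then show ?case by (simp add: cmp_cell_def P.R_farr Q.R_farr cmp_natural)
  next
    case 3
    then show ?case by (simp add: cmp_cell_def P.R_feps Q.R_feps cmp_ep)
  next
    case (4 m n)
    then show ?case by (simp add: cmp_cell_def P.R_fmult Q.R_fmult cmp_mt)
  qed
  then show ?thesis
    by (auto simp: act_2cells_def cmp_cell_def cmp_th)
qed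

text \<open>The premises speak of single components and their triangle at \<j>, so that the lemma
  applies directly to identities and to composites of 2-cells.\<close>

lemma cmp_cell_unique:
  assumes "\<kappa> \<in> extensional (Ob M)"
    and "\<And>m. m \<in> Ob M \<Longrightarrow> Src P.Z (\<kappa> m) = fob R m \<and> Tgt P.Z (\<kappa> m) = fob S m \<and> \<kappa> m \<in> Arr P.Z \<and>
      \<sigma> (m, \<j>\<^sub>C) \<cdot>\<^sub>C (snd (snd (\<kappa> m)) \<odot>\<^sub>C Ident C \<j>\<^sub>C) = \<theta> (m, \<j>\<^sub>C)"
  shows "\<kappa> = cmp_cell"
proof (rule extensionalityI[OF assms(1)])
  show "cmp_cell \<in> extensional (Ob M)" by (simp add: cmp_cell_def)
  fix m assume m: "m \<in> Ob M"
  obtain g where g: "\<kappa> m = (fob R m, fob S m, g)"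
    using assms(2)[OF m] by (cases "\<kappa> m" rule: prod_cases3) simp
  then have "g = cmp m"
    using assms(2)[OF m] m by (intro cmp_unique) (simp_all add: P.ob_def Q.ob_def)
  then show "\<kappa> m = cmp_cell m" using m g by (simp add: cmp_cell_def)
qed

lemma act_2cells_eq: "P.two_cells (R, \<theta>) (S, \<sigma>) = {cmp_cell}"
proof -
  have "\<kappa> = cmp_cell" if k: "\<kappa> \<in> P.two_cells (R, \<theta>) (S, \<sigma>)" for \<kappa>
  proof (rule cmp_cell_unique)
    show "\<kappa> \<in> extensional (Ob M)" using k by (simp add: act_2cells_def)
    interpret monoidal_nat_trans M P.Z R S \<kappa> using k by (simp add: act_2cells_def)
    fix m assume m: "m \<in> Ob M"
    then show "Src P.Z (\<kappa> m) = fob R m \<and> Tgt P.Z (\<kappa> m) = fob S m \<and> \<kappa> m \<in> Arr P.Z \<and>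
      \<sigma> (m, \<j>\<^sub>C) \<cdot>\<^sub>C (snd (snd (\<kappa> m)) \<odot>\<^sub>C Ident C \<j>\<^sub>C) = \<theta> (m, \<j>\<^sub>C)"
      using k component_arr[OF m] by (simp add: act_2cells_def)
  qed
  then show ?thesis using cmp_cell_in by blast
qed

end

text \<open>With singleton hom-sets every diagram commutes, so choosing an arrow from each object to
  x gives a natural isomorphism to the constant functor.\<close>

lemma equivalent_unit_catI:
  assumes "category A" "x \<in> Ob A"
    and hom: "\<And>x y. x \<in> Ob A \<Longrightarrow> y \<in> Ob A \<Longrightarrow> \<exists>f. hom A x y = {f}"
  shows "equivalent_categories A unit_cat"
proof -
  interpret A: category A by fact
  have unique: "f = g" if "f \<in> Arr A" "g \<in> Arr A" "Src A f = Src A g" "Tgt A f = Tgt A g" for f g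
  proof -
    have "f \<in> hom A (Src A g) (Tgt A g)" "g \<in> hom A (Src A g) (Tgt A g)"
      using that by (auto simp: hom_def)
    then show ?thesis using hom[of "Src A g" "Tgt A g"] that by auto
  qed
  interpret U: category unit_cat
    by (rule categoryI) (auto simp: unit_cat_def)
  define F :: "('a, 'b, unit, unit) fctr" where "F = \<lparr>fob = (\<lambda>_. ()), farr = (\<lambda>_. ())\<rparr>"
  define G :: "(unit, unit, 'a, 'b) fctr" where "G = \<lparr>fob = (\<lambda>_. x), farr = (\<lambda>_. Ident A x)\<rparr>"
  define \<tau> where "\<tau> y = (SOME f. f \<in> hom A y x)" for y
  have \<tau>: "\<tau> y \<in> Arr A" "Src A (\<tau> y) = y" "Tgt A (\<tau> y) = x" if "y \<in> Ob A" for y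
  proof -
    have "\<tau> y \<in> hom A y x"
      unfolding \<tau>_def using hom[OF that assms(2)] by (intro someI_ex[of "\<lambda>f. f \<in> hom A y x"]) auto
    then show "\<tau> y \<in> Arr A" "Src A (\<tau> y) = y" "Tgt A (\<tau> y) = x" by (auto simp: hom_def)
  qed
  have iso: "iso A (\<tau> y)" if y: "y \<in> Ob A" for y
  proof -
    obtain g where g: "g \<in> hom A x y" using hom[OF assms(2) y] by auto
    then have "inverse_arrows A (\<tau> y) g"
      \<comment> \<open>The composites are parallel to identities and therefore equal to
        them.\<close>
      using \<tau>[OF y] y assms(2) by (auto simp: A.inverse_arrows_iff hom_def intro!: unique)
    then show ?thesis by (rule A.isoI)
  qed
  have F: "cfunctor A unit_cat F"
    by (rule cfunctorI[OF A.category_axioms U.category_axioms]) (auto simp: F_def unit_cat_def)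
  have G: "cfunctor unit_cat A G"
    by (rule cfunctorI) (use assms(2) in \<open>auto simp: A.category_axioms U.category_axioms G_def\<close>)
  have GF: "cfunctor A A (comp_fctr G F)"
    by (rule cfunctorI) (use assms(2) in \<open>auto simp: A.category_axioms comp_fctr_def G_def\<close>)
  have FG: "cfunctor unit_cat unit_cat (comp_fctr F G)"
    by (rule cfunctorI[OF U.category_axioms U.category_axioms]) (auto simp: comp_fctr_def F_def unit_cat_def)
  have 1: "nat_iso A A id_fctr (comp_fctr G F) \<tau>"
    by (rule nat_isoI[OF cfunctor_id[OF assms(1)] GF])
      (use assms(2) in \<open>auto simp: \<tau> iso id_fctr_def comp_fctr_def G_def intro!: unique\<close>)
  have 2: "nat_iso unit_cat unit_cat (comp_fctr F G) id_fctr (\<lambda>_. ())"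
  proof (rule nat_isoI[OF FG cfunctor_id[OF U.category_axioms]])
    have "inverse_arrows unit_cat () ()" by (simp add: U.inverse_arrows_iff) (simp add: unit_cat_def)
    then show "iso unit_cat () \<and> Src unit_cat () = fob (comp_fctr F G) z \<and> Tgt unit_cat () = fob id_fctr z" for z
      using U.isoI by simp
  qed simp
  show ?thesis
    unfolding equivalent_categories_def using F G 1 2 by blast
qed

section \<open>The hom-category into the center\<close>

context plain_monoidal_action
begin

abbreviation H where
  "H \<equiv> act_hom_cat C M X Z (center_action C)"

lemma two_cellsI:
  assumes "P \<in> one_cells" "Q \<in> one_cells"
  shows "two_classifying_cells M C X (fst P) (snd P) (fst Q) (snd Q)"
  using assms by (simp add: two_classifying_cells_def classifying_cell_def classifying_cell_axioms_def
      plain_monoidal_action_axioms)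

text \<open>The cell \<open>cmp_cell\<close> as a function of two arbitrary 1-cells, outside the
  locale that fixes them, so that composition of several comparisons can be stated.\<close>

definition comparison where
  "comparison P Q = two_classifying_cells.cmp_cell M C (fst P) (snd P) (fst Q) (snd Q)"

lemma act_2cells_comparison:
  assumes "P \<in> one_cells" "Q \<in> one_cells"
  shows "two_cells P Q = {comparison P Q}"
  using two_classifying_cells.act_2cells_eq[OF two_cellsI[OF assms]] by (simp add: comparison_def)

lemma act_2cellsD:
  assumes "P \<in> one_cells" "Q \<in> one_cells"
    and k: "\<kappa> \<in> two_cells P Q" and m: "m \<in> Ob M"
  shows "\<kappa> m \<in> Arr Z" "Src Z (\<kappa> m) = fob (fst P) m" "Tgt Z (\<kappa> m) = fob (fst Q) m"
    "snd Q (m, \<j>\<^sub>C) \<cdot>\<^sub>C (snd (snd (\<kappa> m)) \<odot>\<^sub>C Ident C \<j>\<^sub>C) = snd P (m, \<j>\<^sub>C)"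
proof -
  obtain R \<theta> S \<sigma> where PQ: "P = (R, \<theta>)" "Q = (S, \<sigma>)" by (cases P; cases Q) auto
  interpret monoidal_nat_trans M Z R S \<kappa> using k PQ by (simp add: act_2cells_def)
  show "\<kappa> m \<in> Arr Z" "Src Z (\<kappa> m) = fob (fst P) m" "Tgt Z (\<kappa> m) = fob (fst Q) m"
    using component_arr[OF m] PQ by simp_all
  show "snd Q (m, \<j>\<^sub>C) \<cdot>\<^sub>C (snd (snd (\<kappa> m)) \<odot>\<^sub>C Ident C \<j>\<^sub>C) = snd P (m, \<j>\<^sub>C)"
    using k m PQ by (simp add: act_2cells_def)
qed

lemma act_2cells_ident:
  assumes P: "P \<in> one_cells"
  shows "(\<lambda>m\<in>Ob M. Ident Z (fob (fst P) m)) = comparison P P"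
proof -
  interpret P: two_classifying_cells M C X "fst P" "snd P" "fst P" "snd P"
    using two_cellsI[OF P P] .
  show ?thesis
    unfolding comparison_def
    by (rule P.cmp_cell_unique) (simp_all add: C.center_natural_ident P.P.ob_def)
qed

text \<open>Pasting the triangles at \<j> for the two comparisons gives the triangle for their
  composite, and uniqueness identifies it with the direct comparison.\<close>

lemma act_2cells_comp:
  assumes P: "P \<in> one_cells" and Q: "Q \<in> one_cells"
    and T: "T \<in> one_cells"
  shows "(\<lambda>m\<in>Ob M. comparison Q T m \<cdot>\<^bsub>Z\<^esub> comparison P Q m) = comparison P T"
proof -
  interpret PQ: two_classifying_cells M C X "fst P" "snd P" "fst Q" "snd Q" using two_cellsI[OF P Q] .
  interpret QT: two_classifying_cells M C X "fst Q" "snd Q" "fst T" "snd T" using two_cellsI[OF Q T] .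
  interpret PT: two_classifying_cells M C X "fst P" "snd P" "fst T" "snd T" using two_cellsI[OF P T] .
  have f: "comparison P Q \<in> two_cells P Q"
    and g: "comparison Q T \<in> two_cells Q T"
    using act_2cells_comparison[OF P Q] act_2cells_comparison[OF Q T] by auto
  have "(\<lambda>m\<in>Ob M. comparison Q T m \<cdot>\<^bsub>Z\<^esub> comparison P Q m) = PT.cmp_cell"
  proof (rule PT.cmp_cell_unique)
    fix m assume m: "m \<in> Ob M"
    note F = act_2cellsD[OF P Q f m] and G = act_2cellsD[OF Q T g m]
    have "Src Z (comparison Q T m \<cdot>\<^bsub>Z\<^esub> comparison P Q m) = fob (fst P) m"
      "Tgt Z (comparison Q T m \<cdot>\<^bsub>Z\<^esub> comparison P Q m) = fob (fst T) m"
      "comparison Q T m \<cdot>\<^bsub>Z\<^esub> comparison P Q m \<in> Arr Z"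
      using F G category.arr_comp[OF C.category_center, of "comparison P Q m" "comparison Q T m"] by simp_all
    moreover have "snd T (m, \<j>\<^sub>C) \<cdot>\<^sub>C (snd (snd (comparison Q T m \<cdot>\<^bsub>Z\<^esub> comparison P Q m)) \<odot>\<^sub>C Ident C \<j>\<^sub>C) = snd P (m, \<j>\<^sub>C)"
    proof -
      obtain f g where fg: "comparison P Q m = (fob (fst P) m, fob (fst Q) m, f)"
        "comparison Q T m = (fob (fst Q) m, fob (fst T) m, g)"
        using F(2,3) G(2,3) by (cases "comparison P Q m" rule: prod_cases3; cases "comparison Q T m" rule: prod_cases3) simp
      have f: "f \<in> Arr C" "Src C f = PQ.P.ob m" "Tgt C f = PQ.Q.ob m"
        and g: "g \<in> Arr C" "Src C g = PQ.Q.ob m" "Tgt C g = QT.Q.ob m"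
        using F(1) G(1) fg by (simp_all add: PQ.P.ob_def PQ.Q.ob_def QT.Q.ob_def)
      have "snd T (m, \<j>\<^sub>C) \<cdot>\<^sub>C ((g \<cdot>\<^sub>C f) \<odot>\<^sub>C Ident C \<j>\<^sub>C) = (snd T (m, \<j>\<^sub>C) \<cdot>\<^sub>C (g \<odot>\<^sub>C Ident C \<j>\<^sub>C)) \<cdot>\<^sub>C (f \<odot>\<^sub>C Ident C \<j>\<^sub>C)"
        using f g m by (simp add: C.interchange)
      then show ?thesis
        using F(4) G(4) fg by simp
    qed
    ultimately show "Src Z ((\<lambda>m\<in>Ob M. comparison Q T m \<cdot>\<^bsub>Z\<^esub> comparison P Q m) m) = fob (fst P) m \<and>
       Tgt Z ((\<lambda>m\<in>Ob M. comparison Q T m \<cdot>\<^bsub>Z\<^esub> comparison P Q m) m) = fob (fst T) m \<and>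
       (\<lambda>m\<in>Ob M. comparison Q T m \<cdot>\<^bsub>Z\<^esub> comparison P Q m) m \<in> Arr Z \<and>
       snd T (m, \<j>\<^sub>C) \<cdot>\<^sub>C (snd (snd ((\<lambda>m\<in>Ob M. comparison Q T m \<cdot>\<^bsub>Z\<^esub> comparison P Q m) m)) \<odot>\<^sub>C Ident C \<j>\<^sub>C) = snd P (m, \<j>\<^sub>C)"
      using m by simp
  qed simp
  then show ?thesis by (simp add: comparison_def)
qed

text \<open>The hom-category is the codiscrete category on the 1-cells, with
  \<open>comparison\<close> as the arrow between any two. In this form the category axioms are
  immediate.\<close>

lemma act_hom_cat_simps:
  "Ob H = one_cells"
  "(P, Q, \<kappa>) \<in> Arr H \<longleftrightarrow> P \<in> Ob H \<and> Q \<in> Ob H \<and> \<kappa> = comparison P Q"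
  "Src H (P, Q, \<kappa>) = P" "Tgt H (P, Q, \<kappa>) = Q"
  "P \<in> Ob H \<Longrightarrow> Ident H P = (P, P, comparison P P)"
  "P \<in> Ob H \<Longrightarrow> Q \<in> Ob H \<Longrightarrow> T \<in> Ob H \<Longrightarrow>
    (Q, T, comparison Q T) \<cdot>\<^bsub>H\<^esub> (P, Q, comparison P Q) = (P, T, comparison P T)"
  by (simp_all add: act_hom_cat_def act_2cells_comparison act_2cells_ident[simplified] act_2cells_comp
      cong: conj_cong)

lemma act_hom_cat_equivalent: "equivalent_categories H unit_cat"
proof (rule equivalent_unit_catI)
  note [simp] = act_hom_cat_simps(2-6)
  show "category H"
  proof (rule categoryI, goal_cases)
    case (1 f)
    then show ?case by (cases f rule: prod_cases3) simp
  next
    case (2 f)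
    then show ?case by (cases f rule: prod_cases3) simp
  next
    case (4 f g)
    then show ?case by (cases f rule: prod_cases3; cases g rule: prod_cases3) simp
  next
    case (5 f)
    then show ?case by (cases f rule: prod_cases3) simp
  next
    case (6 f)
    then show ?case by (cases f rule: prod_cases3) simp
  next
    case (7 f g h)
    then show ?case
      by (cases f rule: prod_cases3; cases g rule: prod_cases3; cases h rule: prod_cases3) simp
  qed simp
  show "(class_fctr, class_iso) \<in> Ob H"
    using class_1cell by (simp add: act_hom_cat_simps(1))
  show "\<exists>f. hom H P Q = {f}" if "P \<in> Ob H" "Q \<in> Ob H" for P Q
    using that by (intro exI[of _ "(P, Q, comparison P Q)"]) (auto simp: hom_def)
qed

end

theorem theorem5p5p3:
  fixes C :: "('o, 'a) moncat"
  assumes "monoidal_category C"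
  shows "monoidal_action (drinfeld_center C) C (center_action C) \<and>
    (\<forall>(M :: ('mo, 'ma) bmoncat) (X :: ('mo, 'ma, 'o, 'a) mon_action).
       monoidal_action M C X \<longrightarrow>
       equivalent_categories
         (act_hom_cat C M X (drinfeld_center C) (center_action C)) unit_cat)"
  using monoidal_category.monoidal_action_center[OF assms]
    plain_monoidal_action.act_hom_cat_equivalent[OF plain_monoidal_action.intro] by blast

end
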